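(* Let $(E,\{S_\alpha,g_\alpha\}_{\alpha\in I})$ be a stratified Riemannian state space and suppose that Assumptions (D) and (J) stated in the context hold. Then, for every $x\in E$, the martingale problem for $(A,\mathcal D_0)$ has at most one solution on $D_E$ with initial condition $x$. Consequently (a solution existing for every $x$), the martingale problem for $(A,\mathcal D_0)$ is well-posed, i.e. for every $x\in E$ there is exactly one solution in law with initial condition $x$.
   Context: **Notation.** $(E,d)$ is a locally compact separable metric space, $\mathcal B(E)$ its Borel $\sigma$-algebra, $B_b(E)$ the bounded Borel functions $E\to\mathbb R$, $D_E=D([0,\infty);E)$ the Skorokhod space of càdlàg paths, $\mathcal P(\cdot)$ the space of Borel probability measures. **Stratified Riemannian state space.** $I$ is a countable set and $E=\bigsqcup_{\alpha\in I}S_\alpha$ is a partition such that: each $S_\alpha$ is a connected smooth finite-dimensional manifold without boundary, equipped with a Riemannian metric $g_\alpha$; each inclusion $S_\alpha\hookrightarrow E$ is a homeomorphism onto its image, and this image is a Borel subset of $E$. **Assumption (D).** For every $\alpha\in I$ there is a conservative càdlàg Markov family $(\mathbb Q^\alpha_x)_{x\in S_\alpha}$ on $D([0,\infty);S_\alpha)$, with canonical process $\eta_t(\omega)=\omega(t)$, such that: (D1) $x\mapsto\mathbb Q^\alpha_x\in\mathcal P(D([0,\infty);S_\alpha))$ is Borel measurable; (D2) for every $x\in S_\alpha$, $\mathbb Q^\alpha_x(\eta_0=x)=1$, $\mathbb Q^\alpha_x(\eta_t\in S_\alpha\ \forall t\ge0)=1$, and the paths are continuous in the topology of $S_\alpha$;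 (D3) with $P^\alpha_tg(x):=\mathbb E_{\mathbb Q^\alpha_x}[g(\eta_t)]$, $(P^\alpha_t)_{t\ge0}$ restricts to a strongly continuous contraction semigroup on $C_0(S_\alpha)$ (in particular $P^\alpha_tC_0(S_\alpha)\subset C_0(S_\alpha)$); (D4) with $(L_\alpha,D(L_\alpha))$ the generator of $(P^\alpha_t)$ on $C_0(S_\alpha)$, there is a linear subspace $\mathcal C_\alpha\subset D(L_\alpha)\subset C_0(S_\alpha)$ which is a core for $L_\alpha$ and is measure determining (finite Borel measures $\mu,\nu$ on $S_\alpha$ with $\int g\,d\mu=\int g\,d\nu$ for all $g\in\mathcal C_\alpha$ are equal). **Assumption (J).** There is a directed graph $(I,\mathcal E)$ with countable edge set; $e\in\mathcal E$ has tail $\alpha(e)$ and head $\beta(e)$. For each $e$ there are a Borel probability kernel $K_e:S_{\alpha(e)}\times\mathcal B(E)\to[0,1]$ with $K_e(x,S_{\beta(e)})=1$ and $K_e(x,\{x\})=0$ for all $x\in S_{\alpha(e)}$, and a Borel rate $\lambda_e:S_{\alpha(e)}\to[0,\infty)$. For $x\in S_\alpha$, $\Lambda(x):=\sum_{e:\alpha(e)=\alpha}\lambda_e(x)$ and $\nu(x,B):=\sum_{e:\alpha(e)=\alpha}\lambda_e(x)K_e(x,B)$. It is assumed that $\sup_{x\in E}\Lambda(x)\le\overline\Lambda<\infty$. **Operator.** $\mathcal D_0:=\bigoplus_{\alpha}\mathcal C_\alpha$ is the set of bounded Borel $f:E\to\mathbb R$ with $f|_{S_\alpha}\in\mathcal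 C_\alpha$ for every $\alpha$ and $f|_{S_\alpha}=0$ for all but finitely many $\alpha$. For $f\in\mathcal D_0$, $x\in S_\alpha$: $Jf(x):=\int_E(f(y)-f(x))\,\nu(x,dy)$ and $Af(x):=L_\alpha(f|_{S_\alpha})(x)+Jf(x)$; so $A:\mathcal D_0\to B_b(E)$. **Martingale problem.** $\mathbb P\in\mathcal P(D_E)$ solves the martingale problem for $(A,\mathcal D_0)$ with initial condition $x$ if, for the canonical process $X$ on $D_E$, $\mathbb P(X_0=x)=1$ and for every $f\in\mathcal D_0$ the process $f(X_t)-f(X_0)-\int_0^tAf(X_s)\,ds$, $t\ge0$, is a martingale under $\mathbb P$ for the filtration generated by $X$. *)

theory Defs
  imports "HOL-Probability.Probability" "HOL-Analysis.Abstract_Euclidean_Space"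
begin

section \<open>Smooth manifolds and Riemannian metrics on subsets of a topological space\<close>

text \<open>
  Coordinates live in \<^const>\<open>Euclidean_space\<close> \<open>n\<close>, the sequences \<open>nat \<Rightarrow> real\<close> that vanish from
  index \<open>n\<close> on, so that the dimension is a term and may vary from stratum to stratum.
\<close>

definition partial_deriv :: "nat \<Rightarrow> ((nat \<Rightarrow> real) \<Rightarrow> real) \<Rightarrow> (nat \<Rightarrow> real) \<Rightarrow> real" where
  "partial_deriv i f z = deriv (\<lambda>t. f (z(i := t))) (z i)"

primrec ck_on :: "nat \<Rightarrow> nat \<Rightarrow> (nat \<Rightarrow> real) set \<Rightarrow> ((nat \<Rightarrow> real) \<Rightarrow> real) \<Rightarrow> bool" where
  "ck_on 0 n V f \<longleftrightarrow> continuous_map (subtopology (Euclidean_space n) V) euclideanreal f"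
| "ck_on (Suc k) n V f \<longleftrightarrow>
     continuous_map (subtopology (Euclidean_space n) V) euclideanreal f \<and>
     (\<forall>i<n. (\<forall>z\<in>V. (\<lambda>t. f (z(i := t))) differentiable (at (z i))) \<and>
            ck_on k n V (partial_deriv i f))"

definition smooth_on :: "nat \<Rightarrow> (nat \<Rightarrow> real) set \<Rightarrow> ((nat \<Rightarrow> real) \<Rightarrow> real) \<Rightarrow> bool" where
  "smooth_on n V f \<longleftrightarrow> (\<forall>k. ck_on k n V f)"

type_synonym 'a chart = "'a set \<times> ('a \<Rightarrow> nat \<Rightarrow> real)"

definition is_chart :: "nat \<Rightarrow> 'a::topological_space set \<Rightarrow> 'a chart \<Rightarrow> bool" where
  "is_chart n S c \<longleftrightarrow> (case c of (U, \<phi>) \<Rightarrow>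
     openin (top_of_set S) U \<and> openin (Euclidean_space n) (\<phi> ` U) \<and>
     homeomorphic_map (top_of_set U) (subtopology (Euclidean_space n) (\<phi> ` U)) \<phi>)"

definition smooth_atlas :: "nat \<Rightarrow> 'a::topological_space set \<Rightarrow> 'a chart set \<Rightarrow> bool" where
  "smooth_atlas n S \<A> \<longleftrightarrow>
     (\<forall>c\<in>\<A>. is_chart n S c) \<and> (\<Union>(U, \<phi>)\<in>\<A>. U) = S \<and>
     (\<forall>(U, \<phi>)\<in>\<A>. \<forall>(V, \<psi>)\<in>\<A>. \<forall>i<n.
        smooth_on n (\<phi> ` (U \<inter> V)) (\<lambda>z. \<psi> (inv_into U \<phi> z) i))"

definition smooth_functions :: "nat \<Rightarrow> 'a chart set \<Rightarrow> ('a \<Rightarrow> real) set" where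
  "smooth_functions n \<A> = {f. \<forall>(U, \<phi>)\<in>\<A>. smooth_on n (\<phi> ` U) (\<lambda>z. f (inv_into U \<phi> z))}"

text \<open>
  Tangent vectors are derivations at \<open>p\<close> of the algebra of smooth functions, set to zero on
  functions that are not smooth. Values of a function outside the manifold play no role: if
  \<open>h\<close> vanishes on it, let \<open>k\<close> be zero on it and one elsewhere; then \<open>h * k = h\<close>, and the product
  rule gives \<open>v h = 0\<close>.
\<close>

definition tangent_space :: "nat \<Rightarrow> 'a chart set \<Rightarrow> 'a \<Rightarrow> (('a \<Rightarrow> real) \<Rightarrow> real) set" where
  "tangent_space n \<A> p = {v.
     (\<forall>f\<in>smooth_functions n \<A>. \<forall>h\<in>smooth_functions n \<A>. \<forall>a b.
        v (\<lambda>x. a * f x + b * h x) = a * v f + b * v h) \<and>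
     (\<forall>f\<in>smooth_functions n \<A>. \<forall>h\<in>smooth_functions n \<A>.
        v (\<lambda>x. f x * h x) = f p * v h + h p * v f) \<and>
     (\<forall>f. f \<notin> smooth_functions n \<A> \<longrightarrow> v f = 0)}"

definition coord_vector :: "nat \<Rightarrow> 'a chart set \<Rightarrow> 'a chart \<Rightarrow> nat \<Rightarrow> 'a \<Rightarrow> ('a \<Rightarrow> real) \<Rightarrow> real" where
  "coord_vector n \<A> c i p f = (case c of (U, \<phi>) \<Rightarrow>
     if f \<in> smooth_functions n \<A> then partial_deriv i (\<lambda>z. f (inv_into U \<phi> z)) (\<phi> p) else 0)"

definition riemannian_metric ::
  "nat \<Rightarrow> 'a set \<Rightarrow> 'a chart set \<Rightarrow>
   ('a \<Rightarrow> (('a \<Rightarrow> real) \<Rightarrow> real) \<Rightarrow> (('a \<Rightarrow> real) \<Rightarrow> real) \<Rightarrow> real) \<Rightarrow> bool" where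
  "riemannian_metric n S \<A> g \<longleftrightarrow>
     (\<forall>p\<in>S. \<forall>u\<in>tangent_space n \<A> p. \<forall>v\<in>tangent_space n \<A> p.
        g p u v = g p v u \<and>
        (\<forall>w\<in>tangent_space n \<A> p. \<forall>a b.
           g p (\<lambda>f. a * u f + b * v f) w = a * g p u w + b * g p v w)) \<and>
     (\<forall>p\<in>S. \<forall>v\<in>tangent_space n \<A> p. v \<noteq> (\<lambda>f. 0) \<longrightarrow> g p v v > 0) \<and>
     (\<forall>c\<in>\<A>. \<forall>i<n. \<forall>j<n. case c of (U, \<phi>) \<Rightarrow>
        smooth_on n (\<phi> ` U)
          (\<lambda>z. g (inv_into U \<phi> z) (coord_vector n \<A> c i (inv_into U \<phi> z))
                                  (coord_vector n \<A> c j (inv_into U \<phi> z))))"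

text \<open>
  The state space is the whole type \<open>'a\<close>; separability is the class
  \<^class>\<open>second_countable_topology\<close>. Charts are homeomorphisms for the subspace topology of
  \<open>S \<alpha>\<close>, which is the requirement that the inclusion be a homeomorphism onto its image.
\<close>

locale stratified_riemannian_space =
  fixes I :: "'i set" and S :: "'i \<Rightarrow> 'a::{metric_space, second_countable_topology} set"
    and n :: "'i \<Rightarrow> nat" and \<A> :: "'i \<Rightarrow> 'a chart set"
    and g :: "'i \<Rightarrow> 'a \<Rightarrow> (('a \<Rightarrow> real) \<Rightarrow> real) \<Rightarrow> (('a \<Rightarrow> real) \<Rightarrow> real) \<Rightarrow> real"
  assumes locally_compact: "locally_compact_space (euclidean :: 'a topology)"
    and countable_strata: "countable I"
    and disjoint_strata: "disjoint_family_on S I"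
    and cover: "(\<Union>\<alpha>\<in>I. S \<alpha>) = UNIV"
    and nonempty: "\<And>\<alpha>. \<alpha> \<in> I \<Longrightarrow> S \<alpha> \<noteq> {}"
    and connected: "\<And>\<alpha>. \<alpha> \<in> I \<Longrightarrow> connected (S \<alpha>)"
    and borel_strata: "\<And>\<alpha>. \<alpha> \<in> I \<Longrightarrow> S \<alpha> \<in> sets borel"
    and smooth: "\<And>\<alpha>. \<alpha> \<in> I \<Longrightarrow> smooth_atlas (n \<alpha>) (S \<alpha>) (\<A> \<alpha>)"
    and metric: "\<And>\<alpha>. \<alpha> \<in> I \<Longrightarrow> riemannian_metric (n \<alpha>) (S \<alpha>) (\<A> \<alpha>) (g \<alpha>)"

definition stratum_of :: "'i set \<Rightarrow> ('i \<Rightarrow> 'a set) \<Rightarrow> 'a \<Rightarrow> 'i" where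
  "stratum_of I S x = (THE \<alpha>. \<alpha> \<in> I \<and> x \<in> S \<alpha>)"


section \<open>Skorokhod space\<close>

text \<open>Paths are indexed by \<open>real\<close> and take the value \<^const>\<open>undefined\<close> at negative times.\<close>

definition skorokhod_space :: "'a::metric_space set \<Rightarrow> (real \<Rightarrow> 'a) set" where
  "skorokhod_space S = {\<omega> \<in> {0..} \<rightarrow>\<^sub>E S.
     (\<forall>t\<ge>0. (\<omega> \<longlongrightarrow> \<omega> t) (at_right t)) \<and> (\<forall>t>0. \<exists>l\<in>S. (\<omega> \<longlongrightarrow> l) (at_left t))}"

definition time_change :: "(real \<Rightarrow> real) \<Rightarrow> bool" where
  "time_change \<theta> \<longleftrightarrow> \<theta> ` {0..} = {0..} \<and> strict_mono_on {0..} \<theta>"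

definition skorokhod_nbhd ::
  "'a::metric_space set \<Rightarrow> (real \<Rightarrow> 'a) \<Rightarrow> real \<Rightarrow> real \<Rightarrow> (real \<Rightarrow> 'a) set" where
  "skorokhod_nbhd S \<omega> T \<epsilon> = {\<omega>' \<in> skorokhod_space S. \<exists>\<theta>. time_change \<theta> \<and>
     (\<forall>t\<ge>0. \<bar>\<theta> t - t\<bar> < \<epsilon>) \<and> (\<forall>t\<in>{0..T}. dist (\<omega>' (\<theta> t)) (\<omega> t) < \<epsilon>)}"

text \<open>
  The J1 topology: a sequence \<open>\<omega>\<^sub>n\<close> is eventually in every \<open>skorokhod_nbhd S \<omega> T \<epsilon>\<close> iff there are
  time changes \<open>\<theta>\<^sub>n\<close> with \<open>\<theta>\<^sub>n t - t\<close> tending to zero uniformly in \<open>t\<close> and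
  \<open>dist (\<omega>\<^sub>n (\<theta>\<^sub>n t)) (\<omega> t)\<close> tending to zero uniformly on bounded time intervals.
\<close>

definition skorokhod_topology :: "'a::metric_space set \<Rightarrow> (real \<Rightarrow> 'a) topology" where
  "skorokhod_topology S = topology (\<lambda>G. G \<subseteq> skorokhod_space S \<and>
     (\<forall>\<omega>\<in>G. \<exists>T>0. \<exists>\<epsilon>>0. skorokhod_nbhd S \<omega> T \<epsilon> \<subseteq> G))"

lemma skorokhod_nbhd_mono:
  "T' \<le> T \<Longrightarrow> \<epsilon> \<le> \<epsilon>' \<Longrightarrow> skorokhod_nbhd S \<omega> T \<epsilon> \<subseteq> skorokhod_nbhd S \<omega> T' \<epsilon>'"
  unfolding skorokhod_nbhd_def
  by (intro Collect_mono conj_mono ex_mono imp_refl impI ballI allI)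
    (simp, meson order_less_le_trans, meson atLeastAtMost_iff order_less_le_trans order_trans)

lemma openin_skorokhod_topology:
  "openin (skorokhod_topology S) G \<longleftrightarrow> G \<subseteq> skorokhod_space S \<and>
     (\<forall>\<omega>\<in>G. \<exists>T>0. \<exists>\<epsilon>>0. skorokhod_nbhd S \<omega> T \<epsilon> \<subseteq> G)"
proof -
  have "istopology (\<lambda>G. G \<subseteq> skorokhod_space S \<and>
     (\<forall>\<omega>\<in>G. \<exists>T>0. \<exists>\<epsilon>>0. skorokhod_nbhd S \<omega> T \<epsilon> \<subseteq> G))"
    (is "istopology ?P")
    unfolding istopology_def
  proof (intro conjI allI impI)
    fix G H assume GH: "?P G" "?P H"
    show "G \<inter> H \<subseteq> skorokhod_space S" using GH by blast
    show "\<forall>\<omega>\<in>G \<inter> H. \<exists>T>0. \<exists>\<epsilon>>0. skorokhod_nbhd S \<omega> T \<epsilon> \<subseteq> G \<inter> H"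
    proof
      fix \<omega> assume "\<omega> \<in> G \<inter> H"
      then obtain T1 e1 T2 e2 where *: "T1 > 0" "e1 > 0" "T2 > 0" "e2 > 0"
          "skorokhod_nbhd S \<omega> T1 e1 \<subseteq> G" "skorokhod_nbhd S \<omega> T2 e2 \<subseteq> H"
        using GH by (metis IntD1 IntD2)
      have "skorokhod_nbhd S \<omega> (max T1 T2) (min e1 e2) \<subseteq> skorokhod_nbhd S \<omega> T1 e1"
           "skorokhod_nbhd S \<omega> (max T1 T2) (min e1 e2) \<subseteq> skorokhod_nbhd S \<omega> T2 e2"
        by (simp_all add: skorokhod_nbhd_mono)
      with * show "\<exists>T>0. \<exists>\<epsilon>>0. skorokhod_nbhd S \<omega> T \<epsilon> \<subseteq> G \<inter> H"
        by (intro exI[of _ "max T1 T2"] conjI exI[of _ "min e1 e2"]) auto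
    qed
  next
    fix \<K> assume \<K>: "\<forall>K\<in>\<K>. ?P K"
    show "\<Union>\<K> \<subseteq> skorokhod_space S" using \<K> by blast
    show "\<forall>\<omega>\<in>\<Union>\<K>. \<exists>T>0. \<exists>\<epsilon>>0. skorokhod_nbhd S \<omega> T \<epsilon> \<subseteq> \<Union>\<K>"
      using \<K> by (meson UnionE Union_upper subset_trans)
  qed
  then show ?thesis
    by (simp add: skorokhod_topology_def)
qed

lemma topspace_skorokhod_topology: "topspace (skorokhod_topology S) = skorokhod_space S"
proof
  show "topspace (skorokhod_topology S) \<subseteq> skorokhod_space S"
    using openin_skorokhod_topology[of S "topspace (skorokhod_topology S)"] by simp
  have "openin (skorokhod_topology S) (skorokhod_space S)"
    unfolding openin_skorokhod_topology skorokhod_nbhd_def by (auto intro: exI[of _ 1])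
  then show "skorokhod_space S \<subseteq> topspace (skorokhod_topology S)"
    by (rule openin_subset)
qed

definition skorokhod_borel :: "'a::metric_space set \<Rightarrow> (real \<Rightarrow> 'a) measure" where
  "skorokhod_borel S = sigma (skorokhod_space S) {G. openin (skorokhod_topology S) G}"

definition path_filtration :: "'a::metric_space set \<Rightarrow> real \<Rightarrow> (real \<Rightarrow> 'a) measure" where
  "path_filtration S t = sigma (skorokhod_space S)
     {{\<omega> \<in> skorokhod_space S. \<omega> s \<in> B} | s B. 0 \<le> s \<and> s \<le> t \<and> B \<in> sets borel}"


section \<open>Semigroups, generators and cores\<close>

text \<open>
  A function on \<open>S\<close> is identified with its extension by zero to the whole type; the supremum
  norm over \<open>S\<close> is then the supremum over the type.
\<close>

definition zero_ext :: "'a set \<Rightarrow> ('a \<Rightarrow> real) \<Rightarrow> 'a \<Rightarrow> real" where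
  "zero_ext S f = (\<lambda>x. if x \<in> S then f x else 0)"

definition C0 :: "'a::topological_space set \<Rightarrow> ('a \<Rightarrow> real) set" where
  "C0 S = {f. continuous_on S f \<and>
     (\<forall>\<epsilon>>0. \<exists>K. compact K \<and> K \<subseteq> S \<and> (\<forall>x\<in>S - K. \<bar>f x\<bar> < \<epsilon>)) \<and> (\<forall>x. x \<notin> S \<longrightarrow> f x = 0)}"

definition sup_norm :: "('a \<Rightarrow> real) \<Rightarrow> real" where
  "sup_norm f = (SUP x. \<bar>f x\<bar>)"

definition contraction_semigroup ::
  "('a \<Rightarrow> real) set \<Rightarrow> (real \<Rightarrow> ('a \<Rightarrow> real) \<Rightarrow> 'a \<Rightarrow> real) \<Rightarrow> bool" where
  "contraction_semigroup V P \<longleftrightarrow>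
     (\<forall>t\<ge>0. \<forall>f\<in>V. P t f \<in> V \<and> sup_norm (P t f) \<le> sup_norm f) \<and>
     (\<forall>t\<ge>0. \<forall>f\<in>V. \<forall>h\<in>V. \<forall>a b.
        P t (\<lambda>x. a * f x + b * h x) = (\<lambda>x. a * P t f x + b * P t h x)) \<and>
     (\<forall>f\<in>V. P 0 f = f) \<and>
     (\<forall>s\<ge>0. \<forall>t\<ge>0. \<forall>f\<in>V. P (s + t) f = P s (P t f)) \<and>
     (\<forall>f\<in>V. ((\<lambda>t. sup_norm (\<lambda>x. P t f x - f x)) \<longlongrightarrow> 0) (at_right 0))"

definition generator_graph ::
  "('a \<Rightarrow> real) set \<Rightarrow> (real \<Rightarrow> ('a \<Rightarrow> real) \<Rightarrow> 'a \<Rightarrow> real) \<Rightarrow> (('a \<Rightarrow> real) \<times> ('a \<Rightarrow> real)) set" where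
  "generator_graph V P = {(f, h). f \<in> V \<and> h \<in> V \<and>
     ((\<lambda>t. sup_norm (\<lambda>x. (P t f x - f x) / t - h x)) \<longlongrightarrow> 0) (at_right 0)}"

definition generator ::
  "('a \<Rightarrow> real) set \<Rightarrow> (real \<Rightarrow> ('a \<Rightarrow> real) \<Rightarrow> 'a \<Rightarrow> real) \<Rightarrow> ('a \<Rightarrow> real) \<Rightarrow> 'a \<Rightarrow> real" where
  "generator V P f = (THE h. (f, h) \<in> generator_graph V P)"

definition linear_subspace :: "('a \<Rightarrow> real) set \<Rightarrow> bool" where
  "linear_subspace C \<longleftrightarrow>
     (\<lambda>x. 0) \<in> C \<and> (\<forall>f\<in>C. \<forall>h\<in>C. \<forall>a b. (\<lambda>x. a * f x + b * h x) \<in> C)"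

text \<open>The closure of the generator restricted to \<open>C\<close> is the generator.\<close>

definition is_core ::
  "('a \<Rightarrow> real) set \<Rightarrow> (real \<Rightarrow> ('a \<Rightarrow> real) \<Rightarrow> 'a \<Rightarrow> real) \<Rightarrow> ('a \<Rightarrow> real) set \<Rightarrow> bool" where
  "is_core V P C \<longleftrightarrow> C \<subseteq> Domain (generator_graph V P) \<and>
     {(f, h). f \<in> V \<and> h \<in> V \<and> (\<forall>\<epsilon>>0. \<exists>k\<in>C.
        sup_norm (\<lambda>x. k x - f x) < \<epsilon> \<and> sup_norm (\<lambda>x. generator V P k x - h x) < \<epsilon>)}
     = generator_graph V P"

definition measure_determining :: "'a::topological_space set \<Rightarrow> ('a \<Rightarrow> real) set \<Rightarrow> bool" where
  "measure_determining S C \<longleftrightarrow> (\<forall>\<mu> \<nu>.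
     finite_measure \<mu> \<longrightarrow> finite_measure \<nu> \<longrightarrow>
     sets \<mu> = sets (restrict_space borel S) \<longrightarrow> sets \<nu> = sets (restrict_space borel S) \<longrightarrow>
     (\<forall>f\<in>C. (\<integral>x. f x \<partial>\<mu>) = (\<integral>x. f x \<partial>\<nu>)) \<longrightarrow> \<mu> = \<nu>)"


section \<open>Diffusions in the strata and jumps between them\<close>

definition transition_op ::
  "'a::metric_space set \<Rightarrow> ('a \<Rightarrow> (real \<Rightarrow> 'a) measure) \<Rightarrow> real \<Rightarrow> ('a \<Rightarrow> real) \<Rightarrow> 'a \<Rightarrow> real" where
  "transition_op S Q t f = zero_ext S (\<lambda>x. \<integral>\<omega>. f (\<omega> t) \<partial>Q x)"

locale stratum_diffusion =
  fixes S :: "'a::{metric_space, second_countable_topology} set"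
    and Q :: "'a \<Rightarrow> (real \<Rightarrow> 'a) measure" and C :: "('a \<Rightarrow> real) set"
  assumes kernel: "Q \<in> restrict_space borel S \<rightarrow>\<^sub>M prob_algebra (skorokhod_borel S)"
    and markov: "\<And>x s t f. x \<in> S \<Longrightarrow> 0 \<le> s \<Longrightarrow> 0 \<le> t \<Longrightarrow>
          f \<in> borel_measurable (restrict_space borel S) \<Longrightarrow> bounded (f ` S) \<Longrightarrow>
          AE \<omega> in Q x. real_cond_exp (Q x) (path_filtration S s) (\<lambda>\<omega>. f (\<omega> (s + t))) \<omega>
                        = transition_op S Q t f (\<omega> s)"
    and start: "\<And>x. x \<in> S \<Longrightarrow> AE \<omega> in Q x. \<omega> 0 = x"
    and stays: "\<And>x. x \<in> S \<Longrightarrow> AE \<omega> in Q x. \<forall>t\<ge>0. \<omega> t \<in> S"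
    and continuous: "\<And>x. x \<in> S \<Longrightarrow> AE \<omega> in Q x. continuous_on {0..} \<omega>"
    and feller: "contraction_semigroup (C0 S) (transition_op S Q)"
    and subspace: "linear_subspace C"
    and core: "is_core (C0 S) (transition_op S Q) C"
    and determining: "measure_determining S C"

text \<open>Sums over the edges leaving \<open>\<alpha>\<close> are integrals against counting measure.\<close>

definition total_rate ::
  "'e set \<Rightarrow> ('e \<Rightarrow> 'i) \<Rightarrow> ('e \<Rightarrow> 'a \<Rightarrow> real) \<Rightarrow> 'i \<Rightarrow> 'a \<Rightarrow> ennreal" where
  "total_rate Ed tail r \<alpha> x = (\<integral>\<^sup>+e. ennreal (r e x) \<partial>count_space {e \<in> Ed. tail e = \<alpha>})"

definition jump_measure ::
  "'e set \<Rightarrow> ('e \<Rightarrow> 'i) \<Rightarrow> ('e \<Rightarrow> 'a::topological_space \<Rightarrow> 'a measure) \<Rightarrow> ('e \<Rightarrow> 'a \<Rightarrow> real) \<Rightarrow>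
   'i \<Rightarrow> 'a \<Rightarrow> 'a measure" where
  "jump_measure Ed tail K r \<alpha> x = measure_of UNIV (sets borel)
     (\<lambda>B. \<integral>\<^sup>+e. ennreal (r e x) * emeasure (K e x) B \<partial>count_space {e \<in> Ed. tail e = \<alpha>})"

lemma emeasure_jump_measure:
  assumes "\<And>e. e \<in> Ed \<Longrightarrow> tail e = \<alpha> \<Longrightarrow> sets (K e x) = sets borel" and "B \<in> sets borel"
  shows "emeasure (jump_measure Ed tail K r \<alpha> x) B =
    (\<integral>\<^sup>+e. ennreal (r e x) * emeasure (K e x) B \<partial>count_space {e \<in> Ed. tail e = \<alpha>})"
proof (rule emeasure_measure_of[OF jump_measure_def])
  have sets_eq: "sets (jump_measure Ed tail K r \<alpha> x) = sets borel"
    unfolding jump_measure_def using sets.sets_measure_of_eq[of borel] by simp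
  show "sets borel \<subseteq> Pow UNIV" by simp
  show "B \<in> sets (jump_measure Ed tail K r \<alpha> x)" using assms(2) sets_eq by simp
  show "positive (sets (jump_measure Ed tail K r \<alpha> x))
     (\<lambda>B. \<integral>\<^sup>+e. ennreal (r e x) * emeasure (K e x) B \<partial>count_space {e \<in> Ed. tail e = \<alpha>})"
    by (simp add: positive_def)
  show "countably_additive (sets (jump_measure Ed tail K r \<alpha> x))
     (\<lambda>B. \<integral>\<^sup>+e. ennreal (r e x) * emeasure (K e x) B \<partial>count_space {e \<in> Ed. tail e = \<alpha>})"
  proof (rule countably_additiveI)
    fix F :: "nat \<Rightarrow> _"
    assume F: "range F \<subseteq> sets (jump_measure Ed tail K r \<alpha> x)" "disjoint_family F"
    have "(\<Sum>i. \<integral>\<^sup>+e. ennreal (r e x) * emeasure (K e x) (F i) \<partial>count_space {e \<in> Ed. tail e = \<alpha>})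
        = (\<integral>\<^sup>+e. (\<Sum>i. ennreal (r e x) * emeasure (K e x) (F i)) \<partial>count_space {e \<in> Ed. tail e = \<alpha>})"
      by (rule nn_integral_suminf[symmetric]) simp
    also have "\<dots> = (\<integral>\<^sup>+e. ennreal (r e x) * emeasure (K e x) (\<Union> (range F))
                      \<partial>count_space {e \<in> Ed. tail e = \<alpha>})"
      using F assms(1) sets_eq by (intro nn_integral_cong) (auto simp: suminf_emeasure)
    finally show "(\<Sum>i. \<integral>\<^sup>+e. ennreal (r e x) * emeasure (K e x) (F i)
                         \<partial>count_space {e \<in> Ed. tail e = \<alpha>})
        = (\<integral>\<^sup>+e. ennreal (r e x) * emeasure (K e x) (\<Union> (range F))
                      \<partial>count_space {e \<in> Ed. tail e = \<alpha>})" .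
  qed
qed

locale jump_mechanism =
  fixes I :: "'i set" and S :: "'i \<Rightarrow> 'a::{metric_space, second_countable_topology} set"
    and Ed :: "'e set" and tail head :: "'e \<Rightarrow> 'i"
    and K :: "'e \<Rightarrow> 'a \<Rightarrow> 'a measure" and r :: "'e \<Rightarrow> 'a \<Rightarrow> real"
  assumes countable_edges: "countable Ed"
    and tail_in: "\<And>e. e \<in> Ed \<Longrightarrow> tail e \<in> I"
    and head_in: "\<And>e. e \<in> Ed \<Longrightarrow> head e \<in> I"
    and jump_kernel: "\<And>e. e \<in> Ed \<Longrightarrow> K e \<in> restrict_space borel (S (tail e)) \<rightarrow>\<^sub>M prob_algebra borel"
    and jump_target: "\<And>e x. e \<in> Ed \<Longrightarrow> x \<in> S (tail e) \<Longrightarrow> emeasure (K e x) (S (head e)) = 1"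
    and genuine_jump: "\<And>e x. e \<in> Ed \<Longrightarrow> x \<in> S (tail e) \<Longrightarrow> emeasure (K e x) {x} = 0"
    and rate_borel: "\<And>e. e \<in> Ed \<Longrightarrow> r e \<in> borel_measurable (restrict_space borel (S (tail e)))"
    and rate_nonneg: "\<And>e x. e \<in> Ed \<Longrightarrow> x \<in> S (tail e) \<Longrightarrow> 0 \<le> r e x"
    and rate_bounded: "\<exists>c::real. \<forall>\<alpha>\<in>I. \<forall>x\<in>S \<alpha>. total_rate Ed tail r \<alpha> x \<le> ennreal c"


section \<open>The operator and its martingale problem\<close>

definition operator_domain ::
  "'i set \<Rightarrow> ('i \<Rightarrow> 'a::topological_space set) \<Rightarrow> ('i \<Rightarrow> ('a \<Rightarrow> real) set) \<Rightarrow> ('a \<Rightarrow> real) set" where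
  "operator_domain I S C = {f. f \<in> borel_measurable borel \<and> bounded (range f) \<and>
     (\<forall>\<alpha>\<in>I. zero_ext (S \<alpha>) f \<in> C \<alpha>) \<and> finite {\<alpha> \<in> I. \<exists>x\<in>S \<alpha>. f x \<noteq> 0}}"

definition jump_operator ::
  "'i set \<Rightarrow> ('i \<Rightarrow> 'a::topological_space set) \<Rightarrow> 'e set \<Rightarrow> ('e \<Rightarrow> 'i) \<Rightarrow> ('e \<Rightarrow> 'a \<Rightarrow> 'a measure) \<Rightarrow>
   ('e \<Rightarrow> 'a \<Rightarrow> real) \<Rightarrow> ('a \<Rightarrow> real) \<Rightarrow> 'a \<Rightarrow> real" where
  "jump_operator I S Ed tail K r f x =
     (\<integral>y. (f y - f x) \<partial>jump_measure Ed tail K r (stratum_of I S x) x)"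

definition diffusion_operator ::
  "'i set \<Rightarrow> ('i \<Rightarrow> 'a::metric_space set) \<Rightarrow> ('i \<Rightarrow> 'a \<Rightarrow> (real \<Rightarrow> 'a) measure) \<Rightarrow>
   ('a \<Rightarrow> real) \<Rightarrow> 'a \<Rightarrow> real" where
  "diffusion_operator I S Q f x = (let \<alpha> = stratum_of I S x in
     generator (C0 (S \<alpha>)) (transition_op (S \<alpha>) (Q \<alpha>)) (zero_ext (S \<alpha>) f) x)"

definition full_operator ::
  "'i set \<Rightarrow> ('i \<Rightarrow> 'a::metric_space set) \<Rightarrow> ('i \<Rightarrow> 'a \<Rightarrow> (real \<Rightarrow> 'a) measure) \<Rightarrow>
   'e set \<Rightarrow> ('e \<Rightarrow> 'i) \<Rightarrow> ('e \<Rightarrow> 'a \<Rightarrow> 'a measure) \<Rightarrow> ('e \<Rightarrow> 'a \<Rightarrow> real) \<Rightarrow>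
   ('a \<Rightarrow> real) \<Rightarrow> 'a \<Rightarrow> real" where
  "full_operator I S Q Ed tail K r f x =
     diffusion_operator I S Q f x + jump_operator I S Ed tail K r f x"

definition martingale :: "'w measure \<Rightarrow> (real \<Rightarrow> 'w measure) \<Rightarrow> (real \<Rightarrow> 'w \<Rightarrow> real) \<Rightarrow> bool" where
  "martingale P F M \<longleftrightarrow>
     (\<forall>t\<ge>0. subalgebra P (F t) \<and> M t \<in> borel_measurable (F t) \<and> integrable P (M t)) \<and>
     (\<forall>s\<ge>0. \<forall>t\<ge>s. AE \<omega> in P. real_cond_exp P (F s) (M t) \<omega> = M s \<omega>)"

definition solves_martingale_problem ::
  "(('a::metric_space \<Rightarrow> real) \<Rightarrow> 'a \<Rightarrow> real) \<Rightarrow> ('a \<Rightarrow> real) set \<Rightarrow> 'a \<Rightarrow> (real \<Rightarrow> 'a) measure \<Rightarrow> bool" where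
  "solves_martingale_problem A D x P \<longleftrightarrow>
     P \<in> space (prob_algebra (skorokhod_borel UNIV)) \<and>
     (AE \<omega> in P. \<omega> 0 = x) \<and>
     (\<forall>f\<in>D. martingale P (path_filtration UNIV)
        (\<lambda>t \<omega>. f (\<omega> t) - f (\<omega> 0) - (LINT s:{0..t}|lborel. A f (\<omega> s))))"

end

theory Submission
  imports Defs
begin

text \<open>
  Let \<open>c \<ge> 1\<close> bound the total jump rate. By uniformization \<open>J f = c (\<Pi> f - f)\<close> for a probability
  kernel \<open>\<Pi>\<close>, so the operator is a perturbation, by jumps at the rings of a Poisson clock of rate \<open>c\<close>,
  of the process with semigroup \<open>P\<close> that diffuses in its stratum. Gluing independent pieces of
  diffusion at the rings gives a solution: its Markov and Dynkin identities hold up to a quantity that,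
  by conditioning on the first ring, is bounded on \<open>[0, t]\<close> by \<open>1 - e\<^sup>-\<^sup>c\<^sup>t\<close> times its own supremum,
  hence vanishes.

  For uniqueness, let \<open>X\<close> be a solution, \<open>A\<close> an event of the past of \<open>s\<close>, and
  \<open>m\<^sub>u f = E (1\<^sub>A f (X\<^sub>s\<^sub>+\<^sub>u))\<close>. As the cores are preserved up to small graph-norm errors by the diffusion
  semigroups, the forward equation for \<open>m\<close> yields its mild form
  \<open>\<integral>\<^sub>0\<^sup>t m\<^sub>u f du = \<integral>\<^sub>0\<^sup>t e\<^sup>-\<^sup>c\<^sup>v m\<^sub>0 (P\<^sub>v f) dv + \<integral>\<integral> c e\<^sup>-\<^sup>c\<^sup>v m\<^sub>u (\<Pi> P\<^sub>v f) du dv\<close>, the last integral over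
  \<open>u, v \<ge> 0\<close>, \<open>u + v \<le> t\<close>. Both sides are measures in \<open>f\<close>, so the equation extends from the core to
  bounded Borel \<open>f\<close>, where it is a contraction; thus \<open>m\<^sub>0\<close> determines \<open>m\<close>, and the
  finite-dimensional distributions are determined by induction. They determine the law because the
  Borel sets of the J1 topology are generated by the coordinates.
\<close>

section \<open>The Borel sets of Skorokhod space\<close>

text \<open>A clock whose rate does not depend on the position rings independently of the motion
  between the rings; this is why the bounded total rate is replaced by a constant one, the missing
  rate being spent on jumps that stay put. Uniqueness meets three obstacles. \<open>P v f\<close>
  leaves the domain, so the forward equation is first extended to it by approximation.
  Differentiating m_u (P_v f) along v = t - u would act on both factors at once; integration over
  the triangle u + v \<le> t needs only separate integral identities in u and in v. The price is
  that time integrals of m are compared; fixed times return through the forward equation, whose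
  right side is a time integral of the bounded function \<open>gen f\<close>. Finally, the
  determining class separates finite measures, not signed ones, so terms with a minus sign change
  sides before it is used. Conditioning on the past is integration over an event throughout, so no
  conditional laws are needed and events of probability 0 cause no trouble.\<close>

lemma space_skorokhod_borel [simp]: "space (skorokhod_borel S) = skorokhod_space S"
  unfolding skorokhod_borel_def by (rule space_measure_of) (auto simp: openin_skorokhod_topology)

lemma sets_skorokhod_borel:
  "sets (skorokhod_borel S) = sigma_sets (skorokhod_space S) {G. openin (skorokhod_topology S) G}"
  unfolding skorokhod_borel_def by (rule sets_measure_of) (auto simp: openin_skorokhod_topology)

lemma openin_imp_sets_skorokhod: "openin (skorokhod_topology S) G \<Longrightarrow> G \<in> sets (skorokhod_borel S)"
  by (auto simp: sets_skorokhod_borel)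

lemma skorokhod_space_right: "\<omega> \<in> skorokhod_space S \<Longrightarrow> 0 \<le> t \<Longrightarrow> (\<omega> \<longlongrightarrow> \<omega> t) (at_right t)"
  by (simp add: skorokhod_space_def)

lemma skorokhod_space_in: "\<omega> \<in> skorokhod_space S \<Longrightarrow> 0 \<le> t \<Longrightarrow> \<omega> t \<in> S"
  by (auto simp: skorokhod_space_def PiE_iff)

lemma skorokhod_space_mono: "S \<subseteq> S' \<Longrightarrow> skorokhod_space S \<subseteq> skorokhod_space S'"
  by (fastforce simp: skorokhod_space_def PiE_iff)

section \<open>Evaluation at a fixed time\<close>

lemma skorokhod_space_eventually:
  assumes "\<omega> \<in> skorokhod_space S" "0 \<le> t" "e > 0"
  obtains b where "b > t" "\<And>u. t \<le> u \<Longrightarrow> u < b \<Longrightarrow> dist (\<omega> u) (\<omega> t) < e"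
proof -
  have "eventually (\<lambda>u. dist (\<omega> u) (\<omega> t) < e) (at_right t)"
    using skorokhod_space_right[OF assms(1,2)] assms(3) by (rule tendstoD)
  then obtain b where "b > t" "\<And>u. t < u \<Longrightarrow> u < b \<Longrightarrow> dist (\<omega> u) (\<omega> t) < e"
    by (auto simp: eventually_at_right_field)
  then show ?thesis
    using that[of b] \<open>e > 0\<close> by (metis dist_self order_le_less)
qed

text \<open>Evaluation at one time is not continuous for J1, but visiting an open set somewhere in
  an open time interval is stable: a small perturbation moves the visit at \<open>u\<close> by less
  than its distance to the ends of the interval, and the value by less than the room that
  \<open>U\<close> leaves around it. Since \<open>u > a \<ge> 0\<close>, the horizon
  \<open>u\<close> is admissible.\<close>

lemma openin_skorokhod_hit:
  assumes U: "open U" and a: "0 \<le> a"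
  shows "openin (skorokhod_topology S) {\<omega> \<in> skorokhod_space S. \<exists>u\<in>{a<..<b}. \<omega> u \<in> U}"
  unfolding openin_skorokhod_topology
proof (intro conjI ballI)
  fix \<omega> assume "\<omega> \<in> {\<omega> \<in> skorokhod_space S. \<exists>u\<in>{a<..<b}. \<omega> u \<in> U}"
  then obtain u where u: "a < u" "u < b" "\<omega> u \<in> U" by auto
  obtain d where d: "d > 0" "ball (\<omega> u) d \<subseteq> U"
    using U u(3) by (meson open_contains_ball)
  let ?e = "min d (min (u - a) (b - u))"
  have "skorokhod_nbhd S \<omega> u ?e \<subseteq> {\<omega> \<in> skorokhod_space S. \<exists>u\<in>{a<..<b}. \<omega> u \<in> U}"
  proof
    fix \<omega>' assume "\<omega>' \<in> skorokhod_nbhd S \<omega> u ?e"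
    then obtain \<theta> where \<theta>: "\<omega>' \<in> skorokhod_space S" "\<And>t. t \<ge> 0 \<Longrightarrow> \<bar>\<theta> t - t\<bar> < ?e"
        "\<And>t. t \<in> {0..u} \<Longrightarrow> dist (\<omega>' (\<theta> t)) (\<omega> t) < ?e"
      unfolding skorokhod_nbhd_def by blast
    have "\<bar>\<theta> u - u\<bar> < ?e" "dist (\<omega>' (\<theta> u)) (\<omega> u) < ?e"
      using \<theta>(2)[of u] \<theta>(3)[of u] a u by auto
    then have "\<theta> u \<in> {a<..<b}" "\<omega>' (\<theta> u) \<in> U"
      using d(2) by (auto simp: dist_commute)
    then show "\<omega>' \<in> {\<omega> \<in> skorokhod_space S. \<exists>u\<in>{a<..<b}. \<omega> u \<in> U}"
      using \<theta>(1) by blast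
  qed
  then show "\<exists>T>0. \<exists>\<epsilon>>0. skorokhod_nbhd S \<omega> T \<epsilon>
      \<subseteq> {\<omega> \<in> skorokhod_space S. \<exists>u\<in>{a<..<b}. \<omega> u \<in> U}"
    using a u d(1) by (intro exI[of _ u] conjI exI[of _ ?e]) auto
qed auto

text \<open>By right continuity, \<open>\<omega> t\<close> lies in a closed \<open>F\<close> exactly
  when for every \<open>k\<close> the path visits the open 1/(k+1)-neighbourhood of \<open>F\<close>
  during the open interval of length 1/(k+1) after \<open>t\<close>. These are countably many open
  conditions.\<close>

lemma measurable_skorokhod_eval:
  assumes t: "0 \<le> t"
  shows "(\<lambda>\<omega>. \<omega> t) \<in> skorokhod_borel S \<rightarrow>\<^sub>M borel"
proof -
  have closed: "{\<omega> \<in> skorokhod_space S. \<omega> t \<in> F} \<in> sets (skorokhod_borel S)" if F: "closed F" for F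
  \<comment> \<open>The empty set is split off because \<open>infdist\<close> to it is 0 by
    convention, which would make every path qualify.\<close>
  proof (cases "F = {}")
    case False
    define U where "U k = {y. infdist y F < 1 / real (Suc k)}" for k
    have U: "open (U k)" for k
      unfolding U_def by (intro open_Collect_less continuous_intros)
    define H where "H k = {\<omega> \<in> skorokhod_space S. \<exists>u\<in>{t<..<t + 1 / real (Suc k)}. \<omega> u \<in> U k}" for k
    have "{\<omega> \<in> skorokhod_space S. \<omega> t \<in> F} = (\<Inter>k. H k)"
    proof (intro equalityI subsetI)
      fix \<omega> assume \<omega>: "\<omega> \<in> {\<omega> \<in> skorokhod_space S. \<omega> t \<in> F}"
      have "\<omega> \<in> H k" for k
      proof -
        obtain b where b: "b > t" "\<And>u. t \<le> u \<Longrightarrow> u < b \<Longrightarrow> dist (\<omega> u) (\<omega> t) < 1 / real (Suc k)"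
          using skorokhod_space_eventually[of \<omega> S t "1 / real (Suc k)"] \<omega> t by auto
        obtain u where u: "t < u" "u < min b (t + 1 / real (Suc k))"
          using dense[of t "min b (t + 1 / real (Suc k))"] b(1) by auto
        have "infdist (\<omega> u) F \<le> dist (\<omega> u) (\<omega> t)"
          using \<omega> by (intro infdist_le) auto
        then have "\<omega> u \<in> U k" using b(2)[of u] u unfolding U_def by auto
        with u \<omega> show ?thesis unfolding H_def by auto
      qed
      then show "\<omega> \<in> (\<Inter>k. H k)" by auto
    next
      fix \<omega> assume \<omega>: "\<omega> \<in> (\<Inter>k. H k)"
      then have sp: "\<omega> \<in> skorokhod_space S" unfolding H_def by auto
      have "infdist (\<omega> t) F < e" if "e > 0" for e
      proof -
        obtain b where b: "b > t" "\<And>u. t \<le> u \<Longrightarrow> u < b \<Longrightarrow> dist (\<omega> u) (\<omega> t) < e / 2"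
          using skorokhod_space_eventually[OF sp t, of "e/2"] \<open>e > 0\<close> by auto
        obtain k where k: "1 / real (Suc k) < min (e / 2) (b - t)"
          using nat_approx_posE[of "min (e/2) (b-t)"] \<open>e > 0\<close> b(1) by auto
        obtain u where "u \<in> {t<..<t + 1 / real (Suc k)}" and uk: "\<omega> u \<in> U k"
          using \<omega> unfolding H_def by blast
        then have u: "t < u" "u < t + 1 / real (Suc k)" by simp_all
        have "infdist (\<omega> t) F \<le> infdist (\<omega> u) F + dist (\<omega> t) (\<omega> u)"
          by (rule infdist_triangle)
        then show ?thesis using b(2)[of u] k u uk unfolding U_def by (auto simp: dist_commute)
      qed
      then have "infdist (\<omega> t) F \<le> 0" by (meson linorder_not_le order_less_irrefl)
      then have "\<omega> t \<in> F" using F False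
        by (metis antisym in_closed_iff_infdist_zero infdist_nonneg)
      with sp show "\<omega> \<in> {\<omega> \<in> skorokhod_space S. \<omega> t \<in> F}" by simp
    qed
    moreover have "H k \<in> sets (skorokhod_borel S)" for k
      unfolding H_def by (intro openin_imp_sets_skorokhod openin_skorokhod_hit U t)
    ultimately show ?thesis by (auto intro!: sets.countable_INT)
  qed simp
  have b: "borel = sigma UNIV (Collect closed :: 'a set set)" by (rule borel_eq_closed)
  show ?thesis
    unfolding b by (rule measurable_measure_of) (use closed in \<open>auto simp: vimage_def Int_def conj_commute\<close>)
qed

text \<open>The witness is the inverse time change. It can exceed the identity by almost
  \<open>e\<close>, so only times up to \<open>T - e\<close> are sure to be pulled back into
  \<open>{0..T}\<close>, where the distance is controlled.\<close>

lemma skorokhod_nbhd_sym: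
  assumes "\<omega> \<in> skorokhod_space S" "\<omega>' \<in> skorokhod_nbhd S \<omega> T e"
  shows "\<omega> \<in> skorokhod_nbhd S \<omega>' (T - e) e"
proof -
  obtain \<theta> where \<theta>: "\<omega>' \<in> skorokhod_space S" "time_change \<theta>" "\<And>t. t \<ge> 0 \<Longrightarrow> \<bar>\<theta> t - t\<bar> < e"
     "\<And>t. t \<in> {0..T} \<Longrightarrow> dist (\<omega>' (\<theta> t)) (\<omega> t) < e"
    using assms(2) unfolding skorokhod_nbhd_def by blast
  have inj: "inj_on \<theta> {0..}"
    using \<theta>(2) unfolding time_change_def by (simp add: strict_mono_on_imp_inj_on)
  have im: "\<theta> ` {0..} = {0..}" and mono: "strict_mono_on {0..} \<theta>"
    using \<theta>(2) unfolding time_change_def by auto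
  define h where "h = inv_into {0..} \<theta>"
  have h: "h s \<ge> 0" "\<theta> (h s) = s" if "s \<ge> 0" for s
    using that im inv_into_into[of s \<theta> "{0..}"] f_inv_into_f[of s \<theta> "{0..}"] unfolding h_def by auto
  have h\<theta>: "h (\<theta> t) = t" if "t \<ge> 0" for t
    using that inj unfolding h_def by simp
  have "time_change h"
    unfolding time_change_def
  proof
    have "t \<in> h ` {0..}" if "t \<ge> 0" for t
    proof -
      have "\<theta> t \<in> {0..}" using im that by blast
      then show ?thesis using h\<theta>[OF that] by (metis imageI)
    qed
    then show "h ` {0..} = {0..}" using h(1) by auto
    show "strict_mono_on {0..} h"
    proof (rule strict_mono_onI)
      fix r s :: real assume "r \<in> {0..}" "s \<in> {0..}" "r < s"
      then show "h r < h s"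
        using h(1)[of r] h(1)[of s] h(2)[of r] h(2)[of s] strict_mono_on_leD[OF mono, of "h s" "h r"]
        by (metis atLeast_iff linorder_not_le)
    qed
  qed
  moreover have A: "\<bar>h s - s\<bar> < e" if "s \<ge> 0" for s
    using \<theta>(3)[of "h s"] h[OF that] by (auto simp: abs_minus_commute)
  moreover have "dist (\<omega> (h s)) (\<omega>' s) < e" if "s \<in> {0..T - e}" for s
    using \<theta>(4)[of "h s"] A[of s] h[of s] that by (auto simp: dist_commute)
  ultimately show ?thesis
    using assms(1) unfolding skorokhod_nbhd_def by blast
qed

text \<open>Time changes are composed. The first may carry a time in \<open>{0..T}\<close> beyond
  \<open>T\<close> by up to \<open>e\<close>, hence the longer horizon in the second
  hypothesis.\<close>

lemma skorokhod_nbhd_trans: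
  assumes "\<omega>1 \<in> skorokhod_nbhd S \<omega>0 T e" "\<omega>2 \<in> skorokhod_nbhd S \<omega>1 (T + e) e'"
  shows "\<omega>2 \<in> skorokhod_nbhd S \<omega>0 T (e + e')"
proof -
  obtain \<theta> where \<theta>: "time_change \<theta>" "\<And>t. t \<ge> 0 \<Longrightarrow> \<bar>\<theta> t - t\<bar> < e"
     "\<And>t. t \<in> {0..T} \<Longrightarrow> dist (\<omega>1 (\<theta> t)) (\<omega>0 t) < e"
    using assms(1) unfolding skorokhod_nbhd_def by blast
  obtain \<eta> where \<eta>: "\<omega>2 \<in> skorokhod_space S" "time_change \<eta>" "\<And>t. t \<ge> 0 \<Longrightarrow> \<bar>\<eta> t - t\<bar> < e'"
     "\<And>t. t \<in> {0..T + e} \<Longrightarrow> dist (\<omega>2 (\<eta> t)) (\<omega>1 t) < e'"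
    using assms(2) unfolding skorokhod_nbhd_def by blast
  have pos: "\<theta> t \<ge> 0" if "t \<ge> 0" for t
    using that \<theta>(1) unfolding time_change_def by auto
  have "time_change (\<lambda>t. \<eta> (\<theta> t))"
    using \<theta>(1) \<eta>(2) pos unfolding time_change_def strict_mono_on_def
    by (auto simp: image_image[symmetric])
  moreover have "\<bar>\<eta> (\<theta> t) - t\<bar> < e + e'" if "t \<ge> 0" for t
    using \<theta>(2)[OF that] \<eta>(3)[OF pos[OF that]] by linarith
  moreover have "dist (\<omega>2 (\<eta> (\<theta> t))) (\<omega>0 t) < e + e'" if t: "t \<in> {0..T}" for t
  proof -
    have "\<theta> t \<in> {0..T + e}" using \<theta>(2)[of t] pos[of t] t by auto
    then have "dist (\<omega>2 (\<eta> (\<theta> t))) (\<omega>1 (\<theta> t)) < e'" by (rule \<eta>(4))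
    with \<theta>(3)[OF t] dist_triangle[of "\<omega>2 (\<eta> (\<theta> t))" "\<omega>0 t" "\<omega>1 (\<theta> t)"] show ?thesis by linarith
  qed
  ultimately show ?thesis
    using \<eta>(1) unfolding skorokhod_nbhd_def by blast
qed

text \<open>The values come as a sequence because sequences form a countable product: it is there,
  with Borel sets generated by the coordinates, that closures will be taken. At negative times the
  path must be \<open>undefined\<close>, like every element of the path space.\<close>

definition step_path :: "nat \<Rightarrow> (nat \<Rightarrow> 'a) \<Rightarrow> real \<Rightarrow> 'a" where
  "step_path n y t = (if t < 0 then undefined else y (nat \<lfloor>real n * t\<rfloor>))"

lemma step_path_in_skorokhod_space:
  fixes y :: "nat \<Rightarrow> 'a::metric_space"
  assumes "n \<ge> 1" shows "step_path n y \<in> skorokhod_space UNIV"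
proof -
  have right: "(step_path n y \<longlongrightarrow> step_path n y t) (at_right t)" if "t \<ge> 0" for t
  proof -
    let ?b = "(real_of_int \<lfloor>real n * t\<rfloor> + 1) / real n"
    have b: "t < ?b"
      using assms by (simp add: pos_less_divide_eq mult.commute)
    have "step_path n y u = step_path n y t" if "t < u" "u < ?b" for u
    proof -
      have "real n * u < \<lfloor>real n * t\<rfloor> + 1" using that assms by (simp add: pos_less_divide_eq mult.commute)
      moreover have "real n * t \<le> real n * u" using that by (simp add: mult_left_mono)
      ultimately have "\<lfloor>real n * u\<rfloor> = \<lfloor>real n * t\<rfloor>" by linarith
      then show ?thesis using that \<open>t \<ge> 0\<close> unfolding step_path_def by simp
    qed
    then have "eventually (\<lambda>u. step_path n y t = step_path n y u) (at_right t)"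
      using b by (auto simp: eventually_at_right_field)
    then show ?thesis by (rule Lim_transform_eventually[OF tendsto_const])
  qed
  moreover have "\<exists>l. (step_path n y \<longlongrightarrow> l) (at_left t)" if "t > 0" for t
  proof -
    \<comment> \<open>The index just to the left of \<open>t\<close> is the ceiling minus one and
      not the floor, since \<open>t\<close> may itself be a grid point.\<close>
    let ?k = "\<lceil>real n * t\<rceil> - 1"
    let ?a = "real_of_int ?k / real n"
    have a: "?a < t" using assms by (simp add: pos_divide_less_eq mult.commute) linarith
    have "step_path n y u = y (nat ?k)" if "?a < u" "u < t" "u > 0" for u
    proof -
      have "?k < real n * u" using that assms by (simp add: pos_divide_less_eq mult.commute)
      moreover have "real n * u < real n * t" using that assms by simp
      ultimately have "\<lfloor>real n * u\<rfloor> = ?k" by linarith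
      then show ?thesis using that unfolding step_path_def by simp
    qed
    then have "eventually (\<lambda>u. y (nat ?k) = step_path n y u) (at_left t)"
      using a that unfolding eventually_at_left_field by (intro exI[of _ "max 0 ?a"]) auto
    then show ?thesis using Lim_transform_eventually[OF tendsto_const] by blast
  qed
  ultimately show ?thesis
    unfolding skorokhod_space_def by (auto simp: step_path_def PiE_iff extensional_def)
qed

text \<open>The identity serves as time change, and only finitely many entries of the sequence are
  seen up to time \<open>T\<close>. So closeness of step paths follows from a condition that is open
  in the product topology.\<close>

lemma step_path_nbhd:
  fixes y :: "nat \<Rightarrow> 'a::metric_space"
  assumes "n \<ge> 1" "e > 0" "\<And>k. k \<le> nat \<lfloor>real n * T\<rfloor> \<Longrightarrow> dist (y' k) (y k) < e"
  shows "step_path n y' \<in> skorokhod_nbhd UNIV (step_path n y) T e"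
proof -
  have "time_change (\<lambda>t. t)" unfolding time_change_def by (auto simp: strict_mono_on_def)
  moreover have "dist (step_path n y' t) (step_path n y t) < e" if t: "t \<in> {0..T}" for t
  proof -
    have "real n * t \<le> real n * T" using t by (simp add: mult_left_mono)
    then have "nat \<lfloor>real n * t\<rfloor> \<le> nat \<lfloor>real n * T\<rfloor>" by (intro nat_mono floor_mono)
    with assms(3) t show ?thesis unfolding step_path_def by simp
  qed
  ultimately show ?thesis
    unfolding skorokhod_nbhd_def using assms step_path_in_skorokhod_space[of n y']
    by (auto intro!: exI[of _ "\<lambda>t. t"])
qed

text \<open>
  The time change of the next lemma moves the points of a finite partition, between which the path
  oscillates by less than \<open>e\<close>, to the next grid points; the partition is found by extending it
  as far as possible.
\<close>

lemma time_change_extend: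
  assumes \<theta>: "time_change \<theta>" and ab: "0 \<le> a" "a < b" and c: "\<theta> a < c"
  defines "h \<equiv> \<lambda>t. if t \<le> a then \<theta> t else if t \<le> b then \<theta> a + (t - a) * ((c - \<theta> a) / (b - a)) else c + (t - b)"
  shows "time_change h"
proof -
  have im: "\<theta> ` {0..} = {0..}" and mono: "strict_mono_on {0..} \<theta>"
    using \<theta> unfolding time_change_def by auto
  define q where "q = (c - \<theta> a) / (b - a)"
  have q: "q > 0" using ab c unfolding q_def by simp
  have hb: "\<theta> a + (b - a) * q = c" using ab unfolding q_def by simp
  note h_def = h_def[folded q_def]
  have pos: "\<theta> a \<ge> 0" using im ab by auto
  have mid: "\<theta> a < h t" if "a < t" "t \<le> b" for t
    using that q unfolding h_def by simp
  have mid': "h t \<le> c" if "a < t" "t \<le> b" for t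
  proof -
    have "(t - a) * q \<le> (b - a) * q" using that q by (intro mult_right_mono) auto
    then show ?thesis using hb that unfolding h_def by auto
  qed
  have "strict_mono_on {0..} h"
  proof (rule strict_mono_onI)
    fix r s :: real assume rs: "r \<in> {0..}" "s \<in> {0..}" "r < s"
    consider "s \<le> a" | "r \<le> a" "a < s" "s \<le> b" | "r \<le> a" "b < s" | "a < r" "s \<le> b" | "a < r" "r \<le> b" "b < s" | "b < r"
      using rs by linarith
    then show "h r < h s"
    proof cases
      case 1 then show ?thesis using strict_mono_onD[OF mono, of r s] rs unfolding h_def by auto
    next
      case 2
      have "\<theta> r \<le> \<theta> a" using strict_mono_on_leD[OF mono, of r a] rs 2 ab by auto
      then show ?thesis using mid[of s] 2 unfolding h_def by auto
    next
      case 3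
      have "\<theta> r \<le> \<theta> a" using strict_mono_on_leD[OF mono, of r a] rs 3 ab by auto
      then show ?thesis using 3 c ab unfolding h_def by auto
    next
      case 4
      have "(r - a) * q < (s - a) * q" using rs q by (intro mult_strict_right_mono) auto
      then show ?thesis using 4 rs unfolding h_def by auto
    next
      case 5
      then show ?thesis using mid'[of r] ab unfolding h_def by auto
    next
      case 6 then show ?thesis using rs ab unfolding h_def by auto
    qed
  qed
  moreover have "h ` {0..} = {0..}"
  proof (intro equalityI subsetI)
    fix y assume "y \<in> h ` {0..}"
    then obtain t where t: "t \<ge> 0" "y = h t" by auto
    have "0 \<le> \<theta> t" using im t by auto
    then show "y \<in> {0..}"
      using t mid[of t] pos c unfolding h_def by (auto split: if_splits)
  next
    fix y :: real assume y: "y \<in> {0..}"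
    consider "y \<le> \<theta> a" | "\<theta> a < y" "y \<le> c" | "c < y" by linarith
    then show "y \<in> h ` {0..}"
    proof cases
      case 1
      from y im obtain t where t: "t \<ge> 0" "y = \<theta> t" by (metis atLeast_iff imageE)
      then have "t \<le> a" using 1 strict_mono_onD[OF mono, of a t] ab by force
      then show ?thesis using t unfolding h_def by (intro image_eqI[of _ _ t]) auto
    next
      case 2
      define t where "t = a + (y - \<theta> a) / q"
      have t: "(t - a) * q = y - \<theta> a" using q unfolding t_def by (simp del: times_divide_eq_right)
      have "a < t" unfolding t_def using 2 q by (simp del: divide_divide_eq_right)
      moreover have "t \<le> b"
      proof (rule ccontr)
        assume "\<not> t \<le> b"
        then have "(b - a) * q < (t - a) * q" using q by (intro mult_strict_right_mono) auto
        with t hb 2 show False by linarith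
      qed
      ultimately show ?thesis using t ab unfolding h_def by (intro image_eqI[of _ _ t]) auto
    next
      case 3
      then show ?thesis using ab unfolding h_def by (intro image_eqI[of _ _ "b + (y - c)"]) auto
    qed
  qed
  ultimately show ?thesis unfolding time_change_def by blast
qed

text \<open>Sampling \<open>\<omega>\<close> at the grid point below \<open>\<theta> t\<close> is
  what the step path of mesh 1/n does at time \<open>\<theta> t\<close>. That \<open>T\<close> goes
  to the next grid point is what makes the property extendable: the grid cells met later start at or
  after \<open>T\<close>.\<close>

definition grid_approx :: "(real \<Rightarrow> 'a::metric_space) \<Rightarrow> real \<Rightarrow> real \<Rightarrow> bool" where
  "grid_approx \<omega> e T \<longleftrightarrow> (\<exists>n0\<ge>1. \<forall>n\<ge>n0. \<exists>\<theta>. time_change \<theta> \<and> \<theta> T = \<lceil>real n * T\<rceil> / real n \<and>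
     (\<forall>t\<ge>0. \<bar>\<theta> t - t\<bar> \<le> 1 / real n) \<and>
     (\<forall>t\<in>{0..<T}. dist (\<omega> t) (\<omega> (\<lfloor>real n * \<theta> t\<rfloor> / real n)) < e))"

lemma ceiling_grid:
  assumes "n \<ge> (1::nat)" shows "x \<le> \<lceil>real n * x\<rceil> / real n" "\<lceil>real n * x\<rceil> / real n < x + 1 / real n"
proof -
  show "x \<le> \<lceil>real n * x\<rceil> / real n"
    using assms by (simp add: pos_le_divide_eq mult.commute)
  have "\<lceil>real n * x\<rceil> < real n * x + 1" by linarith
  then have "\<lceil>real n * x\<rceil> / real n < (real n * x + 1) / real n"
    using assms by (intro divide_strict_right_mono) auto
  then show "\<lceil>real n * x\<rceil> / real n < x + 1 / real n"
    using assms by (simp add: add_divide_distrib)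
qed

lemma grid_approx_0: "grid_approx \<omega> e 0"
  unfolding grid_approx_def
  by (intro exI[of _ 1] conjI allI impI exI[of _ "\<lambda>t. t"]) (auto simp: time_change_def strict_mono_on_def)

text \<open>The new piece is mapped affinely onto the interval between the grid points following
  \<open>a\<close> and \<open>b\<close>. The sample points met there are grid points in
  \<open>[a, b)\<close>, where the oscillation is below \<open>e\<close>.\<close>

lemma grid_approx_extend:
  assumes T: "grid_approx \<omega> e a" "0 \<le> a" "a < b"
    and osc: "\<And>s t. a \<le> s \<Longrightarrow> s < b \<Longrightarrow> a \<le> t \<Longrightarrow> t < b \<Longrightarrow> dist (\<omega> s) (\<omega> t) < e"
  shows "grid_approx \<omega> e b"
proof -
  obtain n0 where n0: "n0 \<ge> 1" "\<And>n. n \<ge> n0 \<Longrightarrow> \<exists>\<theta>. time_change \<theta> \<and> \<theta> a = \<lceil>real n * a\<rceil> / real n \<and>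
     (\<forall>t\<ge>0. \<bar>\<theta> t - t\<bar> \<le> 1 / real n) \<and>
     (\<forall>t\<in>{0..<a}. dist (\<omega> t) (\<omega> (\<lfloor>real n * \<theta> t\<rfloor> / real n)) < e)"
    using T(1) unfolding grid_approx_def by blast
  \<comment> \<open>A mesh finer than \<open>b - a\<close> keeps the two rounded end points apart,
    as \<open>time_change_extend\<close> requires.\<close>
  obtain n1 where n1: "n1 \<ge> 1" "1 / real n1 < b - a"
    using nat_approx_posE[of "b - a"] T(3) by (metis Suc_le_eq diff_gt_0_iff_gt zero_less_Suc One_nat_def)
  show ?thesis
    unfolding grid_approx_def
  proof (intro exI[of _ "max n0 n1"] conjI allI impI)
    show "1 \<le> max n0 n1" using n0 by simp
    fix n assume n: "max n0 n1 \<le> n"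
    then obtain \<theta> where \<theta>: "time_change \<theta>" "\<theta> a = \<lceil>real n * a\<rceil> / real n"
     "\<And>t. t \<ge> 0 \<Longrightarrow> \<bar>\<theta> t - t\<bar> \<le> 1 / real n"
     "\<And>t. t \<in> {0..<a} \<Longrightarrow> dist (\<omega> t) (\<omega> (\<lfloor>real n * \<theta> t\<rfloor> / real n)) < e"
      using n0(2)[of n] by auto
    have n1': "n \<ge> 1" "1 / real n \<le> 1 / real n1" using n n1 by (auto simp: frac_le)
    let ?c = "\<lceil>real n * b\<rceil> / real n"
    have ca: "a \<le> \<theta> a" "\<theta> a < a + 1 / real n" and cb: "b \<le> ?c" "?c < b + 1 / real n"
      using ceiling_grid[OF n1'(1), of a] ceiling_grid[OF n1'(1), of b] \<theta>(2) by auto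
    have ac: "\<theta> a < ?c" using ca cb n1 n1' by linarith
    let ?q = "(?c - \<theta> a) / (b - a)"
    define h where "h = (\<lambda>t. if t \<le> a then \<theta> t else if t \<le> b then \<theta> a + (t - a) * ?q else ?c + (t - b))"
    have tc: "time_change h"
      unfolding h_def by (rule time_change_extend[OF \<theta>(1) T(2,3) ac])
    have q: "?q > 0" using T ac by simp
    have hb: "\<theta> a + (b - a) * ?q = ?c" using T by simp
    have "h b = ?c" using hb T unfolding h_def by auto
    moreover have "\<bar>h t - t\<bar> \<le> 1 / real n" if t: "t \<ge> 0" for t
    proof -
      consider "t \<le> a" | "a < t" "t \<le> b" | "b < t" by linarith
      then show ?thesis
      proof cases
        case 1 then show ?thesis using \<theta>(3)[OF t] unfolding h_def by simp
      next
        case 2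
        define l where "l = (t - a) / (b - a)"
        have l: "0 \<le> l" "l \<le> 1" using 2 unfolding l_def by auto
        have "l * (b - a) = t - a" using T unfolding l_def by simp
        then have teq: "t - a = l * (b - a)" by simp
        \<comment> \<open>The displacement at \<open>t\<close> is the convex combination of the
          displacements at \<open>a\<close> and \<open>b\<close>, each between 0 and 1/n.\<close>
        have "h t - t = (1 - l) * (\<theta> a - a) + l * (?c - b)"
        proof -
          have "(t - a) * ?q = l * (?c - \<theta> a)" unfolding l_def by simp
          then have "h t = \<theta> a + l * (?c - \<theta> a)" using 2 unfolding h_def by simp
          with teq show ?thesis by (simp add: algebra_simps)
        qed
        moreover have "0 \<le> (1 - l) * (\<theta> a - a)" "0 \<le> l * (?c - b)"
          using l ca cb by simp_all
        moreover have "(1 - l) * (\<theta> a - a) \<le> (1 - l) * (1 / real n)" "l * (?c - b) \<le> l * (1 / real n)"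
          using l ca cb by (intro mult_left_mono; simp)+
        moreover have "(1 - l) * (1 / real n) + l * (1 / real n) = 1 / real n" by (simp add: diff_divide_distrib)
        ultimately show ?thesis by linarith
      next
        case 3 then show ?thesis using cb T unfolding h_def by simp
      qed
    qed
    moreover have "dist (\<omega> t) (\<omega> (\<lfloor>real n * h t\<rfloor> / real n)) < e" if t: "t \<in> {0..<b}" for t
    proof (cases "t < a")
      case True then show ?thesis using \<theta>(4)[of t] t unfolding h_def by simp
    next
      case False
      have mono: "strict_mono_on {0..} h" using tc unfolding time_change_def by blast
      have "h a \<le> h t" "h t < h b"
        using strict_mono_on_leD[OF mono, of a t] strict_mono_onD[OF mono, of t b] t False T by auto
      then have ht: "\<lceil>real n * a\<rceil> / real n \<le> h t" "h t < ?c"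
        using \<open>h b = ?c\<close> \<theta>(2) unfolding h_def by auto
      have "\<lceil>real n * a\<rceil> \<le> real n * h t" using ht(1) n1' by (simp add: pos_divide_le_eq mult.commute)
      then have "\<lceil>real n * a\<rceil> \<le> \<lfloor>real n * h t\<rfloor>" by linarith
      then have 1: "real n * a \<le> \<lfloor>real n * h t\<rfloor>" by linarith
      have "real n * h t < \<lceil>real n * b\<rceil>" using ht(2) n1' by (simp add: pos_less_divide_eq mult.commute)
      then have "\<lfloor>real n * h t\<rfloor> < \<lceil>real n * b\<rceil>" by linarith
      then have 2: "\<lfloor>real n * h t\<rfloor> < real n * b" by (simp only: less_ceiling_iff)
      have "a \<le> \<lfloor>real n * h t\<rfloor> / real n" "\<lfloor>real n * h t\<rfloor> / real n < b"
        using 1 2 n1' by (simp_all add: pos_le_divide_eq pos_divide_less_eq mult.commute)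
      then show ?thesis using osc t False by auto
    qed
    ultimately show "\<exists>\<theta>. time_change \<theta> \<and> \<theta> b = \<lceil>real n * b\<rceil> / real n \<and>
     (\<forall>t\<ge>0. \<bar>\<theta> t - t\<bar> \<le> 1 / real n) \<and>
     (\<forall>t\<in>{0..<b}. dist (\<omega> t) (\<omega> (\<lfloor>real n * \<theta> t\<rfloor> / real n)) < e)"
      using tc by blast
  qed
qed

text \<open>Let \<open>s\<close> be the supremum of the horizons that can be reached. The left limit
  at \<open>s\<close> makes the oscillation small just before \<open>s\<close>, so \<open>s\<close>
  itself is reached; right continuity at \<open>s\<close> then carries the construction beyond it
  unless \<open>s = T\<close>.\<close>

lemma grid_approx_skorokhod:
  assumes \<omega>: "\<omega> \<in> skorokhod_space S" and e: "e > 0" and T: "T \<ge> 0"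
  shows "grid_approx \<omega> e T"
proof (rule ccontr)
  assume neg: "\<not> grid_approx \<omega> e T"
  define X where "X = {t \<in> {0..T}. grid_approx \<omega> e t}"
  have X0: "0 \<in> X" unfolding X_def using T grid_approx_0 by auto
  have bdd: "bdd_above X" unfolding X_def by (intro bdd_aboveI[of _ T]) auto
  define s where "s = Sup X"
  have s: "0 \<le> s" "s \<le> T" unfolding s_def
    using X0 bdd by (auto intro: cSup_upper) (auto simp: X_def intro!: cSup_least)
  have "grid_approx \<omega> e s"
  proof (cases "s = 0")
    case False
    then have "s > 0" using s by simp
    then obtain l where "(\<omega> \<longlongrightarrow> l) (at_left s)" using \<omega> unfolding skorokhod_space_def by blast
    then have "eventually (\<lambda>u. dist (\<omega> u) l < e / 2) (at_left s)" using e by (intro tendstoD) auto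
    then obtain a where a: "a < s" "\<And>u. a < u \<Longrightarrow> u < s \<Longrightarrow> dist (\<omega> u) l < e / 2"
      by (auto simp: eventually_at_left_field)
    obtain u where u: "u \<in> X" "a < u"
      using less_cSupE[of a X] a(1) X0 unfolding s_def by blast
    have "u \<le> s" unfolding s_def using u bdd by (auto intro: cSup_upper)
    show ?thesis
    proof (cases "u = s")
      case True then show ?thesis using u unfolding X_def by auto
    next
      case False
      show ?thesis
      proof (rule grid_approx_extend[of \<omega> e u])
        fix p r assume "u \<le> p" "p < s" "u \<le> r" "r < s"
        then have "dist (\<omega> p) l < e / 2" "dist (\<omega> r) l < e / 2" using a(2) u by auto
        then show "dist (\<omega> p) (\<omega> r) < e" using dist_triangle2[of "\<omega> p" "\<omega> r" l] by linarith
      qed (use u False \<open>u \<le> s\<close> in \<open>auto simp: X_def\<close>)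
    qed
  qed (simp add: grid_approx_0)
  then have "s < T" using neg s by (metis order_le_less)
  obtain b where b: "b > s" "\<And>u. s \<le> u \<Longrightarrow> u < b \<Longrightarrow> dist (\<omega> u) (\<omega> s) < e / 2"
    using skorokhod_space_eventually[OF \<omega> s(1), of "e/2"] e by auto
  have "grid_approx \<omega> e (min b T)"
  proof (rule grid_approx_extend[of \<omega> e s])
    fix p r assume "s \<le> p" "p < min b T" "s \<le> r" "r < min b T"
    then have "dist (\<omega> p) (\<omega> s) < e / 2" "dist (\<omega> r) (\<omega> s) < e / 2" using b(2) by auto
    then show "dist (\<omega> p) (\<omega> r) < e" using dist_triangle2[of "\<omega> p" "\<omega> r" "\<omega> s"] by linarith
  qed (use b \<open>s < T\<close> s \<open>grid_approx \<omega> e s\<close> in auto)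
  then have "min b T \<in> X" unfolding X_def using s b by auto
  then have "min b T \<le> s" unfolding s_def using bdd by (auto intro: cSup_upper)
  then show False using b \<open>s < T\<close> by auto
qed

text \<open>The time change of \<open>grid_approx\<close> is a witness as it stands. The horizon
  \<open>T + 1\<close> is taken because \<open>grid_approx\<close> controls a half-open interval,
  whereas the neighbourhood asks for times up to and including \<open>T\<close>.\<close>

lemma skorokhod_nbhd_discretise:
  assumes \<omega>: "\<omega> \<in> skorokhod_space UNIV" and e: "e > 0" and T: "T \<ge> 0"
  shows "\<exists>n0\<ge>1. \<forall>n\<ge>n0. step_path n (\<lambda>k. \<omega> (real k / real n)) \<in> skorokhod_nbhd UNIV \<omega> T e"
proof -
  obtain n0 where n0: "n0 \<ge> 1" "\<And>n. n \<ge> n0 \<Longrightarrow> \<exists>\<theta>. time_change \<theta> \<and>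
     (\<forall>t\<ge>0. \<bar>\<theta> t - t\<bar> \<le> 1 / real n) \<and>
     (\<forall>t\<in>{0..<T+1}. dist (\<omega> t) (\<omega> (\<lfloor>real n * \<theta> t\<rfloor> / real n)) < e)"
    using grid_approx_skorokhod[OF \<omega> e, of "T + 1"] T unfolding grid_approx_def by auto meson
  obtain n1 where n1: "n1 \<ge> 1" "1 / real n1 < e"
    using nat_approx_posE[of e] e by (metis Suc_le_eq zero_less_Suc One_nat_def)
  show ?thesis
  proof (intro exI[of _ "max n0 n1"] conjI allI impI)
    fix n assume n: "max n0 n1 \<le> n"
    then obtain \<theta> where \<theta>: "time_change \<theta>" "\<And>t. t\<ge>0 \<Longrightarrow> \<bar>\<theta> t - t\<bar> \<le> 1 / real n"
     "\<And>t. t\<in>{0..<T+1} \<Longrightarrow> dist (\<omega> t) (\<omega> (\<lfloor>real n * \<theta> t\<rfloor> / real n)) < e"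
      using n0(2)[of n] by auto
    have "1 / real n \<le> 1 / real n1" using n n1 by (auto simp: frac_le)
    then have 1: "\<bar>\<theta> t - t\<bar> < e" if "t \<ge> 0" for t using \<theta>(2)[OF that] n1(2) by linarith
    have "dist (step_path n (\<lambda>k. \<omega> (real k / real n)) (\<theta> t)) (\<omega> t) < e" if t: "t \<in> {0..T}" for t
    proof -
      have "\<theta> t \<ge> 0" using \<theta>(1) t unfolding time_change_def by auto
      then show ?thesis using \<theta>(3)[of t] t unfolding step_path_def
        by (simp add: of_nat_nat dist_commute)
    qed
    then show "step_path n (\<lambda>k. \<omega> (real k / real n)) \<in> skorokhod_nbhd UNIV \<omega> T e"
      unfolding skorokhod_nbhd_def using step_path_in_skorokhod_space[of n] n n0(1) \<theta>(1) 1 by auto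
  qed (use n0 in auto)
qed

text \<open>\<open>G\<close> may be an uncountable union of neighbourhoods, so membership is recast:
  \<open>\<omega>\<close> lies in \<open>G\<close> iff for some \<open>m\<close> infinitely many of
  its discretisations lie in \<open>V m n\<close>, the closure of the sequences whose step path has
  a neighbourhood of size fixed by \<open>m\<close> inside \<open>G\<close>. The set of these
  sequences is not known to be Borel, its closure is. The points added by the closure do no harm,
  since a nearby sequence in the set itself still has \<open>\<omega>\<close> in its
  neighbourhood.\<close>

lemma sets_coordinates_imp_openin:
  fixes G :: "(real \<Rightarrow> 'a::{metric_space, second_countable_topology}) set"
  assumes f: "f \<in> space N \<rightarrow> skorokhod_space UNIV"
    and coord: "\<And>t. 0 \<le> t \<Longrightarrow> (\<lambda>x. f x t) \<in> N \<rightarrow>\<^sub>M borel"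
    and G: "openin (skorokhod_topology UNIV) G"
  shows "f -` G \<inter> space N \<in> sets N"
proof -
  define W where "W m = {\<omega> \<in> skorokhod_space UNIV. skorokhod_nbhd UNIV \<omega> (real (Suc m)) (1 / real (Suc m)) \<subseteq> G}" for m
  define V where "V m n = closure {y. step_path n y \<in> W m}" for m n
  have WG: "W m \<subseteq> G" for m
  proof
    fix \<omega> assume \<omega>: "\<omega> \<in> W m"
    have "\<omega> \<in> skorokhod_nbhd UNIV \<omega> (real (Suc m)) (1 / real (Suc m))"
      using \<omega> unfolding W_def skorokhod_nbhd_def time_change_def strict_mono_on_def
      by (auto intro!: exI[of _ "\<lambda>t. t"])
    then show "\<omega> \<in> G" using \<omega> unfolding W_def by auto
  qed
  have iff: "\<omega> \<in> G \<longleftrightarrow> (\<exists>m. \<forall>n0. \<exists>n\<ge>n0. n \<ge> 1 \<and> (\<lambda>k. \<omega> (real k / real n)) \<in> V m n)" (is "_ = ?R")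
    if \<omega>: "\<omega> \<in> skorokhod_space UNIV" for \<omega>
  proof
    assume "\<omega> \<in> G"
    then obtain T e where Te: "T > 0" "e > 0" "skorokhod_nbhd UNIV \<omega> T e \<subseteq> G"
      using G unfolding openin_skorokhod_topology by blast
    \<comment> \<open>A neighbourhood of size 1/(m+1) around a discretisation of
      \<open>\<omega>\<close> must stay in the \<open>e\<close>-neighbourhood of
      \<open>\<omega>\<close>: two tolerances add up, and the horizon grows by at most one.\<close>
    obtain m where m: "T + 1 \<le> real (Suc m)" "2 / real (Suc m) \<le> e"
    proof -
      obtain m1 where "T + 1 \<le> real m1" using real_arch_simple by blast
      moreover obtain m2 where "2 / e \<le> real m2" using real_arch_simple by blast
      moreover have "2 / e \<le> real (Suc (max m1 m2))" using \<open>2 / e \<le> real m2\<close> by linarith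
      then have "2 / real (Suc (max m1 m2)) \<le> e" using Te
        by (simp add: pos_divide_le_eq mult.commute)
      ultimately show ?thesis using that[of "max m1 m2"] by (simp add: of_nat_max)
    qed
    let ?d = "1 / real (Suc m)"
    obtain n0 where n0: "n0 \<ge> 1" "\<And>n. n \<ge> n0 \<Longrightarrow> step_path n (\<lambda>k. \<omega> (real k / real n)) \<in> skorokhod_nbhd UNIV \<omega> T ?d"
      using skorokhod_nbhd_discretise[OF \<omega>, of ?d T] Te by auto
    have "(\<lambda>k. \<omega> (real k / real n)) \<in> V m n" if n: "n \<ge> n0" for n
    proof -
      have "skorokhod_nbhd UNIV (step_path n (\<lambda>k. \<omega> (real k / real n))) (real (Suc m)) ?d \<subseteq> G"
      proof
        fix \<omega>2 assume "\<omega>2 \<in> skorokhod_nbhd UNIV (step_path n (\<lambda>k. \<omega> (real k / real n))) (real (Suc m)) ?d"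
        moreover have "?d \<le> 1" by simp
        then have "T + ?d \<le> real (Suc m)" using m(1) by linarith
        ultimately have "\<omega>2 \<in> skorokhod_nbhd UNIV (step_path n (\<lambda>k. \<omega> (real k / real n))) (T + ?d) ?d"
          using skorokhod_nbhd_mono by blast
        then have "\<omega>2 \<in> skorokhod_nbhd UNIV \<omega> T (?d + ?d)"
          by (rule skorokhod_nbhd_trans[OF n0(2)[OF n]])
        moreover have "?d + ?d \<le> e" using m(2) by (simp add: add_divide_distrib[symmetric])
        ultimately show "\<omega>2 \<in> G" using Te(3) skorokhod_nbhd_mono[of T T "?d + ?d" e] by blast
      qed
      then have "step_path n (\<lambda>k. \<omega> (real k / real n)) \<in> W m"
        using step_path_in_skorokhod_space[of n] n n0(1) unfolding W_def by auto
      then show ?thesis unfolding V_def by (intro subsetD[OF closure_subset]) simp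
    qed
    then show ?R using n0(1) by (metis max.cobounded1 max.cobounded2 order_trans)
  next
    assume ?R
    then obtain m where m: "\<And>n0. \<exists>n\<ge>n0. n \<ge> 1 \<and> (\<lambda>k. \<omega> (real k / real n)) \<in> V m n" by blast
    define M where "M = real (Suc m)"
    define d where "d = 1 / (2 * M)"
    have M: "M \<ge> 1" unfolding M_def by simp
    then have d: "d > 0" "d \<le> 1" "d + d = 1 / M" unfolding d_def by (simp_all add: field_simps)
    \<comment> \<open>Half the tolerance goes to the discretisation of \<open>\<omega>\<close>, half
      to a sequence \<open>y\<close> near its samples. The horizon \<open>M + 2\<close> leaves room
      for the loss of \<open>d\<close> when a neighbourhood is reversed and of another
      \<open>d\<close> when two are composed.\<close>
    obtain n0 where n0: "n0 \<ge> 1" "\<And>n. n \<ge> n0 \<Longrightarrow> step_path n (\<lambda>k. \<omega> (real k / real n)) \<in> skorokhod_nbhd UNIV \<omega> (M + 2) d"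
      using skorokhod_nbhd_discretise[OF \<omega>, of d "M + 2"] d M by auto
    obtain n where n: "n \<ge> n0" "(\<lambda>k. \<omega> (real k / real n)) \<in> V m n" using m by blast
    have n1: "n \<ge> 1" using n n0 by simp
    let ?z = "\<lambda>k. \<omega> (real k / real n)"
    let ?K = "nat \<lfloor>real n * M\<rfloor>"
    \<comment> \<open>The samples are only a closure point, so a genuine member \<open>y\<close> of
      the set is picked from an open cylinder around them.\<close>
    have "open (\<Inter>k\<in>{..?K}. {y. dist (?z k) (y k) < d})"
      by (intro open_INT) (auto intro!: open_Collect_less continuous_intros continuous_on_product_coordinates)
    moreover have "?z \<in> (\<Inter>k\<in>{..?K}. {y. dist (?z k) (y k) < d})" using d by auto
    ultimately have "{y. step_path n y \<in> W m} \<inter> (\<Inter>k\<in>{..?K}. {y. dist (?z k) (y k) < d}) \<noteq> {}"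
      using n(2) unfolding V_def closure_iff_nhds_not_empty by (meson order_refl)
    then obtain y where y: "step_path n y \<in> W m" "\<And>k. k \<le> ?K \<Longrightarrow> dist (?z k) (y k) < d"
      by auto
    have 1: "step_path n ?z \<in> skorokhod_nbhd UNIV (step_path n y) M d"
      by (rule step_path_nbhd[OF n1 d(1)]) (use y in auto)
    have "\<omega> \<in> skorokhod_nbhd UNIV (step_path n ?z) (M + 2 - d) d"
      by (rule skorokhod_nbhd_sym[OF \<omega> n0(2)[OF n(1)]])
    then have "\<omega> \<in> skorokhod_nbhd UNIV (step_path n ?z) (M + d) d"
      using skorokhod_nbhd_mono[of "M + d" "M + 2 - d" d d] d by auto
    from skorokhod_nbhd_trans[OF 1 this] have "\<omega> \<in> skorokhod_nbhd UNIV (step_path n y) M (1 / M)"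
      using d by simp
    then show "\<omega> \<in> G" using y(1) unfolding W_def M_def by auto
  qed
  have meas: "{x \<in> space N. (\<lambda>k. f x (real k / real n)) \<in> V m n} \<in> sets N" for m n
  proof -
    have "(\<lambda>x k. f x (real k / real n)) \<in> N \<rightarrow>\<^sub>M borel"
      by (rule measurable_coordinatewise_then_product) (auto intro: coord)
    moreover have "V m n \<in> sets borel" unfolding V_def by auto
    ultimately have "(\<lambda>x k. f x (real k / real n)) -` V m n \<inter> space N \<in> sets N"
      by (rule measurable_sets)
    then show ?thesis by (simp add: vimage_def Int_def conj_commute)
  qed
  have "f -` G \<inter> space N = (\<Union>m. \<Inter>n0. \<Union>n\<in>{n0..}\<inter>{1..}. {x \<in> space N. (\<lambda>k. f x (real k / real n)) \<in> V m n})"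
    using f iff by (fastforce simp: Pi_iff)
  also have "\<dots> \<in> sets N"
    by (intro sets.countable_UN' sets.countable_INT' image_subsetI meas) auto
  finally show ?thesis .
qed

text \<open>Reduces measurability of a random path to that of its values at fixed times; the later
  constructions of paths go through it.\<close>

lemma measurable_skorokhodI:
  fixes f :: "'b \<Rightarrow> real \<Rightarrow> 'a::{metric_space, second_countable_topology}"
  assumes "f \<in> space N \<rightarrow> skorokhod_space UNIV"
    and "\<And>t. 0 \<le> t \<Longrightarrow> (\<lambda>x. f x t) \<in> N \<rightarrow>\<^sub>M borel"
  shows "f \<in> N \<rightarrow>\<^sub>M skorokhod_borel UNIV"
  unfolding skorokhod_borel_def
  by (rule measurable_measure_of) (use assms sets_coordinates_imp_openin[OF assms] in \<open>auto simp: openin_skorokhod_topology\<close>)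

text \<open>Progressive measurability: the path is read at a grid point strictly after
  \<open>s\<close>, capped at \<open>T\<close>, and right continuity gives the limit. The cap is
  what confines the argument to coordinates up to \<open>T\<close>.\<close>

lemma measurable_skorokhod_clip:
  fixes X :: "'b \<Rightarrow> real \<Rightarrow> 'a::metric_space"
  assumes T: "0 \<le> T" and X: "\<And>x. x \<in> space N \<Longrightarrow> X x \<in> skorokhod_space S"
    and coord: "\<And>u. 0 \<le> u \<Longrightarrow> u \<le> T \<Longrightarrow> (\<lambda>x. X x u) \<in> N \<rightarrow>\<^sub>M borel"
  shows "(\<lambda>(s, x). X x (max 0 (min s T))) \<in> borel \<Otimes>\<^sub>M N \<rightarrow>\<^sub>M borel"
proof (rule borel_measurable_LIMSEQ_metric)
  let ?g = "\<lambda>n s. (real_of_int \<lfloor>real (Suc n) * s\<rfloor> + 1) / real (Suc n)"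
  let ?f = "\<lambda>n (s, x). X x (max 0 (min (?g n s) T))"
  fix n
  have "(\<lambda>p. X (snd p) (max 0 (min ((real_of_int i + 1) / real (Suc n)) T))) \<in> borel \<Otimes>\<^sub>M N \<rightarrow>\<^sub>M borel" for i
    by (rule measurable_compose[OF measurable_snd coord]) (use T in auto)
  then have "(\<lambda>p. X (snd p) (max 0 (min ((real_of_int \<lfloor>real (Suc n) * fst p\<rfloor> + 1) / real (Suc n)) T)))
      \<in> (borel :: real measure) \<Otimes>\<^sub>M N \<rightarrow>\<^sub>M borel"
    by (rule measurable_compose_countable[where g="\<lambda>p. \<lfloor>real (Suc n) * fst p\<rfloor>"]) measurable
  then show "?f n \<in> borel \<Otimes>\<^sub>M N \<rightarrow>\<^sub>M borel" by (simp add: split_beta')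
next
  let ?g = "\<lambda>n s. (real_of_int \<lfloor>real (Suc n) * s\<rfloor> + 1) / real (Suc n)"
  fix p :: "real \<times> 'b" assume p: "p \<in> space (borel \<Otimes>\<^sub>M N)"
  obtain s x where px: "p = (s, x)" by (cases p)
  have x: "x \<in> space N" using p px by (auto simp: space_pair_measure)
  have g: "s < ?g n s" "?g n s \<le> s + 1 / real (Suc n)" for n
  proof -
    have "real (Suc n) * s < real_of_int \<lfloor>real (Suc n) * s\<rfloor> + 1" by linarith
    then show "s < ?g n s" by (simp add: pos_less_divide_eq mult.commute del: of_nat_Suc)
    have "real_of_int \<lfloor>real (Suc n) * s\<rfloor> + 1 \<le> real (Suc n) * s + 1" by linarith
    then have "?g n s \<le> (real (Suc n) * s + 1) / real (Suc n)" by (intro divide_right_mono) auto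
    then show "?g n s \<le> s + 1 / real (Suc n)" by (simp add: add_divide_distrib del: of_nat_Suc)
  qed
  have lim: "(\<lambda>n. ?g n s) \<longlonglongrightarrow> s"
  proof (rule tendsto_sandwich)
    show "(\<lambda>n. s) \<longlonglongrightarrow> s" by simp
    show "(\<lambda>n. s + 1 / real (Suc n)) \<longlonglongrightarrow> s"
      using tendsto_add[OF tendsto_const[of s] LIMSEQ_inverse_real_of_nat] by (simp add: inverse_eq_divide)
  qed (use g in \<open>auto intro!: always_eventually simp del: of_nat_Suc intro: less_imp_le\<close>)
  define \<phi> where "\<phi> = (\<lambda>s::real. max 0 (min s T))"
  show "(\<lambda>n. (\<lambda>(s, x). X x (max 0 (min (?g n s) T))) p) \<longlonglongrightarrow> (\<lambda>(s, x). X x (max 0 (min s T))) p"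
  proof (cases "0 \<le> s \<and> s < T")
    case True
    have "(X x \<longlongrightarrow> X x s) (at_right s)" using skorokhod_space_right[OF X[OF x]] True by auto
    moreover have "filterlim (\<lambda>n. ?g n s) (at_right s) sequentially"
      unfolding filterlim_at using lim g(1)
      by (intro conjI always_eventually allI) (simp_all only: greaterThan_iff less_imp_neq[symmetric] simp_thms)
    ultimately have "(\<lambda>n. X x (?g n s)) \<longlonglongrightarrow> X x s" by (rule filterlim_compose)
    moreover have "eventually (\<lambda>n. ?g n s < T) sequentially" using order_tendstoD(2)[OF lim] True by blast
    ultimately have "(\<lambda>n. X x (max 0 (min (?g n s) T))) \<longlonglongrightarrow> X x s"
    proof (elim Lim_transform_eventually, elim eventually_mono)
      fix n assume "?g n s < T"
      then show "X x (?g n s) = X x (max 0 (min (?g n s) T))" using g(1)[of n] True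
        by (auto simp: max_def min_def simp del: of_nat_Suc)
    qed
    then show ?thesis using True by (simp add: px max_def min_def del: of_nat_Suc)
  next
    \<comment> \<open>For \<open>s\<close> outside \<open>[0, T)\<close> the clipped time is
      eventually constant in \<open>n\<close>, so no continuity is used; in particular none from the
      left at \<open>T\<close>.\<close>
    case False
    have "eventually (\<lambda>n. \<phi> (?g n s) = \<phi> s) sequentially"
    proof (cases "s < 0")
      case True
      then show ?thesis using order_tendstoD(2)[OF lim, of 0]
        by (auto elim!: eventually_mono simp: \<phi>_def max_def min_def simp del: of_nat_Suc)
    next
      case False
      then have "T \<le> s" using \<open>\<not> (0 \<le> s \<and> s < T)\<close> by auto
      then have "\<phi> (?g n s) = \<phi> s" for n using g(1)[of n] unfolding \<phi>_def
        by (auto simp: max_def min_def simp del: of_nat_Suc)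
      then show ?thesis by simp
    qed
    then have "eventually (\<lambda>n. X x (\<phi> s) = X x (\<phi> (?g n s))) sequentially"
      by (rule eventually_mono) simp
    then have "(\<lambda>n. X x (\<phi> (?g n s))) \<longlonglongrightarrow> X x (\<phi> s)"
      by (rule Lim_transform_eventually[OF tendsto_const])
    then show ?thesis by (simp add: px \<phi>_def del: of_nat_Suc)
  qed
qed

lemma measurable_skorokhod_joint:
  fixes X :: "'b \<Rightarrow> real \<Rightarrow> 'a::metric_space"
  assumes X: "\<And>x. x \<in> space N \<Longrightarrow> X x \<in> skorokhod_space S"
    and coord: "\<And>u. 0 \<le> u \<Longrightarrow> (\<lambda>x. X x u) \<in> N \<rightarrow>\<^sub>M borel"
  shows "(\<lambda>(s, x). X x (max 0 s)) \<in> borel \<Otimes>\<^sub>M N \<rightarrow>\<^sub>M borel"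
proof (rule borel_measurable_LIMSEQ_metric)
  show "(\<lambda>(s, x). X x (max 0 (min s (real n)))) \<in> borel \<Otimes>\<^sub>M N \<rightarrow>\<^sub>M borel" for n
    by (rule measurable_skorokhod_clip[OF _ X]) (auto intro: coord)
  fix p :: "real \<times> 'b"
  obtain s x where p: "p = (s, x)" by (cases p)
  have "eventually (\<lambda>n. s \<le> real n) sequentially"
    using eventually_ge_at_top[of "nat \<lceil>s\<rceil>"] by eventually_elim linarith
  then have "eventually (\<lambda>n. X x (max 0 s) = X x (max 0 (min s (real n)))) sequentially"
    by eventually_elim (simp add: min_absorb1)
  then show "(\<lambda>n. (\<lambda>(s, x). X x (max 0 (min s (real n)))) p) \<longlonglongrightarrow> (\<lambda>(s, x). X x (max 0 s)) p"
    unfolding p by (simp add: Lim_transform_eventually[OF tendsto_const])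
qed

lemma measurable_skorokhod_eval_joint:
  "(\<lambda>(s, \<omega>). \<omega> (max 0 s)) \<in> borel \<Otimes>\<^sub>M skorokhod_borel S \<rightarrow>\<^sub>M borel"
  using measurable_skorokhod_joint[of "skorokhod_borel S" "\<lambda>\<omega>. \<omega>" S] by (simp add: measurable_skorokhod_eval)

lemma measurable_skorokhod_apply:
  assumes "f \<in> N \<rightarrow>\<^sub>M borel" "g \<in> N \<rightarrow>\<^sub>M skorokhod_borel S" "\<And>x. x \<in> space N \<Longrightarrow> 0 \<le> f x"
  shows "(\<lambda>x. g x (f x)) \<in> N \<rightarrow>\<^sub>M borel"
proof -
  have "(\<lambda>x. g x (max 0 (f x))) \<in> N \<rightarrow>\<^sub>M borel"
    using measurable_compose[OF measurable_Pair[OF assms(1,2)] measurable_skorokhod_eval_joint] by simp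
  then show ?thesis by (rule measurable_cong[THEN iffD1, rotated]) (use assms(3) in auto)
qed

section \<open>The natural filtration of the paths\<close>

lemma space_path_filtration [simp]: "space (path_filtration S t) = skorokhod_space S"
  unfolding path_filtration_def by (rule space_measure_of) auto

lemma sets_path_filtration: "sets (path_filtration S t) =
   sigma_sets (skorokhod_space S) {{\<omega> \<in> skorokhod_space S. \<omega> s \<in> B} | s B. 0 \<le> s \<and> s \<le> t \<and> B \<in> sets borel}"
  unfolding path_filtration_def by (rule sets_measure_of) auto

lemma measurable_path_filtration_eval:
  assumes "0 \<le> s" "s \<le> t" shows "(\<lambda>\<omega>. \<omega> s) \<in> path_filtration S t \<rightarrow>\<^sub>M borel"
proof (rule measurableI)
  fix B assume "B \<in> sets (borel :: 'a measure)"
  then show "(\<lambda>\<omega>. \<omega> s) -` B \<inter> space (path_filtration S t) \<in> sets (path_filtration S t)"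
    using assms unfolding sets_path_filtration
    by (intro sigma_sets.Basic) (auto simp: vimage_def Int_def conj_commute)
qed simp

lemma sets_path_filtrationI:
  assumes f: "f \<in> space N \<rightarrow> skorokhod_space S"
    and coord: "\<And>u. 0 \<le> u \<Longrightarrow> u \<le> t \<Longrightarrow> (\<lambda>x. f x u) \<in> N \<rightarrow>\<^sub>M borel"
  shows "f \<in> N \<rightarrow>\<^sub>M path_filtration S t"
  unfolding path_filtration_def
proof (rule measurable_measure_of)
  fix y assume "y \<in> {{\<omega> \<in> skorokhod_space S. \<omega> s \<in> B} |s B. 0 \<le> s \<and> s \<le> t \<and> B \<in> sets borel}"
  then obtain s B where y: "y = {\<omega> \<in> skorokhod_space S. \<omega> s \<in> B}" "0 \<le> s" "s \<le> t" "B \<in> sets borel" by blast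
  have "f -` y \<inter> space N = (\<lambda>x. f x s) -` B \<inter> space N" using f y by auto
  then show "f -` y \<inter> space N \<in> sets N" using measurable_sets[OF coord y(4)] y by simp
qed (use f in auto)

lemma path_filtration_subset: "sets (path_filtration S t) \<subseteq> sets (skorokhod_borel S)"
proof -
  have "(\<lambda>\<omega>. \<omega>) \<in> skorokhod_borel S \<rightarrow>\<^sub>M path_filtration S t"
    by (rule sets_path_filtrationI) (auto intro: measurable_skorokhod_eval)
  note m = measurable_sets[OF this]
  show ?thesis
  proof
    fix A assume A: "A \<in> sets (path_filtration S t)"
    then have "A \<subseteq> skorokhod_space S" using sets.sets_into_space[OF A] by simp
    then show "A \<in> sets (skorokhod_borel S)" using m[OF A] by (simp add: Int_absorb2)
  qed
qed

lemma subalgebra_path_filtration: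
  assumes "sets P = sets (skorokhod_borel S)" shows "subalgebra P (path_filtration S t)"
  using assms path_filtration_subset[of S t] sets_eq_imp_space_eq[OF assms] unfolding subalgebra_def by auto

section \<open>Markov chains from kernels\<close>

text \<open>A chain of marks in \<open>M\<close> whose next mark depends on the last one through a
  state in \<open>E\<close>: \<open>\<kappa>\<close> draws a mark from a state, \<open>j\<close> the
  next state from a mark. Later a mark is a piece of path with a ring time, and the state is the
  place where the next piece starts.\<close>

locale markov_chain_kernels =
  fixes E :: "'a measure" and M :: "'s measure" and \<kappa> :: "'a \<Rightarrow> 's measure" and j :: "'s \<Rightarrow> 'a measure"
  assumes \<kappa>[measurable]: "\<kappa> \<in> E \<rightarrow>\<^sub>M prob_algebra M"
    and j[measurable]: "j \<in> M \<rightarrow>\<^sub>M prob_algebra E"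
begin

text \<open>The states are integrated out, so that only marks remain on the sequence space. The
  kernel is given for whole prefixes \<open>v\<close>, as \<open>Ionescu_Tulcea\<close> expects, but
  reads the last entry only.\<close>

definition step :: "'a \<Rightarrow> nat \<Rightarrow> (nat \<Rightarrow> 's) \<Rightarrow> 's measure" where
  "step x i v = (if i = 0 then \<kappa> x else j (v (i - 1)) \<bind> \<kappa>)"

lemma step_measurable:
  assumes "x \<in> space E" shows "step x i \<in> Pi\<^sub>M {0..<i} (\<lambda>_. M) \<rightarrow>\<^sub>M prob_algebra M"
proof (cases i)
  case 0 then show ?thesis
    unfolding step_def using measurable_space[OF \<kappa> assms] by simp
next
  case (Suc k)
  have "(\<lambda>v. v k) \<in> Pi\<^sub>M {0..<i} (\<lambda>_. M) \<rightarrow>\<^sub>M M" unfolding Suc by (rule measurable_component_singleton) simp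
  then have "(\<lambda>v. j (v k)) \<in> Pi\<^sub>M {0..<i} (\<lambda>_. M) \<rightarrow>\<^sub>M prob_algebra E" by (rule measurable_compose[OF _ j])
  then have "(\<lambda>v. j (v k) \<bind> \<kappa>) \<in> Pi\<^sub>M {0..<i} (\<lambda>_. M) \<rightarrow>\<^sub>M prob_algebra M"
    by (rule measurable_bind_prob_space[OF _ \<kappa>])
  then show ?thesis unfolding step_def Suc by simp
qed

lemma step_Ionescu_Tulcea: assumes "x \<in> space E" shows "Ionescu_Tulcea (step x) (\<lambda>_. M)"
  by (intro Ionescu_Tulcea.intro measurable_prob_algebraD[OF step_measurable[OF assms]])
    (use measurable_space[OF step_measurable[OF assms]] in \<open>auto simp: space_prob_algebra\<close>)

definition prefix_law :: "'a \<Rightarrow> nat \<Rightarrow> (nat \<Rightarrow> 's) measure" where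
  "prefix_law x n = Ionescu_Tulcea.C (step x) (\<lambda>_. M) 0 n (\<lambda>_. undefined)"

definition chain_law :: "'a \<Rightarrow> (nat \<Rightarrow> 's) measure" where
  "chain_law x = projective_family.lim UNIV (Ionescu_Tulcea.CI (step x) (\<lambda>_. M)) (\<lambda>_. M)"

text \<open>The restriction makes the result extensional, as elements of a finite product space have
  to be.\<close>

definition cons_prefix :: "nat \<Rightarrow> 's \<Rightarrow> (nat \<Rightarrow> 's) \<Rightarrow> nat \<Rightarrow> 's" where
  "cons_prefix n y v = restrict (case_nat y v) {0..<Suc n}"

lemma cons_prefix_measurable [measurable]:
  "(\<lambda>(y, v). cons_prefix n y v) \<in> M \<Otimes>\<^sub>M Pi\<^sub>M {0..<n} (\<lambda>_. M) \<rightarrow>\<^sub>M Pi\<^sub>M {0..<Suc n} (\<lambda>_. M)"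
  unfolding cons_prefix_def split_beta'
proof (rule measurable_restrict)
  fix i assume "i \<in> {0..<Suc n}"
  then show "(\<lambda>p. case_nat (fst p) (snd p) i) \<in> M \<Otimes>\<^sub>M Pi\<^sub>M {0..<n} (\<lambda>_. M) \<rightarrow>\<^sub>M M"
    by (cases i) (auto intro: measurable_compose[OF measurable_snd measurable_component_singleton])
qed

lemma cons_prefix_upd: "(cons_prefix n y v)(Suc n := s) = cons_prefix (Suc n) y (v(n := s))"
  unfolding cons_prefix_def by (auto simp: fun_eq_iff restrict_def split: nat.split)

lemma prefix_law_0: assumes "x \<in> space E" shows "prefix_law x 0 = return (Pi\<^sub>M {0..<0::nat} (\<lambda>_. M)) (\<lambda>_. undefined)"
  unfolding prefix_law_def by (simp add: Ionescu_Tulcea.C.simps[OF step_Ionescu_Tulcea[OF assms]])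

lemma sets_prefix_law [measurable_cong]: assumes "x \<in> space E" shows "sets (prefix_law x n) = sets (Pi\<^sub>M {0..<n} (\<lambda>_. M))"
  using Ionescu_Tulcea.sets_C[OF step_Ionescu_Tulcea[OF assms], of "\<lambda>_. undefined" 0 n] unfolding prefix_law_def
  by (simp add: space_PiM)

lemma space_prefix_law: assumes "x \<in> space E" shows "space (prefix_law x n) = space (Pi\<^sub>M {0..<n} (\<lambda>_. M))"
  by (rule sets_eq_imp_space_eq[OF sets_prefix_law[OF assms]])

lemma prob_space_prefix_law: assumes "x \<in> space E" shows "prob_space (prefix_law x n)"
  using Ionescu_Tulcea.prob_space_C[OF step_Ionescu_Tulcea[OF assms], of "\<lambda>_. undefined" 0 n] unfolding prefix_law_def
  by (simp add: space_PiM)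

lemma nn_integral_step_measurable:
  assumes x: "x \<in> space E" and f[measurable]: "f \<in> borel_measurable (Pi\<^sub>M {0..<Suc n} (\<lambda>_. M))"
  shows "(\<lambda>v. \<integral>\<^sup>+s. f (v(n := s)) \<partial>step x n v) \<in> borel_measurable (Pi\<^sub>M {0..<n} (\<lambda>_. M))"
proof (rule nn_integral_measurable_subprob_algebra2[OF _ measurable_prob_algebraD[OF step_measurable[OF x]]])
  have "(\<lambda>p. (fst p)(n := snd p)) \<in> Pi\<^sub>M {0..<n} (\<lambda>_. M) \<Otimes>\<^sub>M M \<rightarrow>\<^sub>M Pi\<^sub>M {0..<Suc n} (\<lambda>_. M)"
    by (rule measurable_fun_upd[where J="{0..<n}"]) auto
  from measurable_compose[OF this f]
  show "(\<lambda>(v, s). f (v(n := s))) \<in> borel_measurable (Pi\<^sub>M {0..<n} (\<lambda>_. M) \<Otimes>\<^sub>M M)"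
    by (simp add: split_beta')
qed

lemma nn_integral_prefix_law_Suc:
  assumes x: "x \<in> space E" and f[measurable]: "f \<in> borel_measurable (Pi\<^sub>M {0..<Suc n} (\<lambda>_. M))"
  shows "(\<integral>\<^sup>+v. f v \<partial>prefix_law x (Suc n)) = (\<integral>\<^sup>+v. \<integral>\<^sup>+s. f (v(n := s)) \<partial>step x n v \<partial>prefix_law x n)"
proof -
  interpret I: Ionescu_Tulcea "step x" "\<lambda>_. M" by (rule step_Ionescu_Tulcea[OF x])
  have "(\<integral>\<^sup>+v. f v \<partial>prefix_law x (Suc n)) = (\<integral>\<^sup>+v. \<integral>\<^sup>+w. f w \<partial>I.eP n v \<partial>prefix_law x n)"
    unfolding prefix_law_def I.C.simps
  proof (subst nn_integral_bind[where B="Pi\<^sub>M {0..<Suc n} (\<lambda>_. M)"])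
    show "I.eP (0 + n) \<in> I.C 0 n (\<lambda>_. undefined) \<rightarrow>\<^sub>M subprob_algebra (Pi\<^sub>M {0..<Suc n} (\<lambda>_. M))"
      using I.measurable_eP[of n] sets_prefix_law[OF x, of n] unfolding prefix_law_def
      by (simp cong: measurable_cong_sets)
  qed (simp_all add: f)
  also have "\<dots> = (\<integral>\<^sup>+v. \<integral>\<^sup>+s. f (v(n := s)) \<partial>step x n v \<partial>prefix_law x n)"
    by (intro nn_integral_cong I.nn_integral_eP) (auto simp: space_prefix_law[OF x])
  finally show ?thesis .
qed

lemma cons_prefix_app [measurable]:
  assumes f[measurable]: "f \<in> borel_measurable (Pi\<^sub>M {0..<Suc n} (\<lambda>_. M))"
  shows "(\<lambda>(y, v). f (cons_prefix n y v)) \<in> borel_measurable (M \<Otimes>\<^sub>M Pi\<^sub>M {0..<n} (\<lambda>_. M))"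
  using measurable_compose[OF cons_prefix_measurable f] by (simp add: split_beta')

lemma j_space: "y \<in> space M \<Longrightarrow> space (j y) = space E" "y \<in> space M \<Longrightarrow> sets (j y) = sets E" "y \<in> space M \<Longrightarrow> prob_space (j y)"
  using measurable_space[OF j, of y] by (auto simp: space_prob_algebra dest: sets_eq_imp_space_eq)

lemma \<kappa>_space: "x \<in> space E \<Longrightarrow> space (\<kappa> x) = space M" "x \<in> space E \<Longrightarrow> sets (\<kappa> x) = sets M" "x \<in> space E \<Longrightarrow> prob_space (\<kappa> x)"
  using measurable_space[OF \<kappa>, of x] by (auto simp: space_prob_algebra dest: sets_eq_imp_space_eq)

text \<open>The Ionescu-Tulcea construction adds marks at the end; a renewal argument needs the
  first mark split off. The two orders agree by induction on the length, because the kernel for the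
  last mark looks only at its predecessor.\<close>

lemma prefix_law_front:
  assumes "x \<in> space E" "f \<in> borel_measurable (Pi\<^sub>M {0..<Suc n} (\<lambda>_. M))"
  shows "(\<integral>\<^sup>+v. f v \<partial>prefix_law x (Suc n)) = (\<integral>\<^sup>+y. \<integral>\<^sup>+z. \<integral>\<^sup>+v. f (cons_prefix n y v) \<partial>prefix_law z n \<partial>j y \<partial>\<kappa> x)"
  using assms
proof (induction n arbitrary: f)
  case 0
  note [measurable] = \<open>f \<in> _\<close>
  have u: "(\<lambda>_. undefined) \<in> space (Pi\<^sub>M {0..<0::nat} (\<lambda>_. M))" by (simp add: space_PiM)
  have "(\<integral>\<^sup>+v. f v \<partial>prefix_law x (Suc 0)) = (\<integral>\<^sup>+s. f ((\<lambda>_. undefined)(0 := s)) \<partial>\<kappa> x)"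
    unfolding nn_integral_prefix_law_Suc[OF 0] prefix_law_0[OF 0(1)]
    by (subst nn_integral_return[OF u nn_integral_step_measurable[OF 0]]) (simp add: step_def)
  also have "\<dots> = (\<integral>\<^sup>+y. \<integral>\<^sup>+z. \<integral>\<^sup>+v. f (cons_prefix 0 y v) \<partial>prefix_law z 0 \<partial>j y \<partial>\<kappa> x)"
  proof (rule nn_integral_cong)
    fix y assume "y \<in> space (\<kappa> x)"
    then have y: "y \<in> space M" by (simp add: \<kappa>_space[OF 0(1)])
    interpret prob_space "j y" by (rule j_space(3)[OF y])
    have "(\<integral>\<^sup>+z. \<integral>\<^sup>+v. f (cons_prefix 0 y v) \<partial>prefix_law z 0 \<partial>j y) = (\<integral>\<^sup>+z. f (cons_prefix 0 y (\<lambda>_. undefined)) \<partial>j y)"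
    proof (rule nn_integral_cong)
      fix z assume "z \<in> space (j y)"
      then have z: "z \<in> space E" by (simp add: j_space[OF y])
      have "(\<lambda>v. f (cons_prefix 0 y v)) \<in> borel_measurable (Pi\<^sub>M {0..<0::nat} (\<lambda>_. M))"
        using measurable_compose[OF measurable_Pair1'[OF y] cons_prefix_app[OF 0(2)]] by simp
      then show "(\<integral>\<^sup>+v. f (cons_prefix 0 y v) \<partial>prefix_law z 0) = f (cons_prefix 0 y (\<lambda>_. undefined))"
        unfolding prefix_law_0[OF z] by (rule nn_integral_return[OF u])
    qed
    also have "\<dots> = f ((\<lambda>_. undefined)(0 := y))"
      unfolding nn_integral_const emeasure_space_1
      by (auto simp: cons_prefix_def fun_eq_iff restrict_def intro!: arg_cong[where f=f])
    finally show "f ((\<lambda>_. undefined)(0 := y)) = (\<integral>\<^sup>+z. \<integral>\<^sup>+v. f (cons_prefix 0 y v) \<partial>prefix_law z 0 \<partial>j y)" ..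
  qed
  finally show ?case .
next
  case (Suc n)
  note x = \<open>x \<in> space E\<close> and f[measurable] = \<open>f \<in> _\<close>
  let ?g = "\<lambda>w. \<integral>\<^sup>+s. f (w(Suc n := s)) \<partial>step x (Suc n) w"
  have "(\<integral>\<^sup>+v. f v \<partial>prefix_law x (Suc (Suc n))) = (\<integral>\<^sup>+w. ?g w \<partial>prefix_law x (Suc n))"
    by (rule nn_integral_prefix_law_Suc[OF x f])
  also have "\<dots> = (\<integral>\<^sup>+y. \<integral>\<^sup>+z. \<integral>\<^sup>+v. ?g (cons_prefix n y v) \<partial>prefix_law z n \<partial>j y \<partial>\<kappa> x)"
    by (rule Suc.IH[OF x nn_integral_step_measurable[OF x f]])
  also have "\<dots> = (\<integral>\<^sup>+y. \<integral>\<^sup>+z. \<integral>\<^sup>+v. f (cons_prefix (Suc n) y v) \<partial>prefix_law z (Suc n) \<partial>j y \<partial>\<kappa> x)"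
  proof (rule nn_integral_cong)
    fix y assume "y \<in> space (\<kappa> x)"
    then have y: "y \<in> space M" by (simp add: \<kappa>_space[OF x])
    interpret J: prob_space "j y" by (rule j_space(3)[OF y])
    have fy: "(\<lambda>v. f (cons_prefix (Suc n) y v)) \<in> borel_measurable (Pi\<^sub>M {0..<Suc n} (\<lambda>_. M))"
      using measurable_compose[OF measurable_Pair1'[OF y] cons_prefix_app[OF f]] by simp
    have *: "(\<integral>\<^sup>+v. f (cons_prefix (Suc n) y v) \<partial>prefix_law z (Suc n))
        = (\<integral>\<^sup>+v. \<integral>\<^sup>+s. f ((cons_prefix n y v)(Suc n := s)) \<partial>step z n v \<partial>prefix_law z n)" if "z \<in> space E" for z
      unfolding cons_prefix_upd by (rule nn_integral_prefix_law_Suc[OF that fy])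
    show "(\<integral>\<^sup>+z. \<integral>\<^sup>+v. ?g (cons_prefix n y v) \<partial>prefix_law z n \<partial>j y)
        = (\<integral>\<^sup>+z. \<integral>\<^sup>+v. f (cons_prefix (Suc n) y v) \<partial>prefix_law z (Suc n) \<partial>j y)"
    \<comment> \<open>With a nonempty tail the last step is the same whether the chain is started at
      \<open>x\<close> or at \<open>z\<close>. With an empty tail its predecessor is the first mark
      \<open>y\<close>: the step then is \<open>j y \<bind> \<kappa>\<close>, and the state
      \<open>z\<close> has to be recovered from the bind.\<close>
    proof (cases n)
      case (Suc k)
      show ?thesis
      proof (intro nn_integral_cong)
        fix z assume "z \<in> space (j y)"
        then have z: "z \<in> space E" by (simp add: j_space[OF y])
        have "step x (Suc n) (cons_prefix n y v) = step z n v" for v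
          unfolding step_def Suc cons_prefix_def by simp
        then show "(\<integral>\<^sup>+v. ?g (cons_prefix n y v) \<partial>prefix_law z n)
          = (\<integral>\<^sup>+v. f (cons_prefix (Suc n) y v) \<partial>prefix_law z (Suc n))" by (simp add: *[OF z])
      qed
    next
      case 0
      have u: "(\<lambda>_. undefined) \<in> space (Pi\<^sub>M {0..<0::nat} (\<lambda>_. M))" by (simp add: space_PiM)
      let ?h = "\<lambda>s. f ((cons_prefix 0 y (\<lambda>_. undefined))(Suc 0 := s))"
      have ret: "(\<integral>\<^sup>+v. h v \<partial>prefix_law z n) = h (\<lambda>_. undefined)" if "z \<in> space E" for z and h :: "_ \<Rightarrow> ennreal"
      proof -
        have "h \<in> borel_measurable (Pi\<^sub>M {0..<0::nat} (\<lambda>_. M))"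
          by (simp add: PiM_empty)
        then show ?thesis unfolding 0 prefix_law_0[OF that] by (rule nn_integral_return[OF u])
      qed
      have stepx: "step x (Suc n) (cons_prefix n y (\<lambda>_. undefined)) = j y \<bind> \<kappa>"
        unfolding step_def 0 cons_prefix_def by simp
      have hm: "?h \<in> borel_measurable M"
      proof -
        have 1: "cons_prefix 0 y (\<lambda>_. undefined) \<in> space (Pi\<^sub>M {0..<Suc 0} (\<lambda>_. M))"
          using y unfolding cons_prefix_def space_PiM by auto
        have "(\<lambda>s. (cons_prefix 0 y (\<lambda>_. undefined))(Suc 0 := s)) \<in> M \<rightarrow>\<^sub>M Pi\<^sub>M {0..<Suc (Suc 0)} (\<lambda>_. M)"
          using 1 by (intro measurable_fun_upd[where J="{0..<Suc 0}"]) auto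
        from measurable_compose[OF this f[unfolded 0]] show ?thesis .
      qed
      have "(\<integral>\<^sup>+z. \<integral>\<^sup>+v. ?g (cons_prefix n y v) \<partial>prefix_law z n \<partial>j y) = (\<integral>\<^sup>+z. \<integral>\<^sup>+s. ?h s \<partial>(j y \<bind> \<kappa>) \<partial>j y)"
        by (intro nn_integral_cong, subst ret) (simp_all add: j_space[OF y] stepx, simp add: 0)
      also have "\<dots> = (\<integral>\<^sup>+s. ?h s \<partial>(j y \<bind> \<kappa>))" by (simp add: J.emeasure_space_1)
      also have "\<dots> = (\<integral>\<^sup>+z. \<integral>\<^sup>+s. ?h s \<partial>\<kappa> z \<partial>j y)"
        using measurable_prob_algebraD[OF \<kappa>] j_space(2)[OF y]
        by (intro nn_integral_bind[OF hm]) (simp cong: measurable_cong_sets)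
      also have "\<dots> = (\<integral>\<^sup>+z. \<integral>\<^sup>+v. f (cons_prefix (Suc n) y v) \<partial>prefix_law z (Suc n) \<partial>j y)"
        by (intro nn_integral_cong, simp add: * ret j_space[OF y]) (simp add: 0 step_def)
      finally show ?thesis .
    qed
  qed
  finally show ?case .
qed

text \<open>In the recursion that splits off the first mark the start \<open>x\<close> enters
  through \<open>\<kappa> x\<close> alone; the remaining law is started at a state that is
  integrated over, which is where the induction hypothesis applies.\<close>

lemma prefix_law_measurable: "(\<lambda>x. prefix_law x n) \<in> E \<rightarrow>\<^sub>M subprob_algebra (Pi\<^sub>M {0..<n} (\<lambda>_. M))"
proof (induction n)
  case 0
  have "(\<lambda>_. undefined) \<in> space (Pi\<^sub>M {0..<0::nat} (\<lambda>_. M))" by (simp add: space_PiM)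
  then have "(\<lambda>x. return (Pi\<^sub>M {0..<0::nat} (\<lambda>_. M)) (\<lambda>_. undefined)) \<in> E \<rightarrow>\<^sub>M subprob_algebra (Pi\<^sub>M {0..<0::nat} (\<lambda>_. M))"
    by (intro measurable_const measurable_space[OF return_measurable])
  then show ?case by (rule measurable_cong[THEN iffD1, rotated]) (simp add: prefix_law_0)
next
  case (Suc n)
  note [measurable] = Suc
  show ?case
  proof (rule measurable_subprob_algebra)
    fix A assume A: "A \<in> sets (Pi\<^sub>M {0..<Suc n} (\<lambda>_. M))"
    have iA: "indicator A \<in> borel_measurable (Pi\<^sub>M {0..<Suc n} (\<lambda>_. M))" using A by simp
    have [measurable]: "(\<lambda>(y, v). indicator A (cons_prefix n y v) :: ennreal) \<in> borel_measurable (M \<Otimes>\<^sub>M Pi\<^sub>M {0..<n} (\<lambda>_. M))"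
      by (rule cons_prefix_app[OF iA])
    have 1: "(\<lambda>p. \<integral>\<^sup>+v. indicator A (cons_prefix n (fst p) v) \<partial>prefix_law (snd p) n) \<in> borel_measurable (M \<Otimes>\<^sub>M E)"
      by (rule nn_integral_measurable_subprob_algebra2) measurable
    have 2: "(\<lambda>y. \<integral>\<^sup>+z. \<integral>\<^sup>+v. indicator A (cons_prefix n y v) \<partial>prefix_law z n \<partial>j y) \<in> borel_measurable M"
      by (rule nn_integral_measurable_subprob_algebra2[where N=E])
         (use 1 in \<open>auto simp: split_beta' intro: measurable_prob_algebraD\<close>)
    have "(\<lambda>x. \<integral>\<^sup>+y. \<integral>\<^sup>+z. \<integral>\<^sup>+v. indicator A (cons_prefix n y v) \<partial>prefix_law z n \<partial>j y \<partial>\<kappa> x) \<in> borel_measurable E"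
      by (rule measurable_compose[OF measurable_prob_algebraD[OF \<kappa>] nn_integral_measurable_subprob_algebra[OF 2]])
    then show "(\<lambda>x. emeasure (prefix_law x (Suc n)) A) \<in> borel_measurable E"
    proof (rule measurable_cong[THEN iffD1, rotated])
      fix x assume x: "x \<in> space E"
      have "emeasure (prefix_law x (Suc n)) A = (\<integral>\<^sup>+v. indicator A v \<partial>prefix_law x (Suc n))"
        using A by (simp add: sets_prefix_law[OF x])
      then show "(\<integral>\<^sup>+y. \<integral>\<^sup>+z. \<integral>\<^sup>+v. indicator A (cons_prefix n y v) \<partial>prefix_law z n \<partial>j y \<partial>\<kappa> x) = emeasure (prefix_law x (Suc n)) A"
        using prefix_law_front[OF x iA] by simp
    qed
  qed (auto intro: prob_space_imp_subprob_space prob_space_prefix_law simp: sets_prefix_law)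
qed

lemma sets_chain_law [measurable_cong]: assumes "x \<in> space E" shows "sets (chain_law x) = sets (Pi\<^sub>M UNIV (\<lambda>_. M))"
proof -
  interpret I: Ionescu_Tulcea "step x" "\<lambda>_. M" by (rule step_Ionescu_Tulcea[OF assms])
  show ?thesis unfolding chain_law_def by (rule I.PF.sets_lim)
qed

lemma emeasure_chain_law:
  assumes x: "x \<in> space E" and X: "X \<in> sets (Pi\<^sub>M {0..<n} (\<lambda>_. M))"
  shows "emeasure (chain_law x) (prod_emb UNIV (\<lambda>_. M) {0..<n} X) = emeasure (prefix_law x n) X"
proof -
  interpret I: Ionescu_Tulcea "step x" "\<lambda>_. M" by (rule step_Ionescu_Tulcea[OF x])
  have "emeasure (chain_law x) (prod_emb UNIV (\<lambda>_. M) {0..<n} X) = emeasure (I.CI {0..<n}) X"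
    unfolding chain_law_def by (rule I.lim[OF _ X]) simp
  also have "\<dots> = emeasure (prefix_law x n) X"
    unfolding prefix_law_def using X by (subst I.emeasure_CI[of _ n]) (auto simp: prod_emb_id[OF sets.sets_into_space[OF X, unfolded space_PiM]])
  finally show ?thesis .
qed

lemma prob_space_chain_law: assumes x: "x \<in> space E" shows "prob_space (chain_law x)"
proof
  have "prod_emb UNIV (\<lambda>_. M) {0..<0::nat} (space (Pi\<^sub>M {0..<0::nat} (\<lambda>_. M))) = space (Pi\<^sub>M UNIV (\<lambda>_. M))"
    by (auto simp: prod_emb_def space_PiM restrict_def)
  moreover have "emeasure (prefix_law x 0) (space (Pi\<^sub>M {0..<0::nat} (\<lambda>_. M))) = 1"
    using prob_space.emeasure_space_1[OF prob_space_prefix_law[OF x, of 0]] by (simp add: space_prefix_law[OF x])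
  ultimately show "emeasure (chain_law x) (space (chain_law x)) = 1"
    using emeasure_chain_law[OF x, of "space (Pi\<^sub>M {0..<0::nat} (\<lambda>_. M))" 0] sets_eq_imp_space_eq[OF sets_chain_law[OF x]] by simp
qed

text \<open>Finite-dimensional cylinders are an intersection-stable generator, and on them the law
  is that of a prefix.\<close>

lemma chain_law_measurable [measurable]: "chain_law \<in> E \<rightarrow>\<^sub>M prob_algebra (Pi\<^sub>M UNIV (\<lambda>_. M))"
proof (rule measurable_prob_algebra_generated[OF sets_PiM Int_stable_prod_algebra prod_algebra_sets_into_space])
  fix A :: "(nat \<Rightarrow> 's) set" assume "A \<in> prod_algebra UNIV (\<lambda>_. M)"
  then obtain J :: "nat set" and X where A: "A = prod_emb UNIV (\<lambda>_. M) J (Pi\<^sub>E J X)" "finite J" "\<And>i. i \<in> J \<Longrightarrow> X i \<in> sets M"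
    by (auto elim!: prod_algebraE)
  obtain n where n: "J \<subseteq> {0..<n}" using A(2) by (metis finite_nat_set_iff_bounded atLeastLessThan_iff subsetI zero_le)
  have X: "Pi\<^sub>E J X \<in> sets (Pi\<^sub>M J (\<lambda>_. M))" using A by (intro sets_PiM_I_finite) auto
  then have "prod_emb {0..<n} (\<lambda>_. M) J (Pi\<^sub>E J X) \<in> sets (Pi\<^sub>M {0..<n} (\<lambda>_. M))"
    using n by (auto intro!: measurable_prod_emb)
  moreover have "A = prod_emb UNIV (\<lambda>_. M) {0..<n} (prod_emb {0..<n} (\<lambda>_. M) J (Pi\<^sub>E J X))"
    unfolding A using n by (subst prod_emb_trans) auto
  ultimately have "emeasure (chain_law x) A = emeasure (prefix_law x n) (prod_emb {0..<n} (\<lambda>_. M) J (Pi\<^sub>E J X))" if "x \<in> space E" for x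
    using emeasure_chain_law[OF that] by simp
  moreover have "(\<lambda>x. emeasure (prefix_law x n) (prod_emb {0..<n} (\<lambda>_. M) J (Pi\<^sub>E J X))) \<in> borel_measurable E"
    using prefix_law_measurable \<open>_ \<in> sets (Pi\<^sub>M {0..<n} _)\<close> by measurable
  ultimately show "(\<lambda>x. emeasure (chain_law x) A) \<in> borel_measurable E"
    by (simp cong: measurable_cong)
qed (simp_all add: prob_space_chain_law sets_chain_law)

text \<open>Both sides are probability measures on sequences and agree on cylinders by
  \<open>prefix_law_front\<close>. This is the renewal identity at the first mark from which the
  first-ring equations descend.\<close>

lemma chain_law_front:
  assumes x: "x \<in> space E"
  shows "chain_law x = \<kappa> x \<bind> (\<lambda>y. j y \<bind> (\<lambda>z. chain_law z \<bind> (\<lambda>v. return (Pi\<^sub>M UNIV (\<lambda>_. M)) (case_nat y v))))" (is "_ = ?R")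
proof -
  let ?N = "Pi\<^sub>M UNIV (\<lambda>_::nat. M)"
  have m3: "(\<lambda>p. return ?N (case_nat (fst p) (snd p))) \<in> (M \<Otimes>\<^sub>M ?N) \<rightarrow>\<^sub>M prob_algebra ?N"
    by (rule measurable_compose[OF _ measurable_return_prob_space]) measurable
  have m2: "(\<lambda>p. chain_law (snd p) \<bind> (\<lambda>v. return ?N (case_nat (fst p) v))) \<in> (M \<Otimes>\<^sub>M E) \<rightarrow>\<^sub>M prob_algebra ?N"
    by (rule measurable_bind_prob_space2[where N="?N"]) measurable
  have m1: "(\<lambda>y. j y \<bind> (\<lambda>z. chain_law z \<bind> (\<lambda>v. return ?N (case_nat y v)))) \<in> M \<rightarrow>\<^sub>M prob_algebra ?N"
    by (rule measurable_bind_prob_space2[OF j]) (use m2 in \<open>simp add: split_beta'\<close>)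
  have R: "?R \<in> space (prob_algebra ?N)"
    using measurable_space[OF measurable_bind_prob_space[OF \<kappa> m1] x] .
  have "emeasure ?R A = emeasure (chain_law x) A" if A: "A = prod_emb UNIV (\<lambda>_. M) J (Pi\<^sub>E J X)" "finite J" "\<And>i. i \<in> J \<Longrightarrow> X i \<in> sets M" for A and J :: "nat set" and X
  proof -
    obtain n where n: "J \<subseteq> {0..<Suc n}" using A(2) by (metis finite_nat_set_iff_bounded atLeastLessThan_iff subsetI zero_le less_SucI)
    have X: "Pi\<^sub>E J X \<in> sets (Pi\<^sub>M J (\<lambda>_. M))" using A by (intro sets_PiM_I_finite) auto
    define Y where "Y = prod_emb {0..<Suc n} (\<lambda>_. M) J (Pi\<^sub>E J X)"
    have Y: "Y \<in> sets (Pi\<^sub>M {0..<Suc n} (\<lambda>_. M))"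
      using n X unfolding Y_def by (auto intro!: measurable_prod_emb)
    have AY: "A = prod_emb UNIV (\<lambda>_. M) {0..<Suc n} Y"
      unfolding A Y_def using n by (subst prod_emb_trans) auto
    have Am[measurable]: "A \<in> sets ?N" unfolding AY using Y by (auto intro!: measurable_prod_emb)
    have iY: "indicator Y \<in> borel_measurable (Pi\<^sub>M {0..<Suc n} (\<lambda>_. M))" using Y by simp
    have "emeasure ?R A = (\<integral>\<^sup>+y. emeasure (j y \<bind> (\<lambda>z. chain_law z \<bind> (\<lambda>v. return ?N (case_nat y v)))) A \<partial>\<kappa> x)"
      by (rule emeasure_bind_prob_algebra[OF measurable_space[OF \<kappa> x] m1 Am])
    also have "\<dots> = (\<integral>\<^sup>+y. \<integral>\<^sup>+z. \<integral>\<^sup>+v. indicator Y (cons_prefix n y v) \<partial>prefix_law z n \<partial>j y \<partial>\<kappa> x)"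
    proof (rule nn_integral_cong)
      fix y assume "y \<in> space (\<kappa> x)"
      then have y: "y \<in> space M" by (simp add: \<kappa>_space[OF x])
      have m2y: "(\<lambda>z. chain_law z \<bind> (\<lambda>v. return ?N (case_nat y v))) \<in> E \<rightarrow>\<^sub>M prob_algebra ?N"
        using measurable_compose[OF measurable_Pair1'[OF y] m2] by simp
      have m3y: "(\<lambda>v. return ?N (case_nat y v)) \<in> ?N \<rightarrow>\<^sub>M prob_algebra ?N"
        using measurable_compose[OF measurable_Pair1'[OF y] m3] by simp
      have "emeasure (j y \<bind> (\<lambda>z. chain_law z \<bind> (\<lambda>v. return ?N (case_nat y v)))) A
        = (\<integral>\<^sup>+z. emeasure (chain_law z \<bind> (\<lambda>v. return ?N (case_nat y v))) A \<partial>j y)"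
        by (rule emeasure_bind_prob_algebra[OF measurable_space[OF j y] m2y Am])
      also have "\<dots> = (\<integral>\<^sup>+z. \<integral>\<^sup>+v. indicator Y (cons_prefix n y v) \<partial>prefix_law z n \<partial>j y)"
      proof (rule nn_integral_cong)
        fix z assume "z \<in> space (j y)"
        then have z: "z \<in> space E" by (simp add: j_space[OF y])
        have sp: "space (chain_law z) = space ?N" by (rule sets_eq_imp_space_eq[OF sets_chain_law[OF z]])
        have ycons: "cons_prefix n y v \<in> space (Pi\<^sub>M {0..<Suc n} (\<lambda>_. M))" if "v \<in> space (Pi\<^sub>M {0..<n} (\<lambda>_. M))" for v
          using measurable_space[OF cons_prefix_measurable, of "(y, v)"] that y by (simp add: space_pair_measure)
        \<comment> \<open>\<open>Z\<close> is the section of the cylinder base at the first mark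
          \<open>y\<close>: a sequence lies over \<open>Z\<close> exactly when prefixing
          \<open>y\<close> puts it in \<open>A\<close>.\<close>
        define Z where "Z = {v \<in> space (Pi\<^sub>M {0..<n} (\<lambda>_. M)). cons_prefix n y v \<in> Y}"
        have "(\<lambda>v. cons_prefix n y v) \<in> Pi\<^sub>M {0..<n} (\<lambda>_. M) \<rightarrow>\<^sub>M Pi\<^sub>M {0..<Suc n} (\<lambda>_. M)"
          using measurable_compose[OF measurable_Pair1'[OF y] cons_prefix_measurable] by simp
        from measurable_sets[OF this Y] have Z: "Z \<in> sets (Pi\<^sub>M {0..<n} (\<lambda>_. M))"
          unfolding Z_def by (simp add: vimage_def Int_def conj_commute)
        have "emeasure (chain_law z \<bind> (\<lambda>v. return ?N (case_nat y v))) A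
          = (\<integral>\<^sup>+v. emeasure (return ?N (case_nat y v)) A \<partial>chain_law z)"
          by (rule emeasure_bind_prob_algebra[OF measurable_space[OF chain_law_measurable z] m3y Am])
        also have "\<dots> = (\<integral>\<^sup>+v. indicator (prod_emb UNIV (\<lambda>_. M) {0..<n} Z) v \<partial>chain_law z)"
        proof (rule nn_integral_cong)
          fix v assume "v \<in> space (chain_law z)"
          then have v: "v \<in> space ?N" by (simp add: sp)
          have cv: "case_nat y v \<in> space ?N" using v y by (auto simp: space_PiM PiE_iff split: nat.split)
          have e: "restrict (case_nat y v) {0..<Suc n} = cons_prefix n y (restrict v {0..<n})"
            unfolding cons_prefix_def by (auto simp: fun_eq_iff restrict_def split: nat.split)
          have rv: "restrict v {0..<n} \<in> space (Pi\<^sub>M {0..<n} (\<lambda>_. M))" using v by (auto simp: space_PiM)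
          have "case_nat y v \<in> A \<longleftrightarrow> v \<in> prod_emb UNIV (\<lambda>_. M) {0..<n} Z"
            unfolding AY prod_emb_iff Z_def e using v cv rv by (auto simp: space_PiM PiE_iff)
          then show "emeasure (return ?N (case_nat y v)) A = indicator (prod_emb UNIV (\<lambda>_. M) {0..<n} Z) v"
            by (simp add: emeasure_return[OF Am] indicator_def)
        qed
        also have "\<dots> = emeasure (chain_law z) (prod_emb UNIV (\<lambda>_. M) {0..<n} Z)"
          using Z by (intro nn_integral_indicator) (auto simp: sets_chain_law[OF z] intro!: measurable_prod_emb)
        also have "\<dots> = emeasure (prefix_law z n) Z" by (rule emeasure_chain_law[OF z Z])
        also have "\<dots> = (\<integral>\<^sup>+v. indicator Z v \<partial>prefix_law z n)" using Z by (simp add: sets_prefix_law[OF z])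
        also have "\<dots> = (\<integral>\<^sup>+v. indicator Y (cons_prefix n y v) \<partial>prefix_law z n)"
          by (intro nn_integral_cong) (auto simp: Z_def indicator_def space_prefix_law[OF z])
        finally show "emeasure (chain_law z \<bind> (\<lambda>v. return ?N (case_nat y v))) A
          = (\<integral>\<^sup>+v. indicator Y (cons_prefix n y v) \<partial>prefix_law z n)" .
      qed
      finally show "emeasure (j y \<bind> (\<lambda>z. chain_law z \<bind> (\<lambda>v. return ?N (case_nat y v)))) A
        = (\<integral>\<^sup>+z. \<integral>\<^sup>+v. indicator Y (cons_prefix n y v) \<partial>prefix_law z n \<partial>j y)" .
    qed
    also have "\<dots> = (\<integral>\<^sup>+v. indicator Y v \<partial>prefix_law x (Suc n))" by (rule prefix_law_front[OF x iY, symmetric])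
    also have "\<dots> = emeasure (prefix_law x (Suc n)) Y" using Y by (simp add: sets_prefix_law[OF x])
    also have "\<dots> = emeasure (chain_law x) A" unfolding AY by (rule emeasure_chain_law[OF x Y, symmetric])
    finally show ?thesis .
  qed
  note eq = this
  show ?thesis
  proof (rule measure_eqI_PiM_infinite[of _ UNIV "\<lambda>_. M"])
    show "sets (chain_law x) = sets ?N" "sets ?R = sets ?N"
      using R by (simp_all add: sets_chain_law[OF x] space_prob_algebra)
    show "finite_measure (chain_law x)"
      using prob_space_chain_law[OF x] by (simp add: prob_space.finite_measure)
    show "emeasure (chain_law x) (prod_emb UNIV (\<lambda>_. M) J (Pi\<^sub>E J X)) = emeasure ?R (prod_emb UNIV (\<lambda>_. M) J (Pi\<^sub>E J X))"
      if "finite J" "J \<subseteq> UNIV" "\<And>i. i \<in> J \<Longrightarrow> X i \<in> sets M" for X and J :: "nat set"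
      using eq[OF refl that(1,3)] by simp
  qed
qed

end

section \<open>Bounded measurable functions and the exponential clock\<close>

text \<open>Boundedness is asked on \<open>space M\<close> only. For such functions integrals
  against finite measures exist and may be exchanged, so one predicate, closed under the operations
  below, takes the place of integrability conditions.\<close>

definition bmeas :: "'a measure \<Rightarrow> ('a \<Rightarrow> real) \<Rightarrow> bool" where
  "bmeas M f \<longleftrightarrow> f \<in> borel_measurable M \<and> (\<exists>B. \<forall>x\<in>space M. \<bar>f x\<bar> \<le> B)"

lemma bmeasI: "f \<in> borel_measurable M \<Longrightarrow> (\<And>x. x \<in> space M \<Longrightarrow> \<bar>f x\<bar> \<le> B) \<Longrightarrow> bmeas M f"
  unfolding bmeas_def by blast

lemma bmeasD: "bmeas M f \<Longrightarrow> f \<in> borel_measurable M"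
  unfolding bmeas_def by blast

lemma bmeasE:
  assumes "bmeas M f" obtains B where "B \<ge> 0" "\<And>x. x \<in> space M \<Longrightarrow> \<bar>f x\<bar> \<le> B"
proof -
  obtain B where "\<forall>x\<in>space M. \<bar>f x\<bar> \<le> B" using assms unfolding bmeas_def by blast
  then show ?thesis by (intro that[of "max 0 B"]) (auto simp: max_def intro: order_trans)
qed

lemma bmeas_const [simp, intro]: "bmeas M (\<lambda>x. k)"
  by (rule bmeasI[of _ _ "\<bar>k\<bar>"]) auto

lemma bmeas_add [intro]: assumes "bmeas M f" "bmeas M g" shows "bmeas M (\<lambda>x. f x + g x)"
proof -
  obtain B B' where "\<And>x. x \<in> space M \<Longrightarrow> \<bar>f x\<bar> \<le> B" "\<And>x. x \<in> space M \<Longrightarrow> \<bar>g x\<bar> \<le> B'"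
    using assms by (metis bmeasE)
  then show ?thesis
    using assms[THEN bmeasD] by (intro bmeasI[of _ _ "B + B'"] borel_measurable_add)
      (auto intro!: order_trans[OF abs_triangle_ineq] add_mono)
qed

lemma bmeas_mult [intro]: assumes "bmeas M f" "bmeas M g" shows "bmeas M (\<lambda>x. f x * g x)"
proof -
  obtain B B' where "\<And>x. x \<in> space M \<Longrightarrow> \<bar>f x\<bar> \<le> B" "\<And>x. x \<in> space M \<Longrightarrow> \<bar>g x\<bar> \<le> B'" "B \<ge> 0" "B' \<ge> 0"
    using assms by (metis bmeasE)
  then show ?thesis
    using assms[THEN bmeasD] by (intro bmeasI[of _ _ "B * B'"] borel_measurable_times)
      (auto simp: abs_mult intro!: mult_mono)
qed

lemma bmeas_cmult [intro]: "bmeas M f \<Longrightarrow> bmeas M (\<lambda>x. k * f x)"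
  by (rule bmeas_mult[OF bmeas_const])

lemma bmeas_diff [intro]: "bmeas M f \<Longrightarrow> bmeas M g \<Longrightarrow> bmeas M (\<lambda>x. f x - g x)"
  using bmeas_add[of M f "\<lambda>x. -1 * g x"] bmeas_cmult[of M g "-1"] by simp

lemma bmeas_indicator [intro]: "A \<in> sets M \<Longrightarrow> bmeas M (indicator A)"
  by (rule bmeasI[of _ _ 1]) (auto simp: indicator_def)

lemma bmeas_If [intro]: "bmeas M f \<Longrightarrow> bmeas M g \<Longrightarrow> Measurable.pred M P \<Longrightarrow> bmeas M (\<lambda>x. if P x then f x else g x)"
proof -
  assume a: "bmeas M f" "bmeas M g" "Measurable.pred M P"
  obtain B B' where "\<And>x. x \<in> space M \<Longrightarrow> \<bar>f x\<bar> \<le> B" "\<And>x. x \<in> space M \<Longrightarrow> \<bar>g x\<bar> \<le> B'"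
    using a by (metis bmeasE)
  then show ?thesis
    using a(1,2)[THEN bmeasD] a(3) by (intro bmeasI[of _ _ "max B B'"] measurable_If) fastforce+
qed

lemma bmeas_compose: "bmeas N f \<Longrightarrow> g \<in> M \<rightarrow>\<^sub>M N \<Longrightarrow> bmeas M (\<lambda>x. f (g x))"
  unfolding bmeas_def by (auto intro: measurable_compose dest: measurable_space)

lemma bmeas_cong: "(\<And>x. x \<in> space M \<Longrightarrow> f x = g x) \<Longrightarrow> bmeas M f \<longleftrightarrow> bmeas M g"
  unfolding bmeas_def by (auto cong: measurable_cong)

lemma bmeas_sets_cong: "sets M = sets N \<Longrightarrow> bmeas M f \<longleftrightarrow> bmeas N f"
  unfolding bmeas_def by (auto cong: measurable_cong_sets dest: sets_eq_imp_space_eq)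

lemma bmeas_borel_iff: "bmeas (borel :: 'a::topological_space measure) f \<longleftrightarrow> f \<in> borel_measurable borel \<and> bounded (range f)"
  unfolding bmeas_def bounded_iff by auto

lemma bmeas_integrable: "finite_measure M \<Longrightarrow> bmeas M f \<Longrightarrow> integrable M f"
  unfolding bmeas_def by (metis AE_I2 finite_measure.integrable_const_bound real_norm_def)

lemma abs_integral_le_const:
  fixes f :: "'b \<Rightarrow> real"
  assumes "prob_space M" "\<And>x. x \<in> space M \<Longrightarrow> \<bar>f x\<bar> \<le> B" "f \<in> borel_measurable M"
  shows "\<bar>\<integral>x. f x \<partial>M\<bar> \<le> B"
proof -
  interpret prob_space M by fact
  have i: "integrable M f" using assms by (intro integrable_const_bound[of _ B]) auto
  have "\<bar>\<integral>x. f x \<partial>M\<bar> \<le> (\<integral>x. \<bar>f x\<bar> \<partial>M)" by (rule integral_abs_bound)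
  also have "\<dots> \<le> (\<integral>x. B \<partial>M)" using assms(2) i by (intro integral_mono) auto
  finally show ?thesis by (simp add: prob_space)
qed

text \<open>Pushing \<open>L x\<close> forward along \<open>y \<mapsto> (x, y)\<close> moves the
  parameter from the integrand into the measure; measurability of the integral as a function of the
  measure then suffices.\<close>

lemma bmeas_kernel:
  assumes f: "bmeas (M \<Otimes>\<^sub>M N) (\<lambda>p. f (fst p) (snd p))" and L: "L \<in> M \<rightarrow>\<^sub>M prob_algebra N"
  shows "bmeas M (\<lambda>x. \<integral>y. f x y \<partial>L x)"
proof -
  obtain B where "0 \<le> B" and B: "\<And>p. p \<in> space (M \<Otimes>\<^sub>M N) \<Longrightarrow> \<bar>f (fst p) (snd p)\<bar> \<le> B"
    by (rule bmeasE[OF f]) blast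
  note fm[measurable] = bmeasD[OF f]
  show ?thesis
  proof (rule bmeasI)
    have d: "(\<lambda>x. distr (L x) (M \<Otimes>\<^sub>M N) (\<lambda>y. (x, y))) \<in> M \<rightarrow>\<^sub>M subprob_algebra (M \<Otimes>\<^sub>M N)"
      using measurable_distr2[of "\<lambda>x y. (x, y)" M N "M \<Otimes>\<^sub>M N" L] measurable_prob_algebraD[OF L] by simp
    have "(\<lambda>x. integral\<^sup>L (distr (L x) (M \<Otimes>\<^sub>M N) (\<lambda>y. (x, y))) (\<lambda>p. f (fst p) (snd p))) \<in> borel_measurable M"
      by (rule measurable_compose[OF d integral_measurable_subprob_algebra[OF fm]])
    then show "(\<lambda>x. \<integral>y. f x y \<partial>L x) \<in> borel_measurable M"
    proof (rule measurable_cong[THEN iffD1, rotated])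
      fix x assume x: "x \<in> space M"
      have s: "sets (L x) = sets N" using measurable_space[OF L x] by (simp add: space_prob_algebra)
      have "(\<lambda>y. (x, y)) \<in> L x \<rightarrow>\<^sub>M M \<Otimes>\<^sub>M N" using x by (simp cong: measurable_cong_sets[OF s refl])
      then show "integral\<^sup>L (distr (L x) (M \<Otimes>\<^sub>M N) (\<lambda>y. (x, y))) (\<lambda>p. f (fst p) (snd p)) = (\<integral>y. f x y \<partial>L x)"
        by (subst integral_distr) (auto simp: fm)
    qed
    fix x assume x: "x \<in> space M"
    have L': "sets (L x) = sets N" "prob_space (L x)" using measurable_space[OF L x] by (auto simp: space_prob_algebra)
    have fx: "f x \<in> borel_measurable N"
      using measurable_compose[OF measurable_Pair1'[OF x] fm] by simp
    show "\<bar>\<integral>y. f x y \<partial>L x\<bar> \<le> B"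
    proof (rule abs_integral_le_const[OF L'(2)])
      show "f x \<in> borel_measurable (L x)" using fx by (simp cong: measurable_cong_sets[OF L'(1) refl])
      fix y assume "y \<in> space (L x)"
      then have "(x, y) \<in> space (M \<Otimes>\<^sub>M N)" using x sets_eq_imp_space_eq[OF L'(1)] by (simp add: space_pair_measure)
      then show "\<bar>f x y\<bar> \<le> B" using B by fastforce
    qed
  qed
qed

lemma bmeas_section: "bmeas (M \<Otimes>\<^sub>M N) (\<lambda>p. f (fst p) (snd p)) \<Longrightarrow> x \<in> space M \<Longrightarrow> bmeas N (f x)"
  using bmeas_compose[OF _ measurable_Pair1', of M N "\<lambda>p. f (fst p) (snd p)" x] by simp

lemma bmeas_swap:
  assumes "finite_measure M" "finite_measure N" and f: "bmeas (M \<Otimes>\<^sub>M N) (\<lambda>p. f (fst p) (snd p))"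
  shows "(\<integral>x. \<integral>y. f x y \<partial>N \<partial>M) = (\<integral>y. \<integral>x. f x y \<partial>M \<partial>N)"
proof -
  interpret M: finite_measure M by fact
  interpret N: finite_measure N by fact
  interpret P: pair_sigma_finite M N by unfold_locales
  have "finite_measure (M \<Otimes>\<^sub>M N)" using finite_measure_pair_measure[OF assms(2,1)] .
  then have "integrable (M \<Otimes>\<^sub>M N) (\<lambda>(x, y). f x y)"
    using bmeas_integrable[OF _ f] by (simp add: split_beta')
  from P.Fubini_integral[OF this] show ?thesis by simp
qed

lemma integral_bind_bmeas:
  assumes f: "bmeas K f" and N: "N \<in> M \<rightarrow>\<^sub>M prob_algebra K" and M: "finite_measure M"
  shows "integral\<^sup>L (bind M N) f = (\<integral>x. integral\<^sup>L (N x) f \<partial>M)"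
proof -
  obtain B where "0 \<le> B" and B: "\<And>x. x \<in> space K \<Longrightarrow> \<bar>f x\<bar> \<le> B" by (rule bmeasE[OF f]) blast
  have "AE x in M. emeasure (N x) (space (N x)) \<le> ennreal 1"
    using measurable_space[OF N] by (auto simp: space_prob_algebra prob_space.emeasure_space_1)
  then show ?thesis
    by (intro integral_bind[where K=K and B=B and B'=1] bmeasD[OF f] B measurable_prob_algebraD[OF N] M)
qed

text \<open>Lebesgue measure on \<open>[0, t]\<close>, not normalised, and null for negative
  \<open>t\<close>. As a finite measure it lets time integrals be exchanged with expectations by
  \<open>bmeas_swap\<close>.\<close>

definition unif :: "real \<Rightarrow> real measure" where "unif t = density lborel (\<lambda>s. ennreal (indicator {0..t} s))"

lemma sets_unif [measurable_cong, simp]: "sets (unif t) = sets borel" by (simp add: unif_def)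
lemma space_unif [simp]: "space (unif t) = UNIV" by (simp add: unif_def)

lemma emeasure_unif: "A \<in> sets borel \<Longrightarrow> emeasure (unif t) A = emeasure lborel ({0..t} \<inter> A)"
  unfolding unif_def ennreal_indicator
  by (subst emeasure_density) (auto simp: nn_integral_indicator[symmetric] indicator_inter_arith simp del: nn_integral_indicator)

lemma finite_measure_unif: "finite_measure (unif t)"
  by (rule finite_measureI) (simp add: emeasure_unif emeasure_lborel_Icc_eq)

lemma measure_unif: "0 \<le> t \<Longrightarrow> measure (unif t) UNIV = t"
  by (simp add: measure_def emeasure_unif emeasure_lborel_Icc_eq)

lemma integral_unif: "(\<integral>s. f s \<partial>unif t) = (LINT s:{0..t}|lborel. f s)" if "f \<in> borel_measurable borel" for f :: "real \<Rightarrow> real"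
  unfolding unif_def set_lebesgue_integral_def using that by (subst integral_density) auto

lemma AE_unif: "AE s in unif t. 0 \<le> s \<and> s \<le> t"
  unfolding unif_def by (subst AE_density) (auto simp: indicator_def)

definition expo :: "real \<Rightarrow> real measure" where "expo c = density lborel (exponential_density c)"

lemma sets_expo [measurable_cong, simp]: "sets (expo c) = sets borel" by (simp add: expo_def)
lemma space_expo [simp]: "space (expo c) = UNIV" by (simp add: expo_def)

lemma prob_space_expo: "0 < c \<Longrightarrow> prob_space (expo c)"
  unfolding expo_def by (rule prob_space_exponential_density)

lemma finite_measure_expo: "0 < c \<Longrightarrow> finite_measure (expo c)"
  by (rule prob_space.finite_measure[OF prob_space_expo])

lemma AE_expo: "0 < c \<Longrightarrow> AE t in expo c. 0 \<le> t"
  unfolding expo_def by (subst AE_density) (auto simp: exponential_density_def)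

lemma integral_expo:
  assumes "0 < c" "f \<in> borel_measurable borel"
  shows "(\<integral>t. f t \<partial>expo c) = (\<integral>t. exponential_density c t * f t \<partial>lborel)"
  unfolding expo_def using assms by (subst integral_real_density) (auto simp: exponential_density_nonneg)

lemma integral_expo_atMost:
  assumes "0 < c" "0 \<le> t" "bmeas borel f"
  shows "(\<integral>s. (if s \<le> t then f s else 0) \<partial>expo c) = (\<integral>s. c * exp (- c * s) * f s \<partial>unif t)"
proof -
  note [measurable] = bmeasD[OF assms(3)]
  have "(\<integral>s. (if s \<le> t then f s else 0) \<partial>expo c) = (\<integral>s. exponential_density c s * (if s \<le> t then f s else 0) \<partial>lborel)"
    using assms(1) by (intro integral_expo) auto
  also have "\<dots> = (LINT s:{0..t}|lborel. c * exp (- c * s) * f s)"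
    unfolding set_lebesgue_integral_def
    by (intro Bochner_Integration.integral_cong) (auto simp: exponential_density_def indicator_def mult.commute)
  also have "\<dots> = (\<integral>s. c * exp (- c * s) * f s \<partial>unif t)"
    by (intro integral_unif[symmetric]) measurable
  finally show ?thesis .
qed

lemma measure_expo:
  assumes c: "0 < c" and t: "0 \<le> t" shows "measure (expo c) {..t} = 1 - exp (- c * t)" "measure (expo c) {t<..} = exp (- c * t)"
proof -
  interpret prob_space "expo c" by (rule prob_space_expo[OF c])
  have "distributed (expo c) lborel (\<lambda>x. x) (exponential_density c)"
    unfolding distributed_def expo_def by (auto simp: distr_id2 exponential_density_nonneg[OF c])
  from exponential_distributedD_le[OF this t c] exponential_distributedD_gt[OF this t c]
  show "measure (expo c) {..t} = 1 - exp (- c * t)" "measure (expo c) {t<..} = exp (- c * t)"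
    by (simp_all add: atMost_def greaterThan_def mult.commute)
qed

lemma expo_memoryless:
  assumes c: "0 < c" and s: "0 \<le> s" and f: "bmeas borel f"
  shows "(\<integral>t. (if s < t then f t else 0) \<partial>expo c) = exp (- c * s) * (\<integral>t. f (s + t) \<partial>expo c)"
proof -
  note [measurable] = bmeasD[OF f]
  have "(\<integral>t. (if s < t then f t else 0) \<partial>expo c) = (\<integral>t. exponential_density c t * (if s < t then f t else 0) \<partial>lborel)"
    using c by (intro integral_expo) auto
  also have "\<dots> = (\<integral>t. exponential_density c (s + 1 * t) * (if s < s + 1 * t then f (s + 1 * t) else 0) \<partial>lborel)"
    by (subst lborel_integral_real_affine[where c=1 and t=s]) auto
  also have "\<dots> = (\<integral>t. exp (- c * s) * (exponential_density c t * f (s + t)) \<partial>lborel)"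
  proof (rule integral_cong_AE)
    \<comment> \<open>At \<open>t = 0\<close> the two integrands may differ, since the ring has to
      come strictly after \<open>s\<close>.\<close>
    have "AE t in lborel. t \<noteq> (0::real)" by (rule AE_lborel_singleton)
    then show "AE t in lborel. exponential_density c (s + 1 * t) * (if s < s + 1 * t then f (s + 1 * t) else 0)
        = exp (- c * s) * (exponential_density c t * f (s + t))"
      by eventually_elim (use s in \<open>auto simp: exponential_density_def mult_exp_exp algebra_simps\<close>)
  qed measurable
  also have "\<dots> = exp (- c * s) * (\<integral>t. f (s + t) \<partial>expo c)"
    using c by (subst integral_expo) auto
  finally show ?thesis .
qed

lemma expo_early:
  assumes c: "0 < c" and s: "0 \<le> s" and b: "0 \<le> b" and h: "bmeas borel h"
    and le: "\<And>\<tau>. 0 \<le> \<tau> \<Longrightarrow> \<tau> \<le> s \<Longrightarrow> \<bar>h \<tau>\<bar> \<le> b"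
  shows "\<bar>\<integral>\<tau>. (if \<tau> \<le> s then h \<tau> else 0) \<partial>expo c\<bar> \<le> b * (1 - exp (- c * s))"
proof -
  have "bmeas borel (\<lambda>\<tau>. if \<tau> \<le> s then h \<tau> else 0)" using h by (intro bmeas_If) auto
  then have i: "integrable (expo c) (\<lambda>\<tau>. if \<tau> \<le> s then h \<tau> else 0)"
    using bmeas_sets_cong[OF sets_expo[of c]] by (intro bmeas_integrable[OF finite_measure_expo[OF c]]) simp
  have "\<bar>\<integral>\<tau>. (if \<tau> \<le> s then h \<tau> else 0) \<partial>expo c\<bar> \<le> (\<integral>\<tau>. \<bar>if \<tau> \<le> s then h \<tau> else 0\<bar> \<partial>expo c)"
    by (rule integral_abs_bound)
  also have "\<dots> \<le> (\<integral>\<tau>. b * indicator {..s} \<tau> \<partial>expo c)"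
  proof (rule integral_mono_AE)
    show "AE \<tau> in expo c. \<bar>if \<tau> \<le> s then h \<tau> else 0\<bar> \<le> b * indicator {..s} \<tau>"
      using AE_expo[OF c] by eventually_elim (use le in \<open>auto simp: indicator_def\<close>)
    show "integrable (expo c) (\<lambda>\<tau>. b * indicator {..s} \<tau>)"
      by (intro bmeas_integrable[OF finite_measure_expo[OF c]] bmeas_cmult bmeas_indicator) simp
  qed (rule integrable_abs[OF i])
  also have "\<dots> = b * (1 - exp (- c * s))" using measure_expo(1)[OF c s] by simp
  finally show ?thesis .
qed

text \<open>
  The recursion over the first ring of the clock bounds a quantity on \<open>[0, S]\<close> by a fraction of
  itself, since the clock rings before \<open>S\<close> with probability less than one.
\<close>

lemma ring_contraction:
  fixes g :: "real \<Rightarrow> 'b \<Rightarrow> real"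
  assumes c: "0 < c" and S: "0 \<le> s" "s \<le> S" "Q s y"
    and bound: "\<And>s y. 0 \<le> s \<Longrightarrow> s \<le> S \<Longrightarrow> Q s y \<Longrightarrow> g s y \<le> B"
    and step: "\<And>b s y. 0 \<le> b \<Longrightarrow> (\<And>s y. 0 \<le> s \<Longrightarrow> s \<le> S \<Longrightarrow> Q s y \<Longrightarrow> g s y \<le> b) \<Longrightarrow>
       0 \<le> s \<Longrightarrow> s \<le> S \<Longrightarrow> Q s y \<Longrightarrow> g s y \<le> b * (1 - exp (- c * s))"
  shows "g s y \<le> 0"
proof -
  let ?q = "1 - exp (- c * S)"
  have q: "0 \<le> ?q" "?q < 1" using c S by auto
  \<comment> \<open>The hypothesis \<open>step\<close> can be fed its own conclusion; each round
    gains \<open>?q\<close>, the largest of the factors on \<open>[0, S]\<close>.\<close>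
  have le: "g s y \<le> max 0 B * ?q ^ n" if "0 \<le> s" "s \<le> S" "Q s y" for n s y
    using that
  proof (induction n arbitrary: s y)
    case 0 then show ?case using bound[of s y] by auto
  next
    case (Suc n)
    have "g s y \<le> (max 0 B * ?q ^ n) * (1 - exp (- c * s))"
      by (rule step[OF _ Suc.IH Suc.prems]) (use q in auto)
    also have "\<dots> \<le> (max 0 B * ?q ^ n) * ?q"
      using Suc.prems c q by (intro mult_left_mono) (auto intro!: mult_nonneg_nonneg)
    finally show ?case by (simp add: ac_simps)
  qed
  have "(\<lambda>n. max 0 B * ?q ^ n) \<longlonglongrightarrow> max 0 B * 0"
    using q by (intro tendsto_mult tendsto_const LIMSEQ_realpow_zero) auto
  then show ?thesis using le[OF S] by (intro LIMSEQ_le_const) auto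
qed

text \<open>The truncation at 0 makes this a path for every real \<open>\<tau>\<close>; negative
  ring times form a null set but exist in the type. At negative \<open>t\<close> the first branch
  passes on the value \<open>undefined\<close> of \<open>\<xi>\<close>.\<close>

definition concat_path :: "(real \<Rightarrow> 'a) \<Rightarrow> real \<Rightarrow> (real \<Rightarrow> 'a) \<Rightarrow> real \<Rightarrow> 'a" where
  "concat_path \<xi> \<tau> \<omega> t = (if t < max 0 \<tau> then \<xi> t else \<omega> (t - max 0 \<tau>))"

lemma tendsto_shift:
  fixes \<omega> :: "real \<Rightarrow> 'a::topological_space"
  shows "(\<omega> \<longlongrightarrow> l) (at_right (t - d)) \<Longrightarrow> ((\<lambda>u. \<omega> (u - d)) \<longlongrightarrow> l) (at_right t)"
    and "(\<omega> \<longlongrightarrow> l) (at_left (t - d)) \<Longrightarrow> ((\<lambda>u. \<omega> (u - d)) \<longlongrightarrow> l) (at_left t)"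
proof -
  have "filterlim (\<lambda>u. u - d) (at_right (t - d)) (at_right t)"
    unfolding filterlim_def by (simp add: filtermap_at_right_shift)
  then show "(\<omega> \<longlongrightarrow> l) (at_right (t - d)) \<Longrightarrow> ((\<lambda>u. \<omega> (u - d)) \<longlongrightarrow> l) (at_right t)"
    by (rule filterlim_compose[rotated])
  have "filterlim (\<lambda>u. u - d) (at_left (t - d)) (at_left t)"
  proof -
    have "((\<lambda>u. u - d) \<longlongrightarrow> t - d) (at_left t)" by (intro tendsto_intros)
    then show ?thesis by (auto simp: filterlim_at eventually_at_filter)
  qed
  then show "(\<omega> \<longlongrightarrow> l) (at_left (t - d)) \<Longrightarrow> ((\<lambda>u. \<omega> (u - d)) \<longlongrightarrow> l) (at_left t)"
    by (rule filterlim_compose[rotated])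
qed

lemma concat_path_in_skorokhod_space:
  assumes \<xi>: "\<xi> \<in> skorokhod_space S" and \<omega>: "\<omega> \<in> skorokhod_space S"
  shows "concat_path \<xi> \<tau> \<omega> \<in> skorokhod_space S"
proof -
  let ?r = "max 0 \<tau>" and ?c = "concat_path \<xi> \<tau> \<omega>"
  have 1: "?c \<in> {0..} \<rightarrow>\<^sub>E S"
    using \<xi> \<omega> unfolding concat_path_def skorokhod_space_def
    by (auto simp: PiE_iff extensional_def)
  have 2: "(?c \<longlongrightarrow> ?c t) (at_right t)" if t: "t \<ge> 0" for t
  proof (cases "t < ?r")
    case True
    then have "eventually (\<lambda>u. \<xi> u = ?c u) (at_right t)"
      unfolding eventually_at_right_field concat_path_def by (intro exI[of _ ?r]) auto
    moreover have "(\<xi> \<longlongrightarrow> ?c t) (at_right t)" using skorokhod_space_right[OF \<xi> t] True by (simp add: concat_path_def)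
    ultimately show ?thesis by (rule Lim_transform_eventually[rotated])
  next
    case False
    then have "eventually (\<lambda>u. \<omega> (u - ?r) = ?c u) (at_right t)"
      unfolding eventually_at_right_field concat_path_def by (intro exI[of _ "t + 1"]) auto
    moreover have "((\<lambda>u. \<omega> (u - ?r)) \<longlongrightarrow> ?c t) (at_right t)"
      using skorokhod_space_right[OF \<omega>, of "t - ?r"] False by (intro tendsto_shift) (auto simp: concat_path_def max_def split: if_splits)
    ultimately show ?thesis by (rule Lim_transform_eventually[rotated])
  qed
  have 3: "\<exists>l\<in>S. (?c \<longlongrightarrow> l) (at_left t)" if t: "t > 0" for t
  proof (cases "t \<le> ?r")
    \<comment> \<open>The junction itself belongs to this case: its left limit is that of
      \<open>\<xi>\<close>.\<close>
    case True
    then have ev: "eventually (\<lambda>u. \<xi> u = ?c u) (at_left t)"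
      unfolding eventually_at_left_field concat_path_def by (intro exI[of _ 0]) (use t in auto)
    obtain l where "l \<in> S" "(\<xi> \<longlongrightarrow> l) (at_left t)" using \<xi> t unfolding skorokhod_space_def by blast
    then show ?thesis using Lim_transform_eventually[OF _ ev] by blast
  next
    case False
    then have ev: "eventually (\<lambda>u. \<omega> (u - ?r) = ?c u) (at_left t)"
      unfolding eventually_at_left_field concat_path_def by (intro exI[of _ ?r]) auto
    have "t - ?r > 0" using False by linarith
    then obtain l where "l \<in> S" "(\<omega> \<longlongrightarrow> l) (at_left (t - ?r))" using \<omega> unfolding skorokhod_space_def by blast
    then show ?thesis using Lim_transform_eventually[OF tendsto_shift(2) ev] by blast
  qed
  show ?thesis using 1 2 3 unfolding skorokhod_space_def by blast
qed

abbreviation paths :: "(real \<Rightarrow> 'a::{metric_space, second_countable_topology}) measure" where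
  "paths \<equiv> skorokhod_borel UNIV"

lemma measurable_concat_path [measurable (raw)]:
  fixes f g :: "'b \<Rightarrow> real \<Rightarrow> 'a::{metric_space, second_countable_topology}"
  assumes f[measurable]: "f \<in> N \<rightarrow>\<^sub>M paths" and h[measurable]: "h \<in> borel_measurable N" and g[measurable]: "g \<in> N \<rightarrow>\<^sub>M paths"
  shows "(\<lambda>x. concat_path (f x) (h x) (g x)) \<in> N \<rightarrow>\<^sub>M paths"
proof (rule measurable_skorokhodI)
  show "(\<lambda>x. concat_path (f x) (h x) (g x)) \<in> space N \<rightarrow> skorokhod_space UNIV"
    using measurable_space[OF f] measurable_space[OF g] by (auto intro!: concat_path_in_skorokhod_space)
  fix t :: real assume t: "0 \<le> t"
  have 1: "(\<lambda>x. f x t) \<in> N \<rightarrow>\<^sub>M borel" by (rule measurable_skorokhod_apply[OF _ f]) (use t in auto)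
  have 2: "(\<lambda>x. g x (max 0 (t - max 0 (h x)))) \<in> N \<rightarrow>\<^sub>M borel" by (rule measurable_skorokhod_apply[OF _ g]) auto
  have "(\<lambda>x. if t < max 0 (h x) then f x t else g x (max 0 (t - max 0 (h x)))) \<in> N \<rightarrow>\<^sub>M borel"
    using 1 2 by measurable
  then show "(\<lambda>x. concat_path (f x) (h x) (g x) t) \<in> N \<rightarrow>\<^sub>M borel"
    by (rule measurable_cong[THEN iffD1, rotated]) (simp add: concat_path_def max_def)
qed

text \<open>The first \<open>n\<close> rings are carried out and the next path is followed for ever.
  The jumps are not visible here: they sit in the starting points of the successive paths.\<close>

primrec glue :: "nat \<Rightarrow> (nat \<Rightarrow> (real \<Rightarrow> 'a) \<times> real) \<Rightarrow> real \<Rightarrow> 'a" where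
  "glue 0 v = fst (v 0)"
| "glue (Suc n) v = concat_path (fst (v 0)) (snd (v 0)) (glue n (\<lambda>i. v (Suc i)))"

definition ring_time :: "nat \<Rightarrow> (nat \<Rightarrow> (real \<Rightarrow> 'a) \<times> real) \<Rightarrow> real" where
  "ring_time n v = (\<Sum>i<n. max 0 (snd (v i)))"

lemma ring_time_Suc: "ring_time (Suc n) v = max 0 (snd (v 0)) + ring_time n (\<lambda>i. v (Suc i))"
  unfolding ring_time_def by (rule sum.lessThan_Suc_shift)

lemma ring_time_mono: "m \<le> n \<Longrightarrow> ring_time m v \<le> ring_time n v"
  unfolding ring_time_def by (rule sum_mono2) auto

lemma glue_stable_Suc: "t < ring_time (Suc n) v \<Longrightarrow> glue (Suc n) v t = glue n v t"
proof (induction n arbitrary: v t)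
  case 0 then show ?case by (simp add: ring_time_def concat_path_def)
next
  case (Suc n)
  show ?case
  proof (cases "t < max 0 (snd (v 0))")
    case True then show ?thesis by (simp add: concat_path_def)
  next
    case False
    have "t - max 0 (snd (v 0)) < ring_time (Suc n) (\<lambda>i. v (Suc i))"
      using Suc.prems by (subst (asm) ring_time_Suc) linarith
    from Suc.IH[OF this] show ?thesis using False by (simp add: concat_path_def)
  qed
qed

lemma glue_stable: "n \<le> m \<Longrightarrow> t < ring_time (Suc n) v \<Longrightarrow> glue m v t = glue n v t"
proof (induction m rule: dec_induct)
  case (step m)
  have "t < ring_time (Suc m) v" using ring_time_mono[of "Suc n" "Suc m" v] step by linarith
  then show ?case using glue_stable_Suc[of t m v] step by simp
qed simp

lemma glue_in_skorokhod_space: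
  "(\<And>i. fst (v i) \<in> skorokhod_space S) \<Longrightarrow> glue n v \<in> skorokhod_space S"
  by (induction n arbitrary: v) (auto intro: concat_path_in_skorokhod_space)

text \<open>Natural numbers as thresholds keep the condition a countable one, hence
  measurable.\<close>

definition nonexplosive :: "(nat \<Rightarrow> (real \<Rightarrow> 'a) \<times> real) \<Rightarrow> bool" where
  "nonexplosive v \<longleftrightarrow> (\<forall>k::nat. \<exists>n. real k < ring_time n v)"

text \<open>The glued prefixes agree before the rings that they carry out, so any sufficient number
  of rings gives the same value, and the least one is a measurable choice. Explosive sequences form
  a null set; a constant path is their default, so that the result is a path whenever the marks
  contain paths.\<close>

definition assemble :: "(nat \<Rightarrow> (real \<Rightarrow> 'a) \<times> real) \<Rightarrow> real \<Rightarrow> 'a" where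
  "assemble v t = (if nonexplosive v then glue (LEAST n. t < ring_time (Suc n) v) v t
     else if t < 0 then undefined else fst (v 0) 0)"

lemma nonexplosiveD:
  assumes "nonexplosive v" obtains n where "t < ring_time (Suc n) v"
proof -
  obtain k where "t < real k" using reals_Archimedean2 by blast
  moreover obtain n where "real k < ring_time n v" using assms unfolding nonexplosive_def by blast
  moreover have "ring_time n v \<le> ring_time (Suc n) v" by (rule ring_time_mono) simp
  ultimately show ?thesis using that[of n] by linarith
qed

lemma assemble_eq_glue:
  assumes "nonexplosive v" "t < ring_time (Suc n) v" shows "assemble v t = glue n v t"
proof -
  let ?N = "LEAST n. t < ring_time (Suc n) v"
  have "?N \<le> n" "t < ring_time (Suc ?N) v"
    using assms(2) by (auto intro: Least_le LeastI)
  then have "glue n v t = glue ?N v t" by (rule glue_stable)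
  then show ?thesis using assms(1) unfolding assemble_def by simp
qed

text \<open>The path axioms at \<open>t\<close> involve only times below \<open>t + 1\<close>, and
  agreement below 0 gives the value \<open>undefined\<close> there. This reduces an assembled path
  to finitely many pieces.\<close>

lemma skorokhod_space_local:
  assumes "\<And>T. \<exists>\<omega>\<in>skorokhod_space S. \<forall>t<T. \<eta> t = \<omega> t"
  shows "\<eta> \<in> skorokhod_space S"
proof -
  have 1: "\<eta> t \<in> S" if "t \<ge> 0" for t
    using assms[of "t + 1"] skorokhod_space_in that by fastforce
  have 2: "\<eta> t = undefined" if "\<not> t \<ge> 0" for t
  proof -
    obtain \<omega> where "\<omega> \<in> skorokhod_space S" "\<forall>t<0. \<eta> t = \<omega> t" using assms[of 0] by blast
    then show ?thesis using that by (auto simp: skorokhod_space_def PiE_iff extensional_def)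
  qed
  have 3: "(\<eta> \<longlongrightarrow> \<eta> t) (at_right t)" if t: "t \<ge> 0" for t
  proof -
    obtain \<omega> where \<omega>: "\<omega> \<in> skorokhod_space S" "\<forall>u<t+1. \<eta> u = \<omega> u" using assms[of "t+1"] by blast
    have "eventually (\<lambda>u. \<omega> u = \<eta> u) (at_right t)"
      unfolding eventually_at_right_field by (intro exI[of _ "t + 1"]) (use \<omega> in auto)
    moreover have "(\<omega> \<longlongrightarrow> \<eta> t) (at_right t)" using skorokhod_space_right[OF \<omega>(1) t] \<omega>(2) by simp
    ultimately show ?thesis by (rule Lim_transform_eventually[rotated])
  qed
  have 4: "\<exists>l\<in>S. (\<eta> \<longlongrightarrow> l) (at_left t)" if t: "t > 0" for t
  proof -
    obtain \<omega> where \<omega>: "\<omega> \<in> skorokhod_space S" "\<forall>u<t+1. \<eta> u = \<omega> u" using assms[of "t+1"] by blast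
    have ev: "eventually (\<lambda>u. \<omega> u = \<eta> u) (at_left t)"
      unfolding eventually_at_left_field by (intro exI[of _ 0]) (use \<omega> t in auto)
    obtain l where "l \<in> S" "(\<omega> \<longlongrightarrow> l) (at_left t)" using \<omega> t unfolding skorokhod_space_def by blast
    then show ?thesis using Lim_transform_eventually[OF _ ev] by blast
  qed
  show ?thesis
    using 1 2 3 4 unfolding skorokhod_space_def by (auto simp: PiE_iff extensional_def)
qed

lemma assemble_in_skorokhod_space:
  assumes v: "\<And>i. fst (v i) \<in> skorokhod_space S"
  shows "assemble v \<in> skorokhod_space S"
proof (cases "nonexplosive v")
  case True
  show ?thesis
  proof (rule skorokhod_space_local)
    fix T
    obtain n where n: "T < ring_time (Suc n) v" using nonexplosiveD[OF True] by blast
    show "\<exists>\<omega>\<in>skorokhod_space S. \<forall>t<T. assemble v t = \<omega> t"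
      by (intro bexI[of _ "glue n v"] allI impI assemble_eq_glue[OF True] glue_in_skorokhod_space v) (use n in auto)
  qed
next
  case False
  then have e: "assemble v = (\<lambda>t. if t < 0 then undefined else fst (v 0) 0)" unfolding assemble_def by auto
  have ev: "eventually (\<lambda>u. fst (v 0) 0 = (if u < 0 then undefined else fst (v 0) 0)) (at_right t)" if "t \<ge> 0" for t :: real
    unfolding eventually_at_right_field by (intro exI[of _ "t + 1"]) (use that in auto)
  have ev': "eventually (\<lambda>u. fst (v 0) 0 = (if u < 0 then undefined else fst (v 0) 0)) (at_left t)" if "t > 0" for t :: real
    unfolding eventually_at_left_field by (intro exI[of _ 0]) (use that in auto)
  have "fst (v 0) 0 \<in> S" using skorokhod_space_in[OF v, of 0] by simp
  then show ?thesis unfolding e skorokhod_space_def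
    using Lim_transform_eventually[OF tendsto_const ev] Lim_transform_eventually[OF tendsto_const ev']
    by (auto simp: PiE_iff extensional_def intro!: bexI[of _ "fst (v 0) 0"])
qed

lemma nonexplosive_Cons: "nonexplosive (case_nat y v) \<longleftrightarrow> nonexplosive v"
proof
  let ?r = "max 0 (snd y)"
  have e: "ring_time (Suc n) (case_nat y v) = ?r + ring_time n v" for n by (subst ring_time_Suc) simp
  show "nonexplosive v" if a: "nonexplosive (case_nat y v)"
    unfolding nonexplosive_def
  proof
    fix k :: nat
    obtain n where "real k + ?r < ring_time (Suc n) (case_nat y v)" using nonexplosiveD[OF a] by blast
    then show "\<exists>n. real k < ring_time n v" unfolding e by (intro exI[of _ n]) simp
  qed
  show "nonexplosive (case_nat y v)" if a: "nonexplosive v"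
    unfolding nonexplosive_def
  proof
    fix k :: nat
    obtain n where "real k < ring_time n v" using a unfolding nonexplosive_def by blast
    then show "\<exists>n. real k < ring_time n (case_nat y v)" by (intro exI[of _ "Suc n"]) (simp add: e)
  qed
qed

text \<open>With \<open>n\<close> rings of \<open>v\<close> the prefixed sequence has had
  \<open>n + 1\<close>, and \<open>glue\<close> unfolds accordingly. For an explosive
  \<open>v\<close> the left side would be the default path, which stays at
  \<open>\<xi> 0\<close>.\<close>

lemma assemble_Cons:
  assumes v: "nonexplosive v" shows "assemble (case_nat (\<xi>, \<tau>) v) = concat_path \<xi> \<tau> (assemble v)"
proof
  fix t
  let ?r = "max 0 \<tau>" and ?v = "case_nat (\<xi>, \<tau>) v"
  have c: "nonexplosive ?v" using v by (simp add: nonexplosive_Cons)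
  have e: "ring_time (Suc n) ?v = ?r + ring_time n v" for n by (subst ring_time_Suc) simp
  show "assemble ?v t = concat_path \<xi> \<tau> (assemble v) t"
  proof (cases "t < ?r")
    case True
    then have "t < ring_time (Suc 0) ?v" unfolding e by (simp add: ring_time_def)
    then show ?thesis using True by (simp add: assemble_eq_glue[OF c, of t 0] concat_path_def)
  next
    case False
    obtain n where n: "t - ?r < ring_time (Suc n) v" using nonexplosiveD[OF v] by blast
    then have "t < ring_time (Suc (Suc n)) ?v" unfolding e by linarith
    then have "assemble ?v t = glue (Suc n) ?v t" by (rule assemble_eq_glue[OF c])
    then show ?thesis using False assemble_eq_glue[OF v n] by (simp add: concat_path_def)
  qed
qed

abbreviation marks :: "(nat \<Rightarrow> (real \<Rightarrow> 'a::{metric_space, second_countable_topology}) \<times> real) measure" where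
  "marks \<equiv> Pi\<^sub>M UNIV (\<lambda>_. paths \<Otimes>\<^sub>M borel)"

lemma measurable_ring_time [measurable]: "ring_time n \<in> borel_measurable marks"
  unfolding ring_time_def by measurable

lemma measurable_nonexplosive [measurable]: "Measurable.pred marks nonexplosive"
  unfolding nonexplosive_def by measurable

lemma measurable_glue [measurable]: "glue n \<in> marks \<rightarrow>\<^sub>M paths"
proof (induction n)
  case 0
  show ?case unfolding glue.simps by measurable
next
  case (Suc n)
  have "(\<lambda>v i. v (Suc i)) \<in> marks \<rightarrow>\<^sub>M (marks :: (nat \<Rightarrow> (real \<Rightarrow> 'a) \<times> real) measure)" by (rule measurable_PiM_single') (auto simp: space_PiM)
  from measurable_compose[OF this Suc] show ?case unfolding glue.simps by measurable
qed

text \<open>The value at \<open>t\<close> is one of countably many measurable functions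
  \<open>glue n\<close>, selected by a measurable index.\<close>

lemma measurable_assemble [measurable]: "assemble \<in> marks \<rightarrow>\<^sub>M paths"
proof (rule measurable_skorokhodI)
  show "assemble \<in> space marks \<rightarrow> (skorokhod_space UNIV :: (real \<Rightarrow> 'a) set)"
  proof
    fix v :: "nat \<Rightarrow> (real \<Rightarrow> 'a) \<times> real" assume "v \<in> space marks"
    then show "assemble v \<in> skorokhod_space UNIV"
      by (intro assemble_in_skorokhod_space) (auto simp: space_PiM space_pair_measure PiE_iff mem_Times_iff)
  qed
  fix t :: real assume t: "0 \<le> t"
  have g: "(\<lambda>v. glue n v t) \<in> marks \<rightarrow>\<^sub>M (borel :: 'a measure)" for n
    by (rule measurable_skorokhod_apply[OF _ measurable_glue]) (use t in auto)
  have "(\<lambda>v. v (0::nat)) \<in> (marks :: (nat \<Rightarrow> (real \<Rightarrow> 'a) \<times> real) measure) \<rightarrow>\<^sub>M paths \<Otimes>\<^sub>M borel" by measurable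
  then have "(\<lambda>v. fst (v (0::nat))) \<in> (marks :: (nat \<Rightarrow> (real \<Rightarrow> 'a) \<times> real) measure) \<rightarrow>\<^sub>M paths" by measurable
  then have 0: "(\<lambda>v. fst (v (0::nat)) 0) \<in> marks \<rightarrow>\<^sub>M (borel :: 'a measure)"
    by (rule measurable_compose[OF _ measurable_skorokhod_eval]) simp
  have L: "(\<lambda>v. LEAST n. t < ring_time (Suc n) v) \<in> (marks :: (nat \<Rightarrow> (real \<Rightarrow> 'a) \<times> real) measure) \<rightarrow>\<^sub>M count_space UNIV"
    by (rule measurable_Least) measurable
  have "(\<lambda>v. glue (LEAST n. t < ring_time (Suc n) v) v t) \<in> marks \<rightarrow>\<^sub>M (borel :: 'a measure)"
    by (rule measurable_compose_countable[OF g L])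
  then have "(\<lambda>v. if nonexplosive v then glue (LEAST n. t < ring_time (Suc n) v) v t else fst (v 0) 0) \<in> marks \<rightarrow>\<^sub>M (borel :: 'a measure)"
    using 0 by measurable
  then show "(\<lambda>v. assemble v t) \<in> marks \<rightarrow>\<^sub>M (borel :: 'a measure)"
    using t unfolding assemble_def by (simp add: not_less cong: if_cong)
qed

section \<open>The process with jumps at the rings of a clock\<close>

text \<open>\<open>R\<close> is the law of the motion between rings, \<open>J\<close> the law of the
  place after a ring. The Markov property of \<open>R\<close> is stated with an event of the past
  and a test function, the form in which it can be integrated over the clock.\<close>

locale jump_kernels =
  fixes R :: "'a::{metric_space, second_countable_topology} \<Rightarrow> (real \<Rightarrow> 'a) measure"
    and J :: "'a \<Rightarrow> 'a measure" and c :: real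
  assumes R[measurable]: "R \<in> borel \<rightarrow>\<^sub>M prob_algebra paths"
    and J[measurable]: "J \<in> borel \<rightarrow>\<^sub>M prob_algebra borel"
    and c: "0 < c"
    and R_start: "\<And>x. AE \<omega> in R x. \<omega> 0 = x"
    and R_markov: "\<And>x s t A f. 0 \<le> s \<Longrightarrow> 0 \<le> t \<Longrightarrow> A \<in> sets (path_filtration UNIV s) \<Longrightarrow> bmeas borel f \<Longrightarrow>
       (\<integral>\<omega>. indicator A \<omega> * f (\<omega> (s + t)) \<partial>R x) = (\<integral>\<omega>. indicator A \<omega> * (\<integral>\<eta>. f (\<eta> t) \<partial>R (\<omega> s)) \<partial>R x)"
begin

text \<open>The product of \<open>R x\<close> with the exponential law, so the ring time is
  independent of the path. Writing it with binds yields measurability in \<open>x\<close>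
  directly.\<close>

definition mark_kernel :: "'a \<Rightarrow> ((real \<Rightarrow> 'a) \<times> real) measure" where
  "mark_kernel x = R x \<bind> (\<lambda>\<xi>. expo c \<bind> (\<lambda>\<tau>. return (paths \<Otimes>\<^sub>M borel) (\<xi>, \<tau>)))"

definition jump_kernel :: "(real \<Rightarrow> 'a) \<times> real \<Rightarrow> 'a measure" where
  "jump_kernel p = J (fst p (max 0 (snd p)))"

lemma R_prob: "sets (R x) = sets paths" "space (R x) = skorokhod_space UNIV" "prob_space (R x)" "finite_measure (R x)"
  using measurable_space[OF R, of x] by (auto simp: space_prob_algebra prob_space.finite_measure dest: sets_eq_imp_space_eq)

lemma J_prob: "sets (J x) = sets borel" "space (J x) = UNIV" "prob_space (J x)" "finite_measure (J x)"
  using measurable_space[OF J, of x] by (auto simp: space_prob_algebra prob_space.finite_measure dest: sets_eq_imp_space_eq)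

lemma expo_in_prob_algebra: "expo c \<in> space (prob_algebra borel)"
  by (simp add: space_prob_algebra prob_space_expo[OF c])

lemma mark_kernel_measurable [measurable]: "mark_kernel \<in> borel \<rightarrow>\<^sub>M prob_algebra (paths \<Otimes>\<^sub>M borel)"
proof -
  have "(\<lambda>p. return (paths \<Otimes>\<^sub>M borel) (fst p, snd p)) \<in> paths \<Otimes>\<^sub>M borel \<rightarrow>\<^sub>M prob_algebra (paths \<Otimes>\<^sub>M (borel :: real measure))"
    by (rule measurable_compose[OF _ measurable_return_prob_space]) measurable
  then have "(\<lambda>\<xi>. expo c \<bind> (\<lambda>\<tau>. return (paths \<Otimes>\<^sub>M borel) (\<xi>, \<tau>))) \<in> paths \<rightarrow>\<^sub>M prob_algebra (paths \<Otimes>\<^sub>M borel)"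
    by (intro measurable_bind_prob_space2[OF measurable_const[OF expo_in_prob_algebra]]) (simp add: split_beta')
  then show ?thesis unfolding mark_kernel_def by (rule measurable_bind_prob_space[OF R])
qed

lemma eval_mark_measurable [measurable]: "(\<lambda>p. fst p (max 0 (snd p))) \<in> paths \<Otimes>\<^sub>M borel \<rightarrow>\<^sub>M borel"
  by (rule measurable_skorokhod_apply) auto

lemma jump_kernel_measurable [measurable]: "jump_kernel \<in> paths \<Otimes>\<^sub>M borel \<rightarrow>\<^sub>M prob_algebra borel"
  unfolding jump_kernel_def by (rule measurable_compose[OF eval_mark_measurable J])

lemma mark_kernel_prob: "sets (mark_kernel x) = sets (paths \<Otimes>\<^sub>M borel)" "space (mark_kernel x) = skorokhod_space UNIV \<times> UNIV"
   "prob_space (mark_kernel x)" "finite_measure (mark_kernel x)"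
  using measurable_space[OF mark_kernel_measurable, of x]
  by (auto simp: space_prob_algebra prob_space.finite_measure space_pair_measure dest: sets_eq_imp_space_eq)

lemma integral_mark_kernel:
  assumes H: "bmeas (paths \<Otimes>\<^sub>M borel) H"
  shows "(\<integral>p. H p \<partial>mark_kernel x) = (\<integral>\<xi>. \<integral>\<tau>. H (\<xi>, \<tau>) \<partial>expo c \<partial>R x)"
proof -
  have 1: "(\<lambda>p. return (paths \<Otimes>\<^sub>M borel) (fst p, snd p)) \<in> paths \<Otimes>\<^sub>M borel \<rightarrow>\<^sub>M prob_algebra (paths \<Otimes>\<^sub>M (borel :: real measure))"
    by (rule measurable_compose[OF _ measurable_return_prob_space]) measurable
  then have 2: "(\<lambda>\<xi>. expo c \<bind> (\<lambda>\<tau>. return (paths \<Otimes>\<^sub>M borel) (\<xi>, \<tau>))) \<in> paths \<rightarrow>\<^sub>M prob_algebra (paths \<Otimes>\<^sub>M borel)"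
    by (intro measurable_bind_prob_space2[OF measurable_const[OF expo_in_prob_algebra]]) (simp add: split_beta')
  have 3: "(\<lambda>\<tau>. return (paths \<Otimes>\<^sub>M borel) (\<xi>, \<tau>)) \<in> borel \<rightarrow>\<^sub>M prob_algebra (paths \<Otimes>\<^sub>M borel)" if "\<xi> \<in> skorokhod_space UNIV" for \<xi> :: "real \<Rightarrow> 'a"
    using measurable_compose[OF measurable_Pair1' 1, of \<xi>] that by simp
  have "(\<integral>p. H p \<partial>mark_kernel x) = (\<integral>\<xi>. integral\<^sup>L (expo c \<bind> (\<lambda>\<tau>. return (paths \<Otimes>\<^sub>M borel) (\<xi>, \<tau>))) H \<partial>R x)"
    unfolding mark_kernel_def
    by (rule integral_bind_bmeas[OF H _ R_prob(4)]) (use 2 in \<open>simp cong: measurable_cong_sets[OF R_prob(1) refl]\<close>)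
  also have "\<dots> = (\<integral>\<xi>. \<integral>\<tau>. H (\<xi>, \<tau>) \<partial>expo c \<partial>R x)"
  proof (rule Bochner_Integration.integral_cong[OF refl])
    fix \<xi> assume "\<xi> \<in> space (R x)"
    then have \<xi>: "\<xi> \<in> skorokhod_space UNIV" by (simp add: R_prob)
    have "integral\<^sup>L (expo c \<bind> (\<lambda>\<tau>. return (paths \<Otimes>\<^sub>M borel) (\<xi>, \<tau>))) H
        = (\<integral>\<tau>. integral\<^sup>L (return (paths \<Otimes>\<^sub>M borel) (\<xi>, \<tau>)) H \<partial>expo c)"
      by (rule integral_bind_bmeas[OF H _ finite_measure_expo[OF c]])
        (use 3[OF \<xi>] in \<open>simp cong: measurable_cong_sets[OF sets_expo refl]\<close>)
    also have "\<dots> = (\<integral>\<tau>. H (\<xi>, \<tau>) \<partial>expo c)"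
      using \<xi> bmeasD[OF H] by (intro Bochner_Integration.integral_cong refl integral_return) (auto simp: space_pair_measure)
    finally show "integral\<^sup>L (expo c \<bind> (\<lambda>\<tau>. return (paths \<Otimes>\<^sub>M borel) (\<xi>, \<tau>))) H = (\<integral>\<tau>. H (\<xi>, \<tau>) \<partial>expo c)" .
  qed
  finally show ?thesis .
qed

lemma integral_mark_kernel':
  assumes H: "bmeas (paths \<Otimes>\<^sub>M borel) H"
  shows "(\<integral>p. H p \<partial>mark_kernel x) = (\<integral>\<tau>. \<integral>\<xi>. H (\<xi>, \<tau>) \<partial>R x \<partial>expo c)"
proof -
  have "bmeas (R x \<Otimes>\<^sub>M expo c) (\<lambda>p. H (fst p, snd p))"
    using H bmeas_sets_cong[OF sets_pair_measure_cong[OF R_prob(1) sets_expo]] by simp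
  from bmeas_swap[OF R_prob(4) finite_measure_expo[OF c], of x "\<lambda>\<xi> \<tau>. H (\<xi>, \<tau>)"] this
  show ?thesis unfolding integral_mark_kernel[OF H] by simp
qed

lemma AE_mark_kernel: "AE p in mark_kernel x. fst p \<in> skorokhod_space UNIV \<and> 0 \<le> snd p"
proof -
  interpret mk: prob_space "mark_kernel x" by (rule mark_kernel_prob)
  interpret E: prob_space "expo c" by (rule prob_space_expo[OF c])
  define A :: "((real \<Rightarrow> 'a) \<times> real) set" where "A = skorokhod_space UNIV \<times> {0..}"
  have A: "A \<in> sets (paths \<Otimes>\<^sub>M borel)"
    unfolding A_def using sets.top[of "paths :: (real \<Rightarrow> 'a) measure"] by (intro pair_measureI) auto
  have "measure (mark_kernel x) A = (\<integral>p. indicator A p \<partial>mark_kernel x)"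
    using A by (simp add: mark_kernel_prob(1))
  also have "\<dots> = (\<integral>\<xi>. \<integral>\<tau>. indicator A (\<xi>, \<tau>) \<partial>expo c \<partial>R x)"
    by (rule integral_mark_kernel[OF bmeas_indicator[OF A]])
  also have "\<dots> = (\<integral>\<xi>. 1 \<partial>R x)"
  proof (rule Bochner_Integration.integral_cong[OF refl])
    fix \<xi> assume \<xi>: "\<xi> \<in> space (R x)"
    have "(\<lambda>\<tau>. indicator A (\<xi>, \<tau>) :: real) = indicator {0..}"
      using \<xi> unfolding A_def by (auto simp: indicator_def R_prob fun_eq_iff)
    moreover have "measure (expo c) {0..} = 1"
      using AE_expo[OF c] by (subst E.prob_eq_1) auto
    ultimately show "(\<integral>\<tau>. indicator A (\<xi>, \<tau>) \<partial>expo c) = (1::real)" by simp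
  qed
  also have "\<dots> = 1" using prob_space.prob_space[OF R_prob(3)] by simp
  finally have "AE p in mark_kernel x. p \<in> A" by (rule mk.AE_prob_1)
  then show ?thesis by eventually_elim (auto simp: A_def)
qed

text \<open>With the path frozen, \<open>expo_early\<close> supplies the bound under the clock;
  averaging over \<open>R x\<close> preserves it.\<close>

lemma mark_kernel_early:
  assumes H: "bmeas (paths \<Otimes>\<^sub>M borel) H" and s: "0 \<le> s" and b: "0 \<le> b"
    and le: "\<And>\<xi> \<tau>. \<xi> \<in> skorokhod_space UNIV \<Longrightarrow> 0 \<le> \<tau> \<Longrightarrow> \<tau> \<le> s \<Longrightarrow> \<bar>H (\<xi>, \<tau>)\<bar> \<le> b"
  shows "\<bar>\<integral>p. (if snd p \<le> s then H p else 0) \<partial>mark_kernel x\<bar> \<le> b * (1 - exp (- c * s))"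
proof -
  let ?H = "\<lambda>p. if snd p \<le> s then H p else 0"
  have bH: "bmeas (paths \<Otimes>\<^sub>M borel) ?H" using H by (intro bmeas_If) auto
  have "\<bar>\<integral>p. ?H p \<partial>mark_kernel x\<bar> = \<bar>\<integral>\<xi>. \<integral>\<tau>. ?H (\<xi>, \<tau>) \<partial>expo c \<partial>R x\<bar>"
    by (simp only: integral_mark_kernel[OF bH])
  also have "\<dots> \<le> b * (1 - exp (- c * s))"
  proof (rule abs_integral_le_const[OF R_prob(3)])
    have "bmeas paths (\<lambda>\<xi>. \<integral>\<tau>. ?H (\<xi>, \<tau>) \<partial>expo c)"
      using bmeas_kernel[of paths borel "\<lambda>\<xi> \<tau>. ?H (\<xi>, \<tau>)" "\<lambda>_. expo c"] bH expo_in_prob_algebra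
      by (simp cong: if_cong)
    then show "(\<lambda>\<xi>. \<integral>\<tau>. ?H (\<xi>, \<tau>) \<partial>expo c) \<in> borel_measurable (R x)"
      using bmeasD measurable_cong_sets[OF R_prob(1) refl] by blast
    fix \<xi> assume "\<xi> \<in> space (R x)"
    then have \<xi>: "\<xi> \<in> skorokhod_space UNIV" by (simp add: R_prob)
    have "bmeas borel (\<lambda>\<tau>. H (\<xi>, \<tau>))" using bmeas_section[of paths borel "\<lambda>\<xi> \<tau>. H (\<xi>, \<tau>)" \<xi>] H \<xi> by simp
    from expo_early[OF c s b this le[OF \<xi>]]
    show "\<bar>\<integral>\<tau>. ?H (\<xi>, \<tau>) \<partial>expo c\<bar> \<le> b * (1 - exp (- c * s))" by simp
  qed
  finally show ?thesis .
qed

sublocale chain: markov_chain_kernels borel "paths \<Otimes>\<^sub>M borel" mark_kernel jump_kernel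
  by unfold_locales measurable

lemma chain_prob: "sets (chain.chain_law x) = sets marks" "space (chain.chain_law x) = space marks"
   "prob_space (chain.chain_law x)" "finite_measure (chain.chain_law x)"
  using measurable_space[OF chain.chain_law_measurable, of x]
  by (auto simp: space_prob_algebra prob_space.finite_measure dest: sets_eq_imp_space_eq)

lemma chain_ring:
  assumes F: "bmeas marks F"
  shows "(\<integral>v. F v \<partial>chain.chain_law x) = (\<integral>p. \<integral>z. \<integral>v. F (case_nat p v) \<partial>chain.chain_law z \<partial>jump_kernel p \<partial>mark_kernel x)"
proof -
  let ?M = "paths \<Otimes>\<^sub>M (borel :: real measure)"
  have m3: "(\<lambda>p. return marks (case_nat (fst p) (snd p))) \<in> (?M \<Otimes>\<^sub>M marks) \<rightarrow>\<^sub>M prob_algebra marks"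
    by (rule measurable_compose[OF _ measurable_return_prob_space]) measurable
  have m2: "(\<lambda>p. chain.chain_law (snd p) \<bind> (\<lambda>v. return marks (case_nat (fst p) v))) \<in> (?M \<Otimes>\<^sub>M borel) \<rightarrow>\<^sub>M prob_algebra marks"
    by (rule measurable_bind_prob_space2[where N="marks"]) measurable
  have m1: "(\<lambda>y. jump_kernel y \<bind> (\<lambda>z. chain.chain_law z \<bind> (\<lambda>v. return marks (case_nat y v)))) \<in> ?M \<rightarrow>\<^sub>M prob_algebra marks"
    by (rule measurable_bind_prob_space2[OF jump_kernel_measurable]) (use m2 in \<open>simp add: split_beta'\<close>)
  have "(\<integral>v. F v \<partial>chain.chain_law x)
      = integral\<^sup>L (mark_kernel x \<bind> (\<lambda>y. jump_kernel y \<bind> (\<lambda>z. chain.chain_law z \<bind> (\<lambda>v. return marks (case_nat y v))))) F"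
    by (subst chain.chain_law_front) simp_all
  also have "\<dots> = (\<integral>p. integral\<^sup>L (jump_kernel p \<bind> (\<lambda>z. chain.chain_law z \<bind> (\<lambda>v. return marks (case_nat p v)))) F \<partial>mark_kernel x)"
    by (rule integral_bind_bmeas[OF F _ mark_kernel_prob(4)]) (use m1 in \<open>simp cong: measurable_cong_sets[OF mark_kernel_prob(1) refl]\<close>)
  also have "\<dots> = (\<integral>p. \<integral>z. \<integral>v. F (case_nat p v) \<partial>chain.chain_law z \<partial>jump_kernel p \<partial>mark_kernel x)"
  proof (rule Bochner_Integration.integral_cong[OF refl])
    fix p assume "p \<in> space (mark_kernel x)"
    then have p: "p \<in> space ?M" by (simp add: mark_kernel_prob space_pair_measure)
    have m2p: "(\<lambda>z. chain.chain_law z \<bind> (\<lambda>v. return marks (case_nat p v))) \<in> borel \<rightarrow>\<^sub>M prob_algebra marks"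
      using measurable_compose[OF measurable_Pair1'[OF p] m2] by simp
    have m3p: "(\<lambda>v. return marks (case_nat p v)) \<in> marks \<rightarrow>\<^sub>M prob_algebra marks"
      using measurable_compose[OF measurable_Pair1'[OF p] m3] by simp
    have j: "sets (jump_kernel p) = sets borel" "finite_measure (jump_kernel p)" unfolding jump_kernel_def by (simp_all add: J_prob)
    have "integral\<^sup>L (jump_kernel p \<bind> (\<lambda>z. chain.chain_law z \<bind> (\<lambda>v. return marks (case_nat p v)))) F
      = (\<integral>z. integral\<^sup>L (chain.chain_law z \<bind> (\<lambda>v. return marks (case_nat p v))) F \<partial>jump_kernel p)"
      by (rule integral_bind_bmeas[OF F _ j(2)]) (use m2p in \<open>simp cong: measurable_cong_sets[OF j(1) refl]\<close>)
    also have "\<dots> = (\<integral>z. \<integral>v. F (case_nat p v) \<partial>chain.chain_law z \<partial>jump_kernel p)"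
    proof (rule Bochner_Integration.integral_cong[OF refl])
      fix z
      have "integral\<^sup>L (chain.chain_law z \<bind> (\<lambda>v. return marks (case_nat p v))) F
        = (\<integral>v. integral\<^sup>L (return marks (case_nat p v)) F \<partial>chain.chain_law z)"
        by (rule integral_bind_bmeas[OF F _ chain_prob(4)]) (use m3p in \<open>simp cong: measurable_cong_sets[OF chain_prob(1) refl]\<close>)
      also have "\<dots> = (\<integral>v. F (case_nat p v) \<partial>chain.chain_law z)"
      proof (rule Bochner_Integration.integral_cong[OF refl])
        fix v assume "v \<in> space (chain.chain_law z)"
        then have "case_nat p v \<in> space marks" using p by (auto simp: chain_prob space_PiM PiE_iff split: nat.split)
        then show "integral\<^sup>L (return marks (case_nat p v)) F = F (case_nat p v)"
          by (rule integral_return) (rule bmeasD[OF F])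
      qed
      finally show "integral\<^sup>L (chain.chain_law z \<bind> (\<lambda>v. return marks (case_nat p v))) F = (\<integral>v. F (case_nat p v) \<partial>chain.chain_law z)" .
    qed
    finally show "integral\<^sup>L (jump_kernel p \<bind> (\<lambda>z. chain.chain_law z \<bind> (\<lambda>v. return marks (case_nat p v)))) F
      = (\<integral>z. \<integral>v. F (case_nat p v) \<partial>chain.chain_law z \<partial>jump_kernel p)" .
  qed
  finally show ?thesis .
qed

lemma bmeas_ring_chain:
  assumes "bmeas marks F"
  shows "bmeas (paths \<Otimes>\<^sub>M borel) (\<lambda>p. \<integral>z. \<integral>v. F (case_nat p v) \<partial>chain.chain_law z \<partial>jump_kernel p)"
proof (rule bmeas_kernel[OF _ jump_kernel_measurable])
  show "bmeas ((paths \<Otimes>\<^sub>M borel) \<Otimes>\<^sub>M borel) (\<lambda>q. \<integral>v. F (case_nat (fst q) v) \<partial>chain.chain_law (snd q))"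
    by (rule bmeas_kernel[where N=marks], rule bmeas_compose[OF assms]) measurable
qed

text \<open>Let \<open>g s z\<close> be the probability that all rings occur by time
  \<open>s\<close>. After a first ring at \<open>\<tau> \<le> s\<close> all later ones must fit into
  \<open>s - \<tau>\<close>, so \<open>g\<close> is bounded by the probability of an early ring
  times its own bound, and \<open>ring_contraction\<close> makes it 0.\<close>

lemma AE_nonexplosive: "AE v in chain.chain_law x. nonexplosive v"
proof -
  define g :: "real \<Rightarrow> 'a \<Rightarrow> real" where "g s z = (\<integral>v. indicator {v \<in> space marks. \<forall>n. ring_time n v \<le> s} v \<partial>chain.chain_law z)" for s z
  have B: "{v \<in> space marks. \<forall>n. ring_time n v \<le> s} \<in> sets (marks :: (nat \<Rightarrow> (real \<Rightarrow> 'a) \<times> real) measure)" for s by measurable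
  have g1: "g s z = measure (chain.chain_law z) {v \<in> space marks. \<forall>n. ring_time n v \<le> s}" for s z
    unfolding g_def using B by (simp add: chain_prob)
  have "g s z \<le> 0" if "0 \<le> s" for s z
  proof (rule ring_contraction[where c=c and Q="\<lambda>_ _. True" and g=g and S=s and B=1])
    show "0 < c" "0 \<le> s" "s \<le> s" True using c that by simp_all
    show "g s z \<le> 1" for s z unfolding g1 by (rule prob_space.prob_le_1[OF chain_prob(3)])
    fix b s' z assume b: "0 \<le> b" "\<And>s'' z. 0 \<le> s'' \<Longrightarrow> s'' \<le> s \<Longrightarrow> True \<Longrightarrow> g s'' z \<le> b" and s': "0 \<le> s'" "s' \<le> s"
    let ?F = "indicator {v \<in> space marks. \<forall>n. ring_time n v \<le> s'} :: (nat \<Rightarrow> (real \<Rightarrow> 'a) \<times> real) \<Rightarrow> real"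
    let ?H = "\<lambda>p. \<integral>z. \<integral>v. ?F (case_nat p v) \<partial>chain.chain_law z \<partial>jump_kernel p"
    have F: "bmeas marks ?F" by (intro bmeas_indicator B)
    have Fc: "?F (case_nat (\<xi>, \<tau>) v) = (if \<tau> \<le> s' then indicator {v \<in> space marks. \<forall>n. ring_time n v \<le> s' - \<tau>} v else 0)"
      if v: "v \<in> space marks" and \<xi>: "\<xi> \<in> skorokhod_space UNIV" and \<tau>: "0 \<le> \<tau>" for \<xi> \<tau> v
    proof -
      have e: "ring_time (Suc n) (case_nat (\<xi>, \<tau>) v) = \<tau> + ring_time n v" for n using \<tau> by (subst ring_time_Suc) simp
      have sp: "case_nat (\<xi>, \<tau>) v \<in> space marks" using v \<xi> by (auto simp: space_PiM PiE_iff space_pair_measure split: nat.split)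
      \<comment> \<open>Ring times increase with \<open>n\<close>, so shifting the index by one
        loses no condition.\<close>
      have "(\<forall>n. ring_time n (case_nat (\<xi>, \<tau>) v) \<le> s') \<longleftrightarrow> (\<forall>n. ring_time (Suc n) (case_nat (\<xi>, \<tau>) v) \<le> s')"
        using ring_time_mono[of _ "Suc _"] by (meson le_SucI order_refl order_trans)
      also have "\<dots> \<longleftrightarrow> (\<forall>n. ring_time n v \<le> s' - \<tau>)" unfolding e by (simp add: le_diff_eq add.commute)
      finally have *: "(\<forall>n. ring_time n (case_nat (\<xi>, \<tau>) v) \<le> s') \<longleftrightarrow> (\<forall>n. ring_time n v \<le> s' - \<tau>)" .
      \<comment> \<open>The empty sum at \<open>n = 0\<close> already forces
        \<open>\<tau> \<le> s'\<close>.\<close>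
      have "\<tau> \<le> s'" if "\<forall>n. ring_time n v \<le> s' - \<tau>"
        using that[rule_format, of 0] by (simp add: ring_time_def)
      then show ?thesis using sp v * by (auto simp: indicator_def)
    qed
    have Hle: "\<bar>?H (\<xi>, \<tau>)\<bar> \<le> (if \<tau> \<le> s' then b else 0)" if \<xi>: "\<xi> \<in> skorokhod_space UNIV" and \<tau>: "0 \<le> \<tau>" for \<xi> \<tau>
    proof -
      have "(\<integral>v. ?F (case_nat (\<xi>, \<tau>) v) \<partial>chain.chain_law z) = (if \<tau> \<le> s' then g (s' - \<tau>) z else 0)" for z
      proof -
        have "(\<integral>v. ?F (case_nat (\<xi>, \<tau>) v) \<partial>chain.chain_law z)
          = (\<integral>v. (if \<tau> \<le> s' then indicator {v \<in> space marks. \<forall>n. ring_time n v \<le> s' - \<tau>} v else 0) \<partial>chain.chain_law z)"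
          by (intro Bochner_Integration.integral_cong refl Fc[OF _ \<xi> \<tau>]) (simp add: chain_prob)
        then show ?thesis unfolding g_def by auto
      qed
      then have "?H (\<xi>, \<tau>) = (\<integral>z. (if \<tau> \<le> s' then g (s' - \<tau>) z else 0) \<partial>jump_kernel (\<xi>, \<tau>))" by simp
      also have "\<bar>\<dots>\<bar> \<le> (if \<tau> \<le> s' then b else 0)"
      proof (rule abs_integral_le_const)
        show "prob_space (jump_kernel (\<xi>, \<tau>))" unfolding jump_kernel_def by (rule J_prob)
        show "\<bar>if \<tau> \<le> s' then g (s' - \<tau>) z else 0\<bar> \<le> (if \<tau> \<le> s' then b else 0)" for z
          using b(2)[of "s' - \<tau>" z] s' \<tau> by (auto simp: g1)
        have "(\<lambda>z. g (s' - \<tau>) z) \<in> borel_measurable borel"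
          unfolding g1 by (rule measurable_compose[OF chain.chain_law_measurable measurable_measure_prob_algebra[OF B]])
        then show "(\<lambda>z. if \<tau> \<le> s' then g (s' - \<tau>) z else 0) \<in> borel_measurable (jump_kernel (\<xi>, \<tau>))"
          unfolding jump_kernel_def by (simp cong: measurable_cong_sets[OF J_prob(1) refl])
      qed
      finally show ?thesis .
    qed
    have bH: "bmeas (paths \<Otimes>\<^sub>M borel) ?H" by (rule bmeas_ring_chain[OF F])
    have "g s' z = (\<integral>p. ?H p \<partial>mark_kernel z)" unfolding g_def by (rule chain_ring[OF F])
    also have "\<dots> = (\<integral>p. (if snd p \<le> s' then ?H p else 0) \<partial>mark_kernel z)"
    proof (rule integral_cong_AE)
      have m: "(\<lambda>p. snd p) \<in> mark_kernel z \<rightarrow>\<^sub>M borel" by (simp cong: measurable_cong_sets[OF mark_kernel_prob(1) refl])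
      show "?H \<in> borel_measurable (mark_kernel z)" "(\<lambda>p. if snd p \<le> s' then ?H p else 0) \<in> borel_measurable (mark_kernel z)"
        using bmeasD[OF bH] bmeasD[OF bmeas_If[OF bH bmeas_const, of "\<lambda>p. snd p \<le> s'" 0]]
        by (simp_all cong: measurable_cong_sets[OF mark_kernel_prob(1) refl])
      show "AE p in mark_kernel z. ?H p = (if snd p \<le> s' then ?H p else 0)"
        using AE_mark_kernel[of z]
      proof eventually_elim
        case (elim p)
        define X where "X = ?H p"
        have "\<bar>?H (fst p, snd p)\<bar> \<le> (if snd p \<le> s' then b else 0)" using elim by (intro Hle) auto
        then have "\<bar>X\<bar> \<le> (if snd p \<le> s' then b else 0)" unfolding X_def by simp
        then have "X = (if snd p \<le> s' then X else 0)" by (auto split: if_splits)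
        then show ?case unfolding X_def .
      qed
    qed
    also have "\<dots> \<le> b * (1 - exp (- c * s'))"
    proof (rule abs_le_D1, rule mark_kernel_early[OF bH s'(1) b(1)])
      fix \<xi> :: "real \<Rightarrow> 'a" and \<tau> :: real assume "\<xi> \<in> skorokhod_space UNIV" "0 \<le> \<tau>" "\<tau> \<le> s'"
      then show "\<bar>?H (\<xi>, \<tau>)\<bar> \<le> b" using Hle[of \<xi> \<tau>] by simp
    qed
    finally show "g s' z \<le> b * (1 - exp (- c * s'))" .
  qed
  note g0 = this
  have "measure (chain.chain_law x) {v \<in> space marks. \<forall>n. ring_time n v \<le> real k} = 0" for k
  proof (rule antisym[OF _ measure_nonneg])
    show "measure (chain.chain_law x) {v \<in> space marks. \<forall>n. ring_time n v \<le> real k} \<le> 0"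
      unfolding g1[symmetric] by (rule g0) simp
  qed
  then have "AE v in chain.chain_law x. v \<notin> {v \<in> space marks. \<forall>n. ring_time n v \<le> real k}" for k
    using B by (intro AE_not_in) (auto simp: null_sets_def chain_prob finite_measure.emeasure_eq_measure[OF chain_prob(4)])
  then have "AE v in chain.chain_law x. \<forall>k. v \<notin> {v \<in> space marks. \<forall>n. ring_time n v \<le> real k}"
    unfolding AE_all_countable by blast
  then show ?thesis
    using AE_space[of "chain.chain_law x"]
  proof eventually_elim
    case (elim v)
    then show ?case unfolding nonexplosive_def by (auto simp: chain_prob not_le)
  qed
qed

definition law :: "'a \<Rightarrow> (real \<Rightarrow> 'a) measure" where
  "law x = distr (chain.chain_law x) paths assemble"

lemma law_measurable [measurable]: "law \<in> borel \<rightarrow>\<^sub>M prob_algebra paths"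
  unfolding law_def by (rule measurable_compose[OF chain.chain_law_measurable measurable_distr_prob_space]) measurable

lemma law_prob: "sets (law x) = sets paths" "space (law x) = skorokhod_space UNIV" "prob_space (law x)" "finite_measure (law x)"
  using measurable_space[OF law_measurable, of x] by (auto simp: space_prob_algebra prob_space.finite_measure dest: sets_eq_imp_space_eq)

lemma integral_law:
  assumes "bmeas paths F" shows "(\<integral>\<omega>. F \<omega> \<partial>law x) = (\<integral>v. F (assemble v) \<partial>chain.chain_law x)"
  unfolding law_def using bmeasD[OF assms] measurable_assemble
  by (subst integral_distr) (simp_all cong: measurable_cong_sets[OF chain_prob(1) refl])

lemma bmeas_ring_law:
  assumes F: "bmeas paths F"
  shows "bmeas (paths \<Otimes>\<^sub>M borel) (\<lambda>p. \<integral>z. \<integral>\<omega>. F (concat_path (fst p) (snd p) \<omega>) \<partial>law z \<partial>jump_kernel p)"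
proof (rule bmeas_kernel[OF _ jump_kernel_measurable])
  show "bmeas ((paths \<Otimes>\<^sub>M borel) \<Otimes>\<^sub>M borel) (\<lambda>q. \<integral>\<omega>. F (concat_path (fst (fst q)) (snd (fst q)) \<omega>) \<partial>law (snd q))"
    by (rule bmeas_kernel[where N=paths], rule bmeas_compose[OF F]) measurable
qed

text \<open>\<open>chain_ring\<close> transported to paths: off the null set of explosive sequences,
  prefixing a mark and then assembling is the same as concatenating with the assembled rest.\<close>

lemma law_ring:
  assumes F: "bmeas paths F"
  shows "(\<integral>\<omega>. F \<omega> \<partial>law x) = (\<integral>p. \<integral>z. \<integral>\<omega>. F (concat_path (fst p) (snd p) \<omega>) \<partial>law z \<partial>jump_kernel p \<partial>mark_kernel x)"
proof -
  have Fa: "bmeas marks (\<lambda>v. F (assemble v))" by (rule bmeas_compose[OF F]) measurable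
  have "(\<integral>\<omega>. F \<omega> \<partial>law x) = (\<integral>p. \<integral>z. \<integral>v. F (assemble (case_nat p v)) \<partial>chain.chain_law z \<partial>jump_kernel p \<partial>mark_kernel x)"
    unfolding integral_law[OF F] by (rule chain_ring[OF Fa])
  also have "\<dots> = (\<integral>p. \<integral>z. \<integral>\<omega>. F (concat_path (fst p) (snd p) \<omega>) \<partial>law z \<partial>jump_kernel p \<partial>mark_kernel x)"
  proof (intro Bochner_Integration.integral_cong refl)
    fix p z assume "p \<in> space (mark_kernel x)"
    then have p: "p \<in> space (paths \<Otimes>\<^sub>M borel)" by (simp add: mark_kernel_prob space_pair_measure)
    have c1: "(\<lambda>\<omega>. concat_path (fst p) (snd p) \<omega>) \<in> paths \<rightarrow>\<^sub>M paths"
      using p by (intro measurable_concat_path) (auto simp: space_pair_measure)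
    have Fc: "bmeas paths (\<lambda>\<omega>. F (concat_path (fst p) (snd p) \<omega>))" by (rule bmeas_compose[OF F c1])
    have c2: "(\<lambda>v. case_nat p v) \<in> marks \<rightarrow>\<^sub>M marks" using p by measurable
    show "(\<integral>v. F (assemble (case_nat p v)) \<partial>chain.chain_law z) = (\<integral>\<omega>. F (concat_path (fst p) (snd p) \<omega>) \<partial>law z)"
      unfolding integral_law[OF Fc]
    proof (rule integral_cong_AE)
      show "(\<lambda>v. F (assemble (case_nat p v))) \<in> borel_measurable (chain.chain_law z)"
        using measurable_compose[OF c2 bmeasD[OF Fa]] by (simp cong: measurable_cong_sets[OF chain_prob(1) refl])
      show "(\<lambda>v. F (concat_path (fst p) (snd p) (assemble v))) \<in> borel_measurable (chain.chain_law z)"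
        using measurable_compose[OF measurable_assemble bmeasD[OF Fc]] by (simp cong: measurable_cong_sets[OF chain_prob(1) refl])
      show "AE v in chain.chain_law z. F (assemble (case_nat p v)) = F (concat_path (fst p) (snd p) (assemble v))"
        using AE_nonexplosive[of z] by eventually_elim (simp add: assemble_Cons[of _ "fst p" "snd p", simplified])
    qed
  qed
  finally show ?thesis .
qed

end

text \<open>The generating sets have the property, and complements and countable unions keep it. It
  is applied to a path that runs along \<open>\<xi>\<close> until after \<open>s\<close>, whose
  membership in an event of the past of \<open>s\<close> is decided by \<open>\<xi>\<close>.\<close>

lemma path_filtration_determined:
  assumes A: "A \<in> sets (path_filtration S s)" and "\<omega> \<in> skorokhod_space S" "\<omega>' \<in> skorokhod_space S"
    and eq: "\<And>u. 0 \<le> u \<Longrightarrow> u \<le> s \<Longrightarrow> \<omega> u = \<omega>' u"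
  shows "\<omega> \<in> A \<longleftrightarrow> \<omega>' \<in> A"
proof -
  have "A \<in> sigma_sets (skorokhod_space S) {{\<omega> \<in> skorokhod_space S. \<omega> u \<in> B} | u B. 0 \<le> u \<and> u \<le> s \<and> B \<in> sets borel}"
    using A by (simp add: sets_path_filtration)
  then show ?thesis
  proof induction
    case (Basic a)
    then show ?case using assms by auto
  next
    case (Compl a)
    then show ?case using assms by auto
  qed auto
qed

text \<open>After a ring at \<open>\<tau> \<le> s\<close>, an event of the past of \<open>s\<close>
  becomes an event of the past of \<open>s - \<tau>\<close> for the continuation, the first piece
  being frozen.\<close>

lemma measurable_concat_path_filtration:
  assumes \<xi>: "\<xi> \<in> skorokhod_space S" and \<tau>: "0 \<le> \<tau>" "\<tau> \<le> s"
  shows "concat_path \<xi> \<tau> \<in> path_filtration S (s - \<tau>) \<rightarrow>\<^sub>M path_filtration S s"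
proof (rule sets_path_filtrationI)
  show "concat_path \<xi> \<tau> \<in> space (path_filtration S (s - \<tau>)) \<rightarrow> skorokhod_space S"
    using \<xi> by (auto intro: concat_path_in_skorokhod_space)
  fix u assume u: "0 \<le> u" "u \<le> s"
  show "(\<lambda>\<omega>. concat_path \<xi> \<tau> \<omega> u) \<in> path_filtration S (s - \<tau>) \<rightarrow>\<^sub>M borel"
    unfolding concat_path_def using u \<tau>
    by (cases "u < \<tau>") (auto simp: max_def intro!: measurable_path_filtration_eval)
qed

lemma bmeas_skorokhod_eval:
  "bmeas borel f \<Longrightarrow> 0 \<le> t \<Longrightarrow> bmeas (skorokhod_borel S) (\<lambda>\<omega>. f (\<omega> t))"
  by (erule bmeas_compose) (rule measurable_skorokhod_eval)

lemma bmeas_snd: "bmeas N f \<Longrightarrow> bmeas (M \<Otimes>\<^sub>M N) (\<lambda>q. f (snd q))"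
  by (erule bmeas_compose) simp

context jump_kernels
begin

text \<open>\<open>P\<close> belongs to the motion without jumps, \<open>T\<close> to the process
  with them. Times are truncated at 0 because paths are \<open>undefined\<close> before 0; this
  makes both total in time and jointly measurable.\<close>

definition P :: "real \<Rightarrow> ('a \<Rightarrow> real) \<Rightarrow> 'a \<Rightarrow> real" where "P u g x = (\<integral>\<xi>. g (\<xi> (max 0 u)) \<partial>R x)"
definition T :: "real \<Rightarrow> ('a \<Rightarrow> real) \<Rightarrow> 'a \<Rightarrow> real" where "T t g x = (\<integral>\<omega>. g (\<omega> (max 0 t)) \<partial>law x)"
definition jump_op :: "('a \<Rightarrow> real) \<Rightarrow> 'a \<Rightarrow> real" where "jump_op g y = (\<integral>z. g z \<partial>J y)"

text \<open>Time, starting point and test function may all depend on the parameter; the last is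
  needed for \<open>after t f \<tau>\<close>, which varies with the ring time.\<close>

lemma bmeas_path_kernel:
  fixes k :: "'a \<Rightarrow> (real \<Rightarrow> 'a) measure" and g :: "'n \<Rightarrow> 'a \<Rightarrow> real"
  assumes k: "k \<in> borel \<rightarrow>\<^sub>M prob_algebra paths" and u[measurable]: "u \<in> borel_measurable N" and x[measurable]: "x \<in> N \<rightarrow>\<^sub>M borel"
    and g: "bmeas (N \<Otimes>\<^sub>M borel) (\<lambda>q. g (fst q) (snd q))"
  shows "bmeas N (\<lambda>n. \<integral>\<xi>. g n (\<xi> (max 0 (u n))) \<partial>k (x n))"
proof (rule bmeas_kernel[OF _ measurable_compose[OF x k]])
  have "(\<lambda>q. (fst q, snd q (max 0 (u (fst q))))) \<in> N \<Otimes>\<^sub>M paths \<rightarrow>\<^sub>M N \<Otimes>\<^sub>M (borel :: 'a measure)"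
    by (intro measurable_Pair measurable_fst measurable_skorokhod_apply[OF _ measurable_snd]) auto
  from bmeas_compose[OF g this] show "bmeas (N \<Otimes>\<^sub>M paths) (\<lambda>q. g (fst q) (snd q (max 0 (u (fst q)))))" by simp
qed

lemma bmeas_P:
  assumes "u \<in> borel_measurable N" "x \<in> N \<rightarrow>\<^sub>M borel" "bmeas (N \<Otimes>\<^sub>M borel) (\<lambda>q. g (fst q) (snd q))"
  shows "bmeas N (\<lambda>n. P (u n) (g n) (x n))"
  unfolding P_def by (rule bmeas_path_kernel[OF R assms])

lemma bmeas_T:
  assumes "u \<in> borel_measurable N" "x \<in> N \<rightarrow>\<^sub>M borel" "bmeas (N \<Otimes>\<^sub>M borel) (\<lambda>q. g (fst q) (snd q))"
  shows "bmeas N (\<lambda>n. T (u n) (g n) (x n))"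
  unfolding T_def by (rule bmeas_path_kernel[OF law_measurable assms])

lemma bmeas_jump_op:
  assumes "x \<in> N \<rightarrow>\<^sub>M borel" "bmeas (N \<Otimes>\<^sub>M borel) (\<lambda>q. g (fst q) (snd q))"
  shows "bmeas N (\<lambda>n. jump_op (g n) (x n))"
  unfolding jump_op_def by (rule bmeas_kernel[OF assms(2) measurable_compose[OF assms(1) J]])

lemma bmeas_P1: "bmeas borel f \<Longrightarrow> bmeas borel (P t f)"
  by (rule bmeas_P[of "\<lambda>_. t" borel "\<lambda>x. x" "\<lambda>_. f"]) (auto intro: bmeas_snd)

lemma bmeas_T1: "bmeas borel f \<Longrightarrow> bmeas borel (T t f)"
  by (rule bmeas_T[of "\<lambda>_. t" borel "\<lambda>x. x" "\<lambda>_. f"]) (auto intro: bmeas_snd)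

lemma bmeas_jump_op1: "bmeas borel f \<Longrightarrow> bmeas borel (jump_op f)"
  by (rule bmeas_jump_op[of "\<lambda>x. x" borel "\<lambda>_. f"]) (auto intro: bmeas_snd)

text \<open>Expected value of \<open>f\<close> at time \<open>t\<close>, seen from the position
  \<open>y\<close> at time \<open>min t \<tau>\<close> when the first ring is at
  \<open>\<tau>\<close>: without a ring by \<open>t\<close> this is \<open>f y\<close>, otherwise a
  jump and a fresh start with time \<open>t - \<tau>\<close> left.\<close>

definition after :: "real \<Rightarrow> ('a \<Rightarrow> real) \<Rightarrow> real \<Rightarrow> 'a \<Rightarrow> real" where
  "after t f \<tau> y = (if t < \<tau> then f y else jump_op (T (t - \<tau>) f) y)"

lemma bmeas_after:
  assumes f: "bmeas borel f" shows "bmeas (borel \<Otimes>\<^sub>M borel) (\<lambda>q. after t f (fst q) (snd q))"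
  unfolding after_def
proof (rule bmeas_If[OF bmeas_snd[OF f]])
  have "bmeas ((borel \<Otimes>\<^sub>M borel) \<Otimes>\<^sub>M borel) (\<lambda>r. T (t - fst (fst r)) f (snd r))"
    by (rule bmeas_T[of "\<lambda>r. t - fst (fst r)" _ snd "\<lambda>_. f"]) (auto intro: bmeas_snd[OF f])
  then show "bmeas (borel \<Otimes>\<^sub>M borel) (\<lambda>q. jump_op (T (t - fst q) f) (snd q))"
    by (rule bmeas_jump_op[of snd _ "\<lambda>q. T (t - fst q) f", rotated]) simp
qed measurable

text \<open>The free path is stopped at \<open>min t \<tau>\<close>, which puts the two cases, ring
  before or after \<open>t\<close>, into one formula and leaves path and clock as separate
  integrals.\<close>

lemma T_ring:
  assumes f: "bmeas borel f" and t: "0 \<le> t"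
  shows "T t f x = (\<integral>\<tau>. P (min t \<tau>) (after t f \<tau>) x \<partial>expo c)"
proof -
  let ?F = "\<lambda>\<omega>. f (\<omega> (max 0 t))"
  let ?h = "\<lambda>p. after t f (snd p) (fst p (max 0 (min t (snd p))))"
  have F: "bmeas paths ?F" by (rule bmeas_skorokhod_eval[OF f]) simp
  have "(\<lambda>p. (snd p, fst p (max 0 (min t (snd p))))) \<in> paths \<Otimes>\<^sub>M borel \<rightarrow>\<^sub>M borel \<Otimes>\<^sub>M (borel :: 'a measure)"
    by (intro measurable_Pair measurable_snd measurable_skorokhod_apply[OF _ measurable_fst]) auto
  from bmeas_compose[OF bmeas_after[OF f] this] have h: "bmeas (paths \<Otimes>\<^sub>M borel) ?h" by simp
  have "T t f x = (\<integral>p. \<integral>z. \<integral>\<omega>. ?F (concat_path (fst p) (snd p) \<omega>) \<partial>law z \<partial>jump_kernel p \<partial>mark_kernel x)"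
    unfolding T_def by (rule law_ring[OF F])
  also have "\<dots> = (\<integral>p. ?h p \<partial>mark_kernel x)"
  proof (rule integral_cong_AE)
    show "(\<lambda>p. \<integral>z. \<integral>\<omega>. ?F (concat_path (fst p) (snd p) \<omega>) \<partial>law z \<partial>jump_kernel p) \<in> borel_measurable (mark_kernel x)"
      "?h \<in> borel_measurable (mark_kernel x)"
      using bmeasD[OF bmeas_ring_law[OF F]] bmeasD[OF h]
      by (simp_all cong: measurable_cong_sets[OF mark_kernel_prob(1) refl])
    show "AE p in mark_kernel x. (\<integral>z. \<integral>\<omega>. ?F (concat_path (fst p) (snd p) \<omega>) \<partial>law z \<partial>jump_kernel p) = ?h p"
      using AE_mark_kernel
    proof eventually_elim
      case (elim p)
      show ?case
      proof (cases "t < snd p")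
        case True
        have "(\<integral>z. \<integral>\<omega>. ?F (concat_path (fst p) (snd p) \<omega>) \<partial>law z \<partial>jump_kernel p)
          = (\<integral>z. \<integral>\<omega>. f (fst p t) \<partial>law z \<partial>jump_kernel p)" using True t elim by (simp add: concat_path_def)
        also have "\<dots> = f (fst p t)"
          using prob_space.prob_space[OF law_prob(3)] prob_space.prob_space[OF J_prob(3)] by (simp add: jump_kernel_def)
        finally show ?thesis using True t elim by (simp add: after_def)
      next
        case False
        have "(\<integral>z. \<integral>\<omega>. ?F (concat_path (fst p) (snd p) \<omega>) \<partial>law z \<partial>jump_kernel p)
          = (\<integral>z. T (t - snd p) f z \<partial>jump_kernel p)" using False t elim by (simp add: concat_path_def T_def)
        also have "\<dots> = ?h p" using False elim by (simp add: after_def jump_kernel_def jump_op_def min_absorb2)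
        finally show ?thesis .
      qed
    qed
  qed
  also have "\<dots> = (\<integral>\<tau>. P (min t \<tau>) (after t f \<tau>) x \<partial>expo c)"
    unfolding integral_mark_kernel'[OF h] P_def by simp
  finally show ?thesis .
qed

lemma T_bound:
  assumes "bmeas borel f" "\<And>x. \<bar>f x\<bar> \<le> B" shows "\<bar>T t f x\<bar> \<le> B"
  unfolding T_def using bmeas_skorokhod_eval[OF assms(1), of "max 0 t" UNIV] assms(2)
  by (intro abs_integral_le_const[OF law_prob(3)]) (auto dest: bmeasD simp: measurable_cong_sets[OF law_prob(1) refl])

text \<open>\<open>D\<close> is the defect in the Markov identity. If the first ring comes after
  \<open>s\<close>, it vanishes on average: the clock has no memory, the free motion is Markov, and
  \<open>T_ring\<close> closes the identity. If the ring comes at \<open>\<tau> \<le> s\<close>,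
  what is left is the defect of the restarted process at \<open>s - \<tau>\<close>. So
  \<open>ring_contraction\<close> applies.\<close>

lemma law_markov:
  assumes A: "A \<in> sets (path_filtration UNIV s)" and s: "0 \<le> s" and t: "0 \<le> t" and f: "bmeas borel f"
  shows "(\<integral>\<omega>. indicator A \<omega> * f (\<omega> (s + t)) \<partial>law x) = (\<integral>\<omega>. indicator A \<omega> * T t f (\<omega> s) \<partial>law x)"
proof -
  define F where "F s A \<omega> = indicator A \<omega> * (f (\<omega> (s + t)) - T t f (\<omega> s))" for s A and \<omega> :: "real \<Rightarrow> 'a"
  define D where "D s A x = (\<integral>\<omega>. F s A \<omega> \<partial>law x)" for s A x
  have Am: "A \<in> sets paths" if "A \<in> sets (path_filtration UNIV s)" for A and s
    using that path_filtration_subset by blast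
  have F: "bmeas paths (F s A)" if "A \<in> sets (path_filtration UNIV s)" "0 \<le> s" for s A
    unfolding F_def using Am[OF that(1)] that t
    by (intro bmeas_mult bmeas_indicator bmeas_diff bmeas_skorokhod_eval f bmeas_T1) auto
  obtain B where B: "0 \<le> B" "\<And>x. \<bar>f x\<bar> \<le> B" using bmeasE[OF f] by auto
  \<comment> \<open>The event changes along with the start when the process is restarted, so both
    are varied together, and the admissible events depend on the time.\<close>
  have "\<bar>D s (fst (A, x)) (snd (A, x))\<bar> \<le> 0"
  proof (rule ring_contraction[where c=c and Q="\<lambda>s y. fst y \<in> sets (path_filtration UNIV s)" and S=s and B="2 * B"
        and g="\<lambda>s y. \<bar>D s (fst y) (snd y)\<bar>"])
    show "0 < c" "0 \<le> s" "s \<le> s" "fst (A, x) \<in> sets (path_filtration UNIV s)" using c s A by simp_all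
    fix s and y :: "(real \<Rightarrow> 'a) set \<times> 'a" assume s: "0 \<le> s" and y: "fst y \<in> sets (path_filtration UNIV s)"
    show "\<bar>D s (fst y) (snd y)\<bar> \<le> 2 * B"
      unfolding D_def
    proof (rule abs_integral_le_const[OF law_prob(3)])
      show "F s (fst y) \<in> borel_measurable (law (snd y))"
        using bmeasD[OF F[OF y s]] by (simp cong: measurable_cong_sets[OF law_prob(1) refl])
      fix \<omega>
      have "\<bar>f (\<omega> (s + t)) - T t f (\<omega> s)\<bar> \<le> 2 * B"
        using B(2)[of "\<omega> (s + t)"] T_bound[OF f B(2), of t "\<omega> s"] by linarith
      then show "\<bar>F s (fst y) \<omega>\<bar> \<le> 2 * B" using B(1) unfolding F_def by (auto simp: indicator_def)
    qed
  next
    fix b s' and y :: "(real \<Rightarrow> 'a) set \<times> 'a"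
    assume b: "0 \<le> b" "\<And>s' y. 0 \<le> s' \<Longrightarrow> s' \<le> s \<Longrightarrow> fst y \<in> sets (path_filtration UNIV s') \<Longrightarrow> \<bar>D s' (fst y) (snd y)\<bar> \<le> b"
      and s': "0 \<le> s'" "s' \<le> s" and y: "fst y \<in> sets (path_filtration UNIV s')"
    obtain A x where Ax: "y = (A, x)" by (cases y)
    have A: "A \<in> sets (path_filtration UNIV s')" using y Ax by simp
    note FA = F[OF A s'(1)]
    have iA: "bmeas paths (indicator A)" by (rule bmeas_indicator[OF Am[OF A]])
    define H where "H p = (\<integral>z. \<integral>\<omega>. F s' A (concat_path (fst p) (snd p) \<omega>) \<partial>law z \<partial>jump_kernel p)" for p
    have bH: "bmeas (paths \<Otimes>\<^sub>M borel) H" unfolding H_def by (rule bmeas_ring_law[OF FA])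
    let ?H1 = "\<lambda>p. if snd p \<le> s' then H p else 0"
    \<comment> \<open>\<open>K \<xi> \<tau>\<close> is the contribution when the first ring comes at
      time \<open>s' + \<tau>\<close>; given that the ring is later than \<open>s'\<close>, this
      \<open>\<tau>\<close> is again exponential.\<close>
    define K where "K \<xi> \<tau> = indicator A \<xi> * (after t f \<tau> (\<xi> (max 0 (s' + min t \<tau>))) - T t f (\<xi> s'))" for \<xi> \<tau>
    let ?K1 = "\<lambda>p. if s' < snd p then K (fst p) (snd p - s') else 0"
    have aft: "bmeas (paths \<Otimes>\<^sub>M borel) (\<lambda>q. after t f (snd q) (fst q (max 0 (s' + min t (snd q)))))"
    proof -
      have "(\<lambda>q. (snd q, fst q (max 0 (s' + min t (snd q))))) \<in> paths \<Otimes>\<^sub>M borel \<rightarrow>\<^sub>M borel \<Otimes>\<^sub>M (borel :: 'a measure)"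
        by (intro measurable_Pair measurable_snd measurable_skorokhod_apply[OF _ measurable_fst]) auto
      from bmeas_compose[OF bmeas_after[OF f] this] show ?thesis by simp
    qed
    have iA2: "bmeas (paths \<Otimes>\<^sub>M borel) (\<lambda>q. indicator A (fst q))" by (rule bmeas_compose[OF iA]) simp
    have Ts: "bmeas paths (\<lambda>\<xi>. T t f (\<xi> s'))" by (intro bmeas_skorokhod_eval bmeas_T1 f s')
    have Ts2: "bmeas (paths \<Otimes>\<^sub>M borel) (\<lambda>q. T t f (fst q s'))" by (rule bmeas_compose[OF Ts]) simp
    have bK: "bmeas (paths \<Otimes>\<^sub>M borel) (\<lambda>q. K (fst q) (snd q))"
      unfolding K_def by (intro bmeas_mult bmeas_diff iA2 aft Ts2)
    have bK': "bmeas (paths \<Otimes>\<^sub>M borel) (\<lambda>q. K (fst q) (snd q - s'))"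
    proof -
      have "(\<lambda>q. (fst q, snd q - s')) \<in> paths \<Otimes>\<^sub>M borel \<rightarrow>\<^sub>M paths \<Otimes>\<^sub>M borel" by measurable
      from bmeas_compose[OF bK this] show ?thesis by simp
    qed
    have bH1: "bmeas (paths \<Otimes>\<^sub>M borel) ?H1" using bH by (intro bmeas_If) auto
    have bK1: "bmeas (paths \<Otimes>\<^sub>M borel) ?K1" using bK' by (intro bmeas_If) auto
    have cK: "bmeas borel (\<lambda>\<tau>. K \<xi> \<tau>)" if "\<xi> \<in> skorokhod_space UNIV" for \<xi>
      using bmeas_section[of paths borel K \<xi>] bK that by simp
    have "D s' A x = (\<integral>p. H p \<partial>mark_kernel x)"
      unfolding D_def H_def by (rule law_ring[OF FA])
    also have "\<dots> = (\<integral>p. ?H1 p + ?K1 p \<partial>mark_kernel x)"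
    proof (rule integral_cong_AE)
      show "H \<in> borel_measurable (mark_kernel x)" "(\<lambda>p. ?H1 p + ?K1 p) \<in> borel_measurable (mark_kernel x)"
        unfolding measurable_cong_sets[OF mark_kernel_prob(1) refl]
        by (rule bmeasD[OF bH], rule bmeasD[OF bmeas_add[OF bH1 bK1]])
      show "AE p in mark_kernel x. H p = ?H1 p + ?K1 p"
        using AE_mark_kernel
      proof eventually_elim
        case (elim p)
        obtain \<xi> \<tau> where p: "p = (\<xi>, \<tau>)" by (cases p)
        show ?case
        proof (cases "\<tau> \<le> s'")
          case False
          have cA: "concat_path \<xi> \<tau> \<omega> \<in> A \<longleftrightarrow> \<xi> \<in> A" if "\<omega> \<in> skorokhod_space UNIV" for \<omega>
            by (rule path_filtration_determined[OF A]) (use elim p that False in \<open>auto intro!: concat_path_in_skorokhod_space simp: concat_path_def\<close>)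
          have "H p = (\<integral>z. \<integral>\<omega>. indicator A \<xi> * (f (concat_path \<xi> \<tau> \<omega> (s' + t)) - T t f (\<xi> s')) \<partial>law z \<partial>jump_kernel p)"
            unfolding H_def F_def p using cA False s'
            by (intro Bochner_Integration.integral_cong refl) (simp add: indicator_def law_prob, simp add: concat_path_def)
          also have "\<dots> = K \<xi> (\<tau> - s')"
          proof (cases "s' + t < \<tau>")
            case True
            have "(\<integral>z. \<integral>\<omega>. indicator A \<xi> * (f (concat_path \<xi> \<tau> \<omega> (s' + t)) - T t f (\<xi> s')) \<partial>law z \<partial>jump_kernel p)
              = (\<integral>z. \<integral>\<omega>. indicator A \<xi> * (f (\<xi> (s' + t)) - T t f (\<xi> s')) \<partial>law z \<partial>jump_kernel p)"
            proof -
              have "concat_path \<xi> \<tau> \<omega> (s' + t) = \<xi> (s' + t)" for \<omega> using True by (simp add: concat_path_def less_max_iff_disj)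
              then show ?thesis by simp
            qed
            also have "\<dots> = indicator A \<xi> * (f (\<xi> (s' + t)) - T t f (\<xi> s'))"
              using prob_space.prob_space[OF law_prob(3)] prob_space.prob_space[OF J_prob(3)] by (simp add: jump_kernel_def)
            also have "\<dots> = K \<xi> (\<tau> - s')" unfolding K_def after_def using True s' t by (simp add: min_absorb1)
            finally show ?thesis .
          next
            case False2: False
            have "(\<integral>\<omega>. indicator A \<xi> * (f (concat_path \<xi> \<tau> \<omega> (s' + t)) - T t f (\<xi> s')) \<partial>law z)
               = indicator A \<xi> * (T (s' + t - \<tau>) f z - T t f (\<xi> s'))" for z
            proof -
              have i: "integrable (law z) (\<lambda>\<omega>. f (\<omega> (s' + t - \<tau>)))"
                using bmeas_skorokhod_eval[OF f, of "s' + t - \<tau>" UNIV] False2 bmeas_sets_cong[OF law_prob(1)]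
                by (intro bmeas_integrable[OF law_prob(4)]) simp
              have "(\<integral>\<omega>. indicator A \<xi> * (f (concat_path \<xi> \<tau> \<omega> (s' + t)) - T t f (\<xi> s')) \<partial>law z)
                = (\<integral>\<omega>. indicator A \<xi> * (f (\<omega> (s' + t - \<tau>)) - T t f (\<xi> s')) \<partial>law z)"
                using False False2 s' by (simp add: concat_path_def max_def)
              also have "\<dots> = indicator A \<xi> * (T (s' + t - \<tau>) f z - T t f (\<xi> s'))"
                using i False2 prob_space.prob_space[OF law_prob(3)] integrable_const
                by (simp add: T_def finite_measure.integrable_const[OF law_prob(4)])
              finally show ?thesis .
            qed
            note inner = this
            have "(\<integral>z. \<integral>\<omega>. indicator A \<xi> * (f (concat_path \<xi> \<tau> \<omega> (s' + t)) - T t f (\<xi> s')) \<partial>law z \<partial>jump_kernel p)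
              = (\<integral>z. indicator A \<xi> * (T (s' + t - \<tau>) f z - T t f (\<xi> s')) \<partial>J (\<xi> \<tau>))"
            proof -
              have "jump_kernel p = J (\<xi> \<tau>)" using elim by (simp add: jump_kernel_def p)
              then show ?thesis using inner by (simp only:)
            qed
            also have "\<dots> = indicator A \<xi> * (jump_op (T (s' + t - \<tau>) f) (\<xi> \<tau>) - T t f (\<xi> s'))"
            proof -
              have "integrable (J (\<xi> \<tau>)) (T (s' + t - \<tau>) f)"
                using bmeas_T1[OF f] bmeas_sets_cong[OF J_prob(1)] by (intro bmeas_integrable[OF J_prob(4)]) simp
              then show ?thesis
                using prob_space.prob_space[OF J_prob(3)]
                by (simp add: jump_op_def finite_measure.integrable_const[OF J_prob(4)])
            qed
            also have "\<dots> = K \<xi> (\<tau> - s')"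
              unfolding K_def after_def using False False2 s' t elim p by (simp add: min_absorb2 algebra_simps)
            finally show ?thesis .
          qed
          finally show ?thesis using False by (simp add: p)
        qed (simp add: p)
      qed
    qed
    also have "\<dots> = (\<integral>p. ?H1 p \<partial>mark_kernel x) + (\<integral>p. ?K1 p \<partial>mark_kernel x)"
      using bH1 bK1 bmeas_sets_cong[OF mark_kernel_prob(1)]
      by (intro Bochner_Integration.integral_add bmeas_integrable[OF mark_kernel_prob(4)]) simp_all
    \<comment> \<open>Late rings contribute nothing: an exponential factor comes out by lack of
      memory, \<open>R_markov\<close> replaces the path after \<open>s'\<close> by a fresh one
      started at \<open>\<xi> s'\<close>, and \<open>T_ring\<close> identifies the result with the
      subtracted term.\<close>
    also have "(\<integral>p. ?K1 p \<partial>mark_kernel x) = 0"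
    proof -
      have bmR: "bmeas (R x) h \<longleftrightarrow> bmeas paths h" for h by (rule bmeas_sets_cong[OF R_prob(1)])
      have bmE: "bmeas (expo c) h \<longleftrightarrow> bmeas borel h" for h by (rule bmeas_sets_cong[OF sets_expo])
      have bmRE: "bmeas (R x \<Otimes>\<^sub>M expo c) h \<longleftrightarrow> bmeas (paths \<Otimes>\<^sub>M borel) h" for h
        by (rule bmeas_sets_cong[OF sets_pair_measure_cong[OF R_prob(1) sets_expo]])
      let ?a = "\<lambda>\<xi> \<tau>. indicator A \<xi> * after t f \<tau> (\<xi> (max 0 (s' + min t \<tau>)))"
      let ?b = "\<lambda>\<xi> \<tau>. indicator A \<xi> * P (min t \<tau>) (after t f \<tau>) (\<xi> s')"
      have ba: "bmeas (paths \<Otimes>\<^sub>M borel) (\<lambda>q. ?a (fst q) (snd q))" by (intro bmeas_mult iA2 aft)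
      have Pa: "bmeas (paths \<Otimes>\<^sub>M borel) (\<lambda>q. P (min t (snd q)) (after t f (snd q)) (fst q s'))"
      proof (rule bmeas_P)
        show "(\<lambda>q. fst q s') \<in> paths \<Otimes>\<^sub>M borel \<rightarrow>\<^sub>M borel"
          by (rule measurable_compose[OF measurable_fst measurable_skorokhod_eval[OF s'(1)]])
        have "(\<lambda>r. (snd (fst r), snd r)) \<in> (paths \<Otimes>\<^sub>M borel) \<Otimes>\<^sub>M borel \<rightarrow>\<^sub>M borel \<Otimes>\<^sub>M (borel :: 'a measure)" by measurable
        from bmeas_compose[OF bmeas_after[OF f] this]
        show "bmeas ((paths \<Otimes>\<^sub>M borel) \<Otimes>\<^sub>M borel) (\<lambda>q. after t f (snd (fst q)) (snd q))" by simp
      qed measurable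
      have bb: "bmeas (paths \<Otimes>\<^sub>M borel) (\<lambda>q. ?b (fst q) (snd q))" by (intro bmeas_mult iA2 Pa)
      have sec: "bmeas borel (h \<xi>)" if "bmeas (paths \<Otimes>\<^sub>M borel) (\<lambda>q. h (fst q) (snd q))" "\<xi> \<in> skorokhod_space UNIV" for h :: "(real \<Rightarrow> 'a) \<Rightarrow> real \<Rightarrow> real" and \<xi>
        using bmeas_section[of paths borel h \<xi>] that by simp
      have ker: "bmeas paths (\<lambda>\<xi>. \<integral>\<tau>. h \<xi> \<tau> \<partial>expo c)" if "bmeas (paths \<Otimes>\<^sub>M borel) (\<lambda>q. h (fst q) (snd q))" for h :: "(real \<Rightarrow> 'a) \<Rightarrow> real \<Rightarrow> real"
        by (rule bmeas_kernel[OF that]) (simp add: expo_in_prob_algebra)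
      have "(\<integral>p. ?K1 p \<partial>mark_kernel x) = (\<integral>\<xi>. \<integral>\<tau>. (if s' < \<tau> then K \<xi> (\<tau> - s') else 0) \<partial>expo c \<partial>R x)"
        by (subst integral_mark_kernel[OF bK1]) (simp cong: if_cong)
      also have "\<dots> = (\<integral>\<xi>. exp (- c * s') * (\<integral>\<tau>. K \<xi> \<tau> \<partial>expo c) \<partial>R x)"
      proof (rule Bochner_Integration.integral_cong[OF refl])
        fix \<xi> assume "\<xi> \<in> space (R x)"
        then have "\<xi> \<in> skorokhod_space UNIV" by (simp add: R_prob)
        then have "bmeas borel (\<lambda>\<tau>. K \<xi> (\<tau> - s'))" by (intro bmeas_compose[OF cK]) auto
        from expo_memoryless[OF c s'(1) this]
        show "(\<integral>\<tau>. (if s' < \<tau> then K \<xi> (\<tau> - s') else 0) \<partial>expo c) = exp (- c * s') * (\<integral>\<tau>. K \<xi> \<tau> \<partial>expo c)" by simp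
      qed
      also have "\<dots> = exp (- c * s') * (\<integral>\<xi>. \<integral>\<tau>. K \<xi> \<tau> \<partial>expo c \<partial>R x)" by simp
      also have "(\<integral>\<xi>. \<integral>\<tau>. K \<xi> \<tau> \<partial>expo c \<partial>R x) = (\<integral>\<xi>. (\<integral>\<tau>. ?a \<xi> \<tau> \<partial>expo c) - indicator A \<xi> * T t f (\<xi> s') \<partial>R x)"
      proof (rule Bochner_Integration.integral_cong[OF refl])
        fix \<xi> assume "\<xi> \<in> space (R x)"
        then have \<xi>: "\<xi> \<in> skorokhod_space UNIV" by (simp add: R_prob)
        have "integrable (expo c) (?a \<xi>)"
          using sec[OF ba \<xi>] bmE by (intro bmeas_integrable[OF finite_measure_expo[OF c]]) simp
        then show "(\<integral>\<tau>. K \<xi> \<tau> \<partial>expo c) = (\<integral>\<tau>. ?a \<xi> \<tau> \<partial>expo c) - indicator A \<xi> * T t f (\<xi> s')"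
          using prob_space.prob_space[OF prob_space_expo[OF c]]
          by (simp add: K_def right_diff_distrib finite_measure.integrable_const[OF finite_measure_expo[OF c]])
      qed
      also have "\<dots> = (\<integral>\<xi>. \<integral>\<tau>. ?a \<xi> \<tau> \<partial>expo c \<partial>R x) - (\<integral>\<xi>. indicator A \<xi> * T t f (\<xi> s') \<partial>R x)"
        using ker[OF ba] bmeas_mult[OF iA Ts] bmR
        by (intro Bochner_Integration.integral_diff bmeas_integrable[OF R_prob(4)]) simp_all
      also have "(\<integral>\<xi>. \<integral>\<tau>. ?a \<xi> \<tau> \<partial>expo c \<partial>R x) = (\<integral>\<tau>. \<integral>\<xi>. ?a \<xi> \<tau> \<partial>R x \<partial>expo c)"
        using ba bmRE by (intro bmeas_swap R_prob finite_measure_expo c) simp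
      also have "\<dots> = (\<integral>\<tau>. \<integral>\<xi>. ?b \<xi> \<tau> \<partial>R x \<partial>expo c)"
      proof (rule integral_cong_AE)
        have sw: "bmeas borel (\<lambda>\<tau>. \<integral>\<xi>. h \<xi> \<tau> \<partial>R x)" if "bmeas (paths \<Otimes>\<^sub>M borel) (\<lambda>q. h (fst q) (snd q))" for h :: "(real \<Rightarrow> 'a) \<Rightarrow> real \<Rightarrow> real"
        proof (rule bmeas_kernel[where N=paths and L="\<lambda>_. R x"])
          show "bmeas (borel \<Otimes>\<^sub>M paths) (\<lambda>p. h (snd p) (fst p))"
            using bmeas_compose[OF that, of "\<lambda>p. (snd p, fst p)" "borel \<Otimes>\<^sub>M paths"] by simp
          show "(\<lambda>_. R x) \<in> borel \<rightarrow>\<^sub>M prob_algebra paths" by (intro measurable_const measurable_space[OF R]) simp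
        qed
        show "(\<lambda>\<tau>. \<integral>\<xi>. ?a \<xi> \<tau> \<partial>R x) \<in> borel_measurable (expo c)" "(\<lambda>\<tau>. \<integral>\<xi>. ?b \<xi> \<tau> \<partial>R x) \<in> borel_measurable (expo c)"
          using bmeasD[OF sw[OF ba]] bmeasD[OF sw[OF bb]] by (simp_all cong: measurable_cong_sets)
        show "AE \<tau> in expo c. (\<integral>\<xi>. ?a \<xi> \<tau> \<partial>R x) = (\<integral>\<xi>. ?b \<xi> \<tau> \<partial>R x)"
          using AE_expo[OF c]
        proof eventually_elim
          case (elim \<tau>)
          have "bmeas borel (after t f \<tau>)" using bmeas_section[OF bmeas_after[OF f], of \<tau>] by simp
          from R_markov[OF s'(1) _ A this, of "min t \<tau>" x] show ?case
            using elim t s' unfolding P_def by simp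
        qed
      qed
      also have "\<dots> = (\<integral>\<xi>. \<integral>\<tau>. ?b \<xi> \<tau> \<partial>expo c \<partial>R x)"
        using bb bmRE by (intro bmeas_swap[symmetric] R_prob finite_measure_expo c) simp
      also have "\<dots> = (\<integral>\<xi>. indicator A \<xi> * T t f (\<xi> s') \<partial>R x)"
        by (simp add: T_ring[OF f t])
      finally show ?thesis by simp
    qed
    finally have "D s' A x = (\<integral>p. ?H1 p \<partial>mark_kernel x)" by simp
    also have "\<bar>\<dots>\<bar> \<le> b * (1 - exp (- c * s'))"
    proof (rule mark_kernel_early[OF bH s'(1) b(1)])
      fix \<xi> :: "real \<Rightarrow> 'a" and \<tau> assume \<xi>: "\<xi> \<in> skorokhod_space UNIV" and \<tau>: "0 \<le> \<tau>" "\<tau> \<le> s'"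
      \<comment> \<open>Early ring: with the first piece and \<open>\<tau>\<close> fixed, the
        condition on the continuation is an event of its past of \<open>s' - \<tau>\<close>, so the
        assumed bound \<open>b\<close> covers it.\<close>
      define A' where "A' = {\<omega> \<in> skorokhod_space UNIV. concat_path \<xi> \<tau> \<omega> \<in> A}"
      have A': "A' \<in> sets (path_filtration UNIV (s' - \<tau>))"
        using measurable_sets[OF measurable_concat_path_filtration[OF \<xi> \<tau>] A]
        unfolding A'_def by (simp add: vimage_def Int_def conj_commute)
      have "(\<integral>\<omega>. F s' A (concat_path \<xi> \<tau> \<omega>) \<partial>law z) = D (s' - \<tau>) A' z" for z
        unfolding D_def
      proof (rule Bochner_Integration.integral_cong[OF refl])
        fix \<omega> assume "\<omega> \<in> space (law z)"
        then show "F s' A (concat_path \<xi> \<tau> \<omega>) = F (s' - \<tau>) A' \<omega>"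
          using \<tau> t unfolding F_def A'_def by (auto simp: law_prob indicator_def concat_path_def max_def algebra_simps)
      qed
      then have "H (\<xi>, \<tau>) = (\<integral>z. D (s' - \<tau>) A' z \<partial>J (\<xi> \<tau>))" unfolding H_def jump_kernel_def using \<tau> by simp
      also have "\<bar>\<dots>\<bar> \<le> b"
      proof (rule abs_integral_le_const[OF J_prob(3)])
        show "\<bar>D (s' - \<tau>) A' z\<bar> \<le> b" for z using b(2)[of "s' - \<tau>" "(A', z)"] A' \<tau> s' by simp
        have "bmeas borel (\<lambda>z. D (s' - \<tau>) A' z)"
          unfolding D_def by (rule bmeas_kernel[OF _ law_measurable], rule bmeas_snd, rule F[OF A']) (use \<tau> in simp)
        then show "D (s' - \<tau>) A' \<in> borel_measurable (J (\<xi> \<tau>))"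
          by (simp cong: measurable_cong_sets[OF J_prob(1) refl] add: bmeasD)
      qed
      finally show "\<bar>H (\<xi>, \<tau>)\<bar> \<le> b" .
    qed
    finally show "\<bar>D s' (fst y) (snd y)\<bar> \<le> b * (1 - exp (- c * s'))" by (simp add: Ax)
  qed
  then have "D s A x = 0" by simp
  moreover have "D s A x = (\<integral>\<omega>. indicator A \<omega> * f (\<omega> (s + t)) \<partial>law x) - (\<integral>\<omega>. indicator A \<omega> * T t f (\<omega> s) \<partial>law x)"
    unfolding D_def F_def right_diff_distrib
    using Am[OF A] s t bmeas_sets_cong[OF law_prob(1)]
    by (intro Bochner_Integration.integral_diff bmeas_integrable[OF law_prob(4)])
      (auto intro!: bmeas_mult bmeas_indicator bmeas_skorokhod_eval f bmeas_T1)
  ultimately show ?thesis by simp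
qed

end

section \<open>Time integrals and the martingale problem in integrated form\<close>

lemma bmeas_unif_iff: "bmeas (unif t) h \<longleftrightarrow> bmeas borel h"
  by (rule bmeas_sets_cong) simp

lemma integrable_unif: "bmeas borel h \<Longrightarrow> integrable (unif t) h"
  by (rule bmeas_integrable[OF finite_measure_unif]) (simp add: bmeas_unif_iff)

lemma integral_unif_cong:
  assumes "\<And>s. 0 \<le> s \<Longrightarrow> s \<le> t \<Longrightarrow> f s = g s" "f \<in> borel_measurable borel" "g \<in> borel_measurable borel"
  shows "(\<integral>s. f s \<partial>unif t) = (\<integral>s. g s \<partial>unif t)"
  by (rule integral_cong_AE) (use assms AE_unif[of t] in \<open>auto simp: measurable_cong_sets[OF sets_unif refl]\<close>)

lemma integral_unif_shift:
  fixes h :: "real \<Rightarrow> real"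
  assumes h: "bmeas borel h" and \<tau>: "0 \<le> \<tau>" "\<tau> \<le> t"
  shows "(\<integral>s. (if \<tau> \<le> s then h s else 0) \<partial>unif t) = (\<integral>r. h (\<tau> + r) \<partial>unif (t - \<tau>))"
proof -
  note [measurable] = bmeasD[OF h]
  have m: "(\<lambda>s. if \<tau> \<le> s then h s else 0) \<in> borel_measurable borel" by measurable
  have "(\<integral>s. (if \<tau> \<le> s then h s else 0) \<partial>unif t) = (\<integral>s. indicator {\<tau>..t} s * h s \<partial>lborel)"
    unfolding integral_unif[OF m] set_lebesgue_integral_def
    by (intro Bochner_Integration.integral_cong refl) (use \<tau> in \<open>auto simp: indicator_def\<close>)
  also have "\<dots> = (\<integral>r. indicator {\<tau>..t} (\<tau> + 1 * r) * h (\<tau> + 1 * r) \<partial>lborel)"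
    by (subst lborel_integral_real_affine[where c=1 and t=\<tau>]) auto
  also have "\<dots> = (\<integral>r. h (\<tau> + r) \<partial>unif (t - \<tau>))"
    by (subst integral_unif) (auto simp: set_lebesgue_integral_def indicator_def intro!: Bochner_Integration.integral_cong)
  finally show ?thesis .
qed

lemma integral_unif_add:
  fixes h :: "real \<Rightarrow> real"
  assumes h: "bmeas borel h" and st: "0 \<le> s" "0 \<le> t"
  shows "(\<integral>u. h u \<partial>unif (s + t)) = (\<integral>u. h u \<partial>unif s) + (\<integral>u. h (s + u) \<partial>unif t)"
proof -
  have m: "Measurable.pred borel (\<lambda>u. s \<le> u)" "Measurable.pred borel (\<lambda>u. u < s)" by measurable
  have b: "bmeas borel (\<lambda>u. if s \<le> u then h u else 0)" "bmeas borel (\<lambda>u. if u < s then h u else 0)"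
    using h by (intro bmeas_If bmeas_const m; simp)+
  have "(\<integral>u. h u \<partial>unif (s + t)) = (\<integral>u. (if u < s then h u else 0) + (if s \<le> u then h u else 0) \<partial>unif (s + t))"
    by (intro Bochner_Integration.integral_cong) auto
  also have "\<dots> = (\<integral>u. (if u < s then h u else 0) \<partial>unif (s + t)) + (\<integral>u. (if s \<le> u then h u else 0) \<partial>unif (s + t))"
    by (intro Bochner_Integration.integral_add integrable_unif b)
  also have "(\<integral>u. (if s \<le> u then h u else 0) \<partial>unif (s + t)) = (\<integral>u. h (s + u) \<partial>unif t)"
    using integral_unif_shift[OF h st(1), of "s + t"] st by simp
  also have "(\<integral>u. (if u < s then h u else 0) \<partial>unif (s + t)) = (\<integral>u. h u \<partial>unif s)"
  proof -
    have "(\<integral>u. (if u < s then h u else 0) \<partial>unif (s + t)) = (\<integral>u. indicator {0..s + t} u * (if u < s then h u else 0) \<partial>lborel)"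
      using bmeasD[OF b(2)] by (simp add: integral_unif set_lebesgue_integral_def)
    also have "\<dots> = (\<integral>u. indicator {0..s} u * h u \<partial>lborel)"
    proof (rule integral_cong_AE)
      have "AE u in lborel. u \<noteq> s" by (rule AE_lborel_singleton)
      then show "AE u in lborel. indicator {0..s + t} u * (if u < s then h u else 0) = indicator {0..s} u * h u"
        by eventually_elim (use st in \<open>auto simp: indicator_def\<close>)
    qed (use bmeasD[OF b(2)] bmeasD[OF h] in measurable)
    also have "\<dots> = (\<integral>u. h u \<partial>unif s)"
      using bmeasD[OF h] by (simp add: integral_unif set_lebesgue_integral_def)
    finally show ?thesis .
  qed
  finally show ?thesis .
qed

lemma bmeas_integral_unif:
  assumes "bmeas (N \<Otimes>\<^sub>M borel) (\<lambda>q. h (fst q) (snd q))"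
  shows "bmeas N (\<lambda>x. \<integral>u. h x u \<partial>unif t)"
proof -
  interpret U: finite_measure "unif t" by (rule finite_measure_unif)
  have eq: "sets (N \<Otimes>\<^sub>M unif t) = sets (N \<Otimes>\<^sub>M borel)" by (intro sets_pair_measure_cong) simp_all
  obtain B where B: "0 \<le> B" "\<And>q. q \<in> space (N \<Otimes>\<^sub>M borel) \<Longrightarrow> \<bar>h (fst q) (snd q)\<bar> \<le> B" by (rule bmeasE[OF assms]) blast
  show ?thesis
  proof (rule bmeasI)
    have "(\<lambda>(x, u). h x u) \<in> borel_measurable (N \<Otimes>\<^sub>M unif t)"
      using bmeasD[OF assms] by (simp add: split_beta' measurable_cong_sets[OF eq refl])
    then show "(\<lambda>x. \<integral>u. h x u \<partial>unif t) \<in> borel_measurable N" by (rule U.borel_measurable_lebesgue_integral)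
    fix x assume x: "x \<in> space N"
    have hx: "bmeas borel (h x)" using bmeas_section[OF assms x] .
    have "\<bar>\<integral>u. h x u \<partial>unif t\<bar> \<le> (\<integral>u. \<bar>h x u\<bar> \<partial>unif t)" by (rule integral_abs_bound)
    also have "\<dots> \<le> (\<integral>u. B \<partial>unif t)"
      using B(2)[of "(x, _)"] x by (intro integral_mono integrable_abs integrable_unif hx) (auto simp: space_pair_measure)
    finally show "\<bar>\<integral>u. h x u \<partial>unif t\<bar> \<le> B * measure (unif t) UNIV" by (simp add: mult.commute)
  qed
qed

lemma bmeas_path_time:
  fixes X :: "'b \<Rightarrow> real \<Rightarrow> 'a::metric_space" and k :: "real \<Rightarrow> real"
  assumes g: "bmeas borel g" and X: "(\<lambda>(u, x). X x (k u)) \<in> borel \<Otimes>\<^sub>M N \<rightarrow>\<^sub>M borel"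
  shows "bmeas (N \<Otimes>\<^sub>M borel) (\<lambda>q. g (X (fst q) (k (snd q))))"
proof (rule bmeas_compose[OF g])
  have "(\<lambda>q. (snd q, fst q)) \<in> N \<Otimes>\<^sub>M borel \<rightarrow>\<^sub>M (borel :: real measure) \<Otimes>\<^sub>M N" by measurable
  from measurable_compose[OF this X] show "(\<lambda>q. X (fst q) (k (snd q))) \<in> N \<Otimes>\<^sub>M borel \<rightarrow>\<^sub>M borel" by simp
qed

lemma bmeas_eval_joint:
  assumes g: "bmeas borel g" shows "bmeas (skorokhod_borel S \<Otimes>\<^sub>M borel) (\<lambda>q. g (fst q (max 0 (snd q))))"
  by (rule bmeas_path_time[where X="\<lambda>\<omega>. \<omega>" and k="max 0", OF g measurable_skorokhod_eval_joint])

lemma bmeas_eval_shift: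
  assumes g: "bmeas borel g" shows "bmeas (skorokhod_borel S \<Otimes>\<^sub>M borel) (\<lambda>q. g (fst q (max 0 (s + snd q))))"
proof -
  have "(\<lambda>q. (fst q, s + snd q)) \<in> skorokhod_borel S \<Otimes>\<^sub>M borel \<rightarrow>\<^sub>M skorokhod_borel S \<Otimes>\<^sub>M (borel :: real measure)" by measurable
  from bmeas_compose[OF bmeas_eval_joint[OF g] this] show ?thesis by simp
qed

lemma path_time_section:
  assumes g: "bmeas borel g" and \<omega>: "\<omega> \<in> skorokhod_space S" shows "bmeas borel (\<lambda>u. g (\<omega> (max 0 u)))"
  using bmeas_section[OF bmeas_eval_joint[OF g], of \<omega>] \<omega> by simp

lemma set_integral_path:
  assumes g: "bmeas borel g" and \<omega>: "\<omega> \<in> skorokhod_space S"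
  shows "(LINT u:{0..t}|lborel. g (\<omega> u)) = (\<integral>u. g (\<omega> (max 0 u)) \<partial>unif t)"
  unfolding integral_unif[OF bmeasD[OF path_time_section[OF g \<omega>]]] set_lebesgue_integral_def
  by (intro Bochner_Integration.integral_cong) (auto simp: indicator_def max_def)

text \<open>A martingale is characterised by increments of mean 0 on every event of the past, and
  the increment from \<open>s\<close> to \<open>s + t\<close> involves the path after
  \<open>s\<close> only. Fubini takes the time integral outside; the result is a forward equation
  for expectations over an event.\<close>

lemma solves_martingale_problem_iff:
  fixes \<G> :: "('a::{metric_space, second_countable_topology} \<Rightarrow> real) \<Rightarrow> 'a \<Rightarrow> real"
  assumes D: "\<And>f. f \<in> D \<Longrightarrow> bmeas borel f" and G: "\<And>f. f \<in> D \<Longrightarrow> bmeas borel (\<G> f)"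
  shows "solves_martingale_problem \<G> D x Q \<longleftrightarrow> Q \<in> space (prob_algebra paths) \<and> (AE \<omega> in Q. \<omega> 0 = x) \<and>
    (\<forall>f\<in>D. \<forall>s\<ge>0. \<forall>t\<ge>0. \<forall>B\<in>sets (path_filtration UNIV s).
       (\<integral>\<omega>. indicator B \<omega> * (f (\<omega> (s + t)) - f (\<omega> s)) \<partial>Q) = (\<integral>u. \<integral>\<omega>. indicator B \<omega> * \<G> f (\<omega> (max 0 (s + u))) \<partial>Q \<partial>unif t))"
proof -
  have main: "martingale Q (path_filtration UNIV) (\<lambda>t \<omega>. f (\<omega> t) - f (\<omega> 0) - (LINT s:{0..t}|lborel. \<G> f (\<omega> s)))
     \<longleftrightarrow> (\<forall>s\<ge>0. \<forall>t\<ge>0. \<forall>B\<in>sets (path_filtration UNIV s).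
       (\<integral>\<omega>. indicator B \<omega> * (f (\<omega> (s + t)) - f (\<omega> s)) \<partial>Q) = (\<integral>u. \<integral>\<omega>. indicator B \<omega> * \<G> f (\<omega> (max 0 (s + u))) \<partial>Q \<partial>unif t))"
    if Q: "Q \<in> space (prob_algebra paths)" and f: "f \<in> D" for f
  proof -
    have sets: "sets Q = sets paths" and sp: "space Q = skorokhod_space UNIV" and "prob_space Q"
      using Q by (auto simp: space_prob_algebra dest: sets_eq_imp_space_eq)
    interpret prob_space Q by fact
    have bQ: "bmeas Q h \<longleftrightarrow> bmeas paths h" for h by (rule bmeas_sets_cong[OF sets])
    have bQ2: "bmeas (Q \<Otimes>\<^sub>M unif t) h \<longleftrightarrow> bmeas (paths \<Otimes>\<^sub>M borel) h" for h t
      by (intro bmeas_sets_cong sets_pair_measure_cong sets) simp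
    define M where "M t \<omega> = f (\<omega> t) - f (\<omega> 0) - (LINT s:{0..t}|lborel. \<G> f (\<omega> s))" for t :: real and \<omega> :: "real \<Rightarrow> 'a"
    have sub: "subalgebra Q (path_filtration UNIV t)" for t by (rule subalgebra_path_filtration[OF sets])
    have sfs: "sigma_finite_subalgebra Q (path_filtration UNIV t)" for t
      by (rule finite_measure_subalgebra_is_sigma_finite) (simp add: finite_measure_subalgebra_def finite_measure_axioms sub finite_measure_subalgebra_axioms_def)
    \<comment> \<open>Adaptedness: the integrand is read at times capped at \<open>t\<close>, so
      that only coordinates known at time \<open>t\<close> enter.\<close>
    have MF: "bmeas (path_filtration UNIV t) (M t)" if t: "0 \<le> t" for t
    proof -
      have c: "(\<lambda>(u, \<omega>). \<omega> (max 0 (min u t))) \<in> borel \<Otimes>\<^sub>M path_filtration UNIV t \<rightarrow>\<^sub>M (borel :: 'a measure)"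
        by (rule measurable_skorokhod_clip[OF t, where S=UNIV]) (auto intro: measurable_path_filtration_eval)
      have "bmeas (path_filtration UNIV t) (\<lambda>\<omega>. \<integral>u. \<G> f (\<omega> (max 0 (min u t))) \<partial>unif t)"
        by (rule bmeas_integral_unif) (rule bmeas_path_time[where X="\<lambda>\<omega>. \<omega>" and k="\<lambda>u. max 0 (min u t)", OF G[OF f] c])
      moreover have "bmeas (path_filtration UNIV t) (\<lambda>\<omega>. f (\<omega> t))" "bmeas (path_filtration UNIV t) (\<lambda>\<omega>. f (\<omega> 0))"
        using t by (auto intro!: bmeas_compose[OF D[OF f]] measurable_path_filtration_eval)
      ultimately have "bmeas (path_filtration UNIV t) (\<lambda>\<omega>. f (\<omega> t) - f (\<omega> 0) - (\<integral>u. \<G> f (\<omega> (max 0 (min u t))) \<partial>unif t))"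
        by (intro bmeas_diff)
      moreover have "(\<integral>u. \<G> f (\<omega> (max 0 (min u t))) \<partial>unif t) = (LINT s:{0..t}|lborel. \<G> f (\<omega> s))" if "\<omega> \<in> skorokhod_space UNIV" for \<omega>
      proof -
        have b: "bmeas borel (\<lambda>u. \<G> f (\<omega> (max 0 u)))" by (rule path_time_section[OF G[OF f] that])
        have "(\<lambda>u. \<G> f (\<omega> (max 0 (min u t)))) \<in> borel_measurable borel"
          using measurable_compose[OF _ bmeasD[OF b], of "\<lambda>u. min u t" borel] by simp
        then show ?thesis
          unfolding set_integral_path[OF G[OF f] that] by (intro integral_unif_cong bmeasD[OF b]) (auto simp: min_def)
      qed
      ultimately show ?thesis unfolding M_def by (subst bmeas_cong[symmetric]) auto
    qed
    have MP: "bmeas paths (M t)" if "0 \<le> t" for t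
    proof -
      have "M t \<in> borel_measurable paths"
        by (rule measurable_from_subalg[OF subalgebra_path_filtration[OF refl] bmeasD[OF MF[OF that]]])
      moreover obtain B where "0 \<le> B" "\<And>\<omega>. \<omega> \<in> space (path_filtration UNIV t) \<Longrightarrow> \<bar>M t \<omega>\<bar> \<le> B"
        by (rule bmeasE[OF MF[OF \<open>0 \<le> t\<close>]]) blast
      ultimately show ?thesis by (intro bmeasI[of _ _ B]) simp_all
    qed
    have incr: "(\<integral>\<omega>. indicator B \<omega> * M (s + t) \<omega> \<partial>Q) - (\<integral>\<omega>. indicator B \<omega> * M s \<omega> \<partial>Q)
      = (\<integral>\<omega>. indicator B \<omega> * (f (\<omega> (s + t)) - f (\<omega> s)) \<partial>Q) - (\<integral>u. \<integral>\<omega>. indicator B \<omega> * \<G> f (\<omega> (max 0 (s + u))) \<partial>Q \<partial>unif t)"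
      if s: "0 \<le> s" and t: "0 \<le> t" and B: "B \<in> sets (path_filtration UNIV s)" for s t B
    proof -
      have iB: "bmeas paths (indicator B)" using B path_filtration_subset by (intro bmeas_indicator) blast
      have iB2: "bmeas (paths \<Otimes>\<^sub>M borel) (\<lambda>q. indicator B (fst q))" by (rule bmeas_compose[OF iB]) simp
      have b1: "bmeas paths (\<lambda>\<omega>. indicator B \<omega> * (f (\<omega> (s + t)) - f (\<omega> s)))"
        using s t by (intro bmeas_mult bmeas_diff iB bmeas_skorokhod_eval D f) auto
      have b2: "bmeas (paths \<Otimes>\<^sub>M borel) (\<lambda>q. indicator B (fst q) * \<G> f (fst q (max 0 (s + snd q))))"
        by (intro bmeas_mult iB2 bmeas_eval_shift G f)
      have b3: "bmeas paths (\<lambda>\<omega>. \<integral>u. indicator B \<omega> * \<G> f (\<omega> (max 0 (s + u))) \<partial>unif t)"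
        by (rule bmeas_integral_unif[OF b2])
      have "(\<integral>\<omega>. indicator B \<omega> * M (s + t) \<omega> \<partial>Q) - (\<integral>\<omega>. indicator B \<omega> * M s \<omega> \<partial>Q)
        = (\<integral>\<omega>. indicator B \<omega> * M (s + t) \<omega> - indicator B \<omega> * M s \<omega> \<partial>Q)"
        using s t by (intro Bochner_Integration.integral_diff[symmetric] bmeas_integrable finite_measure_axioms)
          (simp_all add: bQ bmeas_mult[OF iB MP])
      also have "\<dots> = (\<integral>\<omega>. indicator B \<omega> * (f (\<omega> (s + t)) - f (\<omega> s)) - (\<integral>u. indicator B \<omega> * \<G> f (\<omega> (max 0 (s + u))) \<partial>unif t) \<partial>Q)"
      proof (rule Bochner_Integration.integral_cong[OF refl])
        fix \<omega> assume "\<omega> \<in> space Q"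
        then have \<omega>: "\<omega> \<in> skorokhod_space UNIV" by (simp add: sp)
        have b: "bmeas borel (\<lambda>u. \<G> f (\<omega> (max 0 u)))" by (rule path_time_section[OF G[OF f] \<omega>])
        show "indicator B \<omega> * M (s + t) \<omega> - indicator B \<omega> * M s \<omega>
          = indicator B \<omega> * (f (\<omega> (s + t)) - f (\<omega> s)) - (\<integral>u. indicator B \<omega> * \<G> f (\<omega> (max 0 (s + u))) \<partial>unif t)"
          unfolding M_def set_integral_path[OF G[OF f] \<omega>] integral_unif_add[OF b s t]
          by (simp add: algebra_simps)
      qed
      also have "\<dots> = (\<integral>\<omega>. indicator B \<omega> * (f (\<omega> (s + t)) - f (\<omega> s)) \<partial>Q) - (\<integral>\<omega>. \<integral>u. indicator B \<omega> * \<G> f (\<omega> (max 0 (s + u))) \<partial>unif t \<partial>Q)"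
        by (intro Bochner_Integration.integral_diff bmeas_integrable finite_measure_axioms) (simp_all only: bQ b1 b3)
      also have "(\<integral>\<omega>. \<integral>u. indicator B \<omega> * \<G> f (\<omega> (max 0 (s + u))) \<partial>unif t \<partial>Q) = (\<integral>u. \<integral>\<omega>. indicator B \<omega> * \<G> f (\<omega> (max 0 (s + u))) \<partial>Q \<partial>unif t)"
        by (intro bmeas_swap finite_measure_axioms finite_measure_unif) (simp add: bQ2 b2)
      finally show ?thesis .
    qed
    have int: "integrable Q (M t)" if "0 \<le> t" for t
      using MP[OF that] by (intro bmeas_integrable finite_measure_axioms) (simp add: bQ)
    \<comment> \<open>Pairs of times are rewritten as a start \<open>s\<close> and a length
      \<open>t\<close>, to match the increments computed before.\<close>
    have "martingale Q (path_filtration UNIV) M \<longleftrightarrow>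
      (\<forall>s\<ge>0. \<forall>t\<ge>0. AE \<omega> in Q. real_cond_exp Q (path_filtration UNIV s) (M (s + t)) \<omega> = M s \<omega>)"
      unfolding martingale_def using sub MF int by (auto simp: bmeas_def) (metis add.commute diff_add_cancel diff_ge_0_iff_ge)
    also have "\<dots> \<longleftrightarrow> (\<forall>s\<ge>0. \<forall>t\<ge>0. \<forall>B\<in>sets (path_filtration UNIV s). (\<integral>\<omega>. indicator B \<omega> * M (s + t) \<omega> \<partial>Q) = (\<integral>\<omega>. indicator B \<omega> * M s \<omega> \<partial>Q))"
    proof (intro all_cong1 imp_cong refl)
      fix s t :: real assume s: "0 \<le> s" and t: "0 \<le> t"
      interpret sigma_finite_subalgebra Q "path_filtration UNIV s" by (rule sfs)
      have st: "0 \<le> s + t" using s t by simp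
      show "(AE \<omega> in Q. real_cond_exp Q (path_filtration UNIV s) (M (s + t)) \<omega> = M s \<omega>)
        \<longleftrightarrow> (\<forall>B\<in>sets (path_filtration UNIV s). (\<integral>\<omega>. indicator B \<omega> * M (s + t) \<omega> \<partial>Q) = (\<integral>\<omega>. indicator B \<omega> * M s \<omega> \<partial>Q))"
      proof
        assume ae: "AE \<omega> in Q. real_cond_exp Q (path_filtration UNIV s) (M (s + t)) \<omega> = M s \<omega>"
        show "\<forall>B\<in>sets (path_filtration UNIV s). (\<integral>\<omega>. indicator B \<omega> * M (s + t) \<omega> \<partial>Q) = (\<integral>\<omega>. indicator B \<omega> * M s \<omega> \<partial>Q)"
        proof
          fix B :: "(real \<Rightarrow> 'a) set" assume B: "B \<in> sets (path_filtration UNIV s)"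
          have [measurable]: "B \<in> sets Q" using B path_filtration_subset sets by blast
          have [measurable]: "M s \<in> borel_measurable Q" using int[OF s] by simp
          have "(\<integral>\<omega>. indicator B \<omega> * M (s + t) \<omega> \<partial>Q) = (\<integral>\<omega>. indicator B \<omega> * real_cond_exp Q (path_filtration UNIV s) (M (s + t)) \<omega> \<partial>Q)"
            using real_cond_exp_intA[OF int[OF st] B] by (simp add: set_lebesgue_integral_def)
          also have "\<dots> = (\<integral>\<omega>. indicator B \<omega> * M s \<omega> \<partial>Q)"
            by (rule integral_cong_AE) (use ae in auto)
          finally show "(\<integral>\<omega>. indicator B \<omega> * M (s + t) \<omega> \<partial>Q) = (\<integral>\<omega>. indicator B \<omega> * M s \<omega> \<partial>Q)" .
        qed
      next
        assume *: "\<forall>B\<in>sets (path_filtration UNIV s). (\<integral>\<omega>. indicator B \<omega> * M (s + t) \<omega> \<partial>Q) = (\<integral>\<omega>. indicator B \<omega> * M s \<omega> \<partial>Q)"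
        show "AE \<omega> in Q. real_cond_exp Q (path_filtration UNIV s) (M (s + t)) \<omega> = M s \<omega>"
          by (rule real_cond_exp_charact[OF _ int[OF st] int[OF s] bmeasD[OF MF[OF s]]])
            (use * in \<open>simp add: set_lebesgue_integral_def\<close>)
      qed
    qed
    also have "\<dots> \<longleftrightarrow> (\<forall>s\<ge>0. \<forall>t\<ge>0. \<forall>B\<in>sets (path_filtration UNIV s).
       (\<integral>\<omega>. indicator B \<omega> * (f (\<omega> (s + t)) - f (\<omega> s)) \<partial>Q) = (\<integral>u. \<integral>\<omega>. indicator B \<omega> * \<G> f (\<omega> (max 0 (s + u))) \<partial>Q \<partial>unif t))"
    proof -
      have eq: "(\<integral>\<omega>. indicator B \<omega> * M (s + t) \<omega> \<partial>Q) = (\<integral>\<omega>. indicator B \<omega> * M s \<omega> \<partial>Q) \<longleftrightarrow>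
        (\<integral>\<omega>. indicator B \<omega> * (f (\<omega> (s + t)) - f (\<omega> s)) \<partial>Q) = (\<integral>u. \<integral>\<omega>. indicator B \<omega> * \<G> f (\<omega> (max 0 (s + u))) \<partial>Q \<partial>unif t)"
        if "0 \<le> s" "0 \<le> t" "B \<in> sets (path_filtration UNIV s)" for s t B
        using incr[OF that] by linarith
      show ?thesis
      proof (intro iffI allI impI ballI)
        fix s t :: real and B :: "(real \<Rightarrow> 'a) set"
        assume a: "\<forall>s\<ge>0. \<forall>t\<ge>0. \<forall>B\<in>sets (path_filtration UNIV s). (\<integral>\<omega>. indicator B \<omega> * M (s + t) \<omega> \<partial>Q) = (\<integral>\<omega>. indicator B \<omega> * M s \<omega> \<partial>Q)"
          and b: "0 \<le> s" "0 \<le> t" "B \<in> sets (path_filtration UNIV s)"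
        show "(\<integral>\<omega>. indicator B \<omega> * (f (\<omega> (s + t)) - f (\<omega> s)) \<partial>Q) = (\<integral>u. \<integral>\<omega>. indicator B \<omega> * \<G> f (\<omega> (max 0 (s + u))) \<partial>Q \<partial>unif t)"
          by (rule eq[OF b, THEN iffD1]) (rule a[rule_format, OF b])
      next
        fix s t :: real and B :: "(real \<Rightarrow> 'a) set"
        assume a: "\<forall>s\<ge>0. \<forall>t\<ge>0. \<forall>B\<in>sets (path_filtration UNIV s). (\<integral>\<omega>. indicator B \<omega> * (f (\<omega> (s + t)) - f (\<omega> s)) \<partial>Q)
            = (\<integral>u. \<integral>\<omega>. indicator B \<omega> * \<G> f (\<omega> (max 0 (s + u))) \<partial>Q \<partial>unif t)"
          and b: "0 \<le> s" "0 \<le> t" "B \<in> sets (path_filtration UNIV s)"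
        show "(\<integral>\<omega>. indicator B \<omega> * M (s + t) \<omega> \<partial>Q) = (\<integral>\<omega>. indicator B \<omega> * M s \<omega> \<partial>Q)"
          by (rule eq[OF b, THEN iffD2]) (rule a[rule_format, OF b])
      qed
    qed
    finally show ?thesis unfolding M_def .
  qed
  show ?thesis
    unfolding solves_martingale_problem_def using main by blast
qed

section \<open>Existence for perturbed generators\<close>

lemma integral_unif_restrict:
  fixes h :: "real \<Rightarrow> real"
  assumes h: "bmeas borel h" and t: "0 \<le> t" "t \<le> S"
  shows "(\<integral>s. (if s \<le> t then h s else 0) \<partial>unif S) = (\<integral>s. h s \<partial>unif t)"
proof -
  have b: "bmeas borel (\<lambda>s. if s \<le> t then h s else 0)" using h by (intro bmeas_If) auto
  have "(\<integral>s. (if s \<le> t then h s else 0) \<partial>unif S) = (\<integral>s. indicator {0..S} s * (if s \<le> t then h s else 0) \<partial>lborel)"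
    using bmeasD[OF b] by (simp add: integral_unif set_lebesgue_integral_def)
  also have "\<dots> = (\<integral>s. indicator {0..t} s * h s \<partial>lborel)"
    by (intro Bochner_Integration.integral_cong) (use t in \<open>auto simp: indicator_def\<close>)
  also have "\<dots> = (\<integral>s. h s \<partial>unif t)"
    using bmeasD[OF h] by (simp add: integral_unif set_lebesgue_integral_def)
  finally show ?thesis .
qed

context jump_kernels
begin

lemma P_diff:
  assumes "bmeas borel f" "bmeas borel g" shows "P t (\<lambda>x. f x - g x) y = P t f y - P t g y"
  unfolding P_def using bmeas_skorokhod_eval[OF assms(1), of "max 0 t" UNIV] bmeas_skorokhod_eval[OF assms(2), of "max 0 t" UNIV]
  by (intro Bochner_Integration.integral_diff bmeas_integrable[OF R_prob(4)]) (simp_all add: bmeas_sets_cong[OF R_prob(1)])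

lemma P_add:
  assumes "bmeas borel f" "bmeas borel g" shows "P t (\<lambda>x. f x + g x) y = P t f y + P t g y"
  unfolding P_def using bmeas_skorokhod_eval[OF assms(1), of "max 0 t" UNIV] bmeas_skorokhod_eval[OF assms(2), of "max 0 t" UNIV]
  by (intro Bochner_Integration.integral_add bmeas_integrable[OF R_prob(4)]) (simp_all add: bmeas_sets_cong[OF R_prob(1)])

lemma P_cmult: "P t (\<lambda>x. k * f x) y = k * P t f y"
  unfolding P_def by simp

lemma jump_op_diff:
  assumes "bmeas borel f" "bmeas borel g" shows "jump_op (\<lambda>x. f x - g x) y = jump_op f y - jump_op g y"
  unfolding jump_op_def using assms
  by (intro Bochner_Integration.integral_diff bmeas_integrable[OF J_prob(4)]) (simp_all add: bmeas_sets_cong[OF J_prob(1)])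

lemma P_bound:
  assumes "bmeas borel f" "\<And>x. \<bar>f x\<bar> \<le> B" shows "\<bar>P t f x\<bar> \<le> B"
  unfolding P_def using bmeas_skorokhod_eval[OF assms(1), of "max 0 t" UNIV] assms(2)
  by (intro abs_integral_le_const[OF R_prob(3)]) (auto dest: bmeasD simp: measurable_cong_sets[OF R_prob(1) refl])

lemma jump_op_bound:
  assumes "bmeas borel f" "\<And>x. \<bar>f x\<bar> \<le> B" shows "\<bar>jump_op f x\<bar> \<le> B"
  unfolding jump_op_def using assms
  by (intro abs_integral_le_const[OF J_prob(3)]) (auto dest: bmeasD simp: measurable_cong_sets[OF J_prob(1) refl])

lemma P_0: assumes "bmeas borel f" shows "P 0 f x = f x"
proof -
  have "P 0 f x = (\<integral>\<xi>. f x \<partial>R x)"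
    unfolding P_def
  proof (rule integral_cong_AE)
    show "(\<lambda>\<xi>. f (\<xi> (max 0 0))) \<in> borel_measurable (R x)"
      using bmeas_skorokhod_eval[OF assms, of 0 UNIV] by (auto dest: bmeasD simp: measurable_cong_sets[OF R_prob(1) refl])
    show "AE \<xi> in R x. f (\<xi> (max 0 0)) = f x" using R_start[of x] by eventually_elim simp
  qed simp
  then show ?thesis using prob_space.prob_space[OF R_prob(3)] by simp
qed

lemma P_swap_unif:
  assumes g: "bmeas (borel \<Otimes>\<^sub>M borel) (\<lambda>q. g (fst q) (snd q))"
  shows "(\<integral>r. P \<tau> (g r) x \<partial>unif u) = P \<tau> (\<lambda>z. \<integral>r. g r z \<partial>unif u) x"
  unfolding P_def
proof (rule bmeas_swap[OF finite_measure_unif R_prob(4)])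
  have "(\<lambda>q. (fst q, snd q (max 0 \<tau>))) \<in> borel \<Otimes>\<^sub>M paths \<rightarrow>\<^sub>M borel \<Otimes>\<^sub>M (borel :: 'a measure)"
    by (intro measurable_Pair measurable_fst measurable_compose[OF measurable_snd measurable_skorokhod_eval]) simp
  from bmeas_compose[OF g this] show "bmeas (unif u \<Otimes>\<^sub>M R x) (\<lambda>q. g (fst q) (snd q (max 0 \<tau>)))"
    by (simp add: bmeas_sets_cong[OF sets_pair_measure_cong[OF sets_unif R_prob(1)]])
qed

lemma jump_op_swap_unif:
  assumes g: "bmeas (borel \<Otimes>\<^sub>M borel) (\<lambda>q. g (fst q) (snd q))"
  shows "(\<integral>r. jump_op (g r) x \<partial>unif u) = jump_op (\<lambda>z. \<integral>r. g r z \<partial>unif u) x"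
  unfolding jump_op_def
  by (rule bmeas_swap[OF finite_measure_unif J_prob(4)])
    (simp add: bmeas_sets_cong[OF sets_pair_measure_cong[OF sets_unif J_prob(1)]] g)

lemma T_joint: assumes "bmeas borel g" shows "bmeas (borel \<Otimes>\<^sub>M borel) (\<lambda>q. T (fst q) g (snd q))"
  by (rule bmeas_T[of fst _ snd "\<lambda>_. g"]) (auto intro: bmeas_snd[OF assms])

lemma P_joint: assumes "bmeas borel g" shows "bmeas (borel \<Otimes>\<^sub>M borel) (\<lambda>q. P (fst q) g (snd q))"
  by (rule bmeas_P[of fst _ snd "\<lambda>_. g"]) (auto intro: bmeas_snd[OF assms])

lemma bmeas_P_time: assumes "bmeas borel g" shows "bmeas borel (\<lambda>s. P s g x)"
  by (rule bmeas_P[of "\<lambda>s. s" _ "\<lambda>_. x" "\<lambda>_. g"]) (auto intro: bmeas_snd[OF assms])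

lemma bmeas_T_time: assumes "bmeas borel g" shows "bmeas borel (\<lambda>s. T s g x)"
  by (rule bmeas_T[of "\<lambda>s. s" _ "\<lambda>_. x" "\<lambda>_. g"]) (auto intro: bmeas_snd[OF assms])

lemma bmeas_early:
  assumes h: "bmeas (borel \<Otimes>\<^sub>M borel) (\<lambda>q. h (fst q) (snd q))"
  shows "bmeas borel (\<lambda>\<tau>. P \<tau> (jump_op (h (t - \<tau>))) x)"
proof (rule bmeas_P[of "\<lambda>\<tau>. \<tau>" borel "\<lambda>_. x" "\<lambda>\<tau>. jump_op (h (t - \<tau>))"])
  show "bmeas (borel \<Otimes>\<^sub>M borel) (\<lambda>q. jump_op (h (t - fst q)) (snd q))"
  proof (rule bmeas_jump_op[of snd _ "\<lambda>q. h (t - fst q)"])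
    have "(\<lambda>r. (t - fst (fst r), snd r)) \<in> ((borel :: real measure) \<Otimes>\<^sub>M (borel :: 'a measure)) \<Otimes>\<^sub>M borel \<rightarrow>\<^sub>M borel \<Otimes>\<^sub>M (borel :: 'a measure)"
      by measurable
    from bmeas_compose[OF h this]
    show "bmeas (((borel :: real measure) \<Otimes>\<^sub>M (borel :: 'a measure)) \<Otimes>\<^sub>M borel) (\<lambda>r. h (t - fst (fst r)) (snd r))" by simp
  qed simp
qed simp_all

lemma integrable_expo: "bmeas borel h \<Longrightarrow> integrable (expo c) h"
  by (rule bmeas_integrable[OF finite_measure_expo[OF c]]) (simp add: bmeas_sets_cong[OF sets_expo])

text \<open>\<open>T_ring\<close> divided according to whether the clock rings by \<open>t\<close>;
  it does not with probability e^(-ct), and then only the free motion acts.\<close>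

lemma T_split:
  assumes f: "bmeas borel f" and t: "0 \<le> t"
  shows "T t f x = exp (- c * t) * P t f x + (\<integral>\<tau>. (if \<tau> \<le> t then P \<tau> (jump_op (T (t - \<tau>) f)) x else 0) \<partial>expo c)"
proof -
  have b: "bmeas borel (\<lambda>\<tau>. P \<tau> (jump_op (T (t - \<tau>) f)) x)" by (rule bmeas_early[OF T_joint[OF f]])
  have b1: "bmeas borel (\<lambda>\<tau>. if \<tau> \<le> t then P \<tau> (jump_op (T (t - \<tau>) f)) x else 0)" using b by (intro bmeas_If) auto
  have b2: "bmeas borel (\<lambda>\<tau>. P t f x * indicator {t<..} \<tau>)" by (intro bmeas_cmult bmeas_indicator) simp
  have "T t f x = (\<integral>\<tau>. P t f x * indicator {t<..} \<tau> + (if \<tau> \<le> t then P \<tau> (jump_op (T (t - \<tau>) f)) x else 0) \<partial>expo c)"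
    unfolding T_ring[OF f t]
    by (intro Bochner_Integration.integral_cong) (auto simp: after_def[abs_def] indicator_def min_absorb1 min_absorb2)
  also have "\<dots> = (\<integral>\<tau>. P t f x * indicator {t<..} \<tau> \<partial>expo c) + (\<integral>\<tau>. (if \<tau> \<le> t then P \<tau> (jump_op (T (t - \<tau>) f)) x else 0) \<partial>expo c)"
    by (intro Bochner_Integration.integral_add integrable_expo b1 b2)
  also have "(\<integral>\<tau>. P t f x * indicator {t<..} \<tau> \<partial>expo c) = exp (- c * t) * P t f x"
    using measure_expo(2)[OF c t] by simp
  finally show ?thesis .
qed

definition U :: "real \<Rightarrow> ('a \<Rightarrow> real) \<Rightarrow> 'a \<Rightarrow> real" where "U t g x = (\<integral>s. T s g x \<partial>unif t)"

lemma bmeas_U1: assumes "bmeas borel g" shows "bmeas borel (U t g)"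
  unfolding U_def
proof (rule bmeas_integral_unif)
  have "(\<lambda>q. (snd q, fst q)) \<in> (borel :: 'a measure) \<Otimes>\<^sub>M (borel :: real measure) \<rightarrow>\<^sub>M borel \<Otimes>\<^sub>M borel" by measurable
  from bmeas_compose[OF T_joint[OF assms] this] show "bmeas (borel \<Otimes>\<^sub>M borel) (\<lambda>q. T (snd q) g (fst q))" by simp
qed

lemma U_alt:
  assumes "bmeas borel g" "0 \<le> t" "t \<le> S" shows "U t g x = (\<integral>s. (if s \<le> t then T s g x else 0) \<partial>unif S)"
  unfolding U_def by (rule integral_unif_restrict[OF bmeas_T_time[OF assms(1)] assms(2,3), symmetric])

text \<open>A variable upper limit is turned into an indicator on a fixed interval, which is why the
  horizon is clipped to \<open>[0, S]\<close>.\<close>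

lemma U_joint: assumes g: "bmeas borel g" shows "bmeas (borel \<Otimes>\<^sub>M borel) (\<lambda>q. U (max 0 (min S (fst q))) g (snd q))"
proof -
  have e: "U (max 0 (min S r)) g z = (\<integral>s. (if s \<le> max 0 (min S r) then T s g z else 0) \<partial>unif (max 0 S))" for r z
    by (rule U_alt[OF g]) auto
  show ?thesis
    unfolding e
  proof (rule bmeas_integral_unif)
    have "(\<lambda>q. (snd q, snd (fst q))) \<in> ((borel :: real measure) \<Otimes>\<^sub>M (borel :: 'a measure)) \<Otimes>\<^sub>M (borel :: real measure) \<rightarrow>\<^sub>M borel \<Otimes>\<^sub>M borel" by measurable
    from bmeas_compose[OF T_joint[OF g] this]
    have "bmeas (((borel :: real measure) \<Otimes>\<^sub>M (borel :: 'a measure)) \<Otimes>\<^sub>M (borel :: real measure)) (\<lambda>q. T (snd q) g (snd (fst q)))" by simp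
    moreover have "Measurable.pred (((borel :: real measure) \<Otimes>\<^sub>M (borel :: 'a measure)) \<Otimes>\<^sub>M (borel :: real measure))
       (\<lambda>q. snd q \<le> max 0 (min S (fst (fst q))))"
      unfolding pred_def
      by (intro borel_measurable_le borel_measurable_max borel_measurable_min measurable_const measurable_snd
          measurable_compose[OF measurable_fst measurable_fst]) simp_all
    ultimately show "bmeas (((borel :: real measure) \<Otimes>\<^sub>M (borel :: 'a measure)) \<Otimes>\<^sub>M (borel :: real measure))
       (\<lambda>q. if snd q \<le> max 0 (min S (fst (fst q))) then T (snd q) g (snd (fst q)) else 0)"
      by (intro bmeas_If bmeas_const)
  qed
qed

text \<open>The factor e^(-cs) is unbounded for negative \<open>s\<close>, hence not
  \<open>bmeas\<close>; the truncated version is, and the measure does not see the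
  difference.\<close>

lemma integral_unif_exp:
  assumes "\<phi> \<in> borel_measurable borel"
  shows "(\<integral>s. exp (- c * s) * \<phi> s \<partial>unif t) = (\<integral>s. exp (- c * max 0 s) * \<phi> s \<partial>unif t)"
  by (rule integral_unif_cong) (use assms in auto)

lemma bmeas_exp: "bmeas borel (\<lambda>s. exp (- c * max 0 s))"
  by (rule bmeasI[of _ _ 1]) (use c in auto)

lemma bmeas_clipped_U:
  assumes g: "bmeas borel g"
  shows "bmeas borel (\<lambda>\<tau>. if \<tau> \<le> t then P \<tau> (jump_op (U (max 0 (min t (t - \<tau>))) g)) x else 0)"
  using bmeas_early[OF U_joint[OF g], of t t] by (intro bmeas_If) auto

text \<open>\<open>T_split\<close> integrated over \<open>s\<close> up to \<open>t\<close>. In the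
  ring term the order is exchanged over \<open>\<tau> \<le> s \<le> t\<close>; for a fixed ring time
  the remaining integral over \<open>s\<close> is \<open>U\<close> with horizon
  \<open>t - \<tau>\<close>.\<close>

lemma U_split:
  assumes g: "bmeas borel g" and t: "0 \<le> t"
  shows "U t g x = (\<integral>s. exp (- c * s) * P s g x \<partial>unif t)
    + (\<integral>\<tau>. (if \<tau> \<le> t then P \<tau> (jump_op (U (max 0 (min t (t - \<tau>))) g)) x else 0) \<partial>expo c)"
proof -
  let ?h = "\<lambda>s \<tau>. P \<tau> (jump_op (T (s - \<tau>) g)) x"
  have h: "bmeas (borel \<Otimes>\<^sub>M borel) (\<lambda>q. ?h (fst q) (snd q))"
  proof (rule bmeas_P[of snd _ "\<lambda>_. x" "\<lambda>q. jump_op (T (fst q - snd q) g)"])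
    show "bmeas ((borel \<Otimes>\<^sub>M borel) \<Otimes>\<^sub>M borel) (\<lambda>r. jump_op (T (fst (fst r) - snd (fst r)) g) (snd r))"
    proof (rule bmeas_jump_op[of snd _ "\<lambda>r. T (fst (fst r) - snd (fst r)) g"])
      show "bmeas (((borel \<Otimes>\<^sub>M borel) \<Otimes>\<^sub>M (borel :: 'a measure)) \<Otimes>\<^sub>M borel) (\<lambda>r. T (fst (fst (fst r)) - snd (fst (fst r))) g (snd r))"
        by (rule bmeas_T[of "\<lambda>r. fst (fst (fst r)) - snd (fst (fst r))" _ snd "\<lambda>_. g"]) (auto intro: bmeas_snd[OF g])
    qed simp
  qed simp_all
  let ?k = "\<lambda>s \<tau>. if \<tau> \<le> s then ?h s \<tau> else 0"
  have k: "bmeas (borel \<Otimes>\<^sub>M borel) (\<lambda>q. ?k (fst q) (snd q))" by (intro bmeas_If bmeas_const h) measurable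
  have ks: "bmeas borel (\<lambda>s. \<integral>\<tau>. ?k s \<tau> \<partial>expo c)"
    by (rule bmeas_kernel[OF k]) (simp add: expo_in_prob_algebra)
  have kt: "bmeas borel (\<lambda>\<tau>. \<integral>s. ?k s \<tau> \<partial>unif t)"
  proof (rule bmeas_integral_unif)
    have "(\<lambda>q. (snd q, fst q)) \<in> borel \<Otimes>\<^sub>M borel \<rightarrow>\<^sub>M (borel :: real measure) \<Otimes>\<^sub>M (borel :: real measure)" by measurable
    from bmeas_compose[OF k this] show "bmeas (borel \<Otimes>\<^sub>M borel) (\<lambda>q. ?k (snd q) (fst q))"
      by (simp cong: if_cong)
  qed
  have Ps: "bmeas borel (\<lambda>s. P s g x)" by (rule bmeas_P_time[OF g])
  have e: "bmeas borel (\<lambda>s. exp (- c * max 0 s) * P s g x)" by (intro bmeas_mult bmeas_exp Ps)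
  have "U t g x = (\<integral>s. exp (- c * max 0 s) * P s g x + (\<integral>\<tau>. ?k s \<tau> \<partial>expo c) \<partial>unif t)"
    unfolding U_def
    by (intro integral_unif_cong bmeasD[OF bmeas_T_time[OF g]] bmeasD[OF bmeas_add[OF e ks]]) (simp add: T_split[OF g])
  also have "\<dots> = (\<integral>s. exp (- c * max 0 s) * P s g x \<partial>unif t) + (\<integral>s. \<integral>\<tau>. ?k s \<tau> \<partial>expo c \<partial>unif t)"
    by (intro Bochner_Integration.integral_add integrable_unif e ks)
  also have "(\<integral>s. exp (- c * max 0 s) * P s g x \<partial>unif t) = (\<integral>s. exp (- c * s) * P s g x \<partial>unif t)"
    by (rule integral_unif_exp[OF bmeasD[OF Ps], symmetric])
  also have "(\<integral>s. \<integral>\<tau>. ?k s \<tau> \<partial>expo c \<partial>unif t) = (\<integral>\<tau>. \<integral>s. ?k s \<tau> \<partial>unif t \<partial>expo c)"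
    by (rule bmeas_swap[OF finite_measure_unif finite_measure_expo[OF c]])
      (use k in \<open>simp only: bmeas_sets_cong[OF sets_pair_measure_cong[OF sets_unif sets_expo]]\<close>)
  also have "\<dots> = (\<integral>\<tau>. (if \<tau> \<le> t then P \<tau> (jump_op (U (max 0 (min t (t - \<tau>))) g)) x else 0) \<partial>expo c)"
  proof (rule integral_cong_AE)
    show "(\<lambda>\<tau>. \<integral>s. ?k s \<tau> \<partial>unif t) \<in> borel_measurable (expo c)"
      "(\<lambda>\<tau>. if \<tau> \<le> t then P \<tau> (jump_op (U (max 0 (min t (t - \<tau>))) g)) x else 0) \<in> borel_measurable (expo c)"
      unfolding measurable_cong_sets[OF sets_expo refl]
      by (rule bmeasD[OF kt], rule bmeasD[OF bmeas_clipped_U[OF g]])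
    show "AE \<tau> in expo c. (\<integral>s. ?k s \<tau> \<partial>unif t) = (if \<tau> \<le> t then P \<tau> (jump_op (U (max 0 (min t (t - \<tau>))) g)) x else 0)"
      using AE_expo[OF c]
    proof eventually_elim
      case (elim \<tau>)
      have hs: "bmeas borel (\<lambda>s. ?h s \<tau>)"
      proof -
        have "(\<lambda>s. (s, \<tau>)) \<in> borel \<rightarrow>\<^sub>M borel \<Otimes>\<^sub>M borel" by measurable
        from bmeas_compose[OF h this] show ?thesis by simp
      qed
      show ?case
      proof (cases "\<tau> \<le> t")
        case True
        have "(\<integral>s. ?k s \<tau> \<partial>unif t) = (\<integral>r. P \<tau> (jump_op (T r g)) x \<partial>unif (t - \<tau>))"
          using integral_unif_shift[OF hs elim True] by simp
        also have "\<dots> = P \<tau> (\<lambda>y. \<integral>r. jump_op (T r g) y \<partial>unif (t - \<tau>)) x"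
        proof (rule P_swap_unif[of "\<lambda>r. jump_op (T r g)"])
          show "bmeas (borel \<Otimes>\<^sub>M borel) (\<lambda>q. jump_op (T (fst q) g) (snd q))"
          proof (rule bmeas_jump_op[of snd _ "\<lambda>q. T (fst q) g"])
            have "(\<lambda>r. (fst (fst r), snd r)) \<in> ((borel :: real measure) \<Otimes>\<^sub>M (borel :: 'a measure)) \<Otimes>\<^sub>M borel \<rightarrow>\<^sub>M borel \<Otimes>\<^sub>M (borel :: 'a measure)"
              by measurable
            from bmeas_compose[OF T_joint[OF g] this]
            show "bmeas (((borel :: real measure) \<Otimes>\<^sub>M (borel :: 'a measure)) \<Otimes>\<^sub>M borel) (\<lambda>r. T (fst (fst r)) g (snd r))" by simp
          qed simp
        qed
        also have "\<dots> = P \<tau> (jump_op (U (t - \<tau>) g)) x"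
          unfolding U_def using jump_op_swap_unif[OF T_joint[OF g]] by simp
        also have "U (t - \<tau>) g = U (max 0 (min t (t - \<tau>))) g" using elim True by (simp add: min_absorb2)
        finally show ?thesis using True by simp
      next
        case False
        have "(\<integral>s. ?k s \<tau> \<partial>unif t) = (\<integral>s. 0 \<partial>unif t)"
        proof (rule integral_unif_cong)
          have "Measurable.pred borel (\<lambda>s. \<tau> \<le> s)" by measurable
          then show "(\<lambda>s. ?k s \<tau>) \<in> borel_measurable borel" by (intro bmeasD bmeas_If hs) auto
        qed (use False in auto)
        then show ?thesis using False by simp
      qed
    qed
  qed
  finally show ?thesis .
qed

end

text \<open>\<open>dynkin\<close> carries the discount of a process killed at the first ring, so
  that it matches the no-ring term of \<open>T_split\<close> and the factor in the mild equation.
  \<open>approx\<close> says that the domain is invariant under \<open>P t\<close> up to arbitrarily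
  small errors in the uniform graph norm; \<open>P t f\<close> itself need not lie in
  \<open>D0\<close>.\<close>

locale jump_perturbation = jump_kernels +
  fixes D0 :: "('a \<Rightarrow> real) set" and L :: "('a \<Rightarrow> real) \<Rightarrow> 'a \<Rightarrow> real"
  assumes D0: "f \<in> D0 \<Longrightarrow> bmeas borel f" and L: "f \<in> D0 \<Longrightarrow> bmeas borel (L f)"
    and dynkin: "f \<in> D0 \<Longrightarrow> 0 \<le> t \<Longrightarrow>
       exp (- c * t) * P t f x - f x = (\<integral>s. exp (- c * s) * P s (\<lambda>y. L f y - c * f y) x \<partial>unif t)"
    and approx: "f \<in> D0 \<Longrightarrow> 0 \<le> t \<Longrightarrow> 0 < e \<Longrightarrow> \<exists>k\<in>D0. \<forall>x. \<bar>k x - P t f x\<bar> \<le> e \<and> \<bar>L k x - P t (L f) x\<bar> \<le> e"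
    and determining: "finite_measure \<mu> \<Longrightarrow> finite_measure \<nu> \<Longrightarrow> sets \<mu> = sets borel \<Longrightarrow> sets \<nu> = sets borel \<Longrightarrow>
       (\<And>f. f \<in> D0 \<Longrightarrow> (\<integral>x. f x \<partial>\<mu>) = (\<integral>x. f x \<partial>\<nu>)) \<Longrightarrow> \<mu> = \<nu>"
begin

definition gen :: "('a \<Rightarrow> real) \<Rightarrow> 'a \<Rightarrow> real" where "gen f x = L f x + c * (jump_op f x - f x)"

lemma bmeas_gen: "f \<in> D0 \<Longrightarrow> bmeas borel (gen f)"
  unfolding gen_def by (intro bmeas_add bmeas_cmult bmeas_diff L D0 bmeas_jump_op1)

text \<open>\<open>w\<close> is the defect. In the first-ring expansions of \<open>T t f\<close> and
  \<open>U t (gen f)\<close> the free parts cancel by the discounted Dynkin formula, and the part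
  \<open>c * jump_op f\<close> of \<open>gen f\<close> becomes an integral over the ring time. What
  remains is the average of \<open>P \<tau> (jump_op (w (s - \<tau>)))\<close> over rings before
  \<open>s\<close>, so the defect contracts.\<close>

lemma T_dynkin:
  assumes f: "f \<in> D0" and t: "0 \<le> t"
  shows "T t f x - f x = U t (gen f) x"
proof -
  note fm = D0[OF f] and Lm = L[OF f] and gm = bmeas_gen[OF f]
  define w where "w t x = T t f x - f x - U t (gen f) x" for t x
  have wb: "\<exists>B. \<forall>s z. 0 \<le> s \<longrightarrow> s \<le> t \<longrightarrow> \<bar>w s z\<bar> \<le> B"
  proof -
    obtain B where B: "0 \<le> B" "\<And>x. \<bar>f x\<bar> \<le> B" using bmeasE[OF fm] by auto
    obtain B' where B': "0 \<le> B'" "\<And>x. \<bar>gen f x\<bar> \<le> B'" using bmeasE[OF gm] by auto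
    have "\<bar>w s z\<bar> \<le> 2 * B + B' * t" if "0 \<le> s" "s \<le> t" for s z
    proof -
      have "\<bar>U s (gen f) z\<bar> \<le> (\<integral>u. \<bar>T u (gen f) z\<bar> \<partial>unif s)" unfolding U_def by (rule integral_abs_bound)
      also have "\<dots> \<le> (\<integral>u. B' \<partial>unif s)"
        using T_bound[OF gm B'(2)] by (intro integral_mono integrable_abs integrable_unif bmeas_T_time gm) auto
      also have "\<dots> = B' * s" using that by (simp add: measure_unif)
      also have "\<dots> \<le> B' * t" using that B' by (intro mult_left_mono) auto
      finally show ?thesis using T_bound[OF fm B(2), of s z] B(2)[of z] unfolding w_def by linarith
    qed
    then show ?thesis by blast
  qed
  then obtain B where B: "\<And>s z. 0 \<le> s \<Longrightarrow> s \<le> t \<Longrightarrow> \<bar>w s z\<bar> \<le> B" by blast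
  have "\<bar>w t x\<bar> \<le> 0"
  proof (rule ring_contraction[where c=c and Q="\<lambda>_ _. True" and S=t and B=B and g="\<lambda>s z. \<bar>w s z\<bar>"])
    show "0 < c" "0 \<le> t" "t \<le> t" True using c t by simp_all
    show "\<bar>w s z\<bar> \<le> B" if "0 \<le> s" "s \<le> t" for s z using B that .
    fix b s z assume b: "0 \<le> b" "\<And>s z. 0 \<le> s \<Longrightarrow> s \<le> t \<Longrightarrow> True \<Longrightarrow> \<bar>w s z\<bar> \<le> b" and s: "0 \<le> s" "s \<le> t"
    \<comment> \<open>\<open>h\<close> is \<open>w\<close> with a clipped horizon: equal to it for
      the times that occur, and jointly measurable by \<open>U_joint\<close>.\<close>
    define h where "h r y = T r f y - f y - U (max 0 (min s r)) (gen f) y" for r y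
    have hm: "bmeas (borel \<Otimes>\<^sub>M borel) (\<lambda>q. h (fst q) (snd q))"
      unfolding h_def by (intro bmeas_diff T_joint U_joint bmeas_snd fm gm)
    have h1: "bmeas borel (h r)" for r using bmeas_section[OF hm, of r] by simp
    let ?u = "\<lambda>r. U (max 0 (min s r)) (gen f)"
    have e1: "bmeas borel (\<lambda>\<tau>. if \<tau> \<le> s then P \<tau> (jump_op (T (s - \<tau>) f)) x else 0)" for x
      using bmeas_early[OF T_joint[OF fm]] by (intro bmeas_If) auto
    have jf: "bmeas borel (jump_op f)" by (rule bmeas_jump_op1[OF fm])
    have e2: "bmeas borel (\<lambda>\<tau>. if \<tau> \<le> s then P \<tau> (jump_op f) x else 0)" for x
      using bmeas_P_time[OF jf] by (intro bmeas_If) auto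
    have lf: "bmeas borel (\<lambda>y. L f y - c * f y)" by (intro bmeas_diff bmeas_cmult Lm fm)
    have "w s z = exp (- c * s) * P s f z - f z + (\<integral>\<tau>. (if \<tau> \<le> s then P \<tau> (jump_op (T (s - \<tau>) f)) z else 0) \<partial>expo c)
      - (\<integral>u. exp (- c * u) * P u (gen f) z \<partial>unif s)
      - (\<integral>\<tau>. (if \<tau> \<le> s then P \<tau> (jump_op (?u (s - \<tau>))) z else 0) \<partial>expo c)"
      unfolding w_def T_split[OF fm s(1)] U_split[OF gm s(1)] by simp
    \<comment> \<open>The jump part of \<open>gen f\<close> enters with the weight c e^(-cu), which
      is the density of the clock; that is how it turns into an integral over the ring time.\<close>
    also have "(\<integral>u. exp (- c * u) * P u (gen f) z \<partial>unif s)
      = (\<integral>u. exp (- c * u) * P u (\<lambda>y. L f y - c * f y) z \<partial>unif s) + (\<integral>\<tau>. (if \<tau> \<le> s then P \<tau> (jump_op f) z else 0) \<partial>expo c)"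
    proof -
      have g: "P u (gen f) z = P u (\<lambda>y. L f y - c * f y) z + c * P u (jump_op f) z" for u
      proof -
        have "gen f = (\<lambda>y. (L f y - c * f y) + c * jump_op f y)" unfolding gen_def by (auto simp: algebra_simps)
        then show ?thesis using P_add[OF lf bmeas_cmult[OF jf, of c], of u z] by (simp add: P_cmult)
      qed
      have "(\<integral>u. exp (- c * u) * P u (gen f) z \<partial>unif s) = (\<integral>u. exp (- c * max 0 u) * P u (gen f) z \<partial>unif s)"
        by (rule integral_unif_exp[OF bmeasD[OF bmeas_P_time[OF gm]]])
      also have "\<dots> = (\<integral>u. exp (- c * max 0 u) * P u (\<lambda>y. L f y - c * f y) z + exp (- c * max 0 u) * (c * P u (jump_op f) z) \<partial>unif s)"
        unfolding g by (simp add: algebra_simps)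
      also have "\<dots> = (\<integral>u. exp (- c * max 0 u) * P u (\<lambda>y. L f y - c * f y) z \<partial>unif s) + (\<integral>u. exp (- c * max 0 u) * (c * P u (jump_op f) z) \<partial>unif s)"
        by (intro Bochner_Integration.integral_add integrable_unif bmeas_mult bmeas_cmult bmeas_exp bmeas_P_time lf jf)
      also have "(\<integral>u. exp (- c * max 0 u) * P u (\<lambda>y. L f y - c * f y) z \<partial>unif s) = (\<integral>u. exp (- c * u) * P u (\<lambda>y. L f y - c * f y) z \<partial>unif s)"
        by (rule integral_unif_exp[OF bmeasD[OF bmeas_P_time[OF lf]], symmetric])
      also have "(\<integral>u. exp (- c * max 0 u) * (c * P u (jump_op f) z) \<partial>unif s) = (\<integral>u. exp (- c * u) * (c * P u (jump_op f) z) \<partial>unif s)"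
        by (rule integral_unif_exp[symmetric]) (intro bmeasD bmeas_cmult bmeas_P_time jf)
      also have "\<dots> = (\<integral>\<tau>. (if \<tau> \<le> s then P \<tau> (jump_op f) z else 0) \<partial>expo c)"
        using integral_expo_atMost[OF c s(1) bmeas_P_time[OF jf, of z]] by (simp add: ac_simps)
      finally show ?thesis .
    qed
    also have "exp (- c * s) * P s f z - f z = (\<integral>u. exp (- c * u) * P u (\<lambda>y. L f y - c * f y) z \<partial>unif s)"
      by (rule dynkin[OF f s(1)])
    finally have "w s z = (\<integral>\<tau>. (if \<tau> \<le> s then P \<tau> (jump_op (T (s - \<tau>) f)) z else 0) \<partial>expo c)
      - (\<integral>\<tau>. (if \<tau> \<le> s then P \<tau> (jump_op f) z else 0) \<partial>expo c)
      - (\<integral>\<tau>. (if \<tau> \<le> s then P \<tau> (jump_op (?u (s - \<tau>))) z else 0) \<partial>expo c)" by simp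
    also have "\<dots> = (\<integral>\<tau>. (if \<tau> \<le> s then P \<tau> (jump_op (T (s - \<tau>) f)) z else 0) - (if \<tau> \<le> s then P \<tau> (jump_op f) z else 0)
       - (if \<tau> \<le> s then P \<tau> (jump_op (?u (s - \<tau>))) z else 0) \<partial>expo c)"
    proof -
      note i = integrable_expo[OF e1[of z]] integrable_expo[OF e2[of z]] integrable_expo[OF bmeas_clipped_U[OF gm, of s z]]
      show ?thesis
        by (simp only: Bochner_Integration.integral_diff[OF Bochner_Integration.integrable_diff[OF i(1,2)] i(3)] Bochner_Integration.integral_diff[OF i(1,2)])
    qed
    also have "\<dots> = (\<integral>\<tau>. (if \<tau> \<le> s then P \<tau> (jump_op (h (s - \<tau>))) z else 0) \<partial>expo c)"
    proof (intro Bochner_Integration.integral_cong refl)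
      fix \<tau>
      have U1: "bmeas borel (?u r)" for r by (rule bmeas_U1[OF gm])
      have "jump_op (h (s - \<tau>)) = (\<lambda>y. jump_op (T (s - \<tau>) f) y - jump_op f y - jump_op (?u (s - \<tau>)) y)"
        unfolding h_def using U1
        by (intro ext) (simp add: jump_op_diff bmeas_diff bmeas_T1 fm)
      then have "P \<tau> (jump_op (h (s - \<tau>))) z = P \<tau> (jump_op (T (s - \<tau>) f)) z - P \<tau> (jump_op f) z - P \<tau> (jump_op (?u (s - \<tau>))) z"
        using U1 by (simp add: P_diff bmeas_diff bmeas_jump_op1 bmeas_T1 fm)
      then show "(if \<tau> \<le> s then P \<tau> (jump_op (T (s - \<tau>) f)) z else 0) - (if \<tau> \<le> s then P \<tau> (jump_op f) z else 0)
       - (if \<tau> \<le> s then P \<tau> (jump_op (?u (s - \<tau>))) z else 0) = (if \<tau> \<le> s then P \<tau> (jump_op (h (s - \<tau>))) z else 0)" by simp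
    qed
    finally have "\<bar>w s z\<bar> = \<bar>\<integral>\<tau>. (if \<tau> \<le> s then P \<tau> (jump_op (h (s - \<tau>))) z else 0) \<partial>expo c\<bar>" by simp
    also have "\<dots> \<le> b * (1 - exp (- c * s))"
    proof (rule expo_early[OF c s(1) b(1) bmeas_early[OF hm]])
      fix \<tau> assume \<tau>: "0 \<le> \<tau>" "\<tau> \<le> s"
      have "h (s - \<tau>) y = w (s - \<tau>) y" for y unfolding h_def w_def using \<tau> by (simp add: min_absorb2)
      then have "\<bar>h (s - \<tau>) y\<bar> \<le> b" for y using b(2)[of "s - \<tau>" y] \<tau> s by simp
      then show "\<bar>P \<tau> (jump_op (h (s - \<tau>))) z\<bar> \<le> b"
        by (intro P_bound bmeas_jump_op1 h1 jump_op_bound)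
    qed
    finally show "\<bar>w s z\<bar> \<le> b * (1 - exp (- c * s))" .
  qed
  then show ?thesis unfolding w_def by simp
qed

text \<open>At horizon 0 the ring term is at most 1 - e^0 = 0, so \<open>T 0\<close> acts on the
  indicator of \<open>x\<close> as the free motion does, which starts at \<open>x\<close>.\<close>

lemma AE_law_start: "AE \<omega> in law x. \<omega> 0 = x"
proof -
  interpret prob_space "law x" by (rule law_prob)
  let ?f = "indicator {x} :: 'a \<Rightarrow> real"
  have f: "bmeas borel ?f" by (intro bmeas_indicator) simp
  have h1: "bmeas borel (\<lambda>\<tau>. P \<tau> (jump_op (T (0 - \<tau>) ?f)) x)" by (rule bmeas_early[OF T_joint[OF f]])
  have h2: "\<bar>P \<tau> (jump_op (T (0 - \<tau>) ?f)) x\<bar> \<le> 1" for \<tau>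
    by (intro P_bound jump_op_bound T_bound bmeas_jump_op1 bmeas_T1 f) (simp add: indicator_def)
  have "\<bar>\<integral>\<tau>. (if \<tau> \<le> 0 then P \<tau> (jump_op (T (0 - \<tau>) ?f)) x else 0) \<partial>expo c\<bar> \<le> 1 * (1 - exp (- c * 0))"
    by (rule expo_early[OF c order_refl zero_le_one h1 h2])
  then have T1: "T 0 ?f x = 1" using T_split[OF f order_refl, of x] P_0[OF f, of x] by simp
  have m: "(\<lambda>\<omega>. \<omega> 0) \<in> law x \<rightarrow>\<^sub>M borel"
    using measurable_skorokhod_eval[of 0 UNIV] by (simp add: measurable_cong_sets[OF law_prob(1) refl])
  define A where "A = {\<omega> \<in> space (law x). \<omega> 0 = x}"
  have A: "A \<in> sets (law x)" unfolding A_def using measurable_sets[OF m, of "{x}"] by (simp add: vimage_def Int_def conj_commute)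
  have "prob A = (\<integral>\<omega>. indicator A \<omega> \<partial>law x)" using A by simp
  also have "\<dots> = T 0 ?f x" unfolding T_def A_def by (intro Bochner_Integration.integral_cong) (auto simp: indicator_def)
  finally have "prob A = 1" using T1 by simp
  then have "AE \<omega> in law x. \<omega> \<in> A" by (rule AE_prob_1)
  then show ?thesis by eventually_elim (simp add: A_def)
qed

text \<open>The Markov property at \<open>s\<close> reduces the increment over an event to
  \<open>T t f - f\<close> at the position \<open>\<omega> s\<close>; \<open>T_dynkin\<close> turns
  this into a time integral, and the Markov property read backwards restores \<open>gen f\<close> at
  the position at time \<open>s + u\<close>.\<close>

lemma law_solves: "solves_martingale_problem gen D0 x (law x)"
proof -
  have bl: "bmeas (law x) h \<longleftrightarrow> bmeas paths h" for h by (rule bmeas_sets_cong[OF law_prob(1)])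
  have "(\<integral>\<omega>. indicator B \<omega> * (f (\<omega> (s + t)) - f (\<omega> s)) \<partial>law x) = (\<integral>u. \<integral>\<omega>. indicator B \<omega> * gen f (\<omega> (max 0 (s + u))) \<partial>law x \<partial>unif t)"
    if f: "f \<in> D0" and s: "0 \<le> s" and t: "0 \<le> t" and B: "B \<in> sets (path_filtration UNIV s)" for f s t B
  proof -
    note fm = D0[OF f] and gm = bmeas_gen[OF f]
    have iB: "bmeas paths (indicator B)" using B path_filtration_subset by (intro bmeas_indicator) blast
    have iB2: "bmeas (paths \<Otimes>\<^sub>M borel) (\<lambda>q. indicator B (fst q))" by (rule bmeas_compose[OF iB]) simp
    have b: "bmeas paths (\<lambda>\<omega>. indicator B \<omega> * g (\<omega> r))" if "bmeas borel g" "0 \<le> r" for g r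
      by (intro bmeas_mult iB bmeas_skorokhod_eval that)
    have i: "integrable (law x) (\<lambda>\<omega>. indicator B \<omega> * g (\<omega> r))" if "bmeas borel g" "0 \<le> r" for g r
      using b[OF that] by (intro bmeas_integrable law_prob) (simp only: bl)
    have "(\<integral>\<omega>. indicator B \<omega> * (f (\<omega> (s + t)) - f (\<omega> s)) \<partial>law x)
      = (\<integral>\<omega>. indicator B \<omega> * f (\<omega> (s + t)) \<partial>law x) - (\<integral>\<omega>. indicator B \<omega> * f (\<omega> s) \<partial>law x)"
      unfolding right_diff_distrib using s t by (intro Bochner_Integration.integral_diff i fm) auto
    also have "\<dots> = (\<integral>\<omega>. indicator B \<omega> * T t f (\<omega> s) \<partial>law x) - (\<integral>\<omega>. indicator B \<omega> * f (\<omega> s) \<partial>law x)"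
      using law_markov[OF B s t fm] by simp
    also have "\<dots> = (\<integral>\<omega>. indicator B \<omega> * T t f (\<omega> s) - indicator B \<omega> * f (\<omega> s) \<partial>law x)"
      using s by (intro Bochner_Integration.integral_diff[symmetric] i fm bmeas_T1) auto
    also have "\<dots> = (\<integral>\<omega>. \<integral>u. indicator B \<omega> * T u (gen f) (\<omega> s) \<partial>unif t \<partial>law x)"
      using T_dynkin[OF f t] by (intro Bochner_Integration.integral_cong refl) (simp add: U_def right_diff_distrib[symmetric])
    also have "\<dots> = (\<integral>u. \<integral>\<omega>. indicator B \<omega> * T u (gen f) (\<omega> s) \<partial>law x \<partial>unif t)"
    proof (rule bmeas_swap[OF law_prob(4) finite_measure_unif])
      have "(\<lambda>q. (snd q, fst q s)) \<in> paths \<Otimes>\<^sub>M borel \<rightarrow>\<^sub>M borel \<Otimes>\<^sub>M (borel :: 'a measure)"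
        by (intro measurable_Pair measurable_snd measurable_compose[OF measurable_fst measurable_skorokhod_eval] s)
      from bmeas_mult[OF iB2 bmeas_compose[OF T_joint[OF gm] this]]
      show "bmeas (law x \<Otimes>\<^sub>M unif t) (\<lambda>q. indicator B (fst q) * T (snd q) (gen f) (fst q s))"
        by (simp add: bmeas_sets_cong[OF sets_pair_measure_cong[OF law_prob(1) sets_unif]])
    qed
    also have "\<dots> = (\<integral>u. \<integral>\<omega>. indicator B \<omega> * gen f (\<omega> (max 0 (s + u))) \<partial>law x \<partial>unif t)"
    proof (rule integral_unif_cong)
      fix u :: real assume "0 \<le> u" "u \<le> t"
      then show "(\<integral>\<omega>. indicator B \<omega> * T u (gen f) (\<omega> s) \<partial>law x) = (\<integral>\<omega>. indicator B \<omega> * gen f (\<omega> (max 0 (s + u))) \<partial>law x)"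
        using law_markov[OF B s _ gm, of u x] s by simp
    next
      have ker: "bmeas borel (\<lambda>u. \<integral>\<omega>. h \<omega> u \<partial>law x)" if h: "bmeas (paths \<Otimes>\<^sub>M borel) (\<lambda>q. h (fst q) (snd q))" for h :: "(real \<Rightarrow> 'a) \<Rightarrow> real \<Rightarrow> real"
      proof (rule bmeas_kernel[where N=paths and L="\<lambda>_. law x"])
        show "bmeas (borel \<Otimes>\<^sub>M paths) (\<lambda>p. h (snd p) (fst p))"
          using bmeas_compose[OF h, of "\<lambda>p. (snd p, fst p)" "borel \<Otimes>\<^sub>M paths"] by simp
        show "(\<lambda>_. law x) \<in> borel \<rightarrow>\<^sub>M prob_algebra paths" by (intro measurable_const measurable_space[OF law_measurable]) simp
      qed
      have "(\<lambda>q. (snd q, fst q s)) \<in> paths \<Otimes>\<^sub>M borel \<rightarrow>\<^sub>M borel \<Otimes>\<^sub>M (borel :: 'a measure)"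
        by (intro measurable_Pair measurable_snd measurable_compose[OF measurable_fst measurable_skorokhod_eval] s)
      from bmeas_mult[OF iB2 bmeas_compose[OF T_joint[OF gm] this]]
      have "bmeas (paths \<Otimes>\<^sub>M borel) (\<lambda>q. indicator B (fst q) * T (snd q) (gen f) (fst q s))" by simp
      from bmeasD[OF ker[OF this]] show "(\<lambda>u. \<integral>\<omega>. indicator B \<omega> * T u (gen f) (\<omega> s) \<partial>law x) \<in> borel_measurable borel" .
      have "bmeas (paths \<Otimes>\<^sub>M borel) (\<lambda>q. indicator B (fst q) * gen f (fst q (max 0 (s + snd q))))"
        by (intro bmeas_mult iB2 bmeas_eval_shift gm)
      from bmeasD[OF ker[OF this]] show "(\<lambda>u. \<integral>\<omega>. indicator B \<omega> * gen f (\<omega> (max 0 (s + u))) \<partial>law x) \<in> borel_measurable borel" .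
    qed
    finally show ?thesis .
  qed
  then show ?thesis
    using AE_law_start[of x] measurable_space[OF law_measurable, of x]
    by (subst solves_martingale_problem_iff[OF D0 bmeas_gen]) auto
qed

end

section \<open>Uniqueness for perturbed generators\<close>

text \<open>Lets an identity with differences be stated as equality of two finite measures, the kind
  of equality that a determining class yields. It serves again for the mixture of jumping and
  staying put.\<close>

definition sum_measure :: "'a measure \<Rightarrow> 'a measure \<Rightarrow> 'a measure" where
  "sum_measure M N = measure_of (space M) (sets M) (\<lambda>A. emeasure M A + emeasure N A)"

lemma sets_sum_measure [simp, measurable_cong]: "sets (sum_measure M N) = sets M"
  unfolding sum_measure_def by (simp add: sets.sets_measure_of_eq)

lemma space_sum_measure [simp]: "space (sum_measure M N) = space M"
  by (rule sets_eq_imp_space_eq) simp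

lemma emeasure_sum_measure:
  assumes "sets N = sets M" "A \<in> sets M" shows "emeasure (sum_measure M N) A = emeasure M A + emeasure N A"
proof (rule emeasure_measure_of[OF sum_measure_def])
  show "sets M \<subseteq> Pow (space M)" by (rule sets.space_closed)
  show "A \<in> sets (sum_measure M N)" using assms by simp
  show "positive (sets (sum_measure M N)) (\<lambda>A. emeasure M A + emeasure N A)" by (simp add: positive_def)
  show "countably_additive (sets (sum_measure M N)) (\<lambda>A. emeasure M A + emeasure N A)"
    using assms(1) by (auto intro!: countably_additiveI simp: suminf_add[symmetric] suminf_emeasure subset_eq)
qed

lemma nn_integral_sum_measure:
  assumes sN: "sets N = sets M" and "f \<in> borel_measurable M"
  shows "(\<integral>\<^sup>+x. f x \<partial>sum_measure M N) = (\<integral>\<^sup>+x. f x \<partial>M) + (\<integral>\<^sup>+x. f x \<partial>N)"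
  using assms(2)
proof (induction rule: borel_measurable_induct)
  have mN: "h \<in> borel_measurable N" "h \<in> borel_measurable (sum_measure M N)" if "h \<in> borel_measurable M" for h :: "'a \<Rightarrow> ennreal"
    using that measurable_cong_sets[OF sN refl] measurable_cong_sets[OF sets_sum_measure refl] by blast+
  {
    case (cong f g)
    have eq: "(\<integral>\<^sup>+x. f x \<partial>K) = (\<integral>\<^sup>+x. g x \<partial>K)" if "space K = space M" for K
      using cong(3) that by (intro nn_integral_cong) simp
    show ?case
      unfolding eq[OF refl] eq[OF sets_eq_imp_space_eq[OF sN]] eq[OF space_sum_measure] by (rule cong(4))
  next
    case (set A)
    have N: "A \<in> sets N" "A \<in> sets (sum_measure M N)" using set sN by simp_all
    show ?case
      unfolding nn_integral_indicator[OF set] nn_integral_indicator[OF N(1)] nn_integral_indicator[OF N(2)]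
      by (rule emeasure_sum_measure[OF sN set])
  next
    case (mult u k)
    have u: "u \<in> borel_measurable M" using mult by auto
    note u = u mN[OF u]
    show ?case
      unfolding nn_integral_cmult[OF u(1)] nn_integral_cmult[OF u(2)] nn_integral_cmult[OF u(3)] mult.IH
      by (rule distrib_left)
  next
    case (add u v)
    have u: "u \<in> borel_measurable M" and v: "v \<in> borel_measurable M" using add by auto
    note u = u mN[OF u] and v = v mN[OF v]
    show ?case
      unfolding nn_integral_add[OF v(1) u(1)] nn_integral_add[OF v(2) u(2)] nn_integral_add[OF v(3) u(3)] add.IH
      by (simp add: ac_simps)
  next
    case (seq F)
    have "(\<integral>\<^sup>+x. (SUP i. F i) x \<partial>K) = (SUP i. \<integral>\<^sup>+x. F i x \<partial>K)" if "\<And>i. F i \<in> borel_measurable K" for K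
      using nn_integral_monotone_convergence_SUP[OF seq(3) that] by (simp add: image_comp)
    then have "(\<integral>\<^sup>+x. (SUP i. F i) x \<partial>K) = (SUP i. \<integral>\<^sup>+x. F i x \<partial>K)" if "K = M \<or> K = N \<or> K = sum_measure M N" for K
      using that seq(1) mN by blast
    then show ?case
      using seq(3) seq.IH
      by (simp add: ennreal_SUP_add[symmetric] incseq_nn_integral)
  }
qed

lemma finite_measure_sum_measure:
  assumes "sets N = sets M" "finite_measure M" "finite_measure N" shows "finite_measure (sum_measure M N)"
  using assms finite_measure.emeasure_finite[of M "space M"] finite_measure.emeasure_finite[of N "space M"]
  by (intro finite_measureI) (simp add: emeasure_sum_measure)

lemma integral_sum_measure:
  assumes sN: "sets N = sets M" and fin: "finite_measure M" "finite_measure N" and f: "bmeas M f"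
  shows "(\<integral>x. f x \<partial>sum_measure M N) = (\<integral>x. f x \<partial>M) + (\<integral>x. f x \<partial>N)"
proof -
  have i: "integrable M f" "integrable N f" "integrable (sum_measure M N) f"
    using f fin finite_measure_sum_measure[OF sN fin] bmeas_sets_cong[OF sN] bmeas_sets_cong[OF sets_sum_measure, of M N]
    by (auto intro!: bmeas_integrable)
  have n: "(\<integral>\<^sup>+x. ennreal (g x) \<partial>sum_measure M N) = (\<integral>\<^sup>+x. ennreal (g x) \<partial>M) + (\<integral>\<^sup>+x. ennreal (g x) \<partial>N)"
    if "g \<in> borel_measurable M" for g :: "'a \<Rightarrow> real"
    using that by (intro nn_integral_sum_measure[OF sN]) simp
  have fin': "(\<integral>\<^sup>+x. ennreal (f x) \<partial>K) < top" "(\<integral>\<^sup>+x. ennreal (- f x) \<partial>K) < top" if "integrable K f" for K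
    using that by (auto simp: real_integrable_def top.not_eq_extremum)
  show ?thesis
    unfolding real_lebesgue_integral_def[OF i(1)] real_lebesgue_integral_def[OF i(2)] real_lebesgue_integral_def[OF i(3)]
    using n[of f] n[of "\<lambda>x. - f x"] bmeasD[OF f] fin'[OF i(1)] fin'[OF i(2)]
    by (simp add: enn2real_plus)
qed

section \<open>Integrals over the triangle u + v \<le> T\<close>

lemma integral_unif_reflect:
  fixes h :: "real \<Rightarrow> real"
  assumes h: "bmeas borel h" shows "(\<integral>u. h (T - u) \<partial>unif T) = (\<integral>u. h u \<partial>unif T)"
proof -
  note [measurable] = bmeasD[OF h]
  have "(\<integral>u. h u \<partial>unif T) = (\<integral>u. indicator {0..T} u * h u \<partial>lborel)" by (simp add: integral_unif set_lebesgue_integral_def)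
  also have "\<dots> = (\<integral>u. indicator {0..T} (T + (-1) * u) * h (T + (-1) * u) \<partial>lborel)"
    by (subst lborel_integral_real_affine[where c="-1" and t=T]) auto
  also have "\<dots> = (\<integral>u. h (T - u) \<partial>unif T)"
    by (subst integral_unif) (auto simp: set_lebesgue_integral_def indicator_def intro!: Bochner_Integration.integral_cong)
  finally show ?thesis ..
qed

lemma bmeas_integral_unif_joint:
  assumes h: "bmeas (borel \<Otimes>\<^sub>M borel) (\<lambda>q. h (fst q) (snd q))"
  shows "bmeas borel (\<lambda>u. \<integral>v. (if u + v \<le> T then h u v else 0) \<partial>unif S)"
proof (rule bmeas_integral_unif)
  have "Measurable.pred (borel \<Otimes>\<^sub>M borel) (\<lambda>q. fst q + snd q \<le> (T :: real))" by measurable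
  then show "bmeas (borel \<Otimes>\<^sub>M borel) (\<lambda>q. if fst q + snd q \<le> T then h (fst q) (snd q) else 0)"
    by (intro bmeas_If h bmeas_const)
qed

lemma bmeas_pair_swap:
  assumes "bmeas (M \<Otimes>\<^sub>M N) (\<lambda>q. h (fst q) (snd q))" shows "bmeas (N \<Otimes>\<^sub>M M) (\<lambda>q. h (snd q) (fst q))"
  using bmeas_compose[OF assms, of "\<lambda>q. (snd q, fst q)" "N \<Otimes>\<^sub>M M"] by simp

lemma triangle_swap:
  fixes h :: "real \<Rightarrow> real \<Rightarrow> real"
  assumes h: "bmeas (borel \<Otimes>\<^sub>M borel) (\<lambda>q. h (fst q) (snd q))"
  shows "(\<integral>u. \<integral>v. (if u + v \<le> T then h u v else 0) \<partial>unif T \<partial>unif T) = (\<integral>v. \<integral>u. (if u + v \<le> T then h u v else 0) \<partial>unif T \<partial>unif T)"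
proof (rule bmeas_swap[OF finite_measure_unif finite_measure_unif])
  have "Measurable.pred (borel \<Otimes>\<^sub>M borel) (\<lambda>q. fst q + snd q \<le> (T :: real))" by measurable
  then have "bmeas (borel \<Otimes>\<^sub>M borel) (\<lambda>q. if fst q + snd q \<le> T then h (fst q) (snd q) else 0)"
    by (intro bmeas_If h bmeas_const)
  then show "bmeas (unif T \<Otimes>\<^sub>M unif T) (\<lambda>q. if fst q + snd q \<le> T then h (fst q) (snd q) else 0)"
    by (simp only: bmeas_sets_cong[OF sets_pair_measure_cong[OF sets_unif sets_unif]])
qed

lemma triangle_section:
  fixes h :: "real \<Rightarrow> real"
  assumes h: "bmeas borel h" and u: "0 \<le> u" "u \<le> T"
  shows "(\<integral>v. (if u + v \<le> T then h v else 0) \<partial>unif T) = (\<integral>v. h v \<partial>unif (T - u))"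
  using integral_unif_restrict[OF h, of "T - u" T] u by (simp add: le_diff_eq add.commute)

text \<open>
  In the application \<open>\<mu>\<close> is a solution restricted to an event of the past of \<open>s\<close>, so that its total
  mass is arbitrary, and \<open>Y u\<close> evaluates the path at \<open>s + u\<close>.
\<close>

locale forward_solution = jump_perturbation +
  fixes \<mu> :: "'w measure" and Y :: "real \<Rightarrow> 'w \<Rightarrow> 'a"
  assumes fin: "finite_measure \<mu>" and nonempty: "space \<mu> \<noteq> {}"
    and Y: "(\<lambda>(u, w). Y u w) \<in> borel \<Otimes>\<^sub>M \<mu> \<rightarrow>\<^sub>M borel"
    and forward: "f \<in> D0 \<Longrightarrow> 0 \<le> t \<Longrightarrow>
      (\<integral>w. f (Y t w) \<partial>\<mu>) = (\<integral>w. f (Y 0 w) \<partial>\<mu>) + (\<integral>u. \<integral>w. gen f (Y u w) \<partial>\<mu> \<partial>unif t)"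
begin

definition m :: "real \<Rightarrow> ('a \<Rightarrow> real) \<Rightarrow> real" where "m t f = (\<integral>w. f (Y t w) \<partial>\<mu>)"

lemma Y_measurable: "Y t \<in> \<mu> \<rightarrow>\<^sub>M borel"
  using measurable_compose[OF measurable_Pair1' Y, of t] by simp

lemma integrable_m: "bmeas borel f \<Longrightarrow> integrable \<mu> (\<lambda>w. f (Y t w))"
  by (rule bmeas_integrable[OF fin]) (rule bmeas_compose[OF _ Y_measurable])

lemma m_add: "bmeas borel f \<Longrightarrow> bmeas borel g \<Longrightarrow> m t (\<lambda>x. f x + g x) = m t f + m t g"
  unfolding m_def by (intro Bochner_Integration.integral_add integrable_m)

lemma m_diff: "bmeas borel f \<Longrightarrow> bmeas borel g \<Longrightarrow> m t (\<lambda>x. f x - g x) = m t f - m t g"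
  unfolding m_def by (intro Bochner_Integration.integral_diff integrable_m)

lemma m_cmult: "m t (\<lambda>x. k * f x) = k * m t f"
  unfolding m_def by simp

definition mass :: real where "mass = measure \<mu> (space \<mu>)"

lemma mass_nonneg: "0 \<le> mass" unfolding mass_def by simp

lemma m_bound:
  assumes f: "bmeas borel f" and B: "\<And>x. \<bar>f x\<bar> \<le> B" shows "\<bar>m t f\<bar> \<le> mass * B"
proof -
  have "\<bar>m t f\<bar> \<le> (\<integral>w. \<bar>f (Y t w)\<bar> \<partial>\<mu>)" unfolding m_def by (rule integral_abs_bound)
  also have "\<dots> \<le> (\<integral>w. B \<partial>\<mu>)"
    using B by (intro integral_mono integrable_abs integrable_m f finite_measure.integrable_const[OF fin]) auto
  finally show ?thesis unfolding mass_def by (simp add: mult.commute)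
qed

lemma bmeas_m:
  assumes u: "u \<in> borel_measurable N" and g: "bmeas (N \<Otimes>\<^sub>M borel) (\<lambda>q. g (fst q) (snd q))"
  shows "bmeas N (\<lambda>n. m (u n) (g n))"
proof -
  interpret finite_measure \<mu> by (rule fin)
  have "(\<lambda>q. (u (fst q), snd q)) \<in> N \<Otimes>\<^sub>M \<mu> \<rightarrow>\<^sub>M borel \<Otimes>\<^sub>M \<mu>"
    using u by measurable
  from measurable_compose[OF this Y] have "(\<lambda>q. Y (u (fst q)) (snd q)) \<in> N \<Otimes>\<^sub>M \<mu> \<rightarrow>\<^sub>M borel" by simp
  then have "(\<lambda>q. (fst q, Y (u (fst q)) (snd q))) \<in> N \<Otimes>\<^sub>M \<mu> \<rightarrow>\<^sub>M N \<Otimes>\<^sub>M borel" by measurable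
  from bmeas_compose[OF g this] have b: "bmeas (N \<Otimes>\<^sub>M \<mu>) (\<lambda>q. g (fst q) (Y (u (fst q)) (snd q)))" by simp
  obtain B where B: "0 \<le> B" "\<And>q. q \<in> space (N \<Otimes>\<^sub>M (borel :: 'a measure)) \<Longrightarrow> \<bar>g (fst q) (snd q)\<bar> \<le> B" by (rule bmeasE[OF g]) blast
  show ?thesis
  proof (rule bmeasI)
    have "(\<lambda>(n, w). g n (Y (u n) w)) \<in> borel_measurable (N \<Otimes>\<^sub>M \<mu>)" using bmeasD[OF b] by (simp add: split_beta')
    then show "(\<lambda>n. m (u n) (g n)) \<in> borel_measurable N" unfolding m_def by (rule borel_measurable_lebesgue_integral)
    show "\<bar>m (u n) (g n)\<bar> \<le> mass * B" if "n \<in> space N" for n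
      using B(2)[of "(n, _)"] that by (intro m_bound bmeas_section[OF g that]) (simp add: space_pair_measure)
  qed
qed

lemma bmeas_m_time: "bmeas borel f \<Longrightarrow> bmeas borel (\<lambda>u. m u f)"
  by (rule bmeas_m[of "\<lambda>u. u" borel "\<lambda>_. f"]) (auto intro: bmeas_snd)

text \<open>\<open>P v f\<close> is approximated by some \<open>k\<close> in \<open>D0\<close>
  together with its image under \<open>L\<close>. The forward equation for \<open>k\<close> then
  holds for \<open>P v f\<close> up to an error linear in \<open>e\<close>, since \<open>gen\<close>
  adds to \<open>L\<close> only a bounded operator.\<close>

lemma forward_P:
  assumes f: "f \<in> D0" and u: "0 \<le> u" and v: "0 \<le> v"
  shows "m u (P v f) = m 0 (P v f) + (\<integral>r. m r (\<lambda>x. P v (L f) x + c * (jump_op (P v f) x - P v f x)) \<partial>unif u)"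
proof -
  let ?g = "P v f" and ?l = "P v (L f)"
  let ?G = "\<lambda>x. ?l x + c * (jump_op ?g x - ?g x)"
  have gm: "bmeas borel ?g" "bmeas borel ?l" "bmeas borel (jump_op ?g)"
    by (intro bmeas_P1 bmeas_jump_op1 D0[OF f] L[OF f])+
  have Gm: "bmeas borel ?G" by (intro bmeas_add bmeas_cmult bmeas_diff gm)
  let ?\<Delta> = "m u ?g - m 0 ?g - (\<integral>r. m r ?G \<partial>unif u)"
  \<comment> \<open>Errors in units of \<open>e\<close>: \<open>mass\<close> for each of the two
    fixed times, and over the interval of length \<open>u\<close> a multiple of \<open>mass\<close>,
    once for \<open>L\<close> and \<open>2 * c\<close> times for the jump part.\<close>
  define Cst where "Cst = 2 * mass + u * (mass * (1 + 2 * c))"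
  have Cst: "0 \<le> Cst" unfolding Cst_def using mass_nonneg u c by auto
  have bound: "\<bar>?\<Delta>\<bar> \<le> Cst * e" if e: "0 < e" for e
  proof -
    obtain k where k: "k \<in> D0" "\<And>x. \<bar>k x - ?g x\<bar> \<le> e" "\<And>x. \<bar>L k x - ?l x\<bar> \<le> e"
      using approx[OF f v e] by blast
    have km: "bmeas borel k" "bmeas borel (gen k)" "bmeas borel (jump_op k)" by (intro D0 bmeas_gen bmeas_jump_op1 k)+
    have d: "bmeas borel (\<lambda>x. k x - ?g x)" by (intro bmeas_diff km gm)
    have 1: "\<bar>m s k - m s ?g\<bar> \<le> mass * e" for s
      using m_bound[OF d k(2), of s] m_diff[OF km(1) gm(1)] by simp
    have gg: "\<bar>gen k x - ?G x\<bar> \<le> (1 + 2 * c) * e" for x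
    proof -
      have "jump_op (\<lambda>x. k x - ?g x) x = jump_op k x - jump_op ?g x" by (rule jump_op_diff[OF km(1) gm(1)])
      then have "\<bar>jump_op k x - jump_op ?g x\<bar> \<le> e" using jump_op_bound[OF d k(2), of x] by simp
      then have "\<bar>(jump_op k x - jump_op ?g x) - (k x - ?g x)\<bar> \<le> 2 * e" using k(2)[of x] by linarith
      then have "\<bar>c * ((jump_op k x - jump_op ?g x) - (k x - ?g x))\<bar> \<le> c * (2 * e)"
        unfolding abs_mult using c by (intro mult_mono) auto
      moreover have "gen k x - ?G x = (L k x - ?l x) + c * ((jump_op k x - jump_op ?g x) - (k x - ?g x))"
        unfolding gen_def by (simp add: algebra_simps)
      ultimately show ?thesis using k(3)[of x] by (simp add: algebra_simps)
    qed
    have 2: "\<bar>(\<integral>r. m r (gen k) \<partial>unif u) - (\<integral>r. m r ?G \<partial>unif u)\<bar> \<le> u * (mass * ((1 + 2 * c) * e))"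
    proof -
      have i: "integrable (unif u) (\<lambda>r. m r (gen k))" "integrable (unif u) (\<lambda>r. m r ?G)"
        by (intro integrable_unif bmeas_m_time km Gm)+
      have "\<bar>(\<integral>r. m r (gen k) \<partial>unif u) - (\<integral>r. m r ?G \<partial>unif u)\<bar> = \<bar>\<integral>r. m r (gen k) - m r ?G \<partial>unif u\<bar>"
        using i by simp
      also have "\<dots> \<le> (\<integral>r. \<bar>m r (gen k) - m r ?G\<bar> \<partial>unif u)" by (rule integral_abs_bound)
      also have "\<dots> \<le> (\<integral>r. mass * ((1 + 2 * c) * e) \<partial>unif u)"
      proof (rule integral_mono)
        show "integrable (unif u) (\<lambda>r. \<bar>m r (gen k) - m r ?G\<bar>)" "integrable (unif u) (\<lambda>r. mass * ((1 + 2 * c) * e))"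
          by (rule integrable_abs[OF Bochner_Integration.integrable_diff[OF i]], rule integrable_unif[OF bmeas_const])
        show "\<bar>m r (gen k) - m r ?G\<bar> \<le> mass * ((1 + 2 * c) * e)" for r
          using m_bound[OF bmeas_diff[OF km(2) Gm] gg, of r] m_diff[OF km(2) Gm, of r] by simp
      qed
      also have "\<dots> = u * (mass * ((1 + 2 * c) * e))" using u by (simp add: measure_unif)
      finally show ?thesis .
    qed
    have fk: "m u k = m 0 k + (\<integral>r. m r (gen k) \<partial>unif u)" using forward[OF k(1) u] unfolding m_def .
    have "\<bar>?\<Delta>\<bar> \<le> mass * e + mass * e + u * (mass * ((1 + 2 * c) * e))"
      using 1[of u] 1[of 0] 2 fk by linarith
    also have "\<dots> = Cst * e" unfolding Cst_def by (simp add: algebra_simps)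
    finally show ?thesis .
  qed
  have "\<bar>?\<Delta>\<bar> \<le> 0"
  proof (rule field_le_epsilon)
    fix e :: real assume e: "0 < e"
    \<comment> \<open>Division by \<open>Cst + 1\<close> because \<open>Cst\<close> is 0 when the
      total mass is.\<close>
    have "\<bar>?\<Delta>\<bar> \<le> Cst * (e / (Cst + 1))" by (rule bound) (use e Cst in auto)
    also have "\<dots> \<le> e" using e Cst by (simp add: pos_divide_le_eq)
    finally show "\<bar>?\<Delta>\<bar> \<le> 0 + e" by simp
  qed
  then show ?thesis by simp
qed

definition E :: "real \<Rightarrow> real" where "E v = exp (- c * max 0 v)"

lemma bmeas_E: "bmeas borel E"
  unfolding E_def by (rule bmeas_exp)

lemma bmeas_E2: "bmeas (borel \<Otimes>\<^sub>M borel) (\<lambda>q. E (fst q))" "bmeas (borel \<Otimes>\<^sub>M borel) (\<lambda>q. E (snd q))"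
  by (rule bmeas_compose[OF bmeas_E]; simp)+

lemma bmeas_mP:
  assumes "bmeas borel f" shows "bmeas (borel \<Otimes>\<^sub>M borel) (\<lambda>q. m (fst q) (P (snd q) f))"
proof (rule bmeas_m[of fst _ "\<lambda>q. P (snd q) f"])
  have "(\<lambda>r. (snd (fst r), snd r)) \<in> ((borel :: real measure) \<Otimes>\<^sub>M (borel :: real measure)) \<Otimes>\<^sub>M borel \<rightarrow>\<^sub>M borel \<Otimes>\<^sub>M (borel :: 'a measure)" by measurable
  from bmeas_compose[OF P_joint[OF assms] this]
  show "bmeas (((borel :: real measure) \<Otimes>\<^sub>M (borel :: real measure)) \<Otimes>\<^sub>M borel) (\<lambda>r. P (snd (fst r)) f (snd r))" by simp
qed simp

lemma bmeas_jump_P: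
  assumes "bmeas borel f" shows "bmeas (borel \<Otimes>\<^sub>M borel) (\<lambda>q. jump_op (P (fst q) f) (snd q))"
proof (rule bmeas_jump_op[of snd _ "\<lambda>q. P (fst q) f"])
  have "(\<lambda>r. (fst (fst r), snd r)) \<in> ((borel :: real measure) \<Otimes>\<^sub>M (borel :: 'a measure)) \<Otimes>\<^sub>M borel \<rightarrow>\<^sub>M borel \<Otimes>\<^sub>M (borel :: 'a measure)" by measurable
  from bmeas_compose[OF P_joint[OF assms] this]
  show "bmeas (((borel :: real measure) \<Otimes>\<^sub>M (borel :: 'a measure)) \<Otimes>\<^sub>M borel) (\<lambda>r. P (fst (fst r)) f (snd r))" by simp
qed simp

lemma bmeas_mJP:
  assumes "bmeas borel f" shows "bmeas (borel \<Otimes>\<^sub>M borel) (\<lambda>q. m (fst q) (jump_op (P (snd q) f)))"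
proof (rule bmeas_m[of fst _ "\<lambda>q. jump_op (P (snd q) f)"])
  have "(\<lambda>r. (snd (fst r), snd r)) \<in> ((borel :: real measure) \<Otimes>\<^sub>M (borel :: real measure)) \<Otimes>\<^sub>M borel \<rightarrow>\<^sub>M borel \<Otimes>\<^sub>M (borel :: 'a measure)" by measurable
  from bmeas_compose[OF bmeas_jump_P[OF assms] this]
  show "bmeas (((borel :: real measure) \<Otimes>\<^sub>M (borel :: real measure)) \<Otimes>\<^sub>M borel) (\<lambda>r. jump_op (P (snd (fst r)) f) (snd r))" by simp
qed simp

text \<open>Decomposition at the last ring: \<open>u\<close> is its time and \<open>v\<close> the
  time elapsed since. The position at \<open>u\<close> jumps and moves freely for \<open>v\<close>;
  \<open>c\<close> is the rate of the ring, \<open>E v\<close> the probability that no other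
  follows.\<close>

definition W :: "real \<Rightarrow> ('a \<Rightarrow> real) \<Rightarrow> real" where
  "W \<theta> f = (\<integral>v. \<integral>u. (if u + v \<le> \<theta> then c * E v * m u (jump_op (P v f)) else 0) \<partial>unif \<theta> \<partial>unif \<theta>)"

definition occ :: "real \<Rightarrow> ('a \<Rightarrow> real) \<Rightarrow> real" where "occ \<theta> f = (\<integral>u. m u f \<partial>unif \<theta>)"

text \<open>
  The two-parameter function \<open>m u (e\<^sup>-\<^sup>c\<^sup>v P\<^sub>v f)\<close> is differentiated in \<open>u\<close> by the forward
  equation and in \<open>v\<close> by the semigroup; integrating both over the triangle \<open>u + v \<le> \<theta>\<close>,
  the boundary terms on the hypotenuse and the terms with \<open>L\<close> cancel.
\<close>

lemma occ_mild:
  assumes f: "f \<in> D0" and \<theta>: "0 \<le> \<theta>"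
  shows "occ \<theta> f = (\<integral>v. E v * m 0 (P v f) \<partial>unif \<theta>) + W \<theta> f"
proof -
  note fm = D0[OF f] and Lm = L[OF f]
  \<comment> \<open>The derivative of e^(-cv) \<open>P v f\<close> in \<open>v\<close> is e^(-cv)
    \<open>P v l\<close>. The same term - c \<open>f\<close> also comes from the jump part of the
    forward equation, so that one function \<open>a\<close> serves both directions and
    cancels.\<close>
  define l where "l = (\<lambda>x. L f x - c * f x)"
  have lm: "bmeas borel l" unfolding l_def by (intro bmeas_diff bmeas_cmult fm Lm)
  define \<Phi> where "\<Phi> u v = E v * m u (P v f)" for u v
  define a where "a u v = E v * m u (P v l)" for u v
  define b where "b u v = c * E v * m u (jump_op (P v f))" for u v
  have am: "bmeas (borel \<Otimes>\<^sub>M borel) (\<lambda>q. a (fst q) (snd q))" unfolding a_def by (intro bmeas_mult bmeas_E2 bmeas_mP lm)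
  have bm: "bmeas (borel \<Otimes>\<^sub>M borel) (\<lambda>q. b (fst q) (snd q))" unfolding b_def by (intro bmeas_mult bmeas_cmult bmeas_E2 bmeas_mJP fm)
  have \<Phi>m: "bmeas (borel \<Otimes>\<^sub>M borel) (\<lambda>q. \<Phi> (fst q) (snd q))" unfolding \<Phi>_def by (intro bmeas_mult bmeas_E2 bmeas_mP fm)
  have abm: "bmeas (borel \<Otimes>\<^sub>M borel) (\<lambda>q. a (fst q) (snd q) + b (fst q) (snd q))" by (intro bmeas_add am bm)
  have line: "bmeas borel (\<lambda>u. h (p u) (q u))" if "bmeas (borel \<Otimes>\<^sub>M borel) (\<lambda>q. h (fst q) (snd q))" "p \<in> borel_measurable borel" "q \<in> borel_measurable borel"
    for h :: "real \<Rightarrow> real \<Rightarrow> real" and p q :: "real \<Rightarrow> real"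
  proof -
    have "(\<lambda>u. (p u, q u)) \<in> borel \<rightarrow>\<^sub>M borel \<Otimes>\<^sub>M borel" using that by measurable
    from bmeas_compose[OF that(1) this] show ?thesis by simp
  qed
  have in_u: "\<Phi> u v = \<Phi> 0 v + (\<integral>r. a r v + b r v \<partial>unif u)" if u: "0 \<le> u" and v: "0 \<le> v" for u v
  proof -
    have Pl: "P v l x = P v (L f) x - c * P v f x" for x
      unfolding l_def using P_diff[OF Lm bmeas_cmult[OF fm, of c], of v x] by (simp add: P_cmult)
    have "E v * m r (\<lambda>x. P v (L f) x + c * (jump_op (P v f) x - P v f x)) = a r v + b r v" for r
    proof -
      have "(\<lambda>x. P v (L f) x + c * (jump_op (P v f) x - P v f x)) = (\<lambda>x. P v l x + c * jump_op (P v f) x)"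
        unfolding Pl by (simp add: algebra_simps)
      then have "m r (\<lambda>x. P v (L f) x + c * (jump_op (P v f) x - P v f x)) = m r (P v l) + c * m r (jump_op (P v f))"
        using m_add[OF bmeas_P1[OF lm] bmeas_cmult[OF bmeas_jump_op1[OF bmeas_P1[OF fm]], of c], of r v v] by (simp add: m_cmult)
      then show ?thesis unfolding a_def b_def by (simp add: algebra_simps)
    qed
    then have "(\<integral>r. a r v + b r v \<partial>unif u) = E v * (\<integral>r. m r (\<lambda>x. P v (L f) x + c * (jump_op (P v f) x - P v f x)) \<partial>unif u)"
      by (simp add: Bochner_Integration.integral_mult_right_zero[symmetric] del: Bochner_Integration.integral_mult_right_zero)
    then show ?thesis unfolding \<Phi>_def forward_P[OF f u v] by (simp add: algebra_simps)
  qed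
  have in_v: "\<Phi> u v = m u f + (\<integral>w. a u w \<partial>unif v)" if v: "0 \<le> v" for u v
  proof -
    have "E v * P v f x - f x = (\<integral>w. E w * P w l x \<partial>unif v)" for x
      using dynkin[OF f v, of x] integral_unif_exp[OF bmeasD[OF bmeas_P_time[OF lm, of x]], of v] v
      unfolding E_def l_def by simp
    then have "m u (\<lambda>x. E v * P v f x - f x) = (\<integral>w. \<integral>s. E s * P s l (Y u w) \<partial>unif v \<partial>\<mu>)" unfolding m_def by simp
    also have "\<dots> = (\<integral>s. \<integral>w. E s * P s l (Y u w) \<partial>\<mu> \<partial>unif v)"
    proof (rule bmeas_swap[OF fin finite_measure_unif])
      have "(\<lambda>q. (snd q, Y u (fst q))) \<in> \<mu> \<Otimes>\<^sub>M borel \<rightarrow>\<^sub>M borel \<Otimes>\<^sub>M (borel :: 'a measure)"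
        by (intro measurable_Pair measurable_snd measurable_compose[OF measurable_fst Y_measurable])
      from bmeas_compose[OF bmeas_mult[OF bmeas_compose[OF bmeas_E measurable_fst] P_joint[OF lm]] this]
      show "bmeas (\<mu> \<Otimes>\<^sub>M unif v) (\<lambda>q. E (snd q) * P (snd q) l (Y u (fst q)))"
        by (simp add: bmeas_sets_cong[OF sets_pair_measure_cong[OF refl sets_unif]])
    qed
    also have "\<dots> = (\<integral>w. a u w \<partial>unif v)" unfolding a_def m_def by simp
    finally have "m u (\<lambda>x. E v * P v f x - f x) = (\<integral>w. a u w \<partial>unif v)" .
    moreover have "m u (\<lambda>x. E v * P v f x - f x) = \<Phi> u v - m u f"
      unfolding \<Phi>_def using m_diff[OF bmeas_cmult[OF bmeas_P1[OF fm]] fm, of u "E v" v] by (simp add: m_cmult)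
    ultimately show ?thesis by simp
  qed
  let ?tri = "\<lambda>h. \<integral>v. \<integral>u. (if u + v \<le> \<theta> then h u v else 0) \<partial>unif \<theta> \<partial>unif \<theta>"
  \<comment> \<open>Sections at fixed \<open>v\<close>, with \<open>in_u\<close>: boundary values on
    the hypotenuse minus those on the edge u = 0.\<close>
  have tri_ab: "?tri (\<lambda>u v. a u v + b u v) = (\<integral>v. \<Phi> (\<theta> - v) v - \<Phi> 0 v \<partial>unif \<theta>)"
  proof (rule integral_unif_cong)
    fix v assume v: "0 \<le> v" "v \<le> \<theta>"
    have "(\<integral>u. (if u + v \<le> \<theta> then a u v + b u v else 0) \<partial>unif \<theta>) = (\<integral>u. a u v + b u v \<partial>unif (\<theta> - v))"
      using triangle_section[OF line[OF abm, of "\<lambda>u. u" "\<lambda>_. v"] v] by (simp add: add.commute cong: if_cong)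
    then show "(\<integral>u. (if u + v \<le> \<theta> then a u v + b u v else 0) \<partial>unif \<theta>) = \<Phi> (\<theta> - v) v - \<Phi> 0 v"
      using in_u[of "\<theta> - v" v] v by simp
  next
    have "bmeas borel (\<lambda>v. \<integral>u. (if v + u \<le> \<theta> then a u v + b u v else 0) \<partial>unif \<theta>)"
      by (rule bmeas_integral_unif_joint) (rule bmeas_pair_swap[OF abm])
    from bmeasD[OF this] show "(\<lambda>v. \<integral>u. (if u + v \<le> \<theta> then a u v + b u v else 0) \<partial>unif \<theta>) \<in> borel_measurable borel"
      by (simp add: add.commute cong: if_cong)
    show "(\<lambda>v. \<Phi> (\<theta> - v) v - \<Phi> 0 v) \<in> borel_measurable borel"
      by (rule bmeasD[OF bmeas_diff[OF line[OF \<Phi>m, of "\<lambda>v. \<theta> - v" "\<lambda>v. v"] line[OF \<Phi>m, of "\<lambda>_. 0" "\<lambda>v. v"]]]) simp_all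
  qed
  \<comment> \<open>Sections at fixed \<open>u\<close>, with \<open>in_v\<close>: hypotenuse minus
    the edge v = 0, where the occupation integral appears.\<close>
  have tri_a: "?tri a = (\<integral>u. \<Phi> u (\<theta> - u) - m u f \<partial>unif \<theta>)"
    unfolding triangle_swap[OF am, symmetric]
  proof (rule integral_unif_cong)
    fix u assume u: "0 \<le> u" "u \<le> \<theta>"
    have "(\<integral>v. (if u + v \<le> \<theta> then a u v else 0) \<partial>unif \<theta>) = (\<integral>v. a u v \<partial>unif (\<theta> - u))"
      by (rule triangle_section[OF line[OF am, of "\<lambda>_. u" "\<lambda>v. v"] u]) auto
    then show "(\<integral>v. (if u + v \<le> \<theta> then a u v else 0) \<partial>unif \<theta>) = \<Phi> u (\<theta> - u) - m u f"
      using in_v[of "\<theta> - u" u] u by simp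
  next
    show "(\<lambda>u. \<integral>v. (if u + v \<le> \<theta> then a u v else 0) \<partial>unif \<theta>) \<in> borel_measurable borel"
      by (rule bmeasD[OF bmeas_integral_unif_joint[OF am]])
    show "(\<lambda>u. \<Phi> u (\<theta> - u) - m u f) \<in> borel_measurable borel"
      by (rule bmeasD[OF bmeas_diff[OF line[OF \<Phi>m, of "\<lambda>u. u" "\<lambda>u. \<theta> - u"] bmeas_m_time[OF fm]]]) simp_all
  qed
  have tri_add: "?tri (\<lambda>u v. a u v + b u v) = ?tri a + ?tri b"
  proof -
    have ifm: "bmeas borel (\<lambda>u. if u + v \<le> \<theta> then h u v else 0)" if "bmeas (borel \<Otimes>\<^sub>M borel) (\<lambda>q. h (fst q) (snd q))" for h :: "real \<Rightarrow> real \<Rightarrow> real" and v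
    proof -
      have "Measurable.pred borel (\<lambda>u. u + v \<le> \<theta>)" by measurable
      then show ?thesis using line[OF that, of "\<lambda>u. u" "\<lambda>_. v"] by (intro bmeas_If) auto
    qed
    have outer: "bmeas borel (\<lambda>v. \<integral>u. (if u + v \<le> \<theta> then h u v else 0) \<partial>unif \<theta>)" if "bmeas (borel \<Otimes>\<^sub>M borel) (\<lambda>q. h (fst q) (snd q))" for h :: "real \<Rightarrow> real \<Rightarrow> real"
      using bmeas_integral_unif_joint[OF bmeas_pair_swap[OF that]] by (simp add: add.commute cong: if_cong)
    have "(\<integral>u. (if u + v \<le> \<theta> then a u v + b u v else 0) \<partial>unif \<theta>)
      = (\<integral>u. (if u + v \<le> \<theta> then a u v else 0) \<partial>unif \<theta>) + (\<integral>u. (if u + v \<le> \<theta> then b u v else 0) \<partial>unif \<theta>)" for v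
    proof -
      have "(\<integral>u. (if u + v \<le> \<theta> then a u v + b u v else 0) \<partial>unif \<theta>)
        = (\<integral>u. (if u + v \<le> \<theta> then a u v else 0) + (if u + v \<le> \<theta> then b u v else 0) \<partial>unif \<theta>)"
        by (intro Bochner_Integration.integral_cong) auto
      then show ?thesis using integrable_unif[OF ifm[OF am]] integrable_unif[OF ifm[OF bm]] by simp
    qed
    then show ?thesis
      using integrable_unif[OF outer[OF am]] integrable_unif[OF outer[OF bm]] by simp
  qed
  \<comment> \<open>The hypotenuse has been parametrised once by \<open>v\<close> and once by
    \<open>u\<close>; reflection identifies the two integrals, which then cancel.\<close>
  have refl: "(\<integral>v. \<Phi> (\<theta> - v) v \<partial>unif \<theta>) = (\<integral>u. \<Phi> u (\<theta> - u) \<partial>unif \<theta>)"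
    using integral_unif_reflect[OF line[OF \<Phi>m, of "\<lambda>u. u" "\<lambda>u. \<theta> - u"], of \<theta>] by simp
  have "(\<integral>v. \<Phi> (\<theta> - v) v - \<Phi> 0 v \<partial>unif \<theta>) = (\<integral>v. \<Phi> (\<theta> - v) v \<partial>unif \<theta>) - (\<integral>v. \<Phi> 0 v \<partial>unif \<theta>)"
    by (intro Bochner_Integration.integral_diff integrable_unif line[OF \<Phi>m]) auto
  moreover have "(\<integral>u. \<Phi> u (\<theta> - u) - m u f \<partial>unif \<theta>) = (\<integral>u. \<Phi> u (\<theta> - u) \<partial>unif \<theta>) - occ \<theta> f"
    unfolding occ_def by (intro Bochner_Integration.integral_diff integrable_unif line[OF \<Phi>m] bmeas_m_time fm) auto
  ultimately have "occ \<theta> f = (\<integral>v. \<Phi> 0 v \<partial>unif \<theta>) + ?tri b"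
    using tri_ab tri_a tri_add refl by linarith
  then show ?thesis unfolding W_def \<Phi>_def b_def by simp
qed

end

section \<open>Both sides of the mild equation as measures in f\<close>

lemma integral_pair_bmeas:
  assumes "finite_measure M" "finite_measure N" "bmeas (M \<Otimes>\<^sub>M N) h"
  shows "(\<integral>q. h q \<partial>(M \<Otimes>\<^sub>M N)) = (\<integral>x. \<integral>y. h (x, y) \<partial>N \<partial>M)"
proof -
  interpret M: finite_measure M by fact
  interpret N: finite_measure N by fact
  interpret P: pair_sigma_finite M N by unfold_locales
  have "integrable (M \<Otimes>\<^sub>M N) h"
    using bmeas_integrable[OF finite_measure_pair_measure[OF assms(2,1)] assms(3)] .
  from P.integral_fst'[OF this] show ?thesis by simp
qed

lemma finite_measure_density_indicator:
  assumes "finite_measure M" "A \<in> sets M" shows "finite_measure (density M (indicator A))"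
proof (rule finite_measureI)
  have "emeasure (density M (indicator A)) (space M) = emeasure M A"
    using assms(2) sets.sets_into_space[OF assms(2)]
    by (simp add: emeasure_restricted Int_absorb2)
  then show "emeasure (density M (indicator A)) (space (density M (indicator A))) \<noteq> \<infinity>"
    using finite_measure.emeasure_finite[OF assms(1), of A] by simp
qed

lemma integral_density_indicator:
  fixes f :: "'a \<Rightarrow> real"
  assumes A: "A \<in> sets M" and f: "f \<in> borel_measurable M"
  shows "(\<integral>x. f x \<partial>density M (indicator A)) = (\<integral>x. indicator A x * f x \<partial>M)"
proof -
  have "density M (indicator A) = density M (\<lambda>x. ennreal (indicator A x))" by (simp add: ennreal_indicator)
  then show ?thesis using A f by (simp add: integral_density)
qed

context forward_solution
begin

text \<open>The occupation measure of the process on \<open>[0, \<theta>]\<close>, obtained as the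
  image of time and \<open>\<mu>\<close> under \<open>Y\<close>.\<close>

lemma occ_measure:
  obtains \<nu> where "finite_measure \<nu>" "sets \<nu> = sets borel" "\<And>f. bmeas borel f \<Longrightarrow> (\<integral>x. f x \<partial>\<nu>) = occ \<theta> f"
proof
  let ?M = "unif \<theta> \<Otimes>\<^sub>M \<mu>"
  let ?Y = "\<lambda>q. Y (fst q) (snd q)"
  have s: "sets ?M = sets (borel \<Otimes>\<^sub>M \<mu>)" by (intro sets_pair_measure_cong) simp_all
  have Ym: "?Y \<in> ?M \<rightarrow>\<^sub>M borel" using Y by (simp add: split_beta' measurable_cong_sets[OF s refl])
  have fm: "finite_measure ?M" by (rule finite_measure_pair_measure[OF fin finite_measure_unif])
  show "finite_measure (distr ?M borel ?Y)" by (rule finite_measure.finite_measure_distr[OF fm Ym])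
  show "sets (distr ?M borel ?Y) = sets borel" by simp
  show "(\<integral>x. f x \<partial>distr ?M borel ?Y) = occ \<theta> f" if f: "bmeas borel f" for f
    unfolding integral_distr[OF Ym bmeasD[OF f]] occ_def m_def
    using integral_pair_bmeas[OF finite_measure_unif fin bmeas_compose[OF f Ym]] by simp
qed

definition inner :: "real \<Rightarrow> ('a \<Rightarrow> real) \<Rightarrow> real \<Rightarrow> real" where
  "inner \<theta> f \<tau> = (\<integral>u. (if u + \<tau> \<le> \<theta> then m u (jump_op (P \<tau> f)) else 0) \<partial>unif \<theta>)"

lemma bmeas_inner:
  assumes "bmeas borel f" shows "bmeas borel (inner \<theta> f)"
  using bmeas_integral_unif_joint[OF bmeas_pair_swap[OF bmeas_mJP[OF assms]], of \<theta> \<theta>]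
  unfolding inner_def by (simp add: add.commute cong: if_cong)

text \<open>The weight c e^(-cv) on \<open>[0, \<theta>]\<close> is the law of the clock, which
  makes \<open>expo_early\<close> applicable to \<open>W\<close>.\<close>

lemma W_expo:
  assumes f: "bmeas borel f" and \<theta>: "0 \<le> \<theta>"
  shows "W \<theta> f = (\<integral>\<tau>. (if \<tau> \<le> \<theta> then inner \<theta> f \<tau> else 0) \<partial>expo c)"
proof -
  have "(\<integral>u. (if u + v \<le> \<theta> then c * E v * m u (jump_op (P v f)) else 0) \<partial>unif \<theta>) = E v * (c * inner \<theta> f v)" for v
  proof -
    have "(\<integral>u. (if u + v \<le> \<theta> then c * E v * m u (jump_op (P v f)) else 0) \<partial>unif \<theta>)
      = (\<integral>u. (c * E v) * (if u + v \<le> \<theta> then m u (jump_op (P v f)) else 0) \<partial>unif \<theta>)"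
      by (intro Bochner_Integration.integral_cong) auto
    then show ?thesis unfolding inner_def by simp
  qed
  then have "W \<theta> f = (\<integral>v. E v * (c * inner \<theta> f v) \<partial>unif \<theta>)" unfolding W_def by simp
  also have "\<dots> = (\<integral>v. exp (- c * v) * (c * inner \<theta> f v) \<partial>unif \<theta>)"
    unfolding E_def by (rule integral_unif_exp[symmetric]) (intro bmeasD bmeas_cmult bmeas_inner f)
  also have "\<dots> = (\<integral>\<tau>. (if \<tau> \<le> \<theta> then inner \<theta> f \<tau> else 0) \<partial>expo c)"
    using integral_expo_atMost[OF c \<theta> bmeas_inner[OF f, of \<theta>]] by (simp add: ac_simps)
  finally show ?thesis .
qed

text \<open>Closes the recursion: with the delay \<open>\<tau>\<close> fixed, the jump term is an
  occupation integral over a shorter horizon, of another function that obeys the same bounds as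
  \<open>f\<close>.\<close>

lemma inner_eq_occ:
  assumes f: "bmeas borel f" and \<tau>: "0 \<le> \<tau>" "\<tau> \<le> \<theta>"
  shows "inner \<theta> f \<tau> = occ (\<theta> - \<tau>) (jump_op (P \<tau> f))"
  using triangle_section[OF bmeas_m_time[OF bmeas_jump_op1[OF bmeas_P1[OF f]]] \<tau>, of \<tau>]
  unfolding inner_def occ_def by (simp add: add.commute cong: if_cong)

text \<open>The measure is built as the formula reads: choose \<open>\<tau>\<close> from the clock
  and \<open>u\<close> with a sample point from time and \<open>\<mu>\<close>, restrict to the
  triangle, jump from the position at \<open>u\<close> and move freely for the time
  \<open>\<tau>\<close>.\<close>

lemma W_measure:
  assumes \<theta>: "0 \<le> \<theta>"
  obtains \<nu> where "finite_measure \<nu>" "sets \<nu> = sets borel" "\<And>f. bmeas borel f \<Longrightarrow> (\<integral>x. f x \<partial>\<nu>) = W \<theta> f"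
proof
  let ?N = "unif \<theta> \<Otimes>\<^sub>M \<mu>"
  let ?M = "expo c \<Otimes>\<^sub>M ?N"
  let ?B = "borel \<Otimes>\<^sub>M (borel \<Otimes>\<^sub>M \<mu>)"
  have sN: "sets ?N = sets (borel \<Otimes>\<^sub>M \<mu>)" by (intro sets_pair_measure_cong) simp_all
  have s: "sets ?M = sets ?B" by (intro sets_pair_measure_cong sN) simp_all
  note finN = finite_measure_pair_measure[OF fin finite_measure_unif, of \<theta>]
  note finM = finite_measure_pair_measure[OF finN finite_measure_expo[OF c]]
  define S where "S = {p \<in> space ?B. fst p \<le> \<theta> \<and> fst (snd p) + fst p \<le> \<theta>}"
  have SB: "S \<in> sets ?B" unfolding S_def by measurable
  then have S: "S \<in> sets ?M" using s by simp
  define \<beta> where "\<beta> = density ?M (indicator S)"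
  have s\<beta>: "sets \<beta> = sets ?B" unfolding \<beta>_def by (simp add: s)
  have fin\<beta>: "finite_measure \<beta>" unfolding \<beta>_def by (rule finite_measure_density_indicator[OF finM S])
  define K where "K p = J (Y (fst (snd p)) (snd (snd p))) \<bind> (\<lambda>z. distr (R z) borel (\<lambda>\<xi>. \<xi> (max 0 (fst p))))" for p
  have YM: "(\<lambda>p. Y (fst (snd p)) (snd (snd p))) \<in> ?B \<rightarrow>\<^sub>M borel"
    using measurable_compose[OF measurable_snd Y] by (simp add: split_beta')
  have ker: "(\<lambda>q. distr (R (snd q)) borel (\<lambda>\<xi>. \<xi> (max 0 (fst (fst q))))) \<in> ?B \<Otimes>\<^sub>M borel \<rightarrow>\<^sub>M prob_algebra (borel :: 'a measure)"
  proof (rule measurable_distr_prob_space2[where M=paths])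
    show "(\<lambda>q. R (snd q)) \<in> ?B \<Otimes>\<^sub>M borel \<rightarrow>\<^sub>M prob_algebra paths" by (rule measurable_compose[OF measurable_snd R])
    have "(\<lambda>r. snd r (max 0 (fst (fst (fst r))))) \<in> (?B \<Otimes>\<^sub>M (borel :: 'a measure)) \<Otimes>\<^sub>M paths \<rightarrow>\<^sub>M (borel :: 'a measure)"
      by (rule measurable_skorokhod_apply[OF _ measurable_snd]) auto
    then show "(\<lambda>(q, \<xi>). \<xi> (max 0 (fst (fst q)))) \<in> (?B \<Otimes>\<^sub>M (borel :: 'a measure)) \<Otimes>\<^sub>M paths \<rightarrow>\<^sub>M (borel :: 'a measure)"
      by (simp add: split_beta')
  qed
  have K: "K \<in> ?B \<rightarrow>\<^sub>M prob_algebra borel"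
    unfolding K_def by (rule measurable_bind_prob_space2[OF measurable_compose[OF YM J]]) (use ker in \<open>simp add: split_beta'\<close>)
  have K\<beta>: "K \<in> \<beta> \<rightarrow>\<^sub>M prob_algebra borel" using K by (simp add: measurable_cong_sets[OF s\<beta> refl])
  have intK: "(\<integral>x. f x \<partial>K p) = jump_op (P (fst p) f) (Y (fst (snd p)) (snd (snd p)))" if f: "bmeas borel f" and p: "p \<in> space ?B" for f p
  proof -
    let ?y = "Y (fst (snd p)) (snd (snd p))"
    have k1: "(\<lambda>z. distr (R z) borel (\<lambda>\<xi>. \<xi> (max 0 (fst p)))) \<in> borel \<rightarrow>\<^sub>M prob_algebra (borel :: 'a measure)"
      using measurable_compose[OF measurable_Pair1'[OF p] ker] by simp
    have "(\<integral>x. f x \<partial>K p) = (\<integral>z. integral\<^sup>L (distr (R z) borel (\<lambda>\<xi>. \<xi> (max 0 (fst p)))) f \<partial>J ?y)"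
      unfolding K_def
      by (rule integral_bind_bmeas[OF f _ J_prob(4)]) (use k1 in \<open>simp add: measurable_cong_sets[OF J_prob(1) refl]\<close>)
    also have "\<dots> = jump_op (P (fst p) f) ?y"
      unfolding jump_op_def P_def
    proof (intro Bochner_Integration.integral_cong refl)
      fix z
      have "(\<lambda>\<xi>. \<xi> (max 0 (fst p))) \<in> R z \<rightarrow>\<^sub>M borel"
        using measurable_skorokhod_eval[of "max 0 (fst p)" UNIV] by (simp add: measurable_cong_sets[OF R_prob(1) refl])
      then show "integral\<^sup>L (distr (R z) borel (\<lambda>\<xi>. \<xi> (max 0 (fst p)))) f = (\<integral>\<xi>. f (\<xi> (max 0 (fst p))) \<partial>R z)"
        by (rule integral_distr) (rule bmeasD[OF f])
    qed
    finally show ?thesis .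
  qed
  \<comment> \<open>\<open>bind\<close> over an empty space is a degenerate default, so the sets and
    the mass of the bind are known only once \<open>\<beta>\<close> has points.\<close>
  have \<beta>ne: "space \<beta> \<noteq> {}" using nonempty sets_eq_imp_space_eq[OF s\<beta>] by (auto simp: space_pair_measure)
  show sb: "sets (\<beta> \<bind> K) = sets borel"
    using measurable_space[OF K\<beta>] \<beta>ne by (intro sets_bind) (auto simp: space_prob_algebra)
  show "finite_measure (\<beta> \<bind> K)"
  proof (rule finite_measureI)
    have "emeasure (\<beta> \<bind> K) UNIV = (\<integral>\<^sup>+p. emeasure (K p) UNIV \<partial>\<beta>)"
      by (rule emeasure_bind[OF \<beta>ne measurable_prob_algebraD[OF K\<beta>]]) simp
    also have "\<dots> = (\<integral>\<^sup>+p. 1 \<partial>\<beta>)"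
    proof (rule nn_integral_cong)
      fix p assume "p \<in> space \<beta>"
      from measurable_space[OF K\<beta> this] have "sets (K p) = sets borel" "prob_space (K p)"
        by (auto simp: space_prob_algebra)
      then show "emeasure (K p) UNIV = 1"
        using prob_space.emeasure_space_1[of "K p"] sets_eq_imp_space_eq[of "K p" borel] by simp
    qed
    also have "\<dots> = emeasure \<beta> (space \<beta>)" by simp
    finally show "emeasure (\<beta> \<bind> K) (space (\<beta> \<bind> K)) \<noteq> \<infinity>"
      using finite_measure.emeasure_finite[OF fin\<beta>] sets_eq_imp_space_eq[OF sb] by simp
  qed
  show "(\<integral>x. f x \<partial>(\<beta> \<bind> K)) = W \<theta> f" if f: "bmeas borel f" for f
  proof -
    let ?h = "\<lambda>p. jump_op (P (fst p) f) (Y (fst (snd p)) (snd (snd p)))"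
    have hB: "bmeas ?B ?h"
    proof -
      have "(\<lambda>p. (fst p, Y (fst (snd p)) (snd (snd p)))) \<in> ?B \<rightarrow>\<^sub>M borel \<Otimes>\<^sub>M borel"
        by (intro measurable_Pair measurable_fst YM)
      from bmeas_compose[OF bmeas_jump_P[OF f] this] show ?thesis by simp
    qed
    have ih: "bmeas ?B (\<lambda>p. indicator S p * ?h p)" by (intro bmeas_mult bmeas_indicator SB hB)
    have "(\<integral>x. f x \<partial>(\<beta> \<bind> K)) = (\<integral>p. ?h p \<partial>\<beta>)"
      unfolding integral_bind_bmeas[OF f K\<beta> fin\<beta>]
      by (intro Bochner_Integration.integral_cong refl intK f) (simp add: sets_eq_imp_space_eq[OF s\<beta>])
    also have "\<dots> = (\<integral>p. indicator S p * ?h p \<partial>?M)"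
      unfolding \<beta>_def by (rule integral_density_indicator[OF S]) (use bmeasD[OF hB] in \<open>simp add: measurable_cong_sets[OF s refl]\<close>)
    also have "\<dots> = (\<integral>\<tau>. \<integral>q. indicator S (\<tau>, q) * ?h (\<tau>, q) \<partial>?N \<partial>expo c)"
      by (rule integral_pair_bmeas[OF finite_measure_expo[OF c] finN]) (use ih in \<open>simp only: bmeas_sets_cong[OF s]\<close>)
    also have "\<dots> = (\<integral>\<tau>. (if \<tau> \<le> \<theta> then inner \<theta> f \<tau> else 0) \<partial>expo c)"
    proof (intro Bochner_Integration.integral_cong refl)
      fix \<tau> :: real
      have b: "bmeas (borel \<Otimes>\<^sub>M \<mu>) (\<lambda>q. indicator S (\<tau>, q) * ?h (\<tau>, q))"
        using bmeas_section[of borel "borel \<Otimes>\<^sub>M \<mu>" "\<lambda>\<tau> q. indicator S (\<tau>, q) * ?h (\<tau>, q)" \<tau>] ih by simp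
      have "(\<integral>q. indicator S (\<tau>, q) * ?h (\<tau>, q) \<partial>?N) = (\<integral>u. \<integral>w. indicator S (\<tau>, u, w) * ?h (\<tau>, u, w) \<partial>\<mu> \<partial>unif \<theta>)"
        by (rule integral_pair_bmeas[OF finite_measure_unif fin]) (use b in \<open>simp only: bmeas_sets_cong[OF sN]\<close>)
      also have "\<dots> = (\<integral>u. (if \<tau> \<le> \<theta> then if u + \<tau> \<le> \<theta> then m u (jump_op (P \<tau> f)) else 0 else 0) \<partial>unif \<theta>)"
      proof (intro Bochner_Integration.integral_cong refl)
        fix u :: real
        have "(\<integral>w. indicator S (\<tau>, u, w) * ?h (\<tau>, u, w) \<partial>\<mu>) = (\<integral>w. (if \<tau> \<le> \<theta> \<and> u + \<tau> \<le> \<theta> then jump_op (P \<tau> f) (Y u w) else 0) \<partial>\<mu>)"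
          by (intro Bochner_Integration.integral_cong refl) (auto simp: S_def indicator_def space_pair_measure)
        then show "(\<integral>w. indicator S (\<tau>, u, w) * ?h (\<tau>, u, w) \<partial>\<mu>) = (if \<tau> \<le> \<theta> then if u + \<tau> \<le> \<theta> then m u (jump_op (P \<tau> f)) else 0 else 0)"
          unfolding m_def by auto
      qed
      also have "\<dots> = (if \<tau> \<le> \<theta> then inner \<theta> f \<tau> else 0)" unfolding inner_def by auto
      finally show "(\<integral>q. indicator S (\<tau>, q) * ?h (\<tau>, q) \<partial>?N) = (if \<tau> \<le> \<theta> then inner \<theta> f \<tau> else 0)" .
    qed
    also have "\<dots> = W \<theta> f" by (rule W_expo[OF f \<theta>, symmetric])
    finally show ?thesis .
  qed
qed

end

context jump_perturbation
begin

text \<open>The mild equation on \<open>D0\<close> is extended to bounded Borel functions as an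
  equality of measures; by contraction the occupation integrals agree; and for \<open>g\<close> in
  \<open>D0\<close> the forward equation expresses the value at time \<open>t\<close> by the initial
  value and the occupation integral of \<open>gen g\<close>. The determining class then gives all
  bounded Borel functions at time \<open>t\<close>.\<close>

lemma forward_unique:
  assumes X: "forward_solution R J c D0 L \<mu> Y" and Z: "forward_solution R J c D0 L \<mu>' Y'"
    and init: "\<And>f. bmeas borel f \<Longrightarrow> (\<integral>w. f (Y 0 w) \<partial>\<mu>) = (\<integral>w. f (Y' 0 w) \<partial>\<mu>')"
    and t: "0 \<le> t" and f: "bmeas borel f"
  shows "(\<integral>w. f (Y t w) \<partial>\<mu>) = (\<integral>w. f (Y' t w) \<partial>\<mu>')"
proof -
  interpret X: forward_solution R J c D0 L \<mu> Y by (rule X)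
  interpret Z: forward_solution R J c D0 L \<mu>' Y' by (rule Z)
  have init': "X.m 0 f = Z.m 0 f" if "bmeas borel f" for f
    unfolding X.m_def Z.m_def by (rule init[OF that])
  \<comment> \<open>The jump terms are exchanged between the two sides so that each side is a
    positive measure; the initial terms of the two mild equations coincide and cancel.\<close>
  have exchange: "X.occ s f + Z.W s f = Z.occ s f + X.W s f" if f: "bmeas borel f" and s: "0 \<le> s" for s f
  proof -
    obtain a where a: "finite_measure a" "sets a = sets borel" "\<And>f. bmeas borel f \<Longrightarrow> (\<integral>x. f x \<partial>a) = X.occ s f"
      using X.occ_measure[of s] by blast
    obtain a' where a': "finite_measure a'" "sets a' = sets borel" "\<And>f. bmeas borel f \<Longrightarrow> (\<integral>x. f x \<partial>a') = Z.occ s f"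
      using Z.occ_measure[of s] by blast
    obtain w where w: "finite_measure w" "sets w = sets borel" "\<And>f. bmeas borel f \<Longrightarrow> (\<integral>x. f x \<partial>w) = X.W s f"
      using X.W_measure[OF s] by blast
    obtain w' where w': "finite_measure w'" "sets w' = sets borel" "\<And>f. bmeas borel f \<Longrightarrow> (\<integral>x. f x \<partial>w') = Z.W s f"
      using Z.W_measure[OF s] by blast
    have i1: "(\<integral>x. f x \<partial>sum_measure a w') = X.occ s f + Z.W s f" if "bmeas borel f" for f
      using a w' that bmeas_sets_cong[OF a(2)] by (subst integral_sum_measure) simp_all
    have i2: "(\<integral>x. f x \<partial>sum_measure a' w) = Z.occ s f + X.W s f" if "bmeas borel f" for f
      using a' w that bmeas_sets_cong[OF a'(2)] by (subst integral_sum_measure) simp_all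
    have "sum_measure a w' = sum_measure a' w"
    proof (rule determining)
      fix g assume g: "g \<in> D0"
      have "X.occ s g = (\<integral>v. X.E v * X.m 0 (P v g) \<partial>unif s) + X.W s g"
        "Z.occ s g = (\<integral>v. Z.E v * Z.m 0 (P v g) \<partial>unif s) + Z.W s g"
        by (rule X.occ_mild[OF g s], rule Z.occ_mild[OF g s])
      moreover have "X.E v * X.m 0 (P v g) = Z.E v * Z.m 0 (P v g)" for v
        unfolding X.E_def Z.E_def using init'[OF bmeas_P1[OF D0[OF g]]] by simp
      ultimately show "(\<integral>x. g x \<partial>sum_measure a w') = (\<integral>x. g x \<partial>sum_measure a' w)"
        unfolding i1[OF D0[OF g]] i2[OF D0[OF g]] by simp
    qed (use a a' w w' in \<open>auto intro!: finite_measure_sum_measure\<close>)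
    with i1[OF f] i2[OF f] show ?thesis by simp
  qed
  have occ_eq: "X.occ s f = Z.occ s f" if f: "bmeas borel f" and s: "0 \<le> s" for s f
  proof -
    obtain B where B: "0 \<le> B" "\<And>x. \<bar>f x\<bar> \<le> B" using bmeasE[OF f] by auto
    have "\<bar>X.occ s f - Z.occ s f\<bar> \<le> 0"
    \<comment> \<open>The functions bounded by \<open>B\<close> form a suitable class:
      \<open>P \<tau>\<close> and \<open>jump_op\<close> do not enlarge the bound, so the recursion
      stays in it.\<close>
    proof (rule ring_contraction[where c=c and S=s and Q="\<lambda>_ f. bmeas borel f \<and> (\<forall>x. \<bar>f x\<bar> \<le> B)"
          and g="\<lambda>s f. \<bar>X.occ s f - Z.occ s f\<bar>" and B="s * (X.mass * B) + s * (Z.mass * B)"])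
      show "0 < c" "0 \<le> s" "s \<le> s" "bmeas borel f \<and> (\<forall>x. \<bar>f x\<bar> \<le> B)" using c s f B by auto
      have occ_bound: "\<bar>\<integral>u. h u \<partial>unif r\<bar> \<le> s * k" if "0 \<le> r" "r \<le> s" "bmeas borel h" "\<And>u. \<bar>h u\<bar> \<le> k" "0 \<le> k" for h r k
      proof -
        have "\<bar>\<integral>u. h u \<partial>unif r\<bar> \<le> (\<integral>u. \<bar>h u\<bar> \<partial>unif r)" by (rule integral_abs_bound)
        also have "\<dots> \<le> (\<integral>u. k \<partial>unif r)" using that by (intro integral_mono[OF integrable_abs[OF integrable_unif] integrable_unif[OF bmeas_const]]) auto
        also have "\<dots> = r * k" using that by (simp add: measure_unif)
        also have "\<dots> \<le> s * k" using that by (intro mult_right_mono) auto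
        finally show ?thesis .
      qed
      fix r and g :: "'a \<Rightarrow> real" assume r: "0 \<le> r" "r \<le> s" and g: "bmeas borel g \<and> (\<forall>x. \<bar>g x\<bar> \<le> B)"
      have "\<bar>X.occ r g\<bar> \<le> s * (X.mass * B)" unfolding X.occ_def
        by (rule occ_bound[OF r X.bmeas_m_time X.m_bound]) (use g B X.mass_nonneg in auto)
      moreover have "\<bar>Z.occ r g\<bar> \<le> s * (Z.mass * B)" unfolding Z.occ_def
        by (rule occ_bound[OF r Z.bmeas_m_time Z.m_bound]) (use g B Z.mass_nonneg in auto)
      ultimately show "\<bar>X.occ r g - Z.occ r g\<bar> \<le> s * (X.mass * B) + s * (Z.mass * B)" by linarith
    next
      fix b r and g :: "'a \<Rightarrow> real" assume b: "0 \<le> b" "\<And>r g. 0 \<le> r \<Longrightarrow> r \<le> s \<Longrightarrow> bmeas borel g \<and> (\<forall>x. \<bar>g x\<bar> \<le> B) \<Longrightarrow> \<bar>X.occ r g - Z.occ r g\<bar> \<le> b"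
        and r: "0 \<le> r" "r \<le> s" and g': "bmeas borel g \<and> (\<forall>x. \<bar>g x\<bar> \<le> B)"
      have g: "bmeas borel g" using g' by simp
      have bi: "bmeas borel (\<lambda>\<tau>. X.inner r g \<tau> - Z.inner r g \<tau>)" by (intro bmeas_diff X.bmeas_inner Z.bmeas_inner g)
      have bX: "bmeas borel (\<lambda>\<tau>. if \<tau> \<le> r then X.inner r g \<tau> else 0)" using X.bmeas_inner[OF g] by (intro bmeas_If) auto
      have bZ: "bmeas borel (\<lambda>\<tau>. if \<tau> \<le> r then Z.inner r g \<tau> else 0)" using Z.bmeas_inner[OF g] by (intro bmeas_If) auto
      have "X.occ r g - Z.occ r g = X.W r g - Z.W r g" using exchange[OF g r(1)] by simp
      also have "\<dots> = (\<integral>\<tau>. (if \<tau> \<le> r then X.inner r g \<tau> else 0) - (if \<tau> \<le> r then Z.inner r g \<tau> else 0) \<partial>expo c)"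
        unfolding X.W_expo[OF g r(1)] Z.W_expo[OF g r(1)]
        by (rule Bochner_Integration.integral_diff[symmetric, OF integrable_expo[OF bX] integrable_expo[OF bZ]])
      also have "\<dots> = (\<integral>\<tau>. (if \<tau> \<le> r then X.inner r g \<tau> - Z.inner r g \<tau> else 0) \<partial>expo c)"
        by (intro Bochner_Integration.integral_cong) auto
      finally have diff: "X.occ r g - Z.occ r g = (\<integral>\<tau>. (if \<tau> \<le> r then X.inner r g \<tau> - Z.inner r g \<tau> else 0) \<partial>expo c)" .
      show "\<bar>X.occ r g - Z.occ r g\<bar> \<le> b * (1 - exp (- c * r))"
        unfolding diff
      proof (rule expo_early[OF c r(1) b(1) bi])
        fix \<tau> assume \<tau>: "0 \<le> \<tau>" "\<tau> \<le> r"
        have "\<bar>jump_op (P \<tau> g) x\<bar> \<le> B" for x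
          using g' by (intro jump_op_bound bmeas_P1 P_bound) auto
        then show "\<bar>X.inner r g \<tau> - Z.inner r g \<tau>\<bar> \<le> b"
          unfolding X.inner_eq_occ[OF g \<tau>] Z.inner_eq_occ[OF g \<tau>]
          using b(2)[of "r - \<tau>" "jump_op (P \<tau> g)"] \<tau> r bmeas_jump_op1[OF bmeas_P1[OF g]] by simp
      qed
    qed
    then show ?thesis by simp
  qed
  \<comment> \<open>\<open>gen g\<close> is bounded and Borel but need not lie in \<open>D0\<close>,
    which is why \<open>occ_eq\<close> was proved beyond the domain.\<close>
  have D0_eq: "(\<integral>w. g (Y t w) \<partial>\<mu>) = (\<integral>w. g (Y' t w) \<partial>\<mu>')" if g: "g \<in> D0" for g
    using X.forward[OF g t] Z.forward[OF g t] init[OF D0[OF g]] occ_eq[OF bmeas_gen[OF g] t]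
    unfolding X.occ_def Z.occ_def X.m_def Z.m_def by simp
  have "distr \<mu> borel (Y t) = distr \<mu>' borel (Y' t)"
  proof (rule determining)
    show "finite_measure (distr \<mu> borel (Y t))" "finite_measure (distr \<mu>' borel (Y' t))"
      by (rule finite_measure.finite_measure_distr[OF X.fin X.Y_measurable], rule finite_measure.finite_measure_distr[OF Z.fin Z.Y_measurable])
    show "(\<integral>x. g x \<partial>distr \<mu> borel (Y t)) = (\<integral>x. g x \<partial>distr \<mu>' borel (Y' t))" if "g \<in> D0" for g
      unfolding integral_distr[OF X.Y_measurable bmeasD[OF D0[OF that]]] integral_distr[OF Z.Y_measurable bmeasD[OF D0[OF that]]]
      by (rule D0_eq[OF that])
  qed simp_all
  then have "(\<integral>x. f x \<partial>distr \<mu> borel (Y t)) = (\<integral>x. f x \<partial>distr \<mu>' borel (Y' t))" by simp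
  then show ?thesis unfolding integral_distr[OF X.Y_measurable bmeasD[OF f]] integral_distr[OF Z.Y_measurable bmeasD[OF f]] .
qed

text \<open>The integrated martingale identity is linear in the measure, so the event can be imposed
  by a density, without dividing by its probability, which may be 0.\<close>

lemma solution_forward:
  assumes Q: "solves_martingale_problem gen D0 x Q" and s: "0 \<le> s" and A: "A \<in> sets (path_filtration UNIV s)"
  shows "forward_solution R J c D0 L (density Q (indicator A)) (\<lambda>u \<omega>. \<omega> (max 0 (s + u)))"
proof -
  have Q': "Q \<in> space (prob_algebra paths)"
    and mp: "\<And>f t. f \<in> D0 \<Longrightarrow> 0 \<le> t \<Longrightarrow> (\<integral>\<omega>. indicator A \<omega> * (f (\<omega> (s + t)) - f (\<omega> s)) \<partial>Q)
        = (\<integral>u. \<integral>\<omega>. indicator A \<omega> * gen f (\<omega> (max 0 (s + u))) \<partial>Q \<partial>unif t)"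
    using Q A s by (auto simp: solves_martingale_problem_iff[OF D0 bmeas_gen])
  have sets: "sets Q = sets paths" and sp: "space Q = skorokhod_space UNIV" and ps: "prob_space Q"
    using Q' by (auto simp: space_prob_algebra dest: sets_eq_imp_space_eq)
  interpret prob_space Q by (rule ps)
  have AQ: "A \<in> sets Q" using A path_filtration_subset sets by blast
  have iA: "bmeas paths (indicator A)" using AQ sets by (intro bmeas_indicator) simp
  have bQ: "bmeas Q h \<longleftrightarrow> bmeas paths h" for h by (rule bmeas_sets_cong[OF sets])
  have dens: "(\<integral>\<omega>. f (\<omega> (max 0 r)) \<partial>density Q (indicator A)) = (\<integral>\<omega>. indicator A \<omega> * f (\<omega> (max 0 r)) \<partial>Q)" if "bmeas borel f" for f r
    using bmeasD[OF bmeas_skorokhod_eval[OF that, of "max 0 r" UNIV]]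
    by (intro integral_density_indicator[OF AQ]) (simp add: measurable_cong_sets[OF sets refl])
  have i: "integrable Q (\<lambda>\<omega>. indicator A \<omega> * f (\<omega> r))" if "bmeas borel f" "0 \<le> r" for f r
    by (intro bmeas_integrable finite_measure_axioms) (simp only: bQ, intro bmeas_mult iA bmeas_skorokhod_eval that)
  show ?thesis
  proof (rule forward_solution.intro[OF _ forward_solution_axioms.intro])
    show "jump_perturbation R J c D0 L" by unfold_locales
    show "finite_measure (density Q (indicator A))" by (rule finite_measure_density_indicator[OF finite_measure_axioms AQ])
    show "space (density Q (indicator A)) \<noteq> {}" using not_empty by simp
    have "(\<lambda>(u, \<omega>). (s + u, \<omega>)) \<in> borel \<Otimes>\<^sub>M paths \<rightarrow>\<^sub>M borel \<Otimes>\<^sub>M (paths :: (real \<Rightarrow> 'a) measure)" by measurable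
    from measurable_compose[OF this measurable_skorokhod_eval_joint]
    have ev: "(\<lambda>(u, \<omega>). \<omega> (max 0 (s + u))) \<in> borel \<Otimes>\<^sub>M paths \<rightarrow>\<^sub>M (borel :: 'a measure)" by (simp add: split_beta')
    have eq: "sets (borel \<Otimes>\<^sub>M density Q (indicator A)) = sets ((borel :: real measure) \<Otimes>\<^sub>M paths)"
      by (intro sets_pair_measure_cong) (simp_all add: sets)
    show "(\<lambda>(u, \<omega>). \<omega> (max 0 (s + u))) \<in> borel \<Otimes>\<^sub>M density Q (indicator A) \<rightarrow>\<^sub>M borel"
      unfolding measurable_cong_sets[OF eq refl] by (rule ev)
    fix f t assume f: "f \<in> D0" and t: "0 \<le> (t :: real)"
    have "(\<integral>\<omega>. indicator A \<omega> * f (\<omega> (s + t)) \<partial>Q) - (\<integral>\<omega>. indicator A \<omega> * f (\<omega> s) \<partial>Q)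
      = (\<integral>u. \<integral>\<omega>. indicator A \<omega> * gen f (\<omega> (max 0 (s + u))) \<partial>Q \<partial>unif t)"
      using mp[OF f t] i[OF D0[OF f]] s t by (simp add: right_diff_distrib)
    then show "(\<integral>\<omega>. f (\<omega> (max 0 (s + t))) \<partial>density Q (indicator A))
      = (\<integral>\<omega>. f (\<omega> (max 0 (s + 0))) \<partial>density Q (indicator A))
       + (\<integral>u. \<integral>\<omega>. gen f (\<omega> (max 0 (s + u))) \<partial>density Q (indicator A) \<partial>unif t)"
      unfolding dens[OF D0[OF f]] dens[OF bmeas_gen[OF f]] using s t by simp
  qed
qed

section \<open>Finite-dimensional distributions\<close>

definition cylinder :: "real set \<Rightarrow> (real \<Rightarrow> 'a set) \<Rightarrow> (real \<Rightarrow> 'a) set" where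
  "cylinder K B = {\<omega> \<in> skorokhod_space UNIV. \<forall>j\<in>K. \<omega> j \<in> B j}"

lemma cylinder_in_path_filtration:
  assumes "finite K" "\<And>j. j \<in> K \<Longrightarrow> 0 \<le> j \<and> j \<le> s \<and> B j \<in> sets borel"
  shows "cylinder K B \<in> sets (path_filtration UNIV s)"
proof -
  have "{\<omega> \<in> space (path_filtration UNIV s). \<forall>j\<in>K. \<omega> j \<in> B j} \<in> sets (path_filtration UNIV s)"
  proof (rule sets.sets_Collect_finite_All[OF _ assms(1)])
    fix j assume j: "j \<in> K"
    have "(\<lambda>\<omega>. \<omega> j) -` B j \<inter> space (path_filtration UNIV s) \<in> sets (path_filtration UNIV s)"
      using assms(2)[OF j] by (intro measurable_sets[OF measurable_path_filtration_eval]) auto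
    then show "{\<omega> \<in> space (path_filtration UNIV s). \<omega> j \<in> B j} \<in> sets (path_filtration UNIV s)"
      by (simp add: vimage_def Int_def conj_commute)
  qed
  then show ?thesis by (simp add: cylinder_def)
qed

text \<open>Induction on the times in increasing order. The test function at the last time
  \<open>b\<close> absorbs the constraint there, so the statement for \<open>K\<close> with a
  modified function gives the new cylinder at time \<open>b\<close>, and
  \<open>forward_unique\<close> moves on to \<open>s\<close>.\<close>

lemma cylinder_unique:
  assumes Q: "solves_martingale_problem gen D0 x Q" and Q': "solves_martingale_problem gen D0 x Q'"
    and K: "finite K" "\<And>j. j \<in> K \<Longrightarrow> 0 \<le> j \<and> B j \<in> sets borel" and s: "0 \<le> s" "\<And>j. j \<in> K \<Longrightarrow> j \<le> s" and f: "bmeas borel f"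
  shows "(\<integral>\<omega>. indicator (cylinder K B) \<omega> * f (\<omega> s) \<partial>Q) = (\<integral>\<omega>. indicator (cylinder K B) \<omega> * f (\<omega> s) \<partial>Q')"
proof -
  have props: "sets N = sets paths" "space N = skorokhod_space UNIV" "prob_space N" "AE \<omega> in N. \<omega> 0 = x"
    if "solves_martingale_problem gen D0 x N" for N
    using that by (auto simp: solves_martingale_problem_def space_prob_algebra dest: sets_eq_imp_space_eq)
  \<comment> \<open>Agreement at time \<open>b\<close> on an event of the past of \<open>b\<close>
    propagates to every later \<open>s\<close>.\<close>
  have move: "(\<integral>\<omega>. indicator A \<omega> * g (\<omega> s) \<partial>Q) = (\<integral>\<omega>. indicator A \<omega> * g (\<omega> s) \<partial>Q')"
    if A: "A \<in> sets (path_filtration UNIV b)" and b: "0 \<le> b" "b \<le> s" and g: "bmeas borel g"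
      and eq: "\<And>h. bmeas borel h \<Longrightarrow> (\<integral>\<omega>. indicator A \<omega> * h (\<omega> b) \<partial>Q) = (\<integral>\<omega>. indicator A \<omega> * h (\<omega> b) \<partial>Q')"
    for A and b s and g :: "'a \<Rightarrow> real"
  proof -
    have dens: "(\<integral>\<omega>. h (\<omega> (max 0 (b + r))) \<partial>density N (indicator A)) = (\<integral>\<omega>. indicator A \<omega> * h (\<omega> (b + r)) \<partial>N)"
      if N: "solves_martingale_problem gen D0 x N" and h: "bmeas borel h" and r: "0 \<le> r" for h r N
    proof -
      have "A \<in> sets N" using A path_filtration_subset props(1)[OF N] by blast
      moreover have "(\<lambda>\<omega>. h (\<omega> (max 0 (b + r)))) \<in> borel_measurable N"
        using bmeasD[OF bmeas_skorokhod_eval[OF h, of "max 0 (b + r)" UNIV]] by (simp add: measurable_cong_sets[OF props(1)[OF N] refl])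
      ultimately show ?thesis using b r by (simp add: integral_density_indicator)
    qed
    have "(\<integral>\<omega>. g (\<omega> (max 0 (b + (s - b)))) \<partial>density Q (indicator A)) = (\<integral>\<omega>. g (\<omega> (max 0 (b + (s - b)))) \<partial>density Q' (indicator A))"
    proof (rule forward_unique[OF solution_forward[OF Q b(1) A] solution_forward[OF Q' b(1) A] _ _ g])
      show "(\<integral>\<omega>. h (\<omega> (max 0 (b + 0))) \<partial>density Q (indicator A)) = (\<integral>\<omega>. h (\<omega> (max 0 (b + 0))) \<partial>density Q' (indicator A))" if "bmeas borel h" for h
        unfolding dens[OF Q that order_refl] dens[OF Q' that order_refl] using eq[OF that] by simp
    qed (use b in auto)
    then show ?thesis using dens[OF Q g, of "s - b"] dens[OF Q' g, of "s - b"] b by simp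
  qed
  show ?thesis
    using K s f
  proof (induction K arbitrary: s f rule: finite_linorder_max_induct)
    case empty
    \<comment> \<open>Without constraints the starting time is 0, where both solutions sit at
      \<open>x\<close>.\<close>
    have c: "cylinder {} B \<in> sets (path_filtration UNIV 0)" by (rule cylinder_in_path_filtration) auto
    have e0: "(\<integral>\<omega>. indicator (cylinder {} B) \<omega> * h (\<omega> 0) \<partial>N) = h x" if N: "solves_martingale_problem gen D0 x N" and h: "bmeas borel h" for h N
    proof -
      have "(\<integral>\<omega>. indicator (cylinder {} B) \<omega> * h (\<omega> 0) \<partial>N) = (\<integral>\<omega>. h x \<partial>N)"
      proof (rule integral_cong_AE)
        have "cylinder {} B \<in> sets paths" using c path_filtration_subset by blast
        then show "(\<lambda>\<omega>. indicator (cylinder {} B) \<omega> * h (\<omega> 0)) \<in> borel_measurable N"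
          unfolding measurable_cong_sets[OF props(1)[OF N] refl] by (intro bmeasD bmeas_mult bmeas_indicator bmeas_skorokhod_eval h) auto
        show "AE \<omega> in N. indicator (cylinder {} B) \<omega> * h (\<omega> 0) = h x"
          using props(4)[OF N] AE_space[of N] by eventually_elim (simp add: cylinder_def props(2)[OF N])
      qed simp
      then show ?thesis using prob_space.prob_space[OF props(3)[OF N]] by simp
    qed
    show ?case
    proof (rule move[OF c order_refl])
      show "0 \<le> s" "bmeas borel f" using empty by simp_all
      show "(\<integral>\<omega>. indicator (cylinder {} B) \<omega> * h (\<omega> 0) \<partial>Q) = (\<integral>\<omega>. indicator (cylinder {} B) \<omega> * h (\<omega> 0) \<partial>Q')"
        if "bmeas borel h" for h
        unfolding e0[OF Q that] e0[OF Q' that] ..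
    qed
  next
    case (insert b K)
    have c: "cylinder (insert b K) B \<in> sets (path_filtration UNIV b)"
      using insert by (intro cylinder_in_path_filtration) (auto intro: less_imp_le)
    show ?case
    proof (rule move[OF c])
      fix h :: "'a \<Rightarrow> real" assume h: "bmeas borel h"
      have "indicator (cylinder (insert b K) B) \<omega> * h (\<omega> b) = indicator (cylinder K B) \<omega> * (indicator (B b) (\<omega> b) * h (\<omega> b))" for \<omega>
        by (auto simp: cylinder_def indicator_def)
      moreover have "(\<integral>\<omega>. indicator (cylinder K B) \<omega> * (\<lambda>y. indicator (B b) y * h y) (\<omega> b) \<partial>Q)
        = (\<integral>\<omega>. indicator (cylinder K B) \<omega> * (\<lambda>y. indicator (B b) y * h y) (\<omega> b) \<partial>Q')"
        using insert.prems insert.hyps by (intro insert.IH bmeas_mult bmeas_indicator h) (auto intro: less_imp_le)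
      ultimately show "(\<integral>\<omega>. indicator (cylinder (insert b K) B) \<omega> * h (\<omega> b) \<partial>Q)
        = (\<integral>\<omega>. indicator (cylinder (insert b K) B) \<omega> * h (\<omega> b) \<partial>Q')" by (simp only:)
    qed (use insert.prems in auto)
  qed
qed

text \<open>The identity from the space with the generated algebra is measurable coordinate by
  coordinate, hence by \<open>measurable_skorokhodI\<close> for all Borel sets; this is where the
  description of the J1 Borel sets enters uniqueness.\<close>

lemma sets_paths_cylinder:
  "sets paths = sigma_sets (skorokhod_space UNIV) {cylinder K B | K B. finite K \<and> (\<forall>j\<in>K. 0 \<le> j \<and> B j \<in> sets borel)}"
    (is "_ = sigma_sets _ ?G")
proof
  let ?S = "sigma (skorokhod_space UNIV) ?G"
  have G: "?G \<subseteq> Pow (skorokhod_space UNIV)" by (auto simp: cylinder_def)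
  have sS: "sets ?S = sigma_sets (skorokhod_space UNIV) ?G" by (rule sets_measure_of[OF G])
  have spS: "space ?S = skorokhod_space UNIV" by (rule space_measure_of[OF G])
  have "(\<lambda>\<omega>. \<omega>) \<in> ?S \<rightarrow>\<^sub>M paths"
  proof (rule measurable_skorokhodI)
    fix t :: real assume t: "0 \<le> t"
    show "(\<lambda>\<omega>. \<omega> t) \<in> ?S \<rightarrow>\<^sub>M (borel :: 'a measure)"
    proof (rule measurableI)
      fix A assume A: "A \<in> sets (borel :: 'a measure)"
      have "(\<lambda>\<omega>. \<omega> t) -` A \<inter> space ?S = cylinder {t} (\<lambda>_. A)" unfolding spS by (auto simp: cylinder_def)
      also have "\<dots> \<in> sets ?S" unfolding sS using A t by (intro sigma_sets.Basic) blast
      finally show "(\<lambda>\<omega>. \<omega> t) -` A \<inter> space ?S \<in> sets ?S" .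
    qed simp
  qed (simp add: spS)
  note id = measurable_sets[OF this]
  show "sets paths \<subseteq> sigma_sets (skorokhod_space UNIV) ?G"
  proof
    fix A assume A: "A \<in> sets (paths :: (real \<Rightarrow> 'a) measure)"
    have "A \<subseteq> skorokhod_space UNIV" using sets.sets_into_space[OF A] by simp
    then show "A \<in> sigma_sets (skorokhod_space UNIV) ?G" using id[OF A] by (simp add: spS sS Int_absorb2)
  qed
  have "?G \<subseteq> sets paths"
  proof
    fix A assume "A \<in> ?G"
    then obtain K B where KB: "A = cylinder K B" "finite K" "\<forall>j\<in>K. 0 \<le> j \<and> B j \<in> sets borel" by blast
    have "cylinder K B \<in> sets (path_filtration UNIV (Max (insert 0 K)))"
      using KB by (intro cylinder_in_path_filtration) auto
    then show "A \<in> sets paths" using path_filtration_subset KB(1) by blast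
  qed
  then have "sigma_sets (space paths) ?G \<subseteq> sets paths" by (rule sets.sigma_sets_subset)
  then show "sigma_sets (skorokhod_space UNIV) ?G \<subseteq> sets paths" by simp
qed

theorem solution_unique:
  assumes Q: "solves_martingale_problem gen D0 x Q" and Q': "solves_martingale_problem gen D0 x Q'"
  shows "Q = Q'"
proof -
  have props: "sets N = sets paths" "space N = skorokhod_space UNIV" "prob_space N"
    if "solves_martingale_problem gen D0 x N" for N
    using that by (auto simp: solves_martingale_problem_def space_prob_algebra dest: sets_eq_imp_space_eq)
  let ?G = "{cylinder K B | K B. finite K \<and> (\<forall>j\<in>K. 0 \<le> j \<and> B j \<in> sets borel)}"
  interpret Q: prob_space Q by (rule props(3)[OF Q])
  interpret Q': prob_space Q' by (rule props(3)[OF Q'])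
  show ?thesis
  proof (rule measure_eqI_generator_eq[where E="?G" and \<Omega>="skorokhod_space UNIV" and A="\<lambda>_. skorokhod_space UNIV"])
    show "Int_stable ?G"
    proof (rule Int_stableI)
      fix a b assume "a \<in> ?G" "b \<in> ?G"
      then obtain K B K' B' where a: "a = cylinder K B" "finite K" "\<forall>j\<in>K. 0 \<le> j \<and> B j \<in> sets borel"
        and b: "b = cylinder K' B'" "finite K'" "\<forall>j\<in>K'. 0 \<le> j \<and> B' j \<in> sets borel" by blast
      \<comment> \<open>A time that occurs in only one of the two cylinders carries the trivial
        constraint of the other.\<close>
      let ?B = "\<lambda>j. (if j \<in> K then B j else UNIV) \<inter> (if j \<in> K' then B' j else UNIV)"
      have "a \<inter> b = cylinder (K \<union> K') ?B" unfolding a b cylinder_def by auto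
      moreover have "finite (K \<union> K')" "\<forall>j\<in>K \<union> K'. 0 \<le> j \<and> ?B j \<in> sets borel" using a b by auto
      ultimately show "a \<inter> b \<in> ?G" by blast
    qed
    show "?G \<subseteq> Pow (skorokhod_space UNIV)" by (auto simp: cylinder_def)
    show "sets Q = sigma_sets (skorokhod_space UNIV) ?G" "sets Q' = sigma_sets (skorokhod_space UNIV) ?G"
      using props(1)[OF Q] props(1)[OF Q'] sets_paths_cylinder by simp_all
    have "skorokhod_space UNIV = cylinder {} (\<lambda>_. UNIV)" by (simp add: cylinder_def)
    then show "range (\<lambda>_::nat. skorokhod_space UNIV) \<subseteq> ?G" by blast
    show "emeasure Q (skorokhod_space UNIV) \<noteq> \<infinity>" by simp
    fix X assume "X \<in> ?G"
    then obtain K B where X: "X = cylinder K B" "finite K" "\<forall>j\<in>K. 0 \<le> j \<and> B j \<in> sets borel" by blast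
    let ?s = "Max (insert 0 K)"
    have Xs: "X \<in> sets (paths)"
      using cylinder_in_path_filtration[of K ?s B] X path_filtration_subset by force
    have "(\<integral>\<omega>. indicator (cylinder K B) \<omega> * (1 :: real) \<partial>Q) = (\<integral>\<omega>. indicator (cylinder K B) \<omega> * 1 \<partial>Q')"
      by (rule cylinder_unique[OF Q Q' X(2), of B ?s "\<lambda>_. 1"]) (use X in auto)
    then have "measure Q X = measure Q' X"
      using Xs X(1) by (simp add: props(1)[OF Q] props(1)[OF Q'])
    then show "emeasure Q X = emeasure Q' X" by (simp add: Q.emeasure_eq_measure Q'.emeasure_eq_measure)
  qed simp
qed

end

section \<open>Feller semigroups\<close>

text \<open>Some bound has to be exhibited, because the supremum of an unbounded set of reals is
  unspecified.\<close>

lemma sup_norm_ge: "(\<And>x. \<bar>f x\<bar> \<le> B) \<Longrightarrow> \<bar>f x\<bar> \<le> sup_norm f"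
  unfolding sup_norm_def by (rule cSUP_upper) (auto intro: bdd_aboveI[of _ B])

lemma C0_bounded: assumes "f \<in> C0 S" obtains B where "0 \<le> B" "\<And>x. \<bar>f x\<bar> \<le> B"
proof -
  obtain K where K: "compact K" "K \<subseteq> S" "\<And>x. x \<in> S - K \<Longrightarrow> \<bar>f x\<bar> < 1"
    using assms unfolding C0_def by (auto dest!: spec[of _ 1])
  have "continuous_on S f" using assms unfolding C0_def by simp
  then have "compact (f ` K)" using K by (intro compact_continuous_image) (auto intro: continuous_on_subset)
  then obtain B where B: "\<And>y. y \<in> f ` K \<Longrightarrow> \<bar>y\<bar> \<le> B"
    using compact_imp_bounded bounded_real by metis
  have "\<bar>f x\<bar> \<le> max 1 B" for x
  proof -
    consider "x \<in> K" | "x \<in> S - K" | "x \<notin> S" by blast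
    then show ?thesis
    proof cases
      case 3 then show ?thesis using assms unfolding C0_def by auto
    qed (use B K(3) in \<open>fastforce+\<close>)
  qed
  then show ?thesis using that[of "max 1 B"] by auto
qed

lemma C0_sup_norm: "f \<in> C0 S \<Longrightarrow> \<bar>f x\<bar> \<le> sup_norm f"
  by (erule C0_bounded) (rule sup_norm_ge)

lemma C0_linear:
  assumes f: "f \<in> C0 S" and h: "h \<in> C0 S" shows "(\<lambda>x. a * f x + b * h x) \<in> C0 S"
  unfolding C0_def
proof (intro CollectI conjI allI impI)
  show "continuous_on S (\<lambda>x. a * f x + b * h x)" using assms unfolding C0_def by (auto intro!: continuous_intros)
  show "a * f x + b * h x = 0" if "x \<notin> S" for x using that assms unfolding C0_def by simp
  fix e :: real assume e: "0 < e"
  define d where "d = e / (\<bar>a\<bar> + \<bar>b\<bar> + 1)"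
  have d: "0 < d" unfolding d_def using e by simp
  obtain K where K: "compact K" "K \<subseteq> S" "\<And>x. x \<in> S - K \<Longrightarrow> \<bar>f x\<bar> < d"
    using f d unfolding C0_def by (auto dest!: spec[of _ d])
  obtain K' where K': "compact K'" "K' \<subseteq> S" "\<And>x. x \<in> S - K' \<Longrightarrow> \<bar>h x\<bar> < d"
    using h d unfolding C0_def by (auto dest!: spec[of _ d])
  have "\<bar>a * f x + b * h x\<bar> < e" if x: "x \<in> S - (K \<union> K')" for x
  proof -
    have "\<bar>a * f x + b * h x\<bar> \<le> \<bar>a\<bar> * \<bar>f x\<bar> + \<bar>b\<bar> * \<bar>h x\<bar>" by (metis abs_mult abs_triangle_ineq)
    also have "\<dots> \<le> \<bar>a\<bar> * d + \<bar>b\<bar> * d" using K(3)[of x] K'(3)[of x] x by (intro add_mono mult_left_mono) auto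
    also have "\<dots> < (\<bar>a\<bar> + \<bar>b\<bar> + 1) * d" using d by (simp add: algebra_simps)
    also have "\<dots> = e" unfolding d_def by simp
    finally show ?thesis .
  qed
  then show "\<exists>K. compact K \<and> K \<subseteq> S \<and> (\<forall>x\<in>S - K. \<bar>a * f x + b * h x\<bar> < e)"
    using K K' by (intro exI[of _ "K \<union> K'"]) auto
qed

lemma C0_diff: "f \<in> C0 S \<Longrightarrow> h \<in> C0 S \<Longrightarrow> (\<lambda>x. f x - h x) \<in> C0 S"
  using C0_linear[of f S h 1 "-1"] by simp

lemma C0_zero: "(\<lambda>x. 0) \<in> C0 S"
  unfolding C0_def by (auto intro!: exI[of _ "{}"])

lemma C0_borel:
  fixes S :: "'a::metric_space set"
  assumes f: "f \<in> C0 S" and S: "S \<in> sets borel" shows "bmeas borel f"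
proof -
  obtain B where "\<And>x. \<bar>f x\<bar> \<le> B" by (rule C0_bounded[OF f]) blast
  moreover have "f \<in> borel_measurable borel"
  proof (rule measurable_piecewise_restrict[of "{S, - S}"])
    fix A assume "A \<in> {S, - S}"
    then consider "A = S" | "A = - S" by blast
    then show "f \<in> borel_measurable (restrict_space borel A)"
    proof cases
      case 1 then show ?thesis using f unfolding C0_def by (auto intro: borel_measurable_continuous_on_restrict)
    next
      case 2
      have "(\<lambda>x. 0) \<in> borel_measurable (restrict_space borel A)" by simp
      then show ?thesis using f 2 unfolding C0_def
        by (subst measurable_cong[of _ _ "\<lambda>x. 0"]) (auto simp: space_restrict_space)
    qed
  qed (use S in auto)
  ultimately show ?thesis by (intro bmeasI[of _ _ B])
qed

locale feller_semigroup =
  fixes S :: "'a::topological_space set" and G :: "real \<Rightarrow> ('a \<Rightarrow> real) \<Rightarrow> 'a \<Rightarrow> real"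
  assumes semigroup: "contraction_semigroup (C0 S) G"
begin

lemma G_C0: "0 \<le> t \<Longrightarrow> f \<in> C0 S \<Longrightarrow> G t f \<in> C0 S"
  and G_contr: "0 \<le> t \<Longrightarrow> f \<in> C0 S \<Longrightarrow> sup_norm (G t f) \<le> sup_norm f"
  and G_0: "f \<in> C0 S \<Longrightarrow> G 0 f = f"
  and G_add: "0 \<le> s \<Longrightarrow> 0 \<le> t \<Longrightarrow> f \<in> C0 S \<Longrightarrow> G (s + t) f = G s (G t f)"
  and G_cont: "f \<in> C0 S \<Longrightarrow> ((\<lambda>t. sup_norm (\<lambda>x. G t f x - f x)) \<longlongrightarrow> 0) (at_right 0)"
  and G_lin: "0 \<le> t \<Longrightarrow> f \<in> C0 S \<Longrightarrow> h \<in> C0 S \<Longrightarrow> G t (\<lambda>x. a * f x + b * h x) = (\<lambda>x. a * G t f x + b * G t h x)"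
  using semigroup unfolding contraction_semigroup_def by blast+

lemma G_diff: "0 \<le> t \<Longrightarrow> f \<in> C0 S \<Longrightarrow> h \<in> C0 S \<Longrightarrow> G t (\<lambda>x. f x - h x) = (\<lambda>x. G t f x - G t h x)"
  using G_lin[of t f h 1 "-1"] by simp

lemma G_cmult: "0 \<le> t \<Longrightarrow> f \<in> C0 S \<Longrightarrow> G t (\<lambda>x. a * f x) = (\<lambda>x. a * G t f x)"
  using G_lin[of t f f a 0] by simp

lemma G_bound: "0 \<le> t \<Longrightarrow> f \<in> C0 S \<Longrightarrow> \<bar>G t f x\<bar> \<le> sup_norm f"
  using C0_sup_norm[OF G_C0, of t f x] G_contr[of t f] by linarith

abbreviation osc :: "('a \<Rightarrow> real) \<Rightarrow> real \<Rightarrow> real" where "osc f h \<equiv> sup_norm (\<lambda>x. G h f x - f x)"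

text \<open>The increment at \<open>r\<close> is \<open>G r\<close> applied to the increment at 0,
  so contractivity gives a modulus of continuity uniform in \<open>r\<close> and
  \<open>x\<close>.\<close>

lemma G_shift:
  assumes f: "f \<in> C0 S" and r: "0 \<le> r" and h: "0 \<le> h" shows "\<bar>G (r + h) f x - G r f x\<bar> \<le> osc f h"
proof -
  have d: "(\<lambda>x. G h f x - f x) \<in> C0 S" by (intro C0_diff G_C0 f h)
  have "G (r + h) f x - G r f x = G r (\<lambda>x. G h f x - f x) x"
    using G_add[OF r h f] G_diff[OF r G_C0[OF h f] f] by simp
  then show ?thesis using G_bound[OF r d, of x] by simp
qed

lemma osc_eventually:
  fixes \<phi> :: "real \<Rightarrow> real"
  assumes "(\<phi> \<longlongrightarrow> 0) (at_right 0)" "0 < e" shows "\<exists>d>0. \<forall>h>0. h < d \<longrightarrow> \<phi> h < e"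
  using order_tendstoD(2)[OF assms] unfolding eventually_at_right_field by auto

lemma G_continuous:
  assumes f: "f \<in> C0 S" shows "continuous_on {0..} (\<lambda>t. G t f x)"
  unfolding continuous_on_iff
proof (intro ballI allI impI)
  fix t e :: real assume t: "t \<in> {0..}" and e: "0 < e"
  obtain d where d: "0 < d" "\<And>h. 0 < h \<Longrightarrow> h < d \<Longrightarrow> osc f h < e" using osc_eventually[OF G_cont[OF f] e] by blast
  have "dist (G s f x) (G t f x) < e" if s: "s \<in> {0..}" "dist s t < d" for s
  proof -
    consider "s = t" | "s < t" | "t < s" by linarith
    then show ?thesis
    proof cases
      case 1 then show ?thesis using e by simp
    next
      case 2
      then show ?thesis using G_shift[OF f, of s "t - s" x] d(2)[of "t - s"] s by (simp add: dist_real_def abs_minus_commute)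
    next
      case 3
      then show ?thesis using G_shift[OF f, of t "s - t" x] d(2)[of "s - t"] s t by (simp add: dist_real_def)
    qed
  qed
  then show "\<exists>d>0. \<forall>s\<in>{0..}. dist s t < d \<longrightarrow> dist (G s f x) (G t f x) < e" using d(1) by blast
qed

abbreviation graph where "graph \<equiv> generator_graph (C0 S) G"

lemma graphD:
  assumes "(f, h) \<in> graph"
  shows "f \<in> C0 S" "h \<in> C0 S" "((\<lambda>t. sup_norm (\<lambda>x. (G t f x - f x) / t - h x)) \<longlongrightarrow> 0) (at_right 0)"
  using assms unfolding generator_graph_def by auto

lemma quotient_C0:
  assumes "f \<in> C0 S" "h \<in> C0 S" "0 \<le> t" shows "(\<lambda>x. (G t f x - f x) / t - h x) \<in> C0 S"
  using C0_diff[OF C0_linear[OF C0_diff[OF G_C0[OF assms(3,1)] assms(1)] C0_zero, of "1 / t" 0] assms(2)] by simp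

lemma graph_unique:
  assumes a: "(f, h) \<in> graph" and b: "(f, h') \<in> graph" shows "h = h'"
proof
  fix x
  let ?a = "\<lambda>t. sup_norm (\<lambda>x. (G t f x - f x) / t - h x)" and ?b = "\<lambda>t. sup_norm (\<lambda>x. (G t f x - f x) / t - h' x)"
  have "((\<lambda>t. ?a t + ?b t) \<longlongrightarrow> 0 + 0) (at_right 0)" by (intro tendsto_add graphD(3)[OF a] graphD(3)[OF b])
  moreover have "eventually (\<lambda>t. \<bar>h x - h' x\<bar> \<le> ?a t + ?b t) (at_right 0)"
  proof (rule eventually_at_right_less[THEN eventually_mono])
    fix t :: real assume t: "0 < t"
    show "\<bar>h x - h' x\<bar> \<le> ?a t + ?b t"
      using C0_sup_norm[OF quotient_C0[OF graphD(1,2)[OF a]], of t x] C0_sup_norm[OF quotient_C0[OF graphD(1,2)[OF b]], of t x] t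
      by linarith
  qed
  ultimately have "\<bar>h x - h' x\<bar> \<le> 0 + 0" by (intro tendsto_lowerbound) auto
  then show "h x = h' x" by simp
qed

lemma generator_eq: "(f, h) \<in> graph \<Longrightarrow> generator (C0 S) G f = h"
  unfolding generator_def by (rule the_equality) (auto intro: graph_unique)

lemma generator_zero: "generator (C0 S) G (\<lambda>x. 0) = (\<lambda>x. 0)"
proof (rule generator_eq)
  have z: "G t (\<lambda>x. 0) = (\<lambda>x. 0)" if "0 \<le> t" for t using G_cmult[OF that C0_zero, of 0] by simp
  have "((\<lambda>t. 0) \<longlongrightarrow> (0::real)) (at_right 0)" by simp
  moreover have "eventually (\<lambda>t. 0 = sup_norm (\<lambda>x. (G t (\<lambda>x. 0) x - 0) / t - 0)) (at_right 0)"
    by (rule eventually_at_right_less[THEN eventually_mono]) (simp add: z sup_norm_def)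
  ultimately have "((\<lambda>t. sup_norm (\<lambda>x. (G t (\<lambda>x. 0) x - 0) / t - 0)) \<longlongrightarrow> 0) (at_right 0)"
    by (rule Lim_transform_eventually)
  then show "(\<lambda>x. 0, \<lambda>x. 0) \<in> graph" unfolding generator_graph_def by (simp add: C0_zero)
qed

lemma G_quotient:
  assumes g: "(f, h) \<in> graph" and r: "0 \<le> r" and t: "0 < t"
  shows "G r (\<lambda>x. (G t f x - f x) / t - h x) = (\<lambda>x. (G (r + t) f x - G r f x) / t - G r h x)"
proof -
  note C = graphD(1,2)[OF g]
  have tt: "0 \<le> t" using t by simp
  have "G r (\<lambda>x. (1 / t) * (G t f x - f x) - h x) = (\<lambda>x. (1 / t) * (G r (G t f) x - G r f x) - G r h x)"
    using G_diff[OF r, of "\<lambda>x. (1 / t) * (G t f x - f x)" h] G_cmult[OF r C0_diff[OF G_C0[OF tt C(1)] C(1)], of "1 / t"]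
      G_diff[OF r G_C0[OF tt C(1)] C(1)] C0_linear[OF C0_diff[OF G_C0[OF tt C(1)] C(1)] C0_zero, of "1 / t" 0] C
    by simp
  then show ?thesis using G_add[OF r tt C(1)] by simp
qed

text \<open>\<open>G r\<close> commutes with the difference quotients and is a contraction, so their
  convergence for \<open>f\<close> carries over.\<close>

lemma graph_G:
  assumes g: "(f, h) \<in> graph" and r: "0 \<le> r" shows "(G r f, G r h) \<in> graph"
proof -
  note C = graphD[OF g]
  have "((\<lambda>t. sup_norm (\<lambda>x. (G t (G r f) x - G r f x) / t - G r h x)) \<longlongrightarrow> 0) (at_right 0)"
  proof (rule tendsto_sandwich[OF _ _ tendsto_const C(3)])
    show "eventually (\<lambda>t. 0 \<le> sup_norm (\<lambda>x. (G t (G r f) x - G r f x) / t - G r h x)) (at_right 0)"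
    proof (rule eventually_at_right_less[THEN eventually_mono])
      fix t :: real assume "0 < t"
      then have "(\<lambda>x. (G t (G r f) x - G r f x) / t - G r h x) \<in> C0 S" using C r by (intro quotient_C0 G_C0) auto
      from C0_sup_norm[OF this] show "0 \<le> sup_norm (\<lambda>x. (G t (G r f) x - G r f x) / t - G r h x)"
        by (meson abs_ge_zero order_trans)
    qed
    show "eventually (\<lambda>t. sup_norm (\<lambda>x. (G t (G r f) x - G r f x) / t - G r h x) \<le> sup_norm (\<lambda>x. (G t f x - f x) / t - h x)) (at_right 0)"
    proof (rule eventually_at_right_less[THEN eventually_mono])
      fix t :: real assume t: "0 < t"
      have "G t (G r f) = G (r + t) f" using G_add[of t r f] t r C by (simp add: add.commute)
      then have "(\<lambda>x. (G t (G r f) x - G r f x) / t - G r h x) = G r (\<lambda>x. (G t f x - f x) / t - h x)"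
        using G_quotient[OF g r t] by simp
      then show "sup_norm (\<lambda>x. (G t (G r f) x - G r f x) / t - G r h x) \<le> sup_norm (\<lambda>x. (G t f x - f x) / t - h x)"
        using G_contr[OF r quotient_C0[OF C(1,2)], of t] t by simp
    qed
  qed
  then show ?thesis using C r unfolding generator_graph_def by (simp add: G_C0)
qed

text \<open>Contractivity controls forward quotients uniformly in the base point. A quotient to the
  left of \<open>r\<close> is the forward quotient based at \<open>s < r\<close>; it is close to
  \<open>G s h\<close>, which strong continuity compares with \<open>G r h\<close>.\<close>

lemma G_derivative:
  assumes g: "(f, h) \<in> graph" and r: "0 \<le> r"
  shows "((\<lambda>t. G t f x) has_real_derivative G r h x) (at r within {0..})"
proof -
  note C = graphD[OF g]
  let ?q = "\<lambda>t. sup_norm (\<lambda>x. (G t f x - f x) / t - h x)"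
  have lim: "((\<lambda>t. ?q t + osc h t) \<longlongrightarrow> 0) (at_right 0)" using tendsto_add[OF C(3) G_cont[OF C(2)]] by simp
  have q0: "0 \<le> ?q t" "0 \<le> osc h t" if "0 < t" for t
  proof -
    have "(\<lambda>x. (G t f x - f x) / t - h x) \<in> C0 S" "(\<lambda>x. G t h x - h x) \<in> C0 S"
      using that by (auto intro!: quotient_C0[OF C(1,2)] C0_diff[OF G_C0[OF _ C(2)] C(2)])
    from this[THEN C0_sup_norm] show "0 \<le> ?q t" "0 \<le> osc h t" by (meson abs_ge_zero order_trans)+
  qed
  have up: "\<bar>(G (u + t) f x - G u f x) / t - G u h x\<bar> \<le> ?q t" if "0 \<le> u" "0 < t" for u t
    using G_bound[OF that(1) quotient_C0[OF C(1,2)], of t x] G_quotient[OF g that] that by simp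
  have key: "\<bar>(G s f x - G r f x) / (s - r) - G r h x\<bar> \<le> ?q \<bar>s - r\<bar> + osc h \<bar>s - r\<bar>" if s: "0 \<le> s" "s \<noteq> r" for s
  proof (cases "r < s")
    case True
    then show ?thesis using up[OF r, of "s - r"] q0[of "s - r"] by simp
  next
    case False
    then have sr: "s < r" using s by simp
    have "(G s f x - G r f x) / (s - r) = (G r f x - G s f x) / (r - s)" by (metis minus_diff_eq minus_divide_divide)
    moreover have "\<bar>(G r f x - G s f x) / (r - s) - G s h x\<bar> \<le> ?q (r - s)" using up[OF s(1), of "r - s"] sr by simp
    moreover have "\<bar>G r h x - G s h x\<bar> \<le> osc h (r - s)" using G_shift[OF C(2) s(1), of "r - s" x] sr by simp
    moreover have ab: "\<bar>s - r\<bar> = r - s" using sr by simp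
    ultimately show ?thesis unfolding ab by linarith
  qed
  show ?thesis
    unfolding has_field_derivative_iff LIM_def dist_real_def Lim_within
  proof (intro allI impI)
    fix e :: real assume e: "0 < e"
    obtain d where d: "0 < d" "\<And>t. 0 < t \<Longrightarrow> t < d \<Longrightarrow> ?q t + osc h t < e" using osc_eventually[OF lim e] by blast
    show "\<exists>d>0. \<forall>s\<in>{0..}. 0 < \<bar>s - r\<bar> \<and> \<bar>s - r\<bar> < d \<longrightarrow> \<bar>(G s f x - G r f x) / (s - r) - G r h x\<bar> < e"
    proof (intro exI[of _ d] conjI ballI impI d(1))
      fix s assume "s \<in> {0..}" "0 < \<bar>s - r\<bar> \<and> \<bar>s - r\<bar> < d"
      then show "\<bar>(G s f x - G r f x) / (s - r) - G r h x\<bar> < e" using key[of s] d(2)[of "\<bar>s - r\<bar>"] by force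
    qed
  qed
qed

text \<open>The fundamental theorem of calculus for e^(-cs) \<open>G s f x\<close>, whose derivative
  is continuous on \<open>[0, t]\<close>.\<close>

lemma G_dynkin:
  assumes g: "(f, h) \<in> graph" and t: "0 \<le> t"
  shows "exp (- c * t) * G t f x - f x = (LINT s:{0..t}|lborel. exp (- c * s) * (G s h x - c * G s f x))"
proof -
  note C = graphD[OF g]
  have "((\<lambda>s. exp (- c * s) * G s f x) has_vector_derivative exp (- c * s) * (G s h x - c * G s f x)) (at s within {0..t})"
    if s: "0 \<le> s" "s \<le> t" for s
  proof -
    have "((\<lambda>s. G s f x) has_real_derivative G s h x) (at s within {0..t})"
      by (rule DERIV_subset[OF G_derivative[OF g s(1)]]) auto
    then have "((\<lambda>s. exp (- c * s) * G s f x) has_real_derivative exp (- c * s) * (G s h x - c * G s f x)) (at s within {0..t})"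
      by (auto intro!: derivative_eq_intros simp: algebra_simps)
    then show ?thesis by (simp add: has_real_derivative_iff_has_vector_derivative)
  qed
  moreover have "continuous_on {0..t} (\<lambda>s. exp (- c * s) * (G s h x - c * G s f x))"
    by (intro continuous_intros continuous_on_subset[OF G_continuous[OF C(1)]] continuous_on_subset[OF G_continuous[OF C(2)]]) auto
  ultimately have "(LINT s:{0..t}|lborel. exp (- c * s) * (G s h x - c * G s f x)) = exp (- c * t) * G t f x - exp (- c * 0) * G 0 f x"
    unfolding set_lebesgue_integral_def using t by (intro integral_FTC_atLeastAtMost) auto
  then show ?thesis using G_0[OF C(1)] by simp
qed

text \<open>By \<open>graph_G\<close> the semigroup maps the generator graph into itself, and the
  part of the graph over a core is dense in it for the two sup norms.\<close>

lemma core_approx: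
  assumes core: "is_core (C0 S) G D" and f: "f \<in> D" and t: "0 \<le> t" and e: "0 < e"
  obtains k where "k \<in> D" "\<And>x. \<bar>k x - G t f x\<bar> \<le> e" "\<And>x. \<bar>generator (C0 S) G k x - G t (generator (C0 S) G f) x\<bar> \<le> e"
proof -
  have dom: "D \<subseteq> Domain graph" using core unfolding is_core_def by blast
  have gr: "(k, generator (C0 S) G k) \<in> graph" if "k \<in> D" for k
    using dom that generator_eq by auto
  have "(G t f, G t (generator (C0 S) G f)) \<in> graph" by (rule graph_G[OF gr[OF f] t])
  then have "(G t f, G t (generator (C0 S) G f)) \<in> {(f, h). f \<in> C0 S \<and> h \<in> C0 S \<and> (\<forall>\<epsilon>>0. \<exists>k\<in>D.
        sup_norm (\<lambda>x. k x - f x) < \<epsilon> \<and> sup_norm (\<lambda>x. generator (C0 S) G k x - h x) < \<epsilon>)}"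
    using core unfolding is_core_def by simp
  then obtain k where k: "k \<in> D" "sup_norm (\<lambda>x. k x - G t f x) < e"
      "sup_norm (\<lambda>x. generator (C0 S) G k x - G t (generator (C0 S) G f) x) < e" using e by auto
  note kC = graphD(1,2)[OF gr[OF k(1)]] and fC = graphD(1,2)[OF gr[OF f]]
  show ?thesis
  proof (rule that[OF k(1)])
    show "\<bar>k x - G t f x\<bar> \<le> e" for x
      using C0_sup_norm[OF C0_diff[OF kC(1) G_C0[OF t fC(1)]], of x] k(2) by linarith
    show "\<bar>generator (C0 S) G k x - G t (generator (C0 S) G f) x\<bar> \<le> e" for x
      using C0_sup_norm[OF C0_diff[OF kC(2) G_C0[OF t fC(2)]], of x] k(3) by linarith
  qed
qed

end

context stratum_diffusion
begin

sublocale feller: feller_semigroup S "transition_op S Q"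
  by unfold_locales (rule feller)

lemma Q_prob:
  assumes "x \<in> S"
  shows "sets (Q x) = sets (skorokhod_borel S)" "space (Q x) = skorokhod_space S" "prob_space (Q x)"
  using measurable_space[OF kernel, of x] assms
  by (auto simp: space_restrict_space space_prob_algebra dest: sets_eq_imp_space_eq)

text \<open>Integration over an event removes the conditional expectation. The event is taken from
  the filtration of paths in the whole space, because the strata will be treated together.\<close>

lemma markov_integral:
  assumes x: "x \<in> S" and s: "0 \<le> s" and t: "0 \<le> t" and f: "bmeas borel f" and A: "A \<in> sets (path_filtration UNIV s)"
  shows "(\<integral>\<omega>. indicator A \<omega> * f (\<omega> (s + t)) \<partial>Q x) = (\<integral>\<omega>. indicator A \<omega> * transition_op S Q t f (\<omega> s) \<partial>Q x)"
proof -
  note Qp = Q_prob[OF x]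
  interpret prob_space "Q x" by (rule Qp)
  have sub: "subalgebra (Q x) (path_filtration S s)" by (rule subalgebra_path_filtration[OF Qp(1)])
  interpret sigma_finite_subalgebra "Q x" "path_filtration S s"
    by (rule finite_measure_subalgebra_is_sigma_finite) (simp add: finite_measure_subalgebra_def finite_measure_axioms sub finite_measure_subalgebra_axioms_def)
  \<comment> \<open>Cut down to paths in \<open>S\<close>, the event belongs to the filtration with
    respect to which the conditional expectation is taken.\<close>
  define A' where "A' = A \<inter> skorokhod_space S"
  have "(\<lambda>\<omega>. \<omega>) \<in> path_filtration S s \<rightarrow>\<^sub>M path_filtration UNIV s"
    using skorokhod_space_mono[of S UNIV] by (intro sets_path_filtrationI) (auto intro: measurable_path_filtration_eval)
  from measurable_sets[OF this A] have A': "A' \<in> sets (path_filtration S s)" unfolding A'_def by simp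
  have iA: "indicator A \<omega> = (indicator A' \<omega> :: real)" if "\<omega> \<in> space (Q x)" for \<omega>
    using that unfolding A'_def by (simp add: Qp indicator_def)
  have int: "integrable (Q x) (\<lambda>\<omega>. f (\<omega> (s + t)))"
    using bmeas_skorokhod_eval[OF f, of "s + t" S] s t
    by (intro bmeas_integrable finite_measure_axioms) (simp add: bmeas_sets_cong[OF Qp(1)])
  have "f \<in> borel_measurable (restrict_space borel S)" "bounded (f ` S)"
    using f by (auto simp: bmeas_borel_iff intro: measurable_restrict_space1 bounded_subset)
  from markov[OF x s t this]
  have ae: "AE \<omega> in Q x. real_cond_exp (Q x) (path_filtration S s) (\<lambda>\<omega>. f (\<omega> (s + t))) \<omega> = transition_op S Q t f (\<omega> s)" .
  have "(\<integral>\<omega>. indicator A \<omega> * f (\<omega> (s + t)) \<partial>Q x) = (\<integral>\<omega>. indicator A' \<omega> * f (\<omega> (s + t)) \<partial>Q x)"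
    by (intro Bochner_Integration.integral_cong refl) (simp add: iA)
  also have "\<dots> = (\<integral>\<omega>. indicator A' \<omega> * real_cond_exp (Q x) (path_filtration S s) (\<lambda>\<omega>. f (\<omega> (s + t))) \<omega> \<partial>Q x)"
    using real_cond_exp_intA[OF int A'] by (simp add: set_lebesgue_integral_def)
  also have "\<dots> = (\<integral>\<omega>. indicator A \<omega> * transition_op S Q t f (\<omega> s) \<partial>Q x)"
  proof (rule integral_cong_AE)
    have A'Q: "A' \<in> sets (Q x)" using A' sub unfolding subalgebra_def by blast
    have k: "bmeas (restrict_space borel S) (\<lambda>y. \<integral>\<omega>. f (\<omega> t) \<partial>Q y)"
      by (rule bmeas_kernel[OF _ kernel]) (rule bmeas_compose[OF bmeas_skorokhod_eval[OF f t] measurable_snd])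
    have ev: "(\<lambda>\<omega>. \<omega> s) \<in> Q x \<rightarrow>\<^sub>M restrict_space borel S"
    proof (rule measurable_restrict_space2)
      show "(\<lambda>\<omega>. \<omega> s) \<in> space (Q x) \<rightarrow> S" using s by (auto simp: Qp intro: skorokhod_space_in)
      show "(\<lambda>\<omega>. \<omega> s) \<in> Q x \<rightarrow>\<^sub>M borel" using measurable_skorokhod_eval[OF s, of S] by (simp add: measurable_cong_sets[OF Qp(1) refl])
    qed
    have tr: "transition_op S Q t f (\<omega> s) = (\<integral>\<eta>. f (\<eta> t) \<partial>Q (\<omega> s))" if "\<omega> \<in> space (Q x)" for \<omega>
      using that s by (simp add: transition_op_def zero_ext_def Qp skorokhod_space_in)
    have trm: "(\<lambda>\<omega>. transition_op S Q t f (\<omega> s)) \<in> borel_measurable (Q x)"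
      using measurable_compose[OF ev bmeasD[OF k]] by (rule measurable_cong[THEN iffD1, rotated]) (simp add: tr)
    show "(\<lambda>\<omega>. indicator A' \<omega> * real_cond_exp (Q x) (path_filtration S s) (\<lambda>\<omega>. f (\<omega> (s + t))) \<omega>) \<in> borel_measurable (Q x)"
      using A'Q by measurable
    have "(\<lambda>\<omega>. indicator A' \<omega> * transition_op S Q t f (\<omega> s)) \<in> borel_measurable (Q x)"
      using A'Q trm by measurable
    then show "(\<lambda>\<omega>. indicator A \<omega> * transition_op S Q t f (\<omega> s)) \<in> borel_measurable (Q x)"
      by (rule measurable_cong[THEN iffD1, rotated]) (simp add: iA)
    show "AE \<omega> in Q x. indicator A' \<omega> * real_cond_exp (Q x) (path_filtration S s) (\<lambda>\<omega>. f (\<omega> (s + t))) \<omega>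
        = indicator A \<omega> * transition_op S Q t f (\<omega> s)"
      using ae AE_space by eventually_elim (simp add: iA)
  qed
  finally show ?thesis .
qed

lemma generator_graph: "f \<in> C \<Longrightarrow> (f, generator (C0 S) (transition_op S Q) f) \<in> feller.graph"
  using core feller.generator_eq unfolding is_core_def by auto

end

section \<open>The stratified process\<close>

lemma transition_op_zero_ext:
  assumes "x \<in> S" "0 \<le> t" "sets (Q x) = sets (skorokhod_borel S)"
  shows "transition_op S Q t (zero_ext S f) x = (\<integral>\<omega>. f (\<omega> t) \<partial>Q x)"
proof -
  have "(\<integral>\<omega>. zero_ext S f (\<omega> t) \<partial>Q x) = (\<integral>\<omega>. f (\<omega> t) \<partial>Q x)"
    using assms(2) sets_eq_imp_space_eq[OF assms(3)]
    by (intro Bochner_Integration.integral_cong refl) (simp add: zero_ext_def skorokhod_space_in)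
  then show ?thesis using assms(1) by (simp add: transition_op_def zero_ext_def[of S "\<lambda>x. \<integral>\<omega>. zero_ext S f (\<omega> t) \<partial>Q x"])
qed

lemma solves_martingale_problem_cong:
  "(\<And>f. f \<in> D \<Longrightarrow> A f = A' f) \<Longrightarrow> solves_martingale_problem A D x P = solves_martingale_problem A' D x P"
  unfolding solves_martingale_problem_def by (simp cong: ball_cong)

locale stratified_process =
  fixes I :: "'i set" and S :: "'i \<Rightarrow> 'a::{metric_space, second_countable_topology} set"
    and Q :: "'i \<Rightarrow> 'a \<Rightarrow> (real \<Rightarrow> 'a) measure" and C :: "'i \<Rightarrow> ('a \<Rightarrow> real) set"
    and Ed :: "'e set" and tail head :: "'e \<Rightarrow> 'i"
    and K :: "'e \<Rightarrow> 'a \<Rightarrow> 'a measure" and r :: "'e \<Rightarrow> 'a \<Rightarrow> real"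
  assumes strata: "countable I" "disjoint_family_on S I" "(\<Union>\<alpha>\<in>I. S \<alpha>) = UNIV" "\<And>\<alpha>. \<alpha> \<in> I \<Longrightarrow> S \<alpha> \<in> sets borel"
    and diffusion: "\<And>\<alpha>. \<alpha> \<in> I \<Longrightarrow> stratum_diffusion (S \<alpha>) (Q \<alpha>) (C \<alpha>)"
    and jumps: "jump_mechanism I S Ed tail head K r"
begin

abbreviation "stratum \<equiv> stratum_of I S"
abbreviation "G \<alpha> \<equiv> transition_op (S \<alpha>) (Q \<alpha>)"
abbreviation "L\<^sub>0 \<alpha> \<equiv> generator (C0 (S \<alpha>)) (G \<alpha>)"

lemma stratum_eq: assumes "\<alpha> \<in> I" "x \<in> S \<alpha>" shows "stratum x = \<alpha>"
  unfolding stratum_of_def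
  by (rule the_equality) (use assms strata(2) in \<open>auto simp: disjoint_family_on_def\<close>)

lemma stratum_in: "stratum x \<in> I" "x \<in> S (stratum x)"
proof -
  obtain \<alpha> where "\<alpha> \<in> I" "x \<in> S \<alpha>" using strata(3) by blast
  then show "stratum x \<in> I" "x \<in> S (stratum x)" by (auto simp: stratum_eq)
qed

lemma stratumwise_measurable:
  assumes "\<And>\<alpha>. \<alpha> \<in> I \<Longrightarrow> f \<alpha> \<in> restrict_space borel (S \<alpha>) \<rightarrow>\<^sub>M N"
    and "\<And>\<alpha> x. \<alpha> \<in> I \<Longrightarrow> x \<in> S \<alpha> \<Longrightarrow> h x = f \<alpha> x"
  shows "h \<in> borel \<rightarrow>\<^sub>M N"
proof (rule measurable_piecewise_restrict[of "S ` I"])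
  show "\<Omega> \<inter> space borel \<in> sets borel" if "\<Omega> \<in> S ` I" for \<Omega> using that strata(4) by auto
  show "h \<in> restrict_space borel \<Omega> \<rightarrow>\<^sub>M N" if \<Omega>: "\<Omega> \<in> S ` I" for \<Omega>
  proof -
    obtain \<alpha> where \<alpha>: "\<alpha> \<in> I" "\<Omega> = S \<alpha>" using \<Omega> by blast
    have "h \<in> restrict_space borel (S \<alpha>) \<rightarrow>\<^sub>M N \<longleftrightarrow> f \<alpha> \<in> restrict_space borel (S \<alpha>) \<rightarrow>\<^sub>M N"
      using assms(2)[OF \<alpha>(1)] by (intro measurable_cong) (simp add: space_restrict_space)
    then show ?thesis using assms(1)[OF \<alpha>(1)] \<alpha>(2) by simp
  qed
qed (use strata in auto)

text \<open>The identity is the inclusion of the paths in one stratum into the paths in the whole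
  space; an image measure is needed since these are different measurable spaces.\<close>

definition path_law :: "'a \<Rightarrow> (real \<Rightarrow> 'a) measure" where
  "path_law x = distr (Q (stratum x) x) (skorokhod_borel UNIV) (\<lambda>\<omega>. \<omega>)"

lemma path_inclusion_measurable: "(\<lambda>\<omega>. \<omega>) \<in> skorokhod_borel (S \<alpha>) \<rightarrow>\<^sub>M skorokhod_borel UNIV"
  using skorokhod_space_mono[of "S \<alpha>" UNIV]
  by (intro measurable_skorokhodI) (auto simp: space_skorokhod_borel intro: measurable_skorokhod_eval)

lemma Q_stratum:
  "sets (Q (stratum x) x) = sets (skorokhod_borel (S (stratum x)))"
  "space (Q (stratum x) x) = skorokhod_space (S (stratum x))" "prob_space (Q (stratum x) x)"
  using stratum_diffusion.Q_prob[OF diffusion stratum_in(2)] stratum_in(1) by blast+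

lemma path_law_measurable: "path_law \<in> borel \<rightarrow>\<^sub>M prob_algebra (skorokhod_borel UNIV)"
proof (rule stratumwise_measurable)
  show "(\<lambda>x. distr (Q \<alpha> x) (skorokhod_borel UNIV) (\<lambda>\<omega>. \<omega>)) \<in> restrict_space borel (S \<alpha>) \<rightarrow>\<^sub>M prob_algebra (skorokhod_borel UNIV)"
    if "\<alpha> \<in> I" for \<alpha>
    by (rule measurable_compose[OF stratum_diffusion.kernel[OF diffusion[OF that]] measurable_distr_prob_space])
      (rule path_inclusion_measurable)
qed (simp add: path_law_def stratum_eq)

lemma path_inclusion: "(\<lambda>\<omega>. \<omega>) \<in> Q (stratum x) x \<rightarrow>\<^sub>M skorokhod_borel UNIV"
  unfolding measurable_cong_sets[OF Q_stratum(1) refl] by (rule path_inclusion_measurable)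

lemma integral_path_law:
  fixes f :: "(real \<Rightarrow> 'a) \<Rightarrow> real"
  assumes "f \<in> borel_measurable (skorokhod_borel UNIV)"
  shows "(\<integral>\<omega>. f \<omega> \<partial>path_law x) = (\<integral>\<omega>. f \<omega> \<partial>Q (stratum x) x)"
  unfolding path_law_def by (rule integral_distr[OF path_inclusion assms])

lemma path_law_start: "AE \<omega> in path_law x. \<omega> 0 = x"
proof -
  have "(\<lambda>\<omega>. \<omega> 0) \<in> skorokhod_borel UNIV \<rightarrow>\<^sub>M (borel :: 'a measure)" by (rule measurable_skorokhod_eval) simp
  then have "Measurable.pred (skorokhod_borel UNIV) (\<lambda>\<omega>. \<omega> 0 = x)" by measurable
  then have "{\<omega> \<in> space (skorokhod_borel UNIV). \<omega> 0 = x} \<in> sets (skorokhod_borel UNIV)" by measurable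
  from AE_distr_iff[OF path_inclusion this] show ?thesis
    using stratum_diffusion.start[OF diffusion stratum_in(2)] stratum_in(1) unfolding path_law_def by simp
qed

lemma integral_path_law_eval:
  assumes f: "bmeas borel f" and t: "0 \<le> t"
  shows "(\<integral>\<omega>. f (\<omega> t) \<partial>path_law x) = G (stratum x) t f x"
  using integral_path_law[OF bmeasD[OF bmeas_skorokhod_eval[OF f t]]] stratum_in(2)[of x]
  by (simp add: transition_op_def zero_ext_def)

text \<open>The path never leaves the stratum of \<open>x\<close>, so the law restarted at
  \<open>\<omega> s\<close> is that of the same diffusion.\<close>

lemma path_law_markov:
  assumes s: "0 \<le> s" and t: "0 \<le> t" and A: "A \<in> sets (path_filtration UNIV s)" and f: "bmeas borel f"
  shows "(\<integral>\<omega>. indicator A \<omega> * f (\<omega> (s + t)) \<partial>path_law x) = (\<integral>\<omega>. indicator A \<omega> * (\<integral>\<eta>. f (\<eta> t) \<partial>path_law (\<omega> s)) \<partial>path_law x)"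
proof -
  have A': "A \<in> sets (skorokhod_borel UNIV)" using A path_filtration_subset by blast
  have st: "0 \<le> s + t" using s t by simp
  have "bmeas borel (\<lambda>y. \<integral>\<eta>. f (\<eta> t) \<partial>path_law y)"
    by (rule bmeas_kernel[OF _ path_law_measurable]) (rule bmeas_compose[OF bmeas_skorokhod_eval[OF f t] measurable_snd])
  then have m: "(\<lambda>\<omega>. \<integral>\<eta>. f (\<eta> t) \<partial>path_law (\<omega> s)) \<in> borel_measurable (skorokhod_borel UNIV)"
    by (intro bmeasD bmeas_skorokhod_eval s)
  have "(\<integral>\<omega>. indicator A \<omega> * f (\<omega> (s + t)) \<partial>path_law x) = (\<integral>\<omega>. indicator A \<omega> * f (\<omega> (s + t)) \<partial>Q (stratum x) x)"
    by (intro integral_path_law borel_measurable_times borel_measurable_indicator A' bmeasD[OF bmeas_skorokhod_eval[OF f st]])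
  also have "\<dots> = (\<integral>\<omega>. indicator A \<omega> * G (stratum x) t f (\<omega> s) \<partial>Q (stratum x) x)"
    by (rule stratum_diffusion.markov_integral[OF diffusion stratum_in(2) s t f A]) (rule stratum_in)
  also have "\<dots> = (\<integral>\<omega>. indicator A \<omega> * (\<integral>\<eta>. f (\<eta> t) \<partial>path_law (\<omega> s)) \<partial>Q (stratum x) x)"
  proof (intro Bochner_Integration.integral_cong refl)
    fix \<omega> assume "\<omega> \<in> space (Q (stratum x) x)"
    then have "\<omega> s \<in> S (stratum x)" using s by (simp add: Q_stratum skorokhod_space_in)
    then have "stratum (\<omega> s) = stratum x" by (rule stratum_eq[OF stratum_in(1)])
    then show "indicator A \<omega> * G (stratum x) t f (\<omega> s) = indicator A \<omega> * (\<integral>\<eta>. f (\<eta> t) \<partial>path_law (\<omega> s))"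
      by (simp add: integral_path_law_eval[OF f t])
  qed
  also have "\<dots> = (\<integral>\<omega>. indicator A \<omega> * (\<integral>\<eta>. f (\<eta> t) \<partial>path_law (\<omega> s)) \<partial>path_law x)"
    by (intro integral_path_law[symmetric] borel_measurable_times borel_measurable_indicator A' m)
  finally show ?thesis .
qed

text \<open>The lower bound 1 keeps the clock rate positive even when there are no jumps at
  all.\<close>

definition rate_bound :: real where
  "rate_bound = (SOME b. 1 \<le> b \<and> (\<forall>\<alpha>\<in>I. \<forall>x\<in>S \<alpha>. total_rate Ed tail r \<alpha> x \<le> ennreal b))"

lemma rate_bound: "1 \<le> rate_bound" "total_rate Ed tail r (stratum x) x \<le> ennreal rate_bound"
proof -
  obtain b where b: "\<forall>\<alpha>\<in>I. \<forall>x\<in>S \<alpha>. total_rate Ed tail r \<alpha> x \<le> ennreal b"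
    using jump_mechanism.rate_bounded[OF jumps] by blast
  have "ennreal b \<le> ennreal (max 1 b)" by (rule ennreal_leI) simp
  then have "\<forall>\<alpha>\<in>I. \<forall>x\<in>S \<alpha>. total_rate Ed tail r \<alpha> x \<le> ennreal (max 1 b)" using b order_trans by blast
  then have "\<exists>b::real. 1 \<le> b \<and> (\<forall>\<alpha>\<in>I. \<forall>x\<in>S \<alpha>. total_rate Ed tail r \<alpha> x \<le> ennreal b)"
    by (intro exI[of _ "max 1 b"]) simp
  from someI_ex[OF this] show "1 \<le> rate_bound" "total_rate Ed tail r (stratum x) x \<le> ennreal rate_bound"
    unfolding rate_bound_def[symmetric] using stratum_in[of x] by auto
qed

section \<open>Uniformization of the jumps\<close>

definition jump_intensity :: "'a \<Rightarrow> 'a measure" where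
  "jump_intensity x = jump_measure Ed tail K r (stratum x) x"

lemma sets_jump_intensity [simp]: "sets (jump_intensity x) = sets borel"
  unfolding jump_intensity_def jump_measure_def using sets.sets_measure_of_eq[of borel] by simp

lemma space_jump_intensity [simp]: "space (jump_intensity x) = UNIV"
  using sets_eq_imp_space_eq[OF sets_jump_intensity] by simp

lemma K_prob:
  assumes "e \<in> Ed" "x \<in> S (tail e)" shows "sets (K e x) = sets borel" "prob_space (K e x)"
  using measurable_space[OF jump_mechanism.jump_kernel[OF jumps assms(1)], of x] assms(2)
  by (auto simp: space_restrict_space space_prob_algebra)

lemma emeasure_jump_intensity:
  assumes "\<alpha> \<in> I" "x \<in> S \<alpha>" "B \<in> sets borel"
  shows "emeasure (jump_intensity x) B = (\<integral>\<^sup>+e. ennreal (r e x) * emeasure (K e x) B \<partial>count_space {e \<in> Ed. tail e = \<alpha>})"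
  unfolding jump_intensity_def stratum_eq[OF assms(1,2)]
  by (rule emeasure_jump_measure) (use assms K_prob in auto)

lemma emeasure_jump_intensity_UNIV: "emeasure (jump_intensity x) UNIV = total_rate Ed tail r (stratum x) x"
proof -
  have "emeasure (K e x) UNIV = 1" if "e \<in> Ed" "tail e = stratum x" for e
  proof -
    have "x \<in> S (tail e)" using stratum_in(2)[of x] that by simp
    note K = K_prob[OF that(1) this]
    show ?thesis using prob_space.emeasure_space_1[OF K(2)] sets_eq_imp_space_eq[OF K(1)] by simp
  qed
  moreover have "(UNIV :: 'a set) \<in> sets borel" by simp
  ultimately show ?thesis
    unfolding emeasure_jump_intensity[OF stratum_in \<open>UNIV \<in> sets borel\<close>] total_rate_def
    by (intro nn_integral_cong) simp
qed

lemma finite_jump_intensity: "finite_measure (jump_intensity x)"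
  using rate_bound(2)[of x]
  by (intro finite_measureI) (simp add: emeasure_jump_intensity_UNIV, metis ennreal_less_top leD)

definition intensity :: "'a \<Rightarrow> real" where "intensity x = measure (jump_intensity x) UNIV"

lemma emeasure_intensity: "emeasure (jump_intensity x) UNIV = ennreal (intensity x)"
  unfolding intensity_def by (rule finite_measure.emeasure_eq_measure[OF finite_jump_intensity])

lemma intensity_bounds: "0 \<le> intensity x" "intensity x \<le> rate_bound"
proof -
  show "0 \<le> intensity x" unfolding intensity_def by simp
  have "ennreal (intensity x) \<le> ennreal rate_bound"
    using rate_bound(2)[of x] by (simp add: emeasure_intensity[symmetric] emeasure_jump_intensity_UNIV)
  then show "intensity x \<le> rate_bound" using rate_bound(1) by (simp add: ennreal_le_iff)
qed

text \<open>A stratum has countably many outgoing edges, so joint measurability in edge and position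
  follows edge by edge, and Tonelli handles the sum.\<close>

lemma jump_intensity_measurable:
  assumes B: "B \<in> sets borel" shows "(\<lambda>x. emeasure (jump_intensity x) B) \<in> borel_measurable borel"
proof (rule stratumwise_measurable)
  fix \<alpha> assume \<alpha>: "\<alpha> \<in> I"
  let ?E = "{e \<in> Ed. tail e = \<alpha>}"
  have E: "countable ?E" using jump_mechanism.countable_edges[OF jumps] by (rule countable_subset[rotated]) auto
  interpret sigma_finite_measure "count_space ?E" by (rule sigma_finite_measure_count_space_countable[OF E])
  have "(\<lambda>p. ennreal (r (fst p) (snd p)) * emeasure (K (fst p) (snd p)) B)
      \<in> borel_measurable (count_space ?E \<Otimes>\<^sub>M restrict_space borel (S \<alpha>))"
  proof (rule measurable_pair_measure_countable1[OF E])
    fix e assume e: "e \<in> ?E"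
    have "r e \<in> borel_measurable (restrict_space borel (S \<alpha>))"
      using jump_mechanism.rate_borel[OF jumps, of e] e by simp
    moreover have "K e \<in> restrict_space borel (S \<alpha>) \<rightarrow>\<^sub>M subprob_algebra borel"
      using measurable_prob_algebraD[OF jump_mechanism.jump_kernel[OF jumps, of e]] e by simp
    from measurable_compose[OF this measurable_emeasure_subprob_algebra[OF B]]
    have "(\<lambda>x. emeasure (K e x) B) \<in> borel_measurable (restrict_space borel (S \<alpha>))" .
    ultimately show "(\<lambda>x. ennreal (r (fst (e, x)) (snd (e, x))) * emeasure (K (fst (e, x)) (snd (e, x))) B)
        \<in> borel_measurable (restrict_space borel (S \<alpha>))" by simp
  qed
  from measurable_compose[OF measurable_pair_swap' this]
  have "(\<lambda>(x, e). ennreal (r e x) * emeasure (K e x) B) \<in> borel_measurable (restrict_space borel (S \<alpha>) \<Otimes>\<^sub>M count_space ?E)"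
    by (simp add: case_prod_beta')
  from borel_measurable_nn_integral[OF this]
  show "(\<lambda>x. \<integral>\<^sup>+e. ennreal (r e x) * emeasure (K e x) B \<partial>count_space ?E) \<in> borel_measurable (restrict_space borel (S \<alpha>))" .
qed (rule emeasure_jump_intensity[OF _ _ B])

lemma intensity_measurable [measurable]: "intensity \<in> borel_measurable borel"
proof -
  have "(\<lambda>x. emeasure (jump_intensity x) UNIV) \<in> borel_measurable borel" by (rule jump_intensity_measurable) simp
  then have "(\<lambda>x. enn2real (emeasure (jump_intensity x) UNIV)) \<in> borel_measurable borel" by measurable
  then show ?thesis unfolding intensity_def[abs_def] measure_def .
qed

text \<open>Uniformization: at rate \<open>rate_bound\<close> the process either jumps or, with the missing probability, stays put.\<close>

definition jump_law :: "'a \<Rightarrow> 'a measure" where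
  "jump_law x = sum_measure (density (jump_intensity x) (\<lambda>_. ennreal (1 / rate_bound)))
     (density (return borel x) (\<lambda>_. ennreal (1 - intensity x / rate_bound)))"

lemma sets_jump_law [simp]: "sets (jump_law x) = sets borel"
  unfolding jump_law_def by simp

lemma stay_nonneg: "0 \<le> 1 - intensity x / rate_bound"
  using intensity_bounds[of x] rate_bound(1) by (simp add: divide_le_eq_1)

lemma emeasure_jump_law:
  assumes B: "B \<in> sets borel"
  shows "emeasure (jump_law x) B
    = ennreal (1 / rate_bound) * emeasure (jump_intensity x) B + ennreal (1 - intensity x / rate_bound) * indicator B x"
proof -
  have "emeasure (density (jump_intensity x) (\<lambda>_. ennreal (1 / rate_bound))) B = ennreal (1 / rate_bound) * emeasure (jump_intensity x) B"
    using B by (subst emeasure_density) (auto simp: nn_integral_cmult_indicator)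
  moreover have "emeasure (density (return borel x) (\<lambda>_. ennreal (1 - intensity x / rate_bound))) B
      = ennreal (1 - intensity x / rate_bound) * indicator B x"
    using B by (subst emeasure_density) (auto simp: nn_integral_cmult_indicator)
  ultimately show ?thesis unfolding jump_law_def using B by (subst emeasure_sum_measure) auto
qed

lemma prob_jump_law: "prob_space (jump_law x)"
proof
  have "emeasure (jump_law x) UNIV = ennreal (1 / rate_bound) * ennreal (intensity x) + ennreal (1 - intensity x / rate_bound)"
    by (simp add: emeasure_jump_law emeasure_intensity)
  also have "\<dots> = ennreal (1 / rate_bound * intensity x + (1 - intensity x / rate_bound))"
    using stay_nonneg[of x] intensity_bounds(1)[of x] rate_bound(1) by (simp add: ennreal_mult'[symmetric] ennreal_plus[symmetric] del: ennreal_plus)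
  also have "\<dots> = 1" by simp
  finally show "emeasure (jump_law x) (space (jump_law x)) = 1"
    using sets_eq_imp_space_eq[OF sets_jump_law, of x] by simp
qed

lemma jump_law_measurable: "jump_law \<in> borel \<rightarrow>\<^sub>M prob_algebra borel"
proof (rule measurable_prob_algebraI[OF prob_jump_law measurable_subprob_algebra])
  show "subprob_space (jump_law x)" for x by (rule prob_space_imp_subprob_space[OF prob_jump_law])
  show "(\<lambda>x. emeasure (jump_law x) B) \<in> borel_measurable borel" if B: "B \<in> sets borel" for B
  proof -
    note [measurable] = jump_intensity_measurable[OF B] B
    show ?thesis unfolding emeasure_jump_law[OF B] by measurable
  qed
qed simp

lemma integral_jump_law:
  assumes f: "bmeas borel f"
  shows "(\<integral>y. f y \<partial>jump_law x) = (\<integral>y. f y \<partial>jump_intensity x) / rate_bound + (1 - intensity x / rate_bound) * f x"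
proof -
  note m = bmeasD[OF f]
  have fd: "finite_measure (density M (\<lambda>_. ennreal a))" if "finite_measure M" for M :: "'a measure" and a
    using finite_measure.emeasure_finite[OF that, of "space M"]
    by (intro finite_measureI) (auto simp: emeasure_density nn_integral_cmult_indicator ennreal_mult_eq_top_iff)
  have "(\<integral>y. f y \<partial>jump_law x) = (\<integral>y. f y \<partial>density (jump_intensity x) (\<lambda>_. ennreal (1 / rate_bound)))
      + (\<integral>y. f y \<partial>density (return borel x) (\<lambda>_. ennreal (1 - intensity x / rate_bound)))"
    unfolding jump_law_def
    by (intro integral_sum_measure fd finite_jump_intensity prob_space.finite_measure prob_space_return)
      (auto simp: f bmeas_sets_cong[where N = borel])
  also have "(\<integral>y. f y \<partial>density (jump_intensity x) (\<lambda>_. ennreal (1 / rate_bound))) = (\<integral>y. f y \<partial>jump_intensity x) / rate_bound"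
    using m rate_bound(1) by (subst integral_density) (auto cong: measurable_cong_sets)
  also have "(\<integral>y. f y \<partial>density (return borel x) (\<lambda>_. ennreal (1 - intensity x / rate_bound))) = (1 - intensity x / rate_bound) * f x"
    using m stay_nonneg[of x] by (subst integral_density) (auto simp: integral_return cong: measurable_cong_sets)
  finally show ?thesis .
qed

sublocale process: jump_kernels path_law jump_law rate_bound
proof
  show "path_law \<in> borel \<rightarrow>\<^sub>M prob_algebra (skorokhod_borel UNIV)" by (rule path_law_measurable)
  show "jump_law \<in> borel \<rightarrow>\<^sub>M prob_algebra borel" by (rule jump_law_measurable)
  show "0 < rate_bound" using rate_bound(1) by simp
  show "AE \<omega> in path_law x. \<omega> 0 = x" for x by (rule path_law_start)
qed (rule path_law_markov)

text \<open>Staying put contributes nothing to the difference \<open>f y - f x\<close>, and the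
  factor \<open>rate_bound\<close> undoes the normalisation of the intensity.\<close>

lemma jump_operator_eq:
  assumes f: "bmeas borel f"
  shows "jump_operator I S Ed tail K r f x = rate_bound * (process.jump_op f x - f x)"
proof -
  interpret finite_measure "jump_intensity x" by (rule finite_jump_intensity)
  have i: "integrable (jump_intensity x) f"
    by (rule bmeas_integrable[OF finite_jump_intensity]) (simp add: f bmeas_sets_cong[where N = borel])
  have "jump_operator I S Ed tail K r f x = (\<integral>y. f y - f x \<partial>jump_intensity x)"
    unfolding jump_operator_def jump_intensity_def ..
  also have "\<dots> = (\<integral>y. f y \<partial>jump_intensity x) - intensity x * f x"
    using i by (simp add: intensity_def)
  also have "\<dots> = rate_bound * ((\<integral>y. f y \<partial>jump_intensity x) / rate_bound + (1 - intensity x / rate_bound) * f x - f x)"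
    using rate_bound(1) by (simp add: field_simps)
  finally show ?thesis unfolding process.jump_op_def integral_jump_law[OF f] .
qed

abbreviation "D\<^sub>0 \<equiv> operator_domain I S C"
abbreviation "L \<equiv> diffusion_operator I S Q"

section \<open>The stratified operator as a perturbed generator\<close>

lemma D0_bmeas: "f \<in> D\<^sub>0 \<Longrightarrow> bmeas borel f"
  and D0_core: "f \<in> D\<^sub>0 \<Longrightarrow> \<alpha> \<in> I \<Longrightarrow> zero_ext (S \<alpha>) f \<in> C \<alpha>"
  and D0_support: "f \<in> D\<^sub>0 \<Longrightarrow> finite {\<alpha> \<in> I. \<exists>x\<in>S \<alpha>. f x \<noteq> 0}"
  unfolding operator_domain_def bmeas_borel_iff by auto

lemma feller: "\<alpha> \<in> I \<Longrightarrow> feller_semigroup (S \<alpha>) (G \<alpha>)"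
  using stratum_diffusion.feller[OF diffusion] by (rule feller_semigroup.intro)

lemma core_graph: "\<alpha> \<in> I \<Longrightarrow> f \<in> C \<alpha> \<Longrightarrow> (f, L\<^sub>0 \<alpha> f) \<in> generator_graph (C0 (S \<alpha>)) (G \<alpha>)"
  by (rule stratum_diffusion.generator_graph[OF diffusion])

lemma core_C0: "\<alpha> \<in> I \<Longrightarrow> f \<in> C \<alpha> \<Longrightarrow> f \<in> C0 (S \<alpha>)" "\<alpha> \<in> I \<Longrightarrow> f \<in> C \<alpha> \<Longrightarrow> L\<^sub>0 \<alpha> f \<in> C0 (S \<alpha>)"
  using core_graph unfolding generator_graph_def by auto

lemma L_eq: "\<alpha> \<in> I \<Longrightarrow> x \<in> S \<alpha> \<Longrightarrow> L f x = L\<^sub>0 \<alpha> (zero_ext (S \<alpha>) f) x"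
  by (simp add: diffusion_operator_def stratum_eq)

lemma C0_outside: "f \<in> C0 A \<Longrightarrow> x \<notin> A \<Longrightarrow> f x = 0"
  unfolding C0_def by simp

lemma zero_ext_L: assumes "f \<in> D\<^sub>0" "\<alpha> \<in> I" shows "zero_ext (S \<alpha>) (L f) = L\<^sub>0 \<alpha> (zero_ext (S \<alpha>) f)"
  using C0_outside[OF core_C0(2)[OF assms(2) D0_core[OF assms]]] L_eq[OF assms(2)] by (auto simp: zero_ext_def fun_eq_iff)

lemma zero_ext_outside_support:
  assumes "\<alpha> \<in> I" "\<alpha> \<notin> {\<alpha> \<in> I. \<exists>x\<in>S \<alpha>. f x \<noteq> 0}" shows "zero_ext (S \<alpha>) f = (\<lambda>x. 0)"
  using assms by (auto simp: zero_ext_def)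

text \<open>Measurability is checked on countably many Borel pieces; the uniform bound comes from
  the finiteness of \<open>F\<close>.\<close>

lemma stratumwise_bmeas:
  assumes F: "finite F" "F \<subseteq> I" and k: "\<And>\<alpha>. \<alpha> \<in> F \<Longrightarrow> k \<alpha> \<in> C0 (S \<alpha>)"
    and f: "\<And>\<alpha> x. \<alpha> \<in> I \<Longrightarrow> x \<in> S \<alpha> \<Longrightarrow> f x = (if \<alpha> \<in> F then k \<alpha> x else 0)"
  shows "bmeas borel f"
proof -
  have kb: "bmeas borel (k \<alpha>)" if "\<alpha> \<in> F" for \<alpha> using C0_borel[OF k] that strata(4) F by blast
  have "f \<in> borel_measurable borel"
  proof (rule stratumwise_measurable[OF _ f])
    show "(\<lambda>x. if \<alpha> \<in> F then k \<alpha> x else 0) \<in> borel_measurable (restrict_space borel (S \<alpha>))" for \<alpha>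
      using kb by (cases "\<alpha> \<in> F") (auto intro: measurable_restrict_space1 bmeasD)
  qed
  moreover have "bounded (range f)"
  proof (rule bounded_subset)
    show "bounded (insert 0 (\<Union>\<alpha>\<in>F. range (k \<alpha>)))" using F kb by (auto simp: bmeas_borel_iff)
    show "range f \<subseteq> insert 0 (\<Union>\<alpha>\<in>F. range (k \<alpha>))" using f[OF stratum_in] by (auto split: if_splits)
  qed
  ultimately show ?thesis by (simp add: bmeas_borel_iff)
qed

lemma L_bmeas: assumes f: "f \<in> D\<^sub>0" shows "bmeas borel (L f)"
proof (rule stratumwise_bmeas[OF D0_support[OF f]])
  let ?F = "{\<alpha> \<in> I. \<exists>x\<in>S \<alpha>. f x \<noteq> 0}"
  show "?F \<subseteq> I" by blast
  show "L\<^sub>0 \<alpha> (zero_ext (S \<alpha>) f) \<in> C0 (S \<alpha>)" if "\<alpha> \<in> ?F" for \<alpha>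
    using that by (intro core_C0(2) D0_core[OF f]) auto
  show "L f x = (if \<alpha> \<in> ?F then L\<^sub>0 \<alpha> (zero_ext (S \<alpha>) f) x else 0)" if "\<alpha> \<in> I" "x \<in> S \<alpha>" for \<alpha> x
  proof (cases "\<alpha> \<in> ?F")
    case False
    then have "L f x = 0"
      using feller_semigroup.generator_zero[OF feller[OF that(1)]] zero_ext_outside_support[OF that(1) False]
      unfolding L_eq[OF that] by simp
    then show ?thesis by (simp only: if_not_P[OF False])
  qed (simp add: L_eq[OF that])
qed

lemma P_eq:
  assumes t: "0 \<le> t" and f: "bmeas borel f"
  shows "process.P t f x = G (stratum x) t (zero_ext (S (stratum x)) f) x"
proof -
  have "process.P t f x = G (stratum x) t f x"
    unfolding process.P_def using integral_path_law_eval[OF f t] t by simp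
  also have "\<dots> = (\<integral>\<omega>. f (\<omega> t) \<partial>Q (stratum x) x)" using stratum_in(2) by (simp add: transition_op_def zero_ext_def)
  also have "\<dots> = G (stratum x) t (zero_ext (S (stratum x)) f) x"
    by (rule transition_op_zero_ext[OF stratum_in(2) t Q_stratum(1), symmetric])
  finally show ?thesis .
qed

text \<open>Started at \<open>x\<close>, the free motion stays in one stratum, so the formula is
  \<open>G_dynkin\<close> there, after extension by zero.\<close>

lemma process_dynkin:
  assumes f: "f \<in> D\<^sub>0" and t: "0 \<le> t"
  shows "exp (- rate_bound * t) * process.P t f x - f x
    = (\<integral>s. exp (- rate_bound * s) * process.P s (\<lambda>y. L f y - rate_bound * f y) x \<partial>unif t)"
proof -
  define \<alpha> where "\<alpha> = stratum x"
  have \<alpha>: "\<alpha> \<in> I" "x \<in> S \<alpha>" unfolding \<alpha>_def by (rule stratum_in)+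
  let ?f = "zero_ext (S \<alpha>) f" and ?h = "L\<^sub>0 \<alpha> (zero_ext (S \<alpha>) f)" and ?g = "\<lambda>y. L f y - rate_bound * f y"
  note F = feller[OF \<alpha>(1)] and c = D0_core[OF f \<alpha>(1)]
  have g: "bmeas borel ?g" by (intro bmeas_diff bmeas_cmult L_bmeas D0_bmeas f)
  have zg: "zero_ext (S \<alpha>) ?g = (\<lambda>y. 1 * ?h y + (- rate_bound) * ?f y)"
    unfolding zero_ext_L[OF f \<alpha>(1), symmetric] by (auto simp: zero_ext_def)
  have Pg: "process.P s ?g x = G \<alpha> s ?h x - rate_bound * G \<alpha> s ?f x" if s: "0 \<le> s" for s
    unfolding P_eq[OF s g] \<alpha>_def[symmetric] zg
    by (subst feller_semigroup.G_lin[OF F s core_C0(2)[OF \<alpha>(1) c] core_C0(1)[OF \<alpha>(1) c]]) simp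
  have "exp (- rate_bound * t) * process.P t f x - f x = exp (- rate_bound * t) * G \<alpha> t ?f x - ?f x"
    unfolding P_eq[OF t D0_bmeas[OF f]] \<alpha>_def[symmetric] using \<alpha>(2) by (simp add: zero_ext_def)
  also have "\<dots> = (LINT s:{0..t}|lborel. exp (- rate_bound * s) * (G \<alpha> s ?h x - rate_bound * G \<alpha> s ?f x))"
    by (rule feller_semigroup.G_dynkin[OF F core_graph[OF \<alpha>(1) c] t])
  also have "\<dots> = (LINT s:{0..t}|lborel. exp (- rate_bound * s) * process.P s ?g x)"
    by (rule set_lebesgue_integral_cong) (auto simp: Pg)
  also have "\<dots> = (\<integral>s. exp (- rate_bound * s) * process.P s ?g x \<partial>unif t)"
  proof (rule integral_unif[symmetric])
    note [measurable] = bmeasD[OF process.bmeas_P_time[OF g]]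
    show "(\<lambda>s. exp (- rate_bound * s) * process.P s ?g x) \<in> borel_measurable borel" by measurable
  qed
  finally show ?thesis .
qed

text \<open>The core of each stratum in the support of \<open>f\<close> supplies an approximation,
  and these are patched together. On every other stratum \<open>f\<close> and its image under
  \<open>P t\<close> vanish, so zero is exact there and the patched function keeps finite
  support.\<close>

lemma process_approx:
  assumes f: "f \<in> D\<^sub>0" and t: "0 \<le> t" and e: "0 < e"
  shows "\<exists>k\<in>D\<^sub>0. \<forall>x. \<bar>k x - process.P t f x\<bar> \<le> e \<and> \<bar>L k x - process.P t (L f) x\<bar> \<le> e"
proof -
  define F where "F = {\<alpha> \<in> I. \<exists>x\<in>S \<alpha>. f x \<noteq> 0}"
  have F: "finite F" "F \<subseteq> I" unfolding F_def using D0_support[OF f] by auto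
  have "\<exists>k\<in>C \<alpha>. \<forall>x. \<bar>k x - G \<alpha> t (zero_ext (S \<alpha>) f) x\<bar> \<le> e \<and> \<bar>L\<^sub>0 \<alpha> k x - G \<alpha> t (L\<^sub>0 \<alpha> (zero_ext (S \<alpha>) f)) x\<bar> \<le> e"
    if \<alpha>: "\<alpha> \<in> I" for \<alpha>
    by (rule feller_semigroup.core_approx[OF feller[OF \<alpha>] stratum_diffusion.core[OF diffusion[OF \<alpha>]] D0_core[OF f \<alpha>] t e]) blast
  then obtain k where k: "\<And>\<alpha>. \<alpha> \<in> I \<Longrightarrow> k \<alpha> \<in> C \<alpha>"
      "\<And>\<alpha> x. \<alpha> \<in> I \<Longrightarrow> \<bar>k \<alpha> x - G \<alpha> t (zero_ext (S \<alpha>) f) x\<bar> \<le> e"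
      "\<And>\<alpha> x. \<alpha> \<in> I \<Longrightarrow> \<bar>L\<^sub>0 \<alpha> (k \<alpha>) x - G \<alpha> t (L\<^sub>0 \<alpha> (zero_ext (S \<alpha>) f)) x\<bar> \<le> e"
    by metis
  define h where "h x = (if stratum x \<in> F then k (stratum x) x else 0)" for x
  have zh: "zero_ext (S \<alpha>) h = (if \<alpha> \<in> F then k \<alpha> else (\<lambda>x. 0))" if \<alpha>: "\<alpha> \<in> I" for \<alpha>
    using C0_outside[OF core_C0(1)[OF \<alpha> k(1)[OF \<alpha>]]] by (auto simp: zero_ext_def h_def fun_eq_iff stratum_eq[OF \<alpha>])
  have hb: "bmeas borel h"
    by (rule stratumwise_bmeas[OF F, of k]) (use F core_C0(1) k(1) in \<open>auto simp: h_def stratum_eq\<close>)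
  have zero: "(\<lambda>x. 0) \<in> C \<alpha>" if "\<alpha> \<in> I" for \<alpha>
    using stratum_diffusion.subspace[OF diffusion[OF that]] unfolding linear_subspace_def by blast
  have "{\<alpha> \<in> I. \<exists>x\<in>S \<alpha>. h x \<noteq> 0} \<subseteq> F" by (auto simp: h_def stratum_eq)
  then have h: "h \<in> D\<^sub>0"
    using hb zh k(1) zero F(1) finite_subset unfolding operator_domain_def bmeas_borel_iff by auto
  have "\<bar>h x - process.P t f x\<bar> \<le> e \<and> \<bar>L h x - process.P t (L f) x\<bar> \<le> e" for x
  proof -
    define \<alpha> where "\<alpha> = stratum x"
    have \<alpha>: "\<alpha> \<in> I" "x \<in> S \<alpha>" unfolding \<alpha>_def by (rule stratum_in)+
    have P: "process.P t f x = G \<alpha> t (zero_ext (S \<alpha>) f) x" "process.P t (L f) x = G \<alpha> t (L\<^sub>0 \<alpha> (zero_ext (S \<alpha>) f)) x"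
      using P_eq[OF t D0_bmeas[OF f]] P_eq[OF t L_bmeas[OF f]] zero_ext_L[OF f \<alpha>(1)] by (simp_all add: \<alpha>_def)
    show ?thesis
    proof (cases "\<alpha> \<in> F")
      case True
      then have "h x = k \<alpha> x" "L h x = L\<^sub>0 \<alpha> (k \<alpha>) x" using zh[OF \<alpha>(1)] L_eq[OF \<alpha>] by (simp_all add: h_def \<alpha>_def)
      then show ?thesis unfolding P using k(2,3)[OF \<alpha>(1)] by simp
    next
      case False
      then have z: "zero_ext (S \<alpha>) f = (\<lambda>x. 0)" "zero_ext (S \<alpha>) h = (\<lambda>x. 0)" "h x = 0"
        using zero_ext_outside_support[OF \<alpha>(1) False[unfolded F_def]] zh[OF \<alpha>(1)] by (simp_all add: h_def \<alpha>_def)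
      have g: "G \<alpha> t (\<lambda>x. 0) x = 0" by (simp add: transition_op_def zero_ext_def)
      show ?thesis unfolding P L_eq[OF \<alpha>] z feller_semigroup.generator_zero[OF feller[OF \<alpha>(1)]] g using e by simp
    qed
  qed
  then show ?thesis using h by blast
qed

text \<open>On the other strata the function is zero, which belongs to their cores because these are
  linear subspaces.\<close>

lemma core_in_D0:
  assumes \<alpha>: "\<alpha> \<in> I" and g: "g \<in> C \<alpha>" shows "g \<in> D\<^sub>0"
proof -
  have out: "g x = 0" if "x \<notin> S \<alpha>" for x by (rule C0_outside[OF core_C0(1)[OF \<alpha> g] that])
  have "zero_ext (S \<beta>) g \<in> C \<beta>" if \<beta>: "\<beta> \<in> I" for \<beta>
  proof (cases "\<beta> = \<alpha>")
    case True
    have "zero_ext (S \<alpha>) g = g" using out by (auto simp: zero_ext_def fun_eq_iff)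
    then show ?thesis using True g by simp
  next
    case False
    then have "zero_ext (S \<beta>) g = (\<lambda>x. 0)"
      using out stratum_eq[OF \<alpha>] stratum_eq[OF \<beta>] by (fastforce simp: zero_ext_def fun_eq_iff)
    then show ?thesis using stratum_diffusion.subspace[OF diffusion[OF \<beta>]] unfolding linear_subspace_def by simp
  qed
  moreover have "bmeas borel g" by (rule C0_borel[OF core_C0(1)[OF \<alpha> g] strata(4)[OF \<alpha>]])
  moreover have "finite {\<beta> \<in> I. \<exists>x\<in>S \<beta>. g x \<noteq> 0}"
  proof (rule finite_subset[of _ "{\<alpha>}"])
    show "{\<beta> \<in> I. \<exists>x\<in>S \<beta>. g x \<noteq> 0} \<subseteq> {\<alpha>}" using out stratum_eq[OF \<alpha>] stratum_eq by blast
  qed simp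
  ultimately show ?thesis unfolding operator_domain_def bmeas_borel_iff by blast
qed

text \<open>Functions living on a single stratum identify the restriction to it, by the hypothesis
  on its core; countably many restrictions determine the measure.\<close>

lemma D0_determining:
  assumes fin: "finite_measure \<mu>" "finite_measure \<nu>" and sets: "sets \<mu> = sets borel" "sets \<nu> = sets borel"
    and eq: "\<And>f. f \<in> D\<^sub>0 \<Longrightarrow> (\<integral>x. f x \<partial>\<mu>) = (\<integral>x. f x \<partial>\<nu>)"
  shows "\<mu> = \<nu>"
proof -
  have restr: "restrict_space \<mu> (S \<alpha>) = restrict_space \<nu> (S \<alpha>)" if \<alpha>: "\<alpha> \<in> I" for \<alpha>
  proof -
    have S: "S \<alpha> \<inter> space \<mu> \<in> sets \<mu>" "S \<alpha> \<inter> space \<nu> \<in> sets \<nu>"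
      using strata(4)[OF \<alpha>] sets sets_eq_imp_space_eq[OF sets(1)] sets_eq_imp_space_eq[OF sets(2)] by auto
    have "(\<integral>x. g x \<partial>restrict_space \<mu> (S \<alpha>)) = (\<integral>x. g x \<partial>restrict_space \<nu> (S \<alpha>))" if g: "g \<in> C \<alpha>" for g
    proof -
      have "(\<lambda>x. indicator (S \<alpha>) x *\<^sub>R g x) = g"
        using C0_outside[OF core_C0(1)[OF \<alpha> g]] by (auto simp: indicator_def fun_eq_iff)
      then show ?thesis using eq[OF core_in_D0[OF \<alpha> g]] S by (simp add: integral_restrict_space)
    qed
    moreover have "finite_measure (restrict_space \<mu> (S \<alpha>))" "finite_measure (restrict_space \<nu> (S \<alpha>))"
      using finite_measure_restrict_space[OF fin(1)] finite_measure_restrict_space[OF fin(2)] strata(4)[OF \<alpha>] sets by auto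
    ultimately show ?thesis
      using stratum_diffusion.determining[OF diffusion[OF \<alpha>]] sets_restrict_space_cong[OF sets(1)] sets_restrict_space_cong[OF sets(2)]
      unfolding measure_determining_def by blast
  qed
  show ?thesis
  proof (rule measure_eqI)
    show "sets \<mu> = sets \<nu>" using sets by simp
    fix A assume "A \<in> sets \<mu>"
    then have A: "A \<in> sets borel" using sets by simp
    have "A = (\<Union>\<alpha>\<in>I. A \<inter> S \<alpha>)" using strata(3) by blast
    moreover have "disjoint_family_on (\<lambda>\<alpha>. A \<inter> S \<alpha>) I" using strata(2) unfolding disjoint_family_on_def by blast
    ultimately have split: "emeasure M A = (\<integral>\<^sup>+\<alpha>. emeasure M (A \<inter> S \<alpha>) \<partial>count_space I)" if "sets M = sets borel" for M
      using emeasure_UN_countable[of I "\<lambda>\<alpha>. A \<inter> S \<alpha>" M] strata(1,4) A that by auto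
    have "emeasure \<mu> (A \<inter> S \<alpha>) = emeasure \<nu> (A \<inter> S \<alpha>)" if \<alpha>: "\<alpha> \<in> I" for \<alpha>
    proof -
      have S: "S \<alpha> \<inter> space \<mu> \<in> sets \<mu>" "S \<alpha> \<inter> space \<nu> \<in> sets \<nu>"
        using strata(4)[OF \<alpha>] sets sets_eq_imp_space_eq[OF sets(1)] sets_eq_imp_space_eq[OF sets(2)] by auto
      show ?thesis
        using emeasure_restrict_space[OF S(1), of "A \<inter> S \<alpha>"] emeasure_restrict_space[OF S(2), of "A \<inter> S \<alpha>"] restr[OF \<alpha>] by simp
    qed
    then show "emeasure \<mu> A = emeasure \<nu> A" unfolding split[OF sets(1)] split[OF sets(2)] by (intro nn_integral_cong) simp
  qed
qed

sublocale perturbation: jump_perturbation path_law jump_law rate_bound D\<^sub>0 L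
proof
  show "bmeas borel f" "bmeas borel (L f)" if "f \<in> D\<^sub>0" for f using D0_bmeas[OF that] L_bmeas[OF that] by auto
qed (rule process_dynkin process_approx D0_determining; assumption)+

lemma full_operator_eq: "f \<in> D\<^sub>0 \<Longrightarrow> full_operator I S Q Ed tail K r f = perturbation.gen f"
  by (simp add: fun_eq_iff full_operator_def perturbation.gen_def jump_operator_eq D0_bmeas)

lemma solves_iff:
  "solves_martingale_problem (full_operator I S Q Ed tail K r) D\<^sub>0 x P \<longleftrightarrow> solves_martingale_problem perturbation.gen D\<^sub>0 x P"
  by (rule solves_martingale_problem_cong) (rule full_operator_eq)

end

theorem theorem3:
  fixes I :: "'i set" and S :: "'i \<Rightarrow> 'a::{metric_space, second_countable_topology} set"
    and n :: "'i \<Rightarrow> nat" and \<A> :: "'i \<Rightarrow> 'a chart set"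
    and g :: "'i \<Rightarrow> 'a \<Rightarrow> (('a \<Rightarrow> real) \<Rightarrow> real) \<Rightarrow> (('a \<Rightarrow> real) \<Rightarrow> real) \<Rightarrow> real"
    and Q :: "'i \<Rightarrow> 'a \<Rightarrow> (real \<Rightarrow> 'a) measure" and C :: "'i \<Rightarrow> ('a \<Rightarrow> real) set"
    and Ed :: "'e set" and tail head :: "'e \<Rightarrow> 'i"
    and K :: "'e \<Rightarrow> 'a \<Rightarrow> 'a measure" and r :: "'e \<Rightarrow> 'a \<Rightarrow> real"
  assumes "stratified_riemannian_space I S n \<A> g"
    and "\<And>\<alpha>. \<alpha> \<in> I \<Longrightarrow> stratum_diffusion (S \<alpha>) (Q \<alpha>) (C \<alpha>)"
    and "jump_mechanism I S Ed tail head K r"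
  shows "(\<forall>x P P'.
            solves_martingale_problem (full_operator I S Q Ed tail K r) (operator_domain I S C) x P \<longrightarrow>
            solves_martingale_problem (full_operator I S Q Ed tail K r) (operator_domain I S C) x P' \<longrightarrow>
            P = P') \<and>
         (\<forall>x. \<exists>!P.
            solves_martingale_problem (full_operator I S Q Ed tail K r) (operator_domain I S C) x P)"
proof -
  interpret strat: stratified_riemannian_space I S n \<A> g by (rule assms(1))
  interpret stratified_process I S Q C Ed tail head K r
    by (rule stratified_process.intro)
      (fact strat.countable_strata strat.disjoint_strata strat.cover strat.borel_strata assms(2,3))+
  show ?thesis
    unfolding solves_iff using perturbation.solution_unique perturbation.law_solves by blast
qed

end
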